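(* Let $n$ be a positive integer, let $\lambda\in\mathbb R$ (possibly depending on $n$) and let $k$ be an integer. Suppose that $-n^{1/12}\le \lambda \le \frac15 n^{1/12}$ and $(3\lambda\vee 1)n^{2/3}\le k \le n^{3/4}$, and put $a=k/n^{2/3}$. Let $L_1$ be the number of vertices in a largest connected component of the Erdős–Rényi graph $G(n,p_{n,\lambda})$, $p_{n,\lambda}=n^{-1}+\lambda n^{-4/3}$, with law $\mathbb P_{n,\lambda}$. Then (a) $\displaystyle \mathbb P_{n,\lambda}(L_1 = k) = \frac{k^{1/2}}{(8\pi)^{1/2}n} e^{-G_\lambda(a)} (1+O(E_1)) + O(E_2)$, (b) $\displaystyle \mathbb P_{n,\lambda}(L_1 \ge k) = \frac{a^{1/2}}{(8\pi)^{1/2}G'_\lambda(a)}e^{-G_\lambda(a)} (1+O(E_1)) + O(E_2)$, where $E_1=E_1(k,n,\lambda) = \frac{k^4}{n^3} + \frac{|\lambda|}{n^{1/12}} + \frac{|\lambda|^3 k}{n} + \frac{n^{2/3}}{k} + \frac{1}{n^{1/10}}$ and $E_2=E_2(n)=n^{1/4}e^{-n^{1/4}/80}$.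
   Context: $G(n,p)$ is the random graph on $n$ labelled vertices in which each pair of vertices is joined by an edge independently with probability $p$. $G_\lambda(x) = \frac{x^3}{8} - \frac{\lambda x^2}{2} + \frac{\lambda^2 x}{2} = \frac{x}{8}(x-2\lambda)^2$, and $G'_\lambda$ is its derivative in $x$. $x\vee y=\max(x,y)$. Asymptotic notation: an identity $f=g(1+O(h))+O(h')$ means there is an absolute constant $C<\infty$ (not depending on $n,k,\lambda$) such that $|f-g|\le C|g|h+Ch'$ for all sufficiently large $n$ and all parameters satisfying the hypotheses. *)

theory Defs
  imports Complex_Main
begin

text \<open>Simple graphs on the labelled vertex set {0..<n}: an edge set is a set of
  pairs (i,j) with i < j < n.\<close>

definition vpairs :: "nat \<Rightarrow> (nat \<times> nat) set" where
  "vpairs n = {(i, j). i < j \<and> j < n}"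

definition adj :: "(nat \<times> nat) set \<Rightarrow> (nat \<times> nat) set" where
  "adj E = {(i, j). (i, j) \<in> E \<or> (j, i) \<in> E}"

definition component :: "nat \<Rightarrow> (nat \<times> nat) set \<Rightarrow> nat \<Rightarrow> nat set" where
  "component n E v = {w. w < n \<and> (v, w) \<in> (adj E)\<^sup>*}"

definition L1 :: "nat \<Rightarrow> (nat \<times> nat) set \<Rightarrow> nat" where
  "L1 n E = Max (insert 0 ((\<lambda>v. card (component n E v)) ` {..<n}))"

definition er_prob :: "nat \<Rightarrow> real \<Rightarrow> ((nat \<times> nat) set \<Rightarrow> bool) \<Rightarrow> real" where
  "er_prob n p Q = (\<Sum>E\<in>Pow (vpairs n).
      if Q E then p ^ card E * (1 - p) ^ (card (vpairs n) - card E) else 0)"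

definition p_crit :: "nat \<Rightarrow> real \<Rightarrow> real" where
  "p_crit n lam = 1 / real n + lam * real n powr (-4/3)"

definition G_lam :: "real \<Rightarrow> real \<Rightarrow> real" where
  "G_lam lam x = x ^ 3 / 8 - lam * x ^ 2 / 2 + lam ^ 2 * x / 2"

definition G_lam' :: "real \<Rightarrow> real \<Rightarrow> real" where
  "G_lam' lam x = 3 * x ^ 2 / 8 - lam * x + lam ^ 2 / 2"

definition E1 :: "nat \<Rightarrow> nat \<Rightarrow> real \<Rightarrow> real" where
  "E1 k n lam = real k ^ 4 / real n ^ 3 + \<bar>lam\<bar> / real n powr (1/12)
     + \<bar>lam\<bar> ^ 3 * real k / real n + real n powr (2/3) / real k + 1 / real n powr (1/10)"

definition E2 :: "nat \<Rightarrow> real" where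
  "E2 n = real n powr (1/4) * exp (- (real n powr (1/4)) / 80)"

end

(* Exploring a component vertex by vertex, the probability that G(k, p) is connected is, up to an
   explicit Poisson factor, the probability that a random walk with independent Poisson increments,
   of means proportional to (1 - p)^i, stays above the diagonal and ends on it at time m = k - 1.
   Since m p is small compared with 1 and large compared with m^(-1/2), only the constraints near
   the two ends matter: near the start the walk is a barely supercritical Galton-Watson process,
   whose survival probability is found with exponential martingales; seen backwards from the end the
   drift has the same size and the ballot theorem applies. A Hajek-Renyi inequality shows that the middle
   part of the constraint is harmless, and the local limit theorem glues both ends together, giving
   P(G(k, p) connected) = (1 - (1 - p)^m)^m e (m p)^2 / 2 (1 + small). With Stirling's formula this
   yields the expected number of components of size k. A first moment bound and a Bonferroni
   inequality (removing a component of size k leaves a more subcritical graph, so a second large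
   component is unlikely) turn it into (a).
   For (b) one sums (a) over k up to n^(3/4) by comparison with the antiderivative
   sqrt x exp(-G(x)) / G'(x), correct up to a factor 1 + O(x^(-3)), and disposes of larger components
   by a Chernoff bound. Throughout, y = n^(1/12), so that n^(2/3) = y^8 and n^(3/4) = y^9. *)

theory Submission
  imports Defs "HOL-Analysis.Analysis" "HOL-Real_Asymp.Real_Asymp"
begin

section \<open>Components of the random graph\<close>

text \<open>On paths at height \<open>m\<close> after \<open>m\<close> steps, multiplying all
  weights by a constant \<theta> only contributes \<theta>^m. This freedom is spent on making the
  total mean exactly \<open>m\<close>, so that the end condition sits at the centre of a Poisson
  law. With c = m p the means then fall from about 1 + c/2 to about 1 - c/2. The forward survival
  probability is about c, that of the reversed walk about e c / 2, and the local weight 1 / sqrt (2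
  pi m) cancels against Stirling's formula. The obstacle is the relative error, which has to be O(c
  + s) with s = 1 / (c sqrt m). Survival is decided after about c^(-2) steps, while the drift
  changes over m steps; the constraint is therefore evaluated precisely only on windows of length of
  order sqrt m / c, the geometric mean of these two scales. All fluctuations are controlled through
  second moments alone, at the price of large constants. In the end c and s are absorbed by
  \<open>E1\<close>.\<close>

definition vp :: "nat set \<Rightarrow> (nat \<times> nat) set" where
  "vp V = {(i, j). i \<in> V \<and> j \<in> V \<and> i < j}"

definition cross :: "nat set \<Rightarrow> nat set \<Rightarrow> (nat \<times> nat) set" where
  "cross S T = {(i, j). i < j \<and> (i \<in> S \<and> j \<in> T \<or> i \<in> T \<and> j \<in> S)}"

definition gp :: "real \<Rightarrow> 'a set \<Rightarrow> ('a set \<Rightarrow> bool) \<Rightarrow> real" where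
  "gp p A Q = (\<Sum>E\<in>Pow A. if Q E then p ^ card E * (1 - p) ^ (card A - card E) else 0)"

definition reach :: "(nat \<times> nat) set \<Rightarrow> nat \<Rightarrow> nat set" where
  "reach E v = {w. (v, w) \<in> (adj E)\<^sup>*}"

definition is_comp :: "(nat \<times> nat) set \<Rightarrow> nat set \<Rightarrow> bool" where
  "is_comp E S \<longleftrightarrow> S \<noteq> {} \<and> (\<forall>v\<in>S. reach E v = S)"

definition conn_prob :: "real \<Rightarrow> nat set \<Rightarrow> real" where
  "conn_prob p S = gp p (vp S) (\<lambda>E. is_comp E S)"

lemma vpairs_eq_vp: "vpairs n = vp {..<n}"
  by (auto simp: vpairs_def vp_def)

lemma er_prob_eq_gp: "er_prob n p Q = gp p (vp {..<n}) Q"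
  unfolding er_prob_def gp_def vpairs_eq_vp ..

lemma finite_vp [simp]: "finite V \<Longrightarrow> finite (vp V)"
  by (rule finite_subset[of _ "V \<times> V"]) (auto simp: vp_def)

lemma cross_reindex:
  assumes "S \<inter> T = {}"
  shows "bij_betw (\<lambda>(s, t). (min s t, max s t)) (S \<times> T) (cross S T)"
proof (rule bij_betwI')
  fix x y assume "x \<in> S \<times> T" "y \<in> S \<times> T"
  then show "((case x of (s, t) \<Rightarrow> (min s t, max s t)) = (case y of (s, t) \<Rightarrow> (min s t, max s t))) = (x = y)"
    using assms by (cases x; cases y) (auto simp: min_def max_def split: if_splits)
next
  fix x assume "x \<in> S \<times> T"
  then show "(case x of (s, t) \<Rightarrow> (min s t, max s t)) \<in> cross S T"
    using assms by (cases x) (auto simp: cross_def min_def max_def)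
next
  fix y assume "y \<in> cross S T"
  then obtain i j where y: "y = (i, j)" "i < j" "i \<in> S \<and> j \<in> T \<or> i \<in> T \<and> j \<in> S"
    by (auto simp: cross_def)
  from y(3) show "\<exists>x\<in>S \<times> T. y = (case x of (s, t) \<Rightarrow> (min s t, max s t))"
  proof
    assume "i \<in> S \<and> j \<in> T" then show ?thesis using y by (intro bexI[of _ "(i, j)"]) auto
  next
    assume "i \<in> T \<and> j \<in> S" then show ?thesis using y by (intro bexI[of _ "(j, i)"]) auto
  qed
qed

lemma card_cross: "S \<inter> T = {} \<Longrightarrow> card (cross S T) = card S * card T"
  using bij_betw_same_card[OF cross_reindex[of S T]] by (simp add: card_cartesian_product)

lemma finite_cross [simp]: "finite S \<Longrightarrow> finite T \<Longrightarrow> finite (cross S T)"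
  by (rule finite_subset[of _ "(S \<union> T) \<times> (S \<union> T)"]) (auto simp: cross_def)

lemma vp_split: "S \<subseteq> V \<Longrightarrow> vp V = vp S \<union> (cross S (V - S) \<union> vp (V - S))"
  by (auto simp: vp_def cross_def)

lemma vp_split_disjoint:
  "vp S \<inter> (cross S (V - S) \<union> vp (V - S)) = {}" "cross S (V - S) \<inter> vp (V - S) = {}"
  by (auto simp: vp_def cross_def)

section \<open>The product measure on sets of edges\<close>

lemma gp_union:
  assumes "finite A" "finite B" "A \<inter> B = {}"
  shows "gp p (A \<union> B) (\<lambda>E. Q (E \<inter> A) \<and> R (E \<inter> B)) = gp p A Q * gp p B R"
proof -
  have bij: "bij_betw (\<lambda>(E, F). E \<union> F) (Pow A \<times> Pow B) (Pow (A \<union> B))"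
  proof (rule bij_betw_byWitness[where f' = "\<lambda>E. (E \<inter> A, E \<inter> B)"])
    show "\<forall>a\<in>Pow A \<times> Pow B. ((case a of (E, F) \<Rightarrow> E \<union> F) \<inter> A, (case a of (E, F) \<Rightarrow> E \<union> F) \<inter> B) = a"
      using assms(3) by fastforce
  qed auto
  have "gp p (A \<union> B) (\<lambda>E. Q (E \<inter> A) \<and> R (E \<inter> B)) =
    (\<Sum>(E, F)\<in>Pow A \<times> Pow B. (if Q E then p ^ card E * (1 - p) ^ (card A - card E) else 0) *
        (if R F then p ^ card F * (1 - p) ^ (card B - card F) else 0))"
    unfolding gp_def
  proof (subst sum.reindex_bij_betw[OF bij, symmetric], rule sum.cong[OF refl], clarify)
    fix E F assume E: "E \<subseteq> A" and F: "F \<subseteq> B"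
    have fin: "finite E" "finite F" using E F assms finite_subset by blast+
    have "(E \<union> F) \<inter> A = E" "(E \<union> F) \<inter> B = F" using E F assms by auto
    moreover have "card (E \<union> F) = card E + card F"
      using fin E F assms by (intro card_Un_disjoint) auto
    moreover have "card (A \<union> B) = card A + card B" using assms by (intro card_Un_disjoint) auto
    moreover have "card E \<le> card A" "card F \<le> card B" using E F assms by (auto intro: card_mono)
    moreover have "card A + card B - (card E + card F) = (card A - card E) + (card B - card F)"
      using calculation(5,6) by simp
    ultimately have eqs: "(E \<union> F) \<inter> A = E" "(E \<union> F) \<inter> B = F" "card (E \<union> F) = card E + card F"
      "card (A \<union> B) - card (E \<union> F) = (card A - card E) + (card B - card F)" by simp_all
    show "(if Q ((E \<union> F) \<inter> A) \<and> R ((E \<union> F) \<inter> B)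
        then p ^ card (E \<union> F) * (1 - p) ^ (card (A \<union> B) - card (E \<union> F)) else 0) =
       (if Q E then p ^ card E * (1 - p) ^ (card A - card E) else 0) *
        (if R F then p ^ card F * (1 - p) ^ (card B - card F) else 0)"
      unfolding eqs(4) unfolding eqs(1-3) power_add by simp
  qed
  also have "\<dots> = gp p A Q * gp p B R"
    unfolding gp_def sum_product sum.cartesian_product ..
  finally show ?thesis .
qed

lemma gp_cong: "(\<And>E. E \<subseteq> A \<Longrightarrow> Q E = R E) \<Longrightarrow> gp p A Q = gp p A R"
  unfolding gp_def by (rule sum.cong) auto

lemma gp_nonneg: "0 \<le> p \<Longrightarrow> p \<le> 1 \<Longrightarrow> 0 \<le> gp p A Q"
  unfolding gp_def by (rule sum_nonneg) auto

lemma gp_empty: "finite A \<Longrightarrow> gp p A (\<lambda>E. E = {}) = (1 - p) ^ card A"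
  unfolding gp_def by (subst sum.remove[of _ "{}"]) (auto intro!: sum.neutral)

lemma gp_True: "finite A \<Longrightarrow> gp p A (\<lambda>E. True) = 1"
proof (induction A rule: finite_induct)
  case (insert x A)
  have "gp p (insert x A) (\<lambda>E. True) = gp p ({x} \<union> A) (\<lambda>E. (\<lambda>_. True) (E \<inter> {x}) \<and> (\<lambda>_. True) (E \<inter> A))"
    by simp
  also have "\<dots> = gp p {x} (\<lambda>_. True) * gp p A (\<lambda>_. True)"
    using insert by (intro gp_union) auto
  also have "gp p {x} (\<lambda>_. True) = 1" by (simp add: gp_def Pow_insert)
  finally show ?case using insert by simp
qed (simp add: gp_def)

text \<open>Monotonicity of expectations. Both sides are weighted sums of events over arbitrary
  index sets, so union bounds and second-moment inequalities reduce to a check for each single edge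
  set; a lone event is indexed by \<open>()\<close>.\<close>

lemma gp_sum_le:
  assumes "0 \<le> p" "p \<le> 1"
    and "\<And>E. E \<subseteq> A \<Longrightarrow> (\<Sum>i\<in>I. c i * of_bool (Q i E)) \<le> (\<Sum>j\<in>J. d j * of_bool (R j E))"
  shows "(\<Sum>i\<in>I. c i * gp p A (Q i)) \<le> (\<Sum>j\<in>J. d j * gp p A (R j))"
proof -
  have *: "(\<Sum>i\<in>K. e i * gp p A (X i)) =
    (\<Sum>E\<in>Pow A. (\<Sum>i\<in>K. e i * of_bool (X i E)) * (p ^ card E * (1 - p) ^ (card A - card E)))"
    for K :: "'x set" and e X
    unfolding gp_def sum_distrib_left sum_distrib_right
    by (subst sum.swap) (intro sum.cong refl, auto)
  show ?thesis unfolding * using assms by (intro sum_mono mult_right_mono) auto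
qed

section \<open>Reachability, and components as vertex sets\<close>

lemma sym_adj: "sym (adj E)"
  by (auto simp: sym_def adj_def)

lemma reach_sym: "w \<in> reach E v \<Longrightarrow> v \<in> reach E w"
  using sym_rtrancl[OF sym_adj[of E]] by (auto simp: reach_def sym_def)

lemma reach_refl: "v \<in> reach E v" by (simp add: reach_def)

lemma reach_trans: "w \<in> reach E v \<Longrightarrow> u \<in> reach E w \<Longrightarrow> u \<in> reach E v"
  by (auto simp: reach_def)

lemma reach_eq: "w \<in> reach E v \<Longrightarrow> reach E w = reach E v"
  using reach_sym reach_trans by blast

lemma reach_subset: "E \<subseteq> vp V \<Longrightarrow> v \<in> V \<Longrightarrow> reach E v \<subseteq> V"
proof
  fix w assume "E \<subseteq> vp V" "v \<in> V" "w \<in> reach E v"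
  then have "(v, w) \<in> (adj E)\<^sup>*" by (simp add: reach_def)
  then show "w \<in> V"
    by (induction rule: rtrancl_induct) (use \<open>E \<subseteq> vp V\<close> \<open>v \<in> V\<close> in \<open>auto simp: adj_def vp_def\<close>)
qed

lemma is_comp_iff: "is_comp E S \<longleftrightarrow> (\<exists>v. S = reach E v)"
  unfolding is_comp_def using reach_eq reach_refl by blast

lemma is_comp_unique: "is_comp E S \<Longrightarrow> v \<in> S \<Longrightarrow> S = reach E v"
  by (auto simp: is_comp_def)

lemma is_comp_disjoint: "is_comp E S \<Longrightarrow> is_comp E T \<Longrightarrow> S \<noteq> T \<Longrightarrow> S \<inter> T = {}"
  by (metis disjoint_iff is_comp_unique)

lemma component_eq_reach: "E \<subseteq> vp {..<n} \<Longrightarrow> v < n \<Longrightarrow> component n E v = reach E v"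
  using reach_subset[of E "{..<n}" v] by (auto simp: component_def reach_def)

text \<open>A path that starts in \<open>S\<close> could leave it only through a crossing edge, so
  in the absence of such edges it uses edges inside \<open>S\<close> only.\<close>

lemma reach_restrict:
  assumes "E \<subseteq> vp V" "S \<subseteq> V" "E \<inter> cross S (V - S) = {}" "v \<in> S"
  shows "reach (E \<inter> vp S) v = reach E v"
proof
  have "adj (E \<inter> vp S) \<subseteq> adj E" by (auto simp: adj_def)
  then show "reach (E \<inter> vp S) v \<subseteq> reach E v"
    using rtrancl_mono unfolding reach_def by blast
  show "reach E v \<subseteq> reach (E \<inter> vp S) v"
  proof
    fix w assume "w \<in> reach E v"
    then have "(v, w) \<in> (adj E)\<^sup>*" by (simp add: reach_def)
    then have "w \<in> S \<and> (v, w) \<in> (adj (E \<inter> vp S))\<^sup>*"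
    proof (induction rule: rtrancl_induct)
      case (step y z)
      have "z \<in> S \<and> (y, z) \<in> adj (E \<inter> vp S)"
        using step assms(1-3) by (auto simp: adj_def vp_def cross_def)
      then show ?case using step by (auto intro: rtrancl_into_rtrancl)
    qed (use assms in auto)
    then show "w \<in> reach (E \<inter> vp S) v" by (simp add: reach_def)
  qed
qed

lemma is_comp_no_cross:
  assumes "E \<subseteq> vp V" "S \<subseteq> V" "is_comp E S"
  shows "E \<inter> cross S (V - S) = {}"
proof (rule ccontr)
  assume "E \<inter> cross S (V - S) \<noteq> {}"
  then obtain s t where "s \<in> S" "t \<notin> S" "(s, t) \<in> adj E"
    unfolding cross_def adj_def by blast
  then have "t \<in> reach E s" by (auto simp: reach_def)
  then show False using \<open>s \<in> S\<close> \<open>t \<notin> S\<close> assms(3) by (auto simp: is_comp_def)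
qed

lemma is_comp_split:
  assumes "E \<subseteq> vp V" "S \<subseteq> V"
  shows "is_comp E S \<longleftrightarrow> is_comp (E \<inter> vp S) S \<and> E \<inter> cross S (V - S) = {}"
proof -
  have "is_comp E S \<longleftrightarrow> is_comp (E \<inter> vp S) S" if "E \<inter> cross S (V - S) = {}"
    unfolding is_comp_def using reach_restrict[OF assms that] by auto
  then show ?thesis using is_comp_no_cross[OF assms] by blast
qed

lemma is_comp_rest:
  assumes "E \<subseteq> vp V" "S \<subseteq> V" "E \<inter> cross S (V - S) = {}" "T \<subseteq> V - S"
  shows "is_comp E T \<longleftrightarrow> is_comp (E \<inter> vp (V - S)) T"
proof -
  have "cross (V - S) (V - (V - S)) = cross S (V - S)"
    using assms(2) by (auto simp: cross_def)
  then have "reach (E \<inter> vp (V - S)) v = reach E v" if "v \<in> V - S" for v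
    using reach_restrict[of E V "V - S" v] assms that by auto
  then show ?thesis unfolding is_comp_def using assms(4) by (simp add: subset_iff)
qed

text \<open>Being a component is a condition on the edges inside \<open>S\<close> together with the
  absence of crossing edges. These two edge sets and the edges outside \<open>S\<close> are pairwise
  disjoint, hence independent.\<close>

lemma gp_is_comp_and:
  assumes "finite V" "S \<subseteq> V"
  shows "gp p (vp V) (\<lambda>E. is_comp E S \<and> R (E \<inter> vp (V - S))) =
    conn_prob p S * (1 - p) ^ (card S * (card V - card S)) * gp p (vp (V - S)) R"
proof -
  have fin: "finite S" "finite (V - S)" using assms finite_subset by auto
  have "gp p (vp V) (\<lambda>E. is_comp E S \<and> R (E \<inter> vp (V - S))) =
    gp p (vp S \<union> (cross S (V - S) \<union> vp (V - S)))
      (\<lambda>E. (\<lambda>E. is_comp E S) (E \<inter> vp S) \<and>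
        (\<lambda>E. (\<lambda>E. E = {}) (E \<inter> cross S (V - S)) \<and> R (E \<inter> vp (V - S))) (E \<inter> (cross S (V - S) \<union> vp (V - S))))"
    unfolding vp_split[OF assms(2), symmetric]
  proof (rule gp_cong)
    fix E assume E: "E \<subseteq> vp V"
    have eqs: "E \<inter> (cross S (V - S) \<union> vp (V - S)) \<inter> cross S (V - S) = E \<inter> cross S (V - S)"
      "E \<inter> (cross S (V - S) \<union> vp (V - S)) \<inter> vp (V - S) = E \<inter> vp (V - S)" by auto
    show "(is_comp E S \<and> R (E \<inter> vp (V - S))) = (is_comp (E \<inter> vp S) S \<and>
          E \<inter> (cross S (V - S) \<union> vp (V - S)) \<inter> cross S (V - S) = {} \<and>
          R (E \<inter> (cross S (V - S) \<union> vp (V - S)) \<inter> vp (V - S)))"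
      unfolding eqs using is_comp_split[OF E assms(2)] by blast
  qed
  also have "\<dots> = conn_prob p S * ((1 - p) ^ card (cross S (V - S)) * gp p (vp (V - S)) R)"
    using fin by (subst gp_union, simp_all add: vp_split_disjoint conn_prob_def)
      (subst gp_union, simp_all add: vp_split_disjoint gp_empty)
  also have "card (cross S (V - S)) = card S * (card V - card S)"
    using assms fin by (subst card_cross) (auto simp: card_Diff_subset)
  finally show ?thesis by simp
qed

lemma gp_is_comp:
  assumes "finite V" "S \<subseteq> V"
  shows "gp p (vp V) (\<lambda>E. is_comp E S) = conn_prob p S * (1 - p) ^ (card S * (card V - card S))"
  using gp_is_comp_and[OF assms, of p "\<lambda>_. True"] assms by (simp add: gp_True)

lemma gp_is_comp_pair:
  assumes "finite V" "S \<subseteq> V" "T \<subseteq> V - S"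
  shows "gp p (vp V) (\<lambda>E. is_comp E S \<and> is_comp E T) =
    conn_prob p S * (1 - p) ^ (card S * (card V - card S)) *
    (conn_prob p T * (1 - p) ^ (card T * (card V - card S - card T)))"
proof -
  have "gp p (vp V) (\<lambda>E. is_comp E S \<and> is_comp E T) =
    gp p (vp V) (\<lambda>E. is_comp E S \<and> (\<lambda>F. is_comp F T) (E \<inter> vp (V - S)))"
  proof (rule gp_cong)
    fix E assume E: "E \<subseteq> vp V"
    show "(is_comp E S \<and> is_comp E T) = (is_comp E S \<and> is_comp (E \<inter> vp (V - S)) T)"
      using is_comp_no_cross[OF E assms(2)] is_comp_rest[OF E assms(2) _ assms(3)] by blast
  qed
  also have "\<dots> = conn_prob p S * (1 - p) ^ (card S * (card V - card S)) *
      gp p (vp (V - S)) (\<lambda>F. is_comp F T)"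
    by (rule gp_is_comp_and[OF assms(1,2)])
  finally show ?thesis
    using assms finite_subset[OF assms(2,1)] by (simp add: gp_is_comp card_Diff_subset)
qed

text \<open>Exactly one of the sets \<open>S\<close> is the component of \<open>v\<close>, so the
  probabilities add up to 1. Isolating the term \<open>S = V\<close> expresses
  \<open>conn_prob\<close> of \<open>V\<close> through strictly smaller sets, so this identity
  determines \<open>conn_prob\<close>.\<close>

lemma conn_prob_recursion:
  assumes "finite V" "v \<in> V" "0 \<le> p" "p \<le> 1"
  shows "(\<Sum>S\<in>{S. S \<subseteq> V \<and> v \<in> S}. conn_prob p S * (1 - p) ^ (card S * (card V - card S))) = 1"
proof -
  let ?I = "{S. S \<subseteq> V \<and> v \<in> S}"
  have fin: "finite ?I" using assms by simp
  have one: "(\<Sum>S\<in>?I. 1 * of_bool (is_comp E S)) = (\<Sum>j\<in>{()}. 1 * of_bool True :: real)" if "E \<subseteq> vp V" for E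
  proof -
    have "(\<Sum>S\<in>?I. 1 * of_bool (is_comp E S) :: real) = (\<Sum>S\<in>?I. if S = reach E v then 1 else 0)"
    proof (intro sum.cong refl)
      fix S assume "S \<in> ?I"
      then have "is_comp E S \<longleftrightarrow> S = reach E v"
        using is_comp_unique[of E S v] is_comp_iff[of E S] by blast
      then show "1 * of_bool (is_comp E S) = (if S = reach E v then 1 else 0 :: real)" by simp
    qed
    also have "\<dots> = 1"
      using fin reach_subset[OF that assms(2)] reach_refl by (simp add: sum.delta)
    finally show ?thesis by simp
  qed
  have "(\<Sum>S\<in>?I. 1 * gp p (vp V) (\<lambda>E. is_comp E S)) = (\<Sum>j\<in>{()}. 1 * gp p (vp V) (\<lambda>E. True))"
  proof (rule antisym)
    show "(\<Sum>S\<in>?I. 1 * gp p (vp V) (\<lambda>E. is_comp E S)) \<le> (\<Sum>j\<in>{()}. 1 * gp p (vp V) (\<lambda>E. True))"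
      by (rule gp_sum_le) (use assms one in auto)
    show "(\<Sum>j\<in>{()}. 1 * gp p (vp V) (\<lambda>E. True)) \<le> (\<Sum>S\<in>?I. 1 * gp p (vp V) (\<lambda>E. is_comp E S))"
      by (rule gp_sum_le) (use assms one in auto)
  qed
  then show ?thesis
    using assms by (simp add: gp_is_comp gp_True)
qed

text \<open>\<open>mass ok w i y\<close>: total weight of all \<open>(d\<^sub>1, \<dots>, d\<^sub>i)\<close> with sum \<open>y\<close> whose partial sums
  satisfy \<open>ok\<close>, where \<open>d\<^sub>j\<close> has weight \<open>w\<^sub>j\<^sub>-\<^sub>1 ^ d\<^sub>j / d\<^sub>j!\<close>.\<close>

fun mass :: "(nat \<Rightarrow> nat \<Rightarrow> bool) \<Rightarrow> (nat \<Rightarrow> real) \<Rightarrow> nat \<Rightarrow> nat \<Rightarrow> real" where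
  "mass ok w 0 y = (if y = 0 then 1 else 0)"
| "mass ok w (Suc i) y = (if ok (Suc i) y then \<Sum>x\<le>y. mass ok w i x * (w i ^ (y - x) / fact (y - x)) else 0)"

text \<open>The exploration is still alive: after \<open>i\<close> explored vertices and
  \<open>y\<close> discovered ones besides the root, \<open>y + 1 - i\<close> vertices are active,
  and at least one must be.\<close>

abbreviation (input) ahead :: "nat \<Rightarrow> nat \<Rightarrow> bool" where "ahead i y \<equiv> i \<le> y"

text \<open>The probability that \<open>G(k, p)\<close> is connected, as given by exploring the component of a vertex.\<close>

definition conn :: "real \<Rightarrow> nat \<Rightarrow> real" where
  "conn p k = fact (k - 1) * mass ahead (\<lambda>i. p * (1 - p) ^ i) (k - 1) (k - 1)"

section \<open>The exploration weights satisfy the component recursion\<close>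

lemma binomial_fact_sum:
  "(\<Sum>d\<le>m. (x ^ d / fact d) * (y ^ (m - d) / fact (m - d))) = (x + y :: real) ^ m / fact m"
proof -
  have "(x + y) ^ m / fact m = (\<Sum>d\<le>m. of_nat (m choose d) * x ^ d * y ^ (m - d) / fact m)"
    unfolding binomial_ring sum_divide_distrib ..
  also have "\<dots> = (\<Sum>d\<le>m. (x ^ d / fact d) * (y ^ (m - d) / fact (m - d)))"
    by (intro sum.cong refl) (auto simp: binomial_fact field_simps)
  finally show ?thesis ..
qed

text \<open>A component is explored in a graph on \<open>N = M + 1\<close> vertices. Up to the
  factor M!, \<open>alive i\<close> is the probability that the exploration has survived
  \<open>i\<close> steps, \<open>(q ^ i) ^ (M - x)\<close> being the chance that the other
  \<open>M - x\<close> vertices have escaped so far. A step loses only the paths at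
  \<open>x = i\<close> that then discover nothing, that is, the components of size
  \<open>i + 1\<close>.\<close>

lemma conn_recursion:
  assumes "N \<ge> 1"
  shows "(\<Sum>j=1..N. real ((N - 1) choose (j - 1)) * conn p j * (1 - p) ^ (j * (N - j))) = 1"
proof -
  define q where "q = 1 - p"
  define M where "M = N - 1"
  define a where "a = mass ahead (\<lambda>i. p * q ^ i)"
  define alive where "alive i = (\<Sum>x\<le>M. a i x * ((q ^ i) ^ (M - x) / fact (M - x)))" for i
  have step: "alive i = alive (Suc i) + a i i * ((q ^ Suc i) ^ (M - i) / fact (M - i))" if "i \<le> M" for i
  proof -
    let ?b = "\<lambda>y. (q ^ Suc i) ^ (M - y) / fact (M - y)"
    let ?c = "\<lambda>d. (p * q ^ i) ^ d / fact d"
    have zero: "a i x = 0" if "x < i" for x using that by (cases i) (auto simp: a_def)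
    have "alive i = (\<Sum>x\<le>M. a i x * (\<Sum>d\<le>M - x. ?c d * ?b (x + d)))"
      unfolding alive_def
    proof (intro sum.cong refl arg_cong2[where f = "(*)"])
      fix x assume "x \<in> {..M}"
      \<comment> \<open>A vertex that has escaped the first \<open>i\<close> explored ones, with
        probability q^i, is either hit by the next one, with probability p q^i, or escapes it too,
        with probability q^(i+1); the binomial theorem distributes all \<open>M - x\<close> of
        them.\<close>
      have "(\<Sum>d\<le>M - x. ?c d * ?b (x + d)) = (p * q ^ i + q ^ Suc i) ^ (M - x) / fact (M - x)"
        by (subst binomial_fact_sum[symmetric]) simp
      also have "p * q ^ i + q ^ Suc i = q ^ i" by (simp add: q_def algebra_simps)
      finally show "(q ^ i) ^ (M - x) / fact (M - x) = (\<Sum>d\<le>M - x. ?c d * ?b (x + d))" ..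
    qed
    also have "\<dots> = (\<Sum>x\<le>M. \<Sum>y\<in>{x..M}. a i x * ?c (y - x) * ?b y)"
    proof (intro sum.cong refl)
      fix x assume "x \<in> {..M}"
      then have "(\<Sum>y\<in>{x..M}. a i x * ?c (y - x) * ?b y) = (\<Sum>d\<le>M - x. a i x * ?c d * ?b (x + d))"
        by (intro sum.reindex_bij_witness[of _ "\<lambda>d. x + d" "\<lambda>y. y - x"]) auto
      then show "a i x * (\<Sum>d\<le>M - x. ?c d * ?b (x + d)) = (\<Sum>y\<in>{x..M}. a i x * ?c (y - x) * ?b y)"
        by (simp add: sum_distrib_left mult.assoc)
    qed
    also have "\<dots> = (\<Sum>y\<le>M. \<Sum>x\<le>y. a i x * ?c (y - x) * ?b y)"
    proof -
      have "(\<Sum>x\<le>M. \<Sum>y\<in>{x..M}. a i x * ?c (y - x) * ?b y) =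
        (\<Sum>x\<in>{..M}. \<Sum>y\<in>{y\<in>{..M}. x \<le> y}. a i x * ?c (y - x) * ?b y)"
        by (intro sum.cong) auto
      also have "\<dots> = (\<Sum>y\<in>{..M}. \<Sum>x\<in>{x\<in>{..M}. x \<le> y}. a i x * ?c (y - x) * ?b y)"
        by (rule sum.swap_restrict) auto
      also have "\<dots> = (\<Sum>y\<le>M. \<Sum>x\<le>y. a i x * ?c (y - x) * ?b y)"
        by (intro sum.cong) auto
      finally show ?thesis .
    qed
    also have "\<dots> = (\<Sum>y\<le>M. a (Suc i) y * ?b y + (if y = i then a i i * ?b i else 0))"
    proof (intro sum.cong refl)
      fix y assume "y \<in> {..M}"
      consider "Suc i \<le> y" | "y = i" | "y < i" by linarith
      then show "(\<Sum>x\<le>y. a i x * ?c (y - x) * ?b y) = a (Suc i) y * ?b y + (if y = i then a i i * ?b i else 0)"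
      proof cases
        case 1
        then show ?thesis by (simp add: a_def sum_distrib_right sum_divide_distrib)
      next
        case 2
        have "(\<Sum>x\<le>i. a i x * ?c (i - x) * ?b i) = (\<Sum>x\<in>{i}. a i x * ?c (i - x) * ?b i)"
          by (rule sum.mono_neutral_right) (auto simp: zero)
        then show ?thesis using 2 by (simp add: a_def)
      next
        case 3
        have "(\<Sum>x\<le>y. a i x * ?c (y - x) * ?b y) = 0"
          by (rule sum.neutral) (use 3 zero in auto)
        then show ?thesis using 3 by (simp add: a_def)
      qed
    qed
    also have "\<dots> = alive (Suc i) + a i i * ?b i"
      using that by (simp add: alive_def sum.distrib)
    finally show ?thesis .
  qed
  have tel: "alive 0 = alive n + (\<Sum>i<n. a i i * ((q ^ Suc i) ^ (M - i) / fact (M - i)))" if "n \<le> Suc M" for n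
    using that
  proof (induction n)
    case (Suc n)
    then show ?case using step[of n] by simp
  qed simp
  have "alive 0 = 1 / fact M"
    unfolding alive_def a_def by (subst sum.remove[of _ 0]) (auto intro!: sum.neutral)
  moreover have "alive (Suc M) = 0"
    unfolding alive_def a_def by (intro sum.neutral) auto
  ultimately have "1 = fact M * (\<Sum>i<Suc M. a i i * ((q ^ Suc i) ^ (M - i) / fact (M - i)))"
    using tel[of "Suc M"] by simp
  also have "\<dots> = (\<Sum>i<Suc M. real (M choose i) * conn p (Suc i) * q ^ (Suc i * (M - i)))"
    unfolding sum_distrib_left
  proof (intro sum.cong refl)
    fix i assume "i \<in> {..<Suc M}"
    then have "real (M choose i) = fact M / (fact i * fact (M - i))"
      by (intro binomial_fact) auto
    then show "fact M * (a i i * ((q ^ Suc i) ^ (M - i) / fact (M - i))) =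
      real (M choose i) * conn p (Suc i) * q ^ (Suc i * (M - i))"
      by (simp add: conn_def a_def q_def power_mult [of _ "Suc i" "M - i"] del: power_Suc mult_Suc)
  qed
  also have "\<dots> = (\<Sum>j=1..N. real ((N - 1) choose (j - 1)) * conn p j * q ^ (j * (N - j)))"
    by (rule sum.reindex_bij_witness[of _ "\<lambda>j. j - 1" Suc]) (use assms in \<open>auto simp: M_def\<close>)
  finally show ?thesis unfolding q_def ..
qed

lemma sum_subsets_by_card:
  assumes "finite V"
  shows "(\<Sum>S\<in>{S. S \<subseteq> V \<and> P (card S)}. f (card S)) =
    (\<Sum>j\<in>{j. j \<le> card V \<and> P j}. real (card V choose j) * f j)"
proof -
  have "(\<Sum>S\<in>{S. S \<subseteq> V \<and> P (card S)}. f (card S)) =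
    (\<Sum>j\<in>{j. j \<le> card V \<and> P j}. \<Sum>S\<in>{S\<in>{S. S \<subseteq> V \<and> P (card S)}. card S = j}. f (card S))"
    using assms by (intro sum.group[symmetric]) (auto intro: card_mono)
  also have "\<dots> = (\<Sum>j\<in>{j. j \<le> card V \<and> P j}. real (card V choose j) * f j)"
  proof (intro sum.cong refl)
    fix j assume "j \<in> {j. j \<le> card V \<and> P j}"
    then have "{S\<in>{S. S \<subseteq> V \<and> P (card S)}. card S = j} = {S. S \<subseteq> V \<and> card S = j}" by auto
    then show "(\<Sum>S\<in>{S\<in>{S. S \<subseteq> V \<and> P (card S)}. card S = j}. f (card S)) = real (card V choose j) * f j"
      using n_subsets[OF assms, of j] by simp
  qed
  finally show ?thesis .
qed

text \<open>Both quantities satisfy the same recursion, in which the full set \<open>V\<close> has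
  coefficient \<open>(1 - p) ^ 0 = 1\<close> and all other terms concern smaller sets; hence strong
  induction on the cardinality.\<close>

lemma conn_prob_eq_conn:
  assumes "finite V" "V \<noteq> {}" "0 \<le> p" "p \<le> 1"
  shows "conn_prob p V = conn p (card V)"
  using assms(1,2)
proof (induction "card V" arbitrary: V rule: less_induct)
  case less
  then obtain v where v: "v \<in> V" by auto
  define U where "U = V - {v}"
  define N where "N = card V"
  have N: "N \<ge> 1" using less by (simp add: N_def Suc_leI card_gt_0_iff)
  have U: "finite U" "card U = N - 1" "v \<notin> U" "V = insert v U" using less v by (auto simp: U_def N_def)
  let ?F = "\<lambda>f. (\<Sum>S\<in>{S. S \<subseteq> V \<and> v \<in> S}. f S * (1 - p) ^ (card S * (N - card S)))"
  have "?F (\<lambda>S. conn p (card S)) = (\<Sum>T\<in>Pow U. conn p (Suc (card T)) * (1 - p) ^ (Suc (card T) * (N - Suc (card T))))"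
  proof (rule sum.reindex_bij_witness[of _ "insert v" "\<lambda>S. S - {v}"])
    fix S assume S: "S \<in> {S. S \<subseteq> V \<and> v \<in> S}"
    then have "finite S" using less finite_subset by auto
    then have "Suc (card (S - {v})) = card S" using S by (intro card_Suc_Diff1) auto
    then show "conn p (Suc (card (S - {v}))) * (1 - p) ^ (Suc (card (S - {v})) * (N - Suc (card (S - {v})))) =
      conn p (card S) * (1 - p) ^ (card S * (N - card S))" by simp
  qed (use U in auto)
  also have "\<dots> = (\<Sum>T\<in>{S. S \<subseteq> U \<and> True}. conn p (Suc (card T)) * (1 - p) ^ (Suc (card T) * (N - Suc (card T))))"
    by (rule sum.cong) auto
  also have "\<dots> = (\<Sum>j\<in>{j. j \<le> card U \<and> True}. real (card U choose j) * (conn p (Suc j) * (1 - p) ^ (Suc j * (N - Suc j))))"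
    using U by (subst sum_subsets_by_card) auto
  also have "\<dots> = (\<Sum>j=1..N. real ((N - 1) choose (j - 1)) * conn p j * (1 - p) ^ (j * (N - j)))"
    by (rule sum.reindex_bij_witness[of _ "\<lambda>j. j - 1" Suc]) (use N U in auto)
  also have "\<dots> = 1" by (rule conn_recursion[OF N])
  also have "\<dots> = ?F (conn_prob p)"
    using conn_prob_recursion[OF less.prems(1) v assms(3,4)] by (simp add: N_def)
  finally have eq: "?F (conn_prob p) = ?F (\<lambda>S. conn p (card S))" ..
  have fin: "finite {S. S \<subseteq> V \<and> v \<in> S}" using less by simp
  have rest: "(\<Sum>S\<in>{S. S \<subseteq> V \<and> v \<in> S} - {V}. conn_prob p S * (1 - p) ^ (card S * (N - card S))) =
    (\<Sum>S\<in>{S. S \<subseteq> V \<and> v \<in> S} - {V}. conn p (card S) * (1 - p) ^ (card S * (N - card S)))"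
  proof (intro sum.cong refl)
    fix S assume S: "S \<in> {S. S \<subseteq> V \<and> v \<in> S} - {V}"
    then have "card S < card V" "finite S" "S \<noteq> {}"
      using less.prems(1) by (auto intro: psubset_card_mono finite_subset)
    then show "conn_prob p S * (1 - p) ^ (card S * (N - card S)) = conn p (card S) * (1 - p) ^ (card S * (N - card S))"
      using less.hyps by simp
  qed
  have split: "?F f = f V * (1 - p) ^ (card V * (N - card V)) +
      (\<Sum>S\<in>{S. S \<subseteq> V \<and> v \<in> S} - {V}. f S * (1 - p) ^ (card S * (N - card S)))" for f
    using v by (intro sum.remove[OF fin]) auto
  show ?case
    using eq unfolding split rest by (simp add: N_def)
qed

section \<open>First moment and Bonferroni bounds for component counts\<close>

definition expected_comps :: "real \<Rightarrow> nat \<Rightarrow> nat \<Rightarrow> real" where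
  "expected_comps p n k = real (n choose k) * conn p k * (1 - p) ^ (k * (n - k))"

lemma L1_eq_Max: "E \<subseteq> vp {..<n} \<Longrightarrow> L1 n E = Max (insert 0 (card ` {S. S \<subseteq> {..<n} \<and> is_comp E S}))"
proof -
  assume E: "E \<subseteq> vp {..<n}"
  have "(\<lambda>v. card (component n E v)) ` {..<n} = card ` (reach E ` {..<n})"
    using component_eq_reach[OF E] by (auto simp: image_image)
  also have "reach E ` {..<n} = {S. S \<subseteq> {..<n} \<and> is_comp E S}"
    using reach_subset[OF E] reach_refl by (fastforce simp: is_comp_iff)
  finally show ?thesis by (simp add: L1_def)
qed

lemma L1_ge_iff:
  assumes "E \<subseteq> vp {..<n}" "k \<ge> 1"
  shows "L1 n E \<ge> k \<longleftrightarrow> (\<exists>S. S \<subseteq> {..<n} \<and> is_comp E S \<and> card S \<ge> k)"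
proof -
  have "finite (insert 0 (card ` {S. S \<subseteq> {..<n} \<and> is_comp E S}))" by simp
  then show ?thesis unfolding L1_eq_Max[OF assms(1)] using assms(2)
    by (subst Max_ge_iff) auto
qed

lemma expected_comps_sum:
  assumes "finite V" "0 \<le> p" "p \<le> 1" "k \<ge> 1"
  shows "(\<Sum>S\<in>{S. S \<subseteq> V \<and> P (card S) \<and> card S \<ge> k}. gp p (vp V) (\<lambda>E. is_comp E S)) =
    (\<Sum>j\<in>{j. j \<le> card V \<and> P j \<and> j \<ge> k}. expected_comps p (card V) j)"
proof -
  have "(\<Sum>S\<in>{S. S \<subseteq> V \<and> P (card S) \<and> card S \<ge> k}. gp p (vp V) (\<lambda>E. is_comp E S)) =
    (\<Sum>S\<in>{S. S \<subseteq> V \<and> P (card S) \<and> card S \<ge> k}. conn p (card S) * (1 - p) ^ (card S * (card V - card S)))"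
  proof (intro sum.cong refl)
    fix S assume S: "S \<in> {S. S \<subseteq> V \<and> P (card S) \<and> card S \<ge> k}"
    then have "finite S" "S \<noteq> {}" using assms finite_subset by auto
    then show "gp p (vp V) (\<lambda>E. is_comp E S) = conn p (card S) * (1 - p) ^ (card S * (card V - card S))"
      using S assms by (simp add: gp_is_comp conn_prob_eq_conn)
  qed
  also have "\<dots> = (\<Sum>j\<in>{j. j \<le> card V \<and> P j \<and> j \<ge> k}. real (card V choose j) * (conn p j * (1 - p) ^ (j * (card V - j))))"
    by (rule sum_subsets_by_card[OF assms(1), where P = "\<lambda>j. P j \<and> j \<ge> k"])
  finally show ?thesis by (simp add: expected_comps_def mult.assoc)
qed

lemma er_prob_L1_ge_le:
  assumes "0 \<le> p" "p \<le> 1" "k \<ge> 1"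
  shows "er_prob n p (\<lambda>E. L1 n E \<ge> k) \<le> (\<Sum>j=k..n. expected_comps p n j)"
proof -
  have "(\<Sum>j\<in>{()}. 1 * gp p (vp {..<n}) (\<lambda>E. L1 n E \<ge> k)) \<le>
    (\<Sum>S\<in>{S. S \<subseteq> {..<n} \<and> True \<and> card S \<ge> k}. 1 * gp p (vp {..<n}) (\<lambda>E. is_comp E S))"
  proof (rule gp_sum_le[OF assms(1,2)])
    fix E assume E: "E \<subseteq> vp {..<n}"
    show "(\<Sum>j\<in>{()}. 1 * of_bool (k \<le> L1 n E)) \<le>
      (\<Sum>S\<in>{S. S \<subseteq> {..<n} \<and> True \<and> card S \<ge> k}. 1 * of_bool (is_comp E S) :: real)"
    proof (cases "k \<le> L1 n E")
      case True
      then obtain S where S: "S \<subseteq> {..<n}" "is_comp E S" "card S \<ge> k"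
        using L1_ge_iff[OF E assms(3)] by auto
      then have "1 * of_bool (is_comp E S) \<le>
        (\<Sum>S\<in>{S. S \<subseteq> {..<n} \<and> True \<and> card S \<ge> k}. 1 * of_bool (is_comp E S) :: real)"
        by (intro member_le_sum) auto
      then show ?thesis using S True by simp
    qed (auto intro!: sum_nonneg)
  qed
  also have "\<dots> = (\<Sum>j\<in>{j. j \<le> n \<and> True \<and> j \<ge> k}. expected_comps p n j)"
    using expected_comps_sum[of "{..<n}" p k "\<lambda>_. True"] assms by simp
  also have "{j. j \<le> n \<and> True \<and> j \<ge> k} = {k..n}" by auto
  finally show ?thesis by (simp add: er_prob_eq_gp)
qed

lemma er_prob_L1_eq_le:
  assumes "0 \<le> p" "p \<le> 1" "k \<ge> 1" "k \<le> n"
  shows "er_prob n p (\<lambda>E. L1 n E = k) \<le> expected_comps p n k"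
proof -
  have "(\<Sum>j\<in>{()}. 1 * gp p (vp {..<n}) (\<lambda>E. L1 n E = k)) \<le>
    (\<Sum>S\<in>{S. S \<subseteq> {..<n} \<and> card S = k \<and> card S \<ge> k}. 1 * gp p (vp {..<n}) (\<lambda>E. is_comp E S))"
  proof (rule gp_sum_le[OF assms(1,2)])
    fix E assume E: "E \<subseteq> vp {..<n}"
    show "(\<Sum>j\<in>{()}. 1 * of_bool (L1 n E = k)) \<le>
      (\<Sum>S\<in>{S. S \<subseteq> {..<n} \<and> card S = k \<and> card S \<ge> k}. 1 * of_bool (is_comp E S) :: real)"
    proof (cases "L1 n E = k")
      case True
      then obtain S where S: "S \<subseteq> {..<n}" "is_comp E S" "card S \<ge> k"
        using L1_ge_iff[OF E assms(3)] by auto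
      moreover have "\<not> card S \<ge> Suc k" using L1_ge_iff[OF E, of "Suc k"] S True by auto
      ultimately have "1 * of_bool (is_comp E S) \<le>
        (\<Sum>S\<in>{S. S \<subseteq> {..<n} \<and> card S = k \<and> card S \<ge> k}. 1 * of_bool (is_comp E S) :: real)"
        by (intro member_le_sum) auto
      then show ?thesis using S True by simp
    qed (auto intro!: sum_nonneg)
  qed
  also have "\<dots> = (\<Sum>j\<in>{j. j \<le> n \<and> j = k \<and> j \<ge> k}. expected_comps p n j)"
    using expected_comps_sum[of "{..<n}" p k "\<lambda>j. j = k"] assms by simp
  also have "{j. j \<le> n \<and> j = k \<and> j \<ge> k} = {k}" using assms by auto
  finally show ?thesis by (simp add: er_prob_eq_gp)
qed

text \<open>A Bonferroni inequality: with \<open>s\<close> components of size \<open>k\<close> and \<open>t \<ge> s\<close> of size at least \<open>k\<close>,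
  the indicator of \<open>L1 = k\<close> is at least \<open>s - s (t - 1)\<close>.\<close>

lemma er_prob_L1_eq_ge:
  assumes "0 \<le> p" "p \<le> 1" "k \<ge> 1" "k \<le> n"
  shows "expected_comps p n k * (1 - (\<Sum>j=k..n-k. expected_comps p (n - k) j))
    \<le> er_prob n p (\<lambda>E. L1 n E = k)"
proof -
  let ?V = "{..<n}"
  define A where "A = {S. S \<subseteq> ?V \<and> card S = k}"
  define B where "B = (SIGMA S:A. {T. T \<subseteq> ?V - S \<and> True \<and> card T \<ge> k})"
  have fin: "finite A" "finite B" unfolding A_def B_def by (auto intro!: finite_SigmaI)
  \<comment> \<open>The inequality s \<le> [L1 = k] + s (t - 1) has two kinds of events on the
    right. Packing them into one index set, with \<open>None\<close> for the event on
    \<open>L1\<close> and \<open>Some (S, T)\<close> for a pair of components, gives it the shape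
    required by \<open>gp_sum_le\<close>.\<close>
  have "(\<Sum>S\<in>A. 1 * gp p (vp ?V) (\<lambda>E. is_comp E S)) \<le>
    (\<Sum>x\<in>insert None (Some ` B). 1 * gp p (vp ?V) (\<lambda>E. case x of None \<Rightarrow> L1 n E = k
      | Some (S, T) \<Rightarrow> is_comp E S \<and> is_comp E T))"
  proof (rule gp_sum_le[OF assms(1,2)])
    fix E assume E: "E \<subseteq> vp ?V"
    define F where "F = {S. S \<subseteq> ?V \<and> is_comp E S \<and> card S \<ge> k}"
    define F0 where "F0 = {S\<in>A. is_comp E S}"
    have F: "finite F" "F0 \<subseteq> F" "finite F0"
      by (auto simp: F_def F0_def A_def)
    have "(\<Sum>S\<in>A. 1 * of_bool (is_comp E S) :: real) = card F0"
      using fin by (simp add: F0_def of_bool_def sum.If_cases Int_def)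
    moreover have "(\<Sum>x\<in>Some ` B. of_bool (case x of None \<Rightarrow> L1 n E = k
      | Some (S, T) \<Rightarrow> is_comp E S \<and> is_comp E T) :: real) = card F0 * (card F - 1)"
    proof -
      have "(\<Sum>x\<in>Some ` B. of_bool (case x of None \<Rightarrow> L1 n E = k
        | Some (S, T) \<Rightarrow> is_comp E S \<and> is_comp E T) :: real) =
        (\<Sum>(S, T)\<in>B. of_bool (is_comp E S \<and> is_comp E T))"
        by (subst sum.reindex) (auto intro!: sum.cong)
      also have "\<dots> = card {(S, T)\<in>B. is_comp E S \<and> is_comp E T}"
        using fin by (simp add: of_bool_def sum.If_cases Int_def case_prod_unfold)
      also have "{(S, T)\<in>B. is_comp E S \<and> is_comp E T} = (SIGMA S:F0. F - {S})"
      proof (intro equalityI subsetI)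
        fix x assume x: "x \<in> (SIGMA S:F0. F - {S})"
        then obtain S T where ST: "x = (S, T)" "S \<in> F0" "T \<in> F" "T \<noteq> S" by auto
        then have "S \<inter> T = {}" using is_comp_disjoint[of E S T] by (auto simp: F0_def F_def)
        then show "x \<in> {(S, T)\<in>B. is_comp E S \<and> is_comp E T}"
          using ST by (auto simp: F0_def F_def B_def)
      qed (use assms(3) in \<open>auto simp: F0_def F_def A_def B_def is_comp_def\<close>)
      also have "real (card (SIGMA S:F0. F - {S})) = (\<Sum>S\<in>F0. real (card F - 1))"
        using F by (subst card_SigmaI) (auto simp: card_Diff_singleton subset_iff)
      finally show ?thesis by simp
    qed
    \<comment> \<open>If there are two components of size at least \<open>k\<close>, the pair term
      alone pays for s. Otherwise s = t = 1, and the only component of size at least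
      \<open>k\<close> has size exactly \<open>k\<close>, so \<open>L1\<close> equals
      \<open>k\<close>.\<close>
    moreover have "real (card F0) \<le> of_bool (L1 n E = k) + card F0 * real (card F - 1)"
    proof (cases "card F0 = 0 \<or> card F \<ge> 2")
      case True
      then show ?thesis
      proof
        assume "card F \<ge> 2"
        then have "real (card F0) * 1 \<le> card F0 * real (card F - 1)" by (intro mult_left_mono) auto
        then show ?thesis by (simp add: of_bool_def)
      qed auto
    next
      case False
      then have "F0 \<noteq> {}" "card F < 2" by auto
      moreover have "card F0 \<le> card F" using F by (intro card_mono)
      ultimately have one: "card F0 = 1" "card F = 1" using False by linarith+
      then obtain S where S: "F = {S}" "F0 = {S}"
        using F by (metis card_1_singletonE insert_not_empty subset_singletonD)
      have "L1 n E \<ge> k" unfolding L1_ge_iff[OF E assms(3)] using S by (auto simp: F_def)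
      moreover have "\<not> L1 n E \<ge> Suc k"
      proof
        assume "L1 n E \<ge> Suc k"
        then obtain T where "T \<in> F" "card T \<ge> Suc k"
          using L1_ge_iff[OF E, of "Suc k"] by (auto simp: F_def)
        then show False using S by (auto simp: F0_def A_def)
      qed
      ultimately show ?thesis using one by simp
    qed
    ultimately show "(\<Sum>S\<in>A. 1 * of_bool (is_comp E S)) \<le>
      (\<Sum>x\<in>insert None (Some ` B). 1 * of_bool (case x of None \<Rightarrow> L1 n E = k
        | Some (S, T) \<Rightarrow> is_comp E S \<and> is_comp E T) :: real)"
      using fin by (subst sum.insert) auto
  qed
  also have "\<dots> = er_prob n p (\<lambda>E. L1 n E = k) +
      (\<Sum>(S, T)\<in>B. gp p (vp ?V) (\<lambda>E. is_comp E S \<and> is_comp E T))"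
    using fin by (subst sum.insert) (auto simp: er_prob_eq_gp sum.reindex case_prod_unfold)
  also have "(\<Sum>(S, T)\<in>B. gp p (vp ?V) (\<lambda>E. is_comp E S \<and> is_comp E T)) =
    (\<Sum>S\<in>A. conn p k * (1 - p) ^ (k * (n - k)) * (\<Sum>j=k..n-k. expected_comps p (n - k) j))"
  proof -
    have "(\<Sum>(S, T)\<in>B. gp p (vp ?V) (\<lambda>E. is_comp E S \<and> is_comp E T)) =
      (\<Sum>S\<in>A. \<Sum>T\<in>{T. T \<subseteq> ?V - S \<and> True \<and> card T \<ge> k}. gp p (vp ?V) (\<lambda>E. is_comp E S \<and> is_comp E T))"
      unfolding B_def using fin by (intro sum.Sigma[symmetric]) auto
    also have "\<dots> = (\<Sum>S\<in>A. conn p k * (1 - p) ^ (k * (n - k)) * (\<Sum>j=k..n-k. expected_comps p (n - k) j))"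
  proof (intro sum.cong refl)
    fix S assume S: "S \<in> A"
    have finS: "finite S" "S \<noteq> {}" "card S = k" "S \<subseteq> ?V" "card (?V - S) = n - k"
      using S assms finite_subset[of S ?V] by (auto simp: A_def card_Diff_subset)
    have "(\<Sum>T\<in>{T. T \<subseteq> ?V - S \<and> k \<le> card T}. gp p (vp ?V) (\<lambda>E. is_comp E S \<and> is_comp E T)) =
      (\<Sum>T\<in>{T. T \<subseteq> ?V - S \<and> True \<and> k \<le> card T}. conn p k * (1 - p) ^ (k * (n - k)) *
        gp p (vp (?V - S)) (\<lambda>E. is_comp E T))"
      by (intro sum.cong) (use finS assms in \<open>auto simp: gp_is_comp_pair conn_prob_eq_conn gp_is_comp\<close>)
    also have "\<dots> = conn p k * (1 - p) ^ (k * (n - k)) *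
        (\<Sum>j\<in>{j. j \<le> card (?V - S) \<and> True \<and> k \<le> j}. expected_comps p (card (?V - S)) j)"
      unfolding sum_distrib_left[symmetric] using assms by (subst expected_comps_sum) auto
    also have "{j. j \<le> card (?V - S) \<and> True \<and> k \<le> j} = {k..n-k}" using finS by auto
    finally show "(\<Sum>T\<in>{T. T \<subseteq> ?V - S \<and> True \<and> k \<le> card T}. gp p (vp ?V) (\<lambda>E. is_comp E S \<and> is_comp E T)) =
      conn p k * (1 - p) ^ (k * (n - k)) * (\<Sum>j=k..n-k. expected_comps p (n - k) j)"
      using finS by simp
  qed
    finally show ?thesis .
  qed
  also have "\<dots> = expected_comps p n k * (\<Sum>j=k..n-k. expected_comps p (n - k) j)"
    using n_subsets[of ?V k] by (simp add: A_def expected_comps_def)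
  also have "(\<Sum>S\<in>A. 1 * gp p (vp ?V) (\<lambda>E. is_comp E S)) = expected_comps p n k"
  proof -
    have "A = {S. S \<subseteq> ?V \<and> card S = k \<and> card S \<ge> k}" by (auto simp: A_def)
    moreover have "{j. j \<le> n \<and> j = k \<and> k \<le> j} = {k}" using assms by auto
    ultimately show ?thesis
      using expected_comps_sum[of ?V p k "\<lambda>j. j = k"] assms by simp
  qed
  finally show ?thesis by (simp add: algebra_simps)
qed

lemma er_prob_L1_ge_eq_sum:
  assumes "k \<le> J"
  shows "er_prob n p (\<lambda>E. L1 n E \<ge> k) =
    (\<Sum>j=k..J. er_prob n p (\<lambda>E. L1 n E = j)) + er_prob n p (\<lambda>E. L1 n E \<ge> Suc J)"
proof -
  have "er_prob n p (\<lambda>E. L1 n E \<ge> k) = (\<Sum>E\<in>Pow (vpairs n).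
     (\<Sum>j=k..J. if L1 n E = j then p ^ card E * (1 - p) ^ (card (vpairs n) - card E) else 0) +
     (if L1 n E \<ge> Suc J then p ^ card E * (1 - p) ^ (card (vpairs n) - card E) else 0))"
    unfolding er_prob_def using assms by (intro sum.cong refl) (auto simp: sum.delta)
  then show ?thesis
    unfolding er_prob_def by (simp only: sum.distrib) (subst sum.swap, simp)
qed

lemma er_prob_nonneg: "0 \<le> p \<Longrightarrow> p \<le> 1 \<Longrightarrow> 0 \<le> er_prob n p Q"
  by (simp add: er_prob_eq_gp gp_nonneg)

section \<open>Random walks with Poisson increments\<close>

definition pois :: "real \<Rightarrow> nat \<Rightarrow> real" where
  "pois \<mu> j = exp (- \<mu>) * \<mu> ^ j / fact j"

definition mean :: "(nat \<Rightarrow> real) \<Rightarrow> nat \<Rightarrow> real" where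
  "mean w i = (\<Sum>u<i. w u)"

text \<open>\<open>pm ok w i y\<close> is the probability that the random walk with independent Poisson increments of
  means \<open>w 0, w 1, \<dots>\<close> satisfies \<open>ok\<close> up to time \<open>i\<close> and is at \<open>y\<close> at time \<open>i\<close>.\<close>

definition pm :: "(nat \<Rightarrow> nat \<Rightarrow> bool) \<Rightarrow> (nat \<Rightarrow> real) \<Rightarrow> nat \<Rightarrow> nat \<Rightarrow> real" where
  "pm ok w i y = exp (- mean w i) * mass ok w i y"

text \<open>The law at time \<open>i + 1\<close> before the constraint at that time is tested; what
  the constraint removes can then be summed separately.\<close>

definition psucc :: "(nat \<Rightarrow> nat \<Rightarrow> bool) \<Rightarrow> (nat \<Rightarrow> real) \<Rightarrow> nat \<Rightarrow> nat \<Rightarrow> real" where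
  "psucc ok w i y = (\<Sum>x\<le>y. pm ok w i x * pois (w i) (y - x))"

definition tot :: "(nat \<Rightarrow> nat \<Rightarrow> bool) \<Rightarrow> (nat \<Rightarrow> real) \<Rightarrow> nat \<Rightarrow> real" where
  "tot ok w i = infsum (pm ok w i) UNIV"

text \<open>Neither normalised nor recentred: the squared deviation from the mean of the
  unconstrained walk, summed over surviving paths only. Killing a path thus removes its
  share.\<close>

definition vr :: "(nat \<Rightarrow> nat \<Rightarrow> bool) \<Rightarrow> (nat \<Rightarrow> real) \<Rightarrow> nat \<Rightarrow> real" where
  "vr ok w i = infsum (\<lambda>y. pm ok w i y * (real y - mean w i) ^ 2) UNIV"

lemma mean_simps [simp]: "mean w 0 = 0" "mean w (Suc i) = mean w i + w i"
  by (simp_all add: mean_def)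

lemma pm_0: "pm ok w 0 y = (if y = 0 then 1 else 0)"
  by (simp add: pm_def)

lemma pm_Suc: "pm ok w (Suc i) y = (if ok (Suc i) y then psucc ok w i y else 0)"
proof -
  have "exp (- mean w (Suc i)) = exp (- mean w i) * exp (- w i)" by (simp add: exp_add[symmetric])
  then show ?thesis by (auto simp: pm_def psucc_def pois_def sum_distrib_left intro!: sum.cong)
qed

lemma pois_Suc: "real (Suc d) * pois \<mu> (Suc d) = \<mu> * pois \<mu> d"
  by (simp add: pois_def del: of_nat_Suc)

lemma pois_nonneg: "0 \<le> \<mu> \<Longrightarrow> 0 \<le> pois \<mu> j"
  by (simp add: pois_def)

lemma pm_nonneg: "(\<And>i. 0 \<le> w i) \<Longrightarrow> 0 \<le> pm ok w i y"
  by (induction i arbitrary: y) (auto simp: pm_0 pm_Suc psucc_def intro!: sum_nonneg mult_nonneg_nonneg pois_nonneg)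

lemma psucc_nonneg: "(\<And>i. 0 \<le> w i) \<Longrightarrow> 0 \<le> psucc ok w i y"
  by (auto simp: psucc_def intro!: sum_nonneg mult_nonneg_nonneg pois_nonneg pm_nonneg)

lemma pois_pgf_sums: "(\<lambda>d. pois \<mu> d * z ^ d) sums exp (\<mu> * (z - 1))"
proof -
  have "(\<lambda>d. exp (- \<mu>) * ((\<mu> * z) ^ d /\<^sub>R fact d)) sums (exp (- \<mu>) * exp (\<mu> * z))"
    by (intro sums_mult exp_converges)
  moreover have "exp (- \<mu>) * exp (\<mu> * z) = exp (\<mu> * (z - 1))"
    by (simp add: exp_add[symmetric] algebra_simps)
  ultimately show ?thesis
    by (simp add: pois_def power_mult_distrib field_simps)
qed

lemma pois_pgf_deriv_sums: "(\<lambda>d. real d * pois \<mu> d * z ^ d) sums (\<mu> * z * exp (\<mu> * (z - 1)))"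
proof -
  have "(\<lambda>d. \<mu> * z * (pois \<mu> d * z ^ d)) sums (\<mu> * z * exp (\<mu> * (z - 1)))"
    by (intro sums_mult pois_pgf_sums)
  also have "(\<lambda>d. \<mu> * z * (pois \<mu> d * z ^ d)) = (\<lambda>d. real (Suc d) * pois \<mu> (Suc d) * z ^ Suc d)"
    by (rule ext) (simp add: pois_Suc del: of_nat_Suc)
  finally show ?thesis by (subst (asm) sums_Suc_iff) simp
qed

lemma pois_sums: "pois \<mu> sums 1"
  using pois_pgf_sums[of \<mu> 1] by simp

lemma pois_mean_sums: "(\<lambda>d. pois \<mu> d * real d) sums \<mu>"
  using pois_pgf_deriv_sums[of \<mu> 1] by (simp add: mult.commute)

lemma pois_sq_sums: "(\<lambda>d. pois \<mu> d * (c + real d) ^ 2) sums ((c + \<mu>) ^ 2 + \<mu>)"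
proof -
  have "(\<lambda>d. \<mu> * (pois \<mu> d * real d + pois \<mu> d)) sums (\<mu> * (\<mu> + 1))"
    by (intro sums_mult sums_add pois_mean_sums pois_sums)
  also have "(\<lambda>d. \<mu> * (pois \<mu> d * real d + pois \<mu> d)) = (\<lambda>d. pois \<mu> (Suc d) * real (Suc d) ^ 2)"
  proof (rule ext)
    fix d
    have "pois \<mu> (Suc d) * real (Suc d) ^ 2 = real (Suc d) * (real (Suc d) * pois \<mu> (Suc d))"
      by (simp add: power2_eq_square mult_ac)
    then show "\<mu> * (pois \<mu> d * real d + pois \<mu> d) = pois \<mu> (Suc d) * real (Suc d) ^ 2"
      unfolding pois_Suc by (simp add: algebra_simps)
  qed
  finally have sq: "(\<lambda>d. pois \<mu> d * real d ^ 2) sums (\<mu> * (\<mu> + 1))" by (subst (asm) sums_Suc_iff) simp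
  have "(\<lambda>d. c ^ 2 * pois \<mu> d + (2 * c) * (pois \<mu> d * real d) + pois \<mu> d * real d ^ 2)
      sums (c ^ 2 * 1 + (2 * c) * \<mu> + \<mu> * (\<mu> + 1))"
    by (intro sums_add sums_mult sq pois_mean_sums pois_sums)
  then show ?thesis by (simp add: algebra_simps power2_eq_square)
qed

lemmas pois_has_sum = sums_nonneg_imp_has_sum[OF pois_sums pois_nonneg]

text \<open>Tonelli for nonnegative double series, regrouping the pairs \<open>(x, d)\<close> by
  \<open>y = x + d\<close>. The inner sums are prescribed only where \<open>a x\<close> is nonzero,
  because the step formulas used later fail at positions that carry no mass.\<close>

lemma conv_has_sum:
  fixes a b f g :: "nat \<Rightarrow> real"
  assumes "\<And>x. 0 \<le> a x" "\<And>x. 0 \<le> b x" "\<And>x. 0 \<le> f x"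
    and inner: "\<And>x. a x \<noteq> 0 \<Longrightarrow> ((\<lambda>d. b d * f (x + d)) has_sum g x) UNIV"
    and outer: "((\<lambda>x. a x * g x) has_sum S) UNIV"
  shows "((\<lambda>y. (\<Sum>x\<le>y. a x * b (y - x)) * f y) has_sum S) UNIV"
proof -
  let ?F = "\<lambda>(x, d). a x * b d * f (x + d)"
  have in1: "((\<lambda>d. ?F (x, d)) has_sum (a x * g x)) UNIV" for x
  proof (cases "a x = 0")
    case False
    then show ?thesis using has_sum_cmult_right[OF inner[OF False], of "a x"] by (simp add: mult.assoc)
  qed simp
  have nonneg: "norm (?F z) = ?F z" for z using assms(1-3) by (cases z) simp
  have "(\<lambda>z. norm (?F z)) summable_on Sigma UNIV (\<lambda>_. UNIV)"
    unfolding Infinite_Sum.abs_summable_on_Sigma_iff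
  proof (intro conjI ballI)
    fix x :: nat
    show "(\<lambda>y. norm (?F (x, y))) summable_on UNIV"
      unfolding nonneg by (rule has_sum_imp_summable[OF in1])
    have e: "infsum (\<lambda>y. norm (?F (x, y))) UNIV = a x * g x" for x
      unfolding nonneg by (rule infsumI[OF in1])
    show "(\<lambda>x. norm (infsum (\<lambda>y. norm (?F (x, y))) UNIV)) summable_on UNIV"
      unfolding e
      by (rule summable_on_iff_abs_summable_on_real[THEN iffD1, OF has_sum_imp_summable[OF outer]])

  qed
  then have sm: "?F summable_on Sigma UNIV (\<lambda>_. UNIV)" by (simp only: nonneg)
  then obtain S' where S': "(?F has_sum S') (Sigma UNIV (\<lambda>_. UNIV))" unfolding summable_on_def by blast
  have "((\<lambda>x. a x * g x) has_sum S') UNIV"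
    by (rule has_sum_Sigma[OF isUCont_plus S' in1])
  then have "S' = S" using outer by (rule has_sum_unique)
  with S' have "(?F has_sum S) (Sigma UNIV (\<lambda>_. UNIV))" by simp
  then have "((\<lambda>(y, x). a x * b (y - x) * f y) has_sum S) (Sigma UNIV (\<lambda>y. {..y}))"
  proof -
    have "((?F has_sum S) (Sigma UNIV (\<lambda>_. UNIV))) =
      (((\<lambda>(y, x). a x * b (y - x) * f y) has_sum S) (Sigma UNIV (\<lambda>y. {..y})))"
      by (rule has_sum_reindex_bij_witness[where i = "\<lambda>(y, x). (x, y - x)" and j = "\<lambda>(x, d). (x + d, x)"])
        auto
    then show ?thesis using \<open>(?F has_sum S) (Sigma UNIV (\<lambda>_. UNIV))\<close> by blast
  qed
  then have "((\<lambda>y. \<Sum>x\<le>y. a x * b (y - x) * f y) has_sum S) UNIV"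
    by (rule has_sum_Sigma[OF isUCont_plus]) auto
  then show ?thesis by (simp add: sum_distrib_right)
qed

lemma psucc_has_sum:
  assumes "\<And>i. 0 \<le> w i" "\<And>x. 0 \<le> f x"
    and "\<And>x. pm ok w i x \<noteq> 0 \<Longrightarrow> ((\<lambda>d. pois (w i) d * f (x + d)) has_sum g x) UNIV"
    and "((\<lambda>x. pm ok w i x * g x) has_sum S) UNIV"
  shows "((\<lambda>y. psucc ok w i y * f y) has_sum S) UNIV"
  unfolding psucc_def by (rule conv_has_sum) (use assms in \<open>auto intro!: pm_nonneg pois_nonneg\<close>)

text \<open>An unconstrained step turns the expectation of \<open>f\<close> into that of its Poisson
  average \<open>g\<close>; the constraint then splits the result into a surviving part
  \<open>s\<close> and a killed part \<open>k\<close>.\<close>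

lemma pm_step:
  assumes "\<And>i. 0 \<le> w i" "\<And>x. 0 \<le> f x"
    and "\<And>x. pm ok w i x \<noteq> 0 \<Longrightarrow> ((\<lambda>d. pois (w i) d * f (x + d)) has_sum g x) UNIV"
    and "((\<lambda>x. pm ok w i x * g x) has_sum S) UNIV"
  obtains s k where "((\<lambda>y. pm ok w (Suc i) y * f y) has_sum s) UNIV"
    and "((\<lambda>y. psucc ok w i y * f y) has_sum k) {y. \<not> ok (Suc i) y}" and "s + k = S"
proof -
  have tot: "((\<lambda>y. psucc ok w i y * f y) has_sum S) UNIV" by (rule psucc_has_sum) (use assms in auto)
  then have sm: "(\<lambda>y. psucc ok w i y * f y) summable_on UNIV" by (rule has_sum_imp_summable)
  obtain s where s: "((\<lambda>y. psucc ok w i y * f y) has_sum s) {y. ok (Suc i) y}"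
    using summable_on_subset_banach[OF sm, of "{y. ok (Suc i) y}"] by (auto simp: summable_on_def)
  obtain k where k: "((\<lambda>y. psucc ok w i y * f y) has_sum k) {y. \<not> ok (Suc i) y}"
    using summable_on_subset_banach[OF sm, of "{y. \<not> ok (Suc i) y}"] by (auto simp: summable_on_def)
  have "((\<lambda>y. psucc ok w i y * f y) has_sum (s + k)) ({y. ok (Suc i) y} \<union> {y. \<not> ok (Suc i) y})"
    by (rule has_sum_Un_disjoint[OF s k]) auto
  then have "((\<lambda>y. psucc ok w i y * f y) has_sum (s + k)) UNIV" by (simp add: Collect_neg_eq)
  then have "s + k = S" using tot by (rule has_sum_unique)
  moreover have "((\<lambda>y. pm ok w (Suc i) y * f y) has_sum s) UNIV"
    using s by (subst has_sum_cong_neutral[where T = "{y. ok (Suc i) y}" and g = "\<lambda>y. psucc ok w i y * f y"])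
      (auto simp: pm_Suc)
  ultimately show thesis using that k by blast
qed

context
  fixes ok :: "nat \<Rightarrow> nat \<Rightarrow> bool" and w :: "nat \<Rightarrow> real"
  assumes w_nonneg: "\<And>i. 0 \<le> w i"
begin

lemma pm_summable: "pm ok w i summable_on UNIV"
proof (induction i)
  case 0
  have "(pm ok w 0 has_sum 1) UNIV"
    by (subst has_sum_cong_neutral[where T = "{0}" and g = "\<lambda>_. 1"]) (auto simp: pm_0 intro!: has_sum_finiteI)
  then show ?case by (rule has_sum_imp_summable)
next
  case (Suc i)
  have "((\<lambda>x. pm ok w i x * 1) has_sum tot ok w i) UNIV" using Suc by (simp add: tot_def)
  then show ?case
  proof (rule pm_step[rotated 3, where f = "\<lambda>_. 1"])
    show "((\<lambda>d. pois (w i) d * 1) has_sum 1) UNIV" for x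
      using pois_has_sum w_nonneg by simp
  qed (use w_nonneg in \<open>auto intro: has_sum_imp_summable\<close>)
qed

lemma pm_has_sum: "(pm ok w i has_sum tot ok w i) UNIV"
  using pm_summable by (simp add: tot_def)

lemma tot_0: "tot ok w 0 = 1"
  unfolding tot_def by (subst infsum_cong_neutral[where T = "{0}" and g = "\<lambda>_. 1"]) (auto simp: pm_0)

lemma tot_nonneg: "0 \<le> tot ok w i"
  unfolding tot_def by (intro infsum_nonneg pm_nonneg w_nonneg)

lemma tot_step:
  obtains k where "(psucc ok w i has_sum k) {y. \<not> ok (Suc i) y}" "tot ok w (Suc i) + k = tot ok w i"
proof -
  have "((\<lambda>x. pm ok w i x * 1) has_sum tot ok w i) UNIV" using pm_has_sum by simp
  then show ?thesis
  proof (rule pm_step[rotated 3, where f = "\<lambda>_. 1"])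
    show "((\<lambda>d. pois (w i) d * 1) has_sum 1) UNIV" for x
      using pois_has_sum w_nonneg by simp
    fix s k assume "((\<lambda>y. pm ok w (Suc i) y * 1) has_sum s) UNIV"
      "((\<lambda>y. psucc ok w i y * 1) has_sum k) {y. \<not> ok (Suc i) y}" "s + k = tot ok w i"
    then have "s = tot ok w (Suc i)" using pm_has_sum by (intro has_sum_unique[of "pm ok w (Suc i)"]) simp_all
    then show thesis using \<open>((\<lambda>y. psucc ok w i y * 1) has_sum k) {y. \<not> ok (Suc i) y}\<close> \<open>s + k = tot ok w i\<close>
      by (intro that[of k]) simp_all
  qed (use w_nonneg in auto)
qed

lemma tot_Suc_le: "tot ok w (Suc i) \<le> tot ok w i"
proof -
  obtain k where k: "(psucc ok w i has_sum k) {y. \<not> ok (Suc i) y}" "tot ok w (Suc i) + k = tot ok w i"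
    by (rule tot_step)
  have "0 \<le> k" using k(1) by (rule has_sum_nonneg) (rule psucc_nonneg[OF w_nonneg])
  then show ?thesis using k(2) by simp
qed

lemma tot_antimono: "i \<le> j \<Longrightarrow> tot ok w j \<le> tot ok w i"
  by (rule lift_Suc_antimono_le[of "tot ok w"]) (use tot_Suc_le in auto)

lemma tot_le_1: "tot ok w i \<le> 1"
  using tot_antimono[of 0 i] tot_0 by simp

lemma sq_step_has_sum:
  assumes "((\<lambda>x. pm ok w i x * (real x - mean w i) ^ 2) has_sum v) UNIV"
  shows "((\<lambda>x. pm ok w i x * ((real x - mean w i) ^ 2 + w i)) has_sum (v + w i * tot ok w i)) UNIV"
proof -
  have "((\<lambda>x. pm ok w i x * (real x - mean w i) ^ 2 + w i * pm ok w i x) has_sum (v + w i * tot ok w i)) UNIV"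
    by (intro has_sum_add assms has_sum_cmult_right pm_has_sum)
  then show ?thesis by (simp add: algebra_simps)
qed

lemma pois_step_sq_has_sum:
  "((\<lambda>d. pois (w i) d * (real (x + d) - mean w (Suc i)) ^ 2) has_sum ((real x - mean w i) ^ 2 + w i)) UNIV"
proof (rule sums_nonneg_imp_has_sum)
  show "(\<lambda>d. pois (w i) d * (real (x + d) - mean w (Suc i)) ^ 2) sums ((real x - mean w i) ^ 2 + w i)"
    using pois_sq_sums[of "w i" "real x - mean w i - w i"] by (simp add: algebra_simps)
qed (use w_nonneg in \<open>auto intro!: mult_nonneg_nonneg pois_nonneg\<close>)

lemma vr_summable: "(\<lambda>y. pm ok w i y * (real y - mean w i) ^ 2) summable_on UNIV"
proof (induction i)
  case 0
  have "((\<lambda>y. pm ok w 0 y * (real y - mean w 0) ^ 2) has_sum 0) UNIV"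
    by (subst has_sum_cong_neutral[where T = "{}" and g = "\<lambda>_. 1"]) (auto simp: pm_0)
  then show ?case by (rule has_sum_imp_summable)
next
  case (Suc i)
  then have "((\<lambda>x. pm ok w i x * (real x - mean w i) ^ 2) has_sum vr ok w i) UNIV"
    by (simp add: vr_def)
  from sq_step_has_sum[OF this] show ?case
  proof (rule pm_step[rotated 3, where f = "\<lambda>y. (real y - mean w (Suc i)) ^ 2"])
    show "((\<lambda>d. pois (w i) d * (real (x + d) - mean w (Suc i)) ^ 2) has_sum ((real x - mean w i) ^ 2 + w i)) UNIV" for x
      by (rule pois_step_sq_has_sum)
    fix s assume "((\<lambda>y. pm ok w (Suc i) y * (real y - mean w (Suc i)) ^ 2) has_sum s) UNIV"
    then show ?case by (rule has_sum_imp_summable)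
  qed (use w_nonneg in auto)
qed

lemma vr_has_sum: "((\<lambda>y. pm ok w i y * (real y - mean w i) ^ 2) has_sum vr ok w i) UNIV"
  using vr_summable by (simp add: vr_def)

lemma vr_nonneg: "0 \<le> vr ok w i"
  unfolding vr_def by (intro infsum_nonneg mult_nonneg_nonneg pm_nonneg w_nonneg) auto

lemma vr_0: "vr ok w 0 = 0"
  unfolding vr_def by (subst infsum_cong_neutral[where T = "{}" and g = "\<lambda>_. 1"]) (auto simp: pm_0)

text \<open>An unconstrained step adds the variance \<open>w i\<close> of the increment for every
  surviving path. A path killed at time \<open>i + 1\<close> has deviation at least \<kappa> (i +
  1), so it takes at least the square of this with it. With \<kappa> = 0 this is a plain growth
  bound.\<close>

lemma vr_step:
  assumes "0 \<le> \<kappa>" "\<And>y. \<not> ok (Suc i) y \<Longrightarrow> \<kappa> * real (Suc i) \<le> \<bar>real y - mean w (Suc i)\<bar>"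
  shows "vr ok w (Suc i) + \<kappa>\<^sup>2 * (real (Suc i))\<^sup>2 * (tot ok w i - tot ok w (Suc i)) \<le> vr ok w i + w i * tot ok w i"
proof -
  obtain k where k: "(psucc ok w i has_sum k) {y. \<not> ok (Suc i) y}" "tot ok w (Suc i) + k = tot ok w i"
    by (rule tot_step)
  from sq_step_has_sum[OF vr_has_sum] show ?thesis
  proof (rule pm_step[rotated 3, where f = "\<lambda>y. (real y - mean w (Suc i)) ^ 2"])
    fix s t assume s: "((\<lambda>y. pm ok w (Suc i) y * (real y - mean w (Suc i)) ^ 2) has_sum s) UNIV"
      and t: "((\<lambda>y. psucc ok w i y * (real y - mean w (Suc i)) ^ 2) has_sum t) {y. \<not> ok (Suc i) y}"
      and st: "s + t = vr ok w i + w i * tot ok w i"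
    have "s = vr ok w (Suc i)" using has_sum_unique[OF s vr_has_sum] .
    moreover have "\<kappa>\<^sup>2 * (real (Suc i))\<^sup>2 * k \<le> t"
    proof (rule has_sum_mono[OF has_sum_cmult_right[OF k(1)] t])
      fix y assume y: "y \<in> {y. \<not> ok (Suc i) y}"
      then have "(\<kappa> * real (Suc i))\<^sup>2 \<le> \<bar>real y - mean w (Suc i)\<bar>\<^sup>2"
        using assms by (intro power_mono) auto
      then have "\<kappa>\<^sup>2 * (real (Suc i))\<^sup>2 \<le> (real y - mean w (Suc i))\<^sup>2"
        by (simp add: power_mult_distrib)
      then show "\<kappa>\<^sup>2 * (real (Suc i))\<^sup>2 * psucc ok w i y \<le> psucc ok w i y * (real y - mean w (Suc i))\<^sup>2"
        using psucc_nonneg[OF w_nonneg] by (subst mult.commute) (rule mult_left_mono)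
    qed
    moreover have "k = tot ok w i - tot ok w (Suc i)" using k(2) by simp
    ultimately show ?thesis using st by simp
  next
    show "((\<lambda>d. pois (w i) d * (real (x + d) - mean w (Suc i)) ^ 2) has_sum ((real x - mean w i) ^ 2 + w i)) UNIV" for x
      by (rule pois_step_sq_has_sum)
  qed (use w_nonneg in auto)
qed

lemma vr_le: "(\<And>j. j < i \<Longrightarrow> w j \<le> W) \<Longrightarrow> vr ok w i \<le> W * (\<Sum>j<i. tot ok w j)"
proof (induction i)
  case (Suc i)
  have "vr ok w (Suc i) \<le> vr ok w i + w i * tot ok w i" using vr_step[of 0 i] by simp
  also have "\<dots> \<le> W * (\<Sum>j<i. tot ok w j) + W * tot ok w i"
    using Suc tot_nonneg by (intro add_mono mult_right_mono) auto
  finally show ?case by (simp add: algebra_simps)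
qed (simp add: vr_0)

text \<open>A Hajek--Renyi inequality for the walk conditioned to survive until time \<open>r\<close>.\<close>

lemma hajek_renyi:
  assumes "1 \<le> r" "r \<le> l" "0 \<le> \<kappa>" "0 \<le> W" "\<And>i. r \<le> i \<Longrightarrow> i < l \<Longrightarrow> w i \<le> W"
    and "\<And>i y. r \<le> i \<Longrightarrow> i < l \<Longrightarrow> \<not> ok (Suc i) y \<Longrightarrow> \<kappa> * real (Suc i) \<le> \<bar>real y - mean w (Suc i)\<bar>"
  shows "\<kappa>\<^sup>2 * (tot ok w r - tot ok w l) \<le> (vr ok w r / real r + W * tot ok w r) / real r"
proof -
  \<comment> \<open>Dividing \<open>vr\<close> by the squared time matches the linear barrier: every
    unit of lost survival probability releases at least \<kappa>^2. The added variance, W / (l +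
    1)^2 per survivor, is majorised by W (1 / l - 1 / (l + 1)), which telescopes.\<close>
  have "\<kappa>\<^sup>2 * (tot ok w r - tot ok w l) + vr ok w l / (real l)\<^sup>2 \<le>
    vr ok w r / (real r)\<^sup>2 + W * tot ok w r * (1 / real r - 1 / real l)"
    using assms(2,5,6)
  proof (induction l rule: dec_induct)
    case (step l)
    have lpos: "real l > 0" using step assms(1) by simp
    note W0 = assms(4)
    have "\<kappa>\<^sup>2 * (tot ok w l - tot ok w (Suc l)) + vr ok w (Suc l) / (real (Suc l))\<^sup>2
      = (vr ok w (Suc l) + \<kappa>\<^sup>2 * (real (Suc l))\<^sup>2 * (tot ok w l - tot ok w (Suc l))) / (real (Suc l))\<^sup>2"
      by (simp add: add_divide_distrib del: of_nat_Suc)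
    also have "\<dots> \<le> (vr ok w l + w l * tot ok w l) / (real (Suc l))\<^sup>2"
      using vr_step[OF assms(3), of l] step by (intro divide_right_mono) auto
    also have "\<dots> \<le> (vr ok w l + W * tot ok w r) / (real (Suc l))\<^sup>2"
      using step tot_antimono[of r l] tot_nonneg W0
      by (intro divide_right_mono add_left_mono mult_mono) auto
    also have "\<dots> \<le> vr ok w l / (real l)\<^sup>2 + W * tot ok w r * (1 / real l - 1 / real (Suc l))"
    proof -
      have "vr ok w l / (real (Suc l))\<^sup>2 \<le> vr ok w l / (real l)\<^sup>2"
        using lpos vr_nonneg by (intro divide_left_mono power_mono) auto
      moreover have "1 / (real (Suc l))\<^sup>2 \<le> 1 / real l - 1 / real (Suc l)"
        using lpos by (simp add: divide_simps power2_eq_square)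
      then have "W * tot ok w r * (1 / (real (Suc l))\<^sup>2) \<le> W * tot ok w r * (1 / real l - 1 / real (Suc l))"
        using W0 tot_nonneg by (intro mult_left_mono) auto
      ultimately show ?thesis by (simp add: add_divide_distrib)
    qed
    finally have one: "\<kappa>\<^sup>2 * (tot ok w l - tot ok w (Suc l)) + vr ok w (Suc l) / (real (Suc l))\<^sup>2 \<le>
      vr ok w l / (real l)\<^sup>2 + W * tot ok w r * (1 / real l - 1 / real (Suc l))" .
    have "\<kappa>\<^sup>2 * (tot ok w r - tot ok w l) + vr ok w l / (real l)\<^sup>2 \<le>
      vr ok w r / (real r)\<^sup>2 + W * tot ok w r * (1 / real r - 1 / real l)"
      using step by auto
    then have "(\<kappa>\<^sup>2 * (tot ok w r - tot ok w l) + vr ok w l / (real l)\<^sup>2)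
        + (\<kappa>\<^sup>2 * (tot ok w l - tot ok w (Suc l)) + vr ok w (Suc l) / (real (Suc l))\<^sup>2) \<le>
      (vr ok w r / (real r)\<^sup>2 + W * tot ok w r * (1 / real r - 1 / real l))
        + (vr ok w l / (real l)\<^sup>2 + W * tot ok w r * (1 / real l - 1 / real (Suc l)))"
      using one by (rule add_mono)
    then show ?case by (simp only: right_diff_distrib)
  qed simp
  moreover have "0 \<le> vr ok w l / (real l)\<^sup>2" using vr_nonneg by simp
  moreover have "W * tot ok w r * (1 / real r - 1 / real l) \<le> W * tot ok w r * (1 / real r)"
    using assms(4) tot_nonneg by (intro mult_left_mono) auto
  ultimately have "\<kappa>\<^sup>2 * (tot ok w r - tot ok w l) \<le> vr ok w r / (real r)\<^sup>2 + W * tot ok w r * (1 / real r)"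
    by linarith
  also have "\<dots> = (vr ok w r / real r + W * tot ok w r) / real r"
    by (simp add: add_divide_distrib power2_eq_square)
  finally show ?thesis .
qed

end

section \<open>Exponential martingales for the forward walk\<close>

lemma mass_ahead_zero: "x < i \<Longrightarrow> pm ahead w i x = 0"
  by (cases i) (auto simp: pm_Suc)

lemma psucc_ahead_zero: "x < i \<Longrightarrow> psucc ahead w i x = 0"
  by (auto simp: psucc_def mass_ahead_zero intro!: sum.neutral)

context
  fixes w :: "nat \<Rightarrow> real" and \<eta> :: real
  assumes w_nonneg: "\<And>i. 0 \<le> w i" and \<eta>: "0 < \<eta>" "\<eta> < 1"
begin

lemmas w_facts = pm_summable[of w, OF w_nonneg] pm_nonneg[of w, OF w_nonneg] pm_has_sum[of w, OF w_nonneg]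
  tot_0[of w, OF w_nonneg]

text \<open>With S = \<open>x + 1 - i\<close> the number of active vertices, this is the expectation
  of \<eta>^S over surviving paths, and \<open>gs\<close> that of S \<eta>^S. The truncated
  subtraction is exact on survivors, where \<open>i \<le> x\<close>.\<close>

definition es :: "nat \<Rightarrow> real" where
  "es i = infsum (\<lambda>x. pm ahead w i x * \<eta> ^ (x + 1 - i)) UNIV"

definition gs :: "nat \<Rightarrow> real" where
  "gs i = infsum (\<lambda>x. pm ahead w i x * (real (x + 1 - i) * \<eta> ^ (x + 1 - i))) UNIV"

lemma es_has_sum: "((\<lambda>x. pm ahead w i x * \<eta> ^ (x + 1 - i)) has_sum es i) UNIV"
proof -
  have "(\<lambda>x. pm ahead w i x * \<eta> ^ (x + 1 - i)) summable_on UNIV"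
    using w_facts(1)[of ahead i]
    by (rule summable_on_comparison_test) (use \<eta> w_facts(2) in
        \<open>auto intro!: mult_left_le mult_nonneg_nonneg power_le_one\<close>)
  then show ?thesis by (simp add: es_def)
qed

lemma real_power_le: "real s * \<eta> ^ s \<le> 1 / (1 - \<eta>)"
proof -
  have "real s * \<eta> ^ s \<le> (\<Sum>j<s. \<eta> ^ j)"
    using sum_mono[of "{..<s}" "\<lambda>_. \<eta> ^ s" "\<lambda>j. \<eta> ^ j"] \<eta> by (simp add: power_decreasing)
  also have "\<dots> = (1 - \<eta> ^ s) / (1 - \<eta>)" using \<eta> by (subst sum_gp_strict) auto
  also have "\<dots> \<le> 1 / (1 - \<eta>)" using \<eta> by (intro divide_right_mono) auto
  finally show ?thesis .
qed

lemma gs_has_sum: "((\<lambda>x. pm ahead w i x * (real (x + 1 - i) * \<eta> ^ (x + 1 - i))) has_sum gs i) UNIV"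
proof -
  have "(\<lambda>x. pm ahead w i x * (1 / (1 - \<eta>))) summable_on UNIV"
    by (rule summable_on_cmult_left[OF w_facts(1)])
  then have "(\<lambda>x. pm ahead w i x * (real (x + 1 - i) * \<eta> ^ (x + 1 - i))) summable_on UNIV"
  proof (rule summable_on_comparison_test)
    fix x
    show "pm ahead w i x * (real (x + 1 - i) * \<eta> ^ (x + 1 - i)) \<le> pm ahead w i x * (1 / (1 - \<eta>))"
      using real_power_le w_facts(2) by (rule mult_left_mono)
    show "0 \<le> pm ahead w i x * (real (x + 1 - i) * \<eta> ^ (x + 1 - i))"
      using \<eta> w_facts(2) by (intro mult_nonneg_nonneg) auto
  qed
  then show ?thesis by (simp add: gs_def)
qed

lemma es_nonneg: "0 \<le> es i"
  unfolding es_def using \<eta> by (intro infsum_nonneg mult_nonneg_nonneg pm_nonneg w_nonneg) auto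

lemma gs_nonneg: "0 \<le> gs i"
  unfolding gs_def using \<eta> by (intro infsum_nonneg mult_nonneg_nonneg pm_nonneg w_nonneg) auto

lemma es_0: "es 0 = \<eta>"
  unfolding es_def by (subst infsum_cong_neutral[where T = "{0}" and g = "\<lambda>_. \<eta>"]) (auto simp: pm_0)

lemma gs_0: "gs 0 = \<eta>"
  unfolding gs_def by (subst infsum_cong_neutral[where T = "{0}" and g = "\<lambda>_. \<eta>"]) (auto simp: pm_0)

text \<open>The condition \<open>f 0 = 0\<close> absorbs the killing: a path that dies has no active
  vertex left and contributes \<open>f 0\<close>, so dropping it leaves the sum unchanged and the
  step formula is exact.\<close>

lemma ahead_step:
  assumes f: "\<And>x. 0 \<le> f x" "f 0 = 0"
    and g: "\<And>s. s \<ge> 1 \<Longrightarrow> ((\<lambda>d. pois (w i) d * f (s + d - 1)) has_sum g s) UNIV"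
    and S: "((\<lambda>x. pm ahead w i x * g (x + 1 - i)) has_sum S) UNIV"
  shows "((\<lambda>x. pm ahead w (Suc i) x * f (x + 1 - Suc i)) has_sum S) UNIV"
proof -
  have "((\<lambda>x. psucc ahead w i x * f (x + 1 - Suc i)) has_sum S) UNIV"
  proof (rule psucc_has_sum)
    fix x assume "pm ahead w i x \<noteq> 0"
    then have x: "x \<ge> i" using mass_ahead_zero[of x i w] by force
    then have "x + 1 - i + d - 1 = x + d + 1 - Suc i" for d by auto
    then show "((\<lambda>d. pois (w i) d * f (x + d + 1 - Suc i)) has_sum g (x + 1 - i)) UNIV"
      using g[of "x + 1 - i"] x by simp
  qed (use w_nonneg f S in auto)
  moreover have "(\<lambda>x. psucc ahead w i x * f (x + 1 - Suc i)) = (\<lambda>x. pm ahead w (Suc i) x * f (x + 1 - Suc i))"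
  proof
    fix x show "psucc ahead w i x * f (x + 1 - Suc i) = pm ahead w (Suc i) x * f (x + 1 - Suc i)"
  proof (cases "Suc i \<le> x")
    case False
    then show ?thesis using f psucc_ahead_zero by simp
  qed (simp add: pm_Suc)
  qed
  ultimately show ?thesis by simp
qed

lemma pow_has_sum: "((\<lambda>d. pois (w i) d * \<eta> ^ d) has_sum exp (w i * (\<eta> - 1))) UNIV"
  by (rule sums_nonneg_imp_has_sum[OF pois_pgf_sums]) (use w_nonneg \<eta> pois_nonneg in auto)

text \<open>\<open>tot - es\<close> is the expectation of \<open>1 - \<eta>\<^sup>S\<close> over surviving paths; \<open>\<eta>\<^sup>S\<close> is a super- or
  submartingale according to the sign of \<open>exp (w (\<eta> - 1)) - \<eta>\<close>.\<close>

lemma tot_es_step: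
  "tot ahead w (Suc i) - es (Suc i) = tot ahead w i - es i * (exp (w i * (\<eta> - 1)) / \<eta>)"
proof -
  have "((\<lambda>x. pm ahead w (Suc i) x * (1 - \<eta> ^ (x + 1 - Suc i))) has_sum
      (tot ahead w i - es i * (exp (w i * (\<eta> - 1)) / \<eta>))) UNIV"
  proof (rule ahead_step)
    fix s :: nat assume s: "s \<ge> 1"
    have "((\<lambda>d. pois (w i) d + - (\<eta> ^ (s - 1)) * (pois (w i) d * \<eta> ^ d)) has_sum
      (1 + - (\<eta> ^ (s - 1)) * exp (w i * (\<eta> - 1)))) UNIV"
      by (intro has_sum_add has_sum_cmult_right pow_has_sum pois_has_sum w_nonneg)
    moreover have "pois (w i) d + - (\<eta> ^ (s - 1)) * (pois (w i) d * \<eta> ^ d) = pois (w i) d * (1 - \<eta> ^ (s + d - 1))" for d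
      using s by (auto simp: power_add algebra_simps Suc_le_eq gr0_conv_Suc)
    moreover have "1 + - (\<eta> ^ (s - 1)) * exp (w i * (\<eta> - 1)) = 1 - \<eta> ^ s * (exp (w i * (\<eta> - 1)) / \<eta>)"
      using s \<eta> by (auto simp: Suc_le_eq gr0_conv_Suc)
    ultimately show "((\<lambda>d. pois (w i) d * (1 - \<eta> ^ (s + d - 1))) has_sum
       (1 - \<eta> ^ s * (exp (w i * (\<eta> - 1)) / \<eta>))) UNIV" by simp
  next
    have "((\<lambda>x. pm ahead w i x + - (exp (w i * (\<eta> - 1)) / \<eta>) * (pm ahead w i x * \<eta> ^ (x + 1 - i))) has_sum
      (tot ahead w i + - (exp (w i * (\<eta> - 1)) / \<eta>) * es i)) UNIV"
      by (intro has_sum_add has_sum_cmult_right es_has_sum w_facts(3))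
    then show "((\<lambda>x. pm ahead w i x * (1 - \<eta> ^ (x + 1 - i) * (exp (w i * (\<eta> - 1)) / \<eta>))) has_sum
      (tot ahead w i - es i * (exp (w i * (\<eta> - 1)) / \<eta>))) UNIV"
      by (simp add: algebra_simps)
  qed (use \<eta> in \<open>auto intro: power_le_one\<close>)
  moreover have "((\<lambda>x. pm ahead w (Suc i) x + - 1 * (pm ahead w (Suc i) x * \<eta> ^ (x + 1 - Suc i))) has_sum
      (tot ahead w (Suc i) + - 1 * es (Suc i))) UNIV"
    by (intro has_sum_add has_sum_cmult_right es_has_sum w_facts(3))
  then have "((\<lambda>x. pm ahead w (Suc i) x * (1 - \<eta> ^ (x + 1 - Suc i))) has_sum
      (tot ahead w (Suc i) - es (Suc i))) UNIV"
    by (simp add: algebra_simps)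
  ultimately show ?thesis by (rule has_sum_unique[symmetric])
qed

lemma tot_es_upper:
  assumes "\<And>i. i < r \<Longrightarrow> \<eta> \<le> exp (w i * (\<eta> - 1))"
  shows "tot ahead w r - es r \<le> 1 - \<eta>"
  using assms
proof (induction r)
  case (Suc r)
  have "es r * 1 \<le> es r * (exp (w r * (\<eta> - 1)) / \<eta>)"
    using Suc.prems[of r] \<eta> es_nonneg by (intro mult_left_mono) auto
  then show ?case using Suc tot_es_step[of r] by simp
qed (simp add: es_0 w_facts(4))

lemma tot_es_lower:
  assumes "\<And>i. i < r \<Longrightarrow> exp (w i * (\<eta> - 1)) \<le> \<eta>"
  shows "1 - \<eta> \<le> tot ahead w r - es r"
  using assms
proof (induction r)
  case (Suc r)
  have "es r * (exp (w r * (\<eta> - 1)) / \<eta>) \<le> es r * 1"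
    using Suc.prems[of r] \<eta> es_nonneg by (intro mult_left_mono) auto
  then show ?case using Suc tot_es_step[of r] by simp
qed (simp add: es_0 w_facts(4))

text \<open>With c = exp (w (\<eta> - 1)) / \<eta>, a step takes S \<eta>^S to c \<eta>^S (S - (1 -
  w \<eta>)) on average; this comes from differentiating the generating function. Every step
  therefore subtracts at least \<kappa> \<open>es\<close> before the factor L, and summing over time
  bounds the total of \<open>es\<close>.\<close>

lemma gs_step:
  assumes "exp (w i * (\<eta> - 1)) \<le> L * \<eta>" "w i * \<eta> \<le> 1 - \<kappa>"
  shows "gs (Suc i) \<le> L * (gs i - \<kappa> * es i)"
proof -
  define c where "c = exp (w i * (\<eta> - 1)) / \<eta>"
  have c: "0 < c" "c \<le> L" using assms(1) \<eta> by (auto simp: c_def field_simps)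
  have "((\<lambda>x. pm ahead w (Suc i) x * (real (x + 1 - Suc i) * \<eta> ^ (x + 1 - Suc i))) has_sum
      (c * (gs i - (1 - w i * \<eta>) * es i))) UNIV"
  proof (rule ahead_step)
    fix s :: nat assume s: "s \<ge> 1"
    have der: "((\<lambda>d. real d * pois (w i) d * \<eta> ^ d) has_sum (w i * \<eta> * exp (w i * (\<eta> - 1)))) UNIV"
      by (rule sums_nonneg_imp_has_sum[OF pois_pgf_deriv_sums]) (use w_nonneg \<eta> pois_nonneg in auto)
    have "((\<lambda>d. \<eta> ^ (s - 1) * real (s - 1) * (pois (w i) d * \<eta> ^ d) + \<eta> ^ (s - 1) * (real d * pois (w i) d * \<eta> ^ d)) has_sum
      (\<eta> ^ (s - 1) * real (s - 1) * exp (w i * (\<eta> - 1)) + \<eta> ^ (s - 1) * (w i * \<eta> * exp (w i * (\<eta> - 1))))) UNIV"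
      by (intro has_sum_add has_sum_cmult_right pow_has_sum der)
    moreover have "\<eta> ^ (s - 1) * real (s - 1) * (pois (w i) d * \<eta> ^ d) + \<eta> ^ (s - 1) * (real d * pois (w i) d * \<eta> ^ d)
      = pois (w i) d * (real (s + d - 1) * \<eta> ^ (s + d - 1))" for d
      using s by (auto simp: power_add algebra_simps Suc_le_eq gr0_conv_Suc)
    moreover have "\<eta> ^ (s - 1) * real (s - 1) * exp (w i * (\<eta> - 1)) + \<eta> ^ (s - 1) * (w i * \<eta> * exp (w i * (\<eta> - 1)))
      = \<eta> ^ s * c * (real s - (1 - w i * \<eta>))"
      using s \<eta> by (auto simp: c_def Suc_le_eq gr0_conv_Suc field_simps)
    ultimately show "((\<lambda>d. pois (w i) d * (real (s + d - 1) * \<eta> ^ (s + d - 1))) has_sum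
       (\<eta> ^ s * c * (real s - (1 - w i * \<eta>)))) UNIV" by simp
  next
    have "((\<lambda>x. c * (pm ahead w i x * (real (x + 1 - i) * \<eta> ^ (x + 1 - i)) +
        - (1 - w i * \<eta>) * (pm ahead w i x * \<eta> ^ (x + 1 - i)))) has_sum
      (c * (gs i + - (1 - w i * \<eta>) * es i))) UNIV"
      by (intro has_sum_add has_sum_cmult_right es_has_sum gs_has_sum)
    then show "((\<lambda>x. pm ahead w i x * (\<eta> ^ (x + 1 - i) * c * (real (x + 1 - i) - (1 - w i * \<eta>)))) has_sum
      (c * (gs i - (1 - w i * \<eta>) * es i))) UNIV"
      by (simp add: algebra_simps)
  qed (use \<eta> in auto)
  then have "gs (Suc i) = c * (gs i - (1 - w i * \<eta>) * es i)"
    using gs_has_sum by (intro has_sum_unique)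
  \<comment> \<open>The bracket is nonnegative because c times it equals \<open>gs (Suc i)\<close>;
    this is what allows c to be enlarged to L.\<close>
  moreover have "0 \<le> gs i - (1 - w i * \<eta>) * es i"
    using calculation gs_nonneg[of "Suc i"] c by (simp add: zero_le_mult_iff)
  then have "c * (gs i - (1 - w i * \<eta>) * es i) \<le> L * (gs i - (1 - w i * \<eta>) * es i)"
    using c by (intro mult_right_mono) auto
  moreover have "\<kappa> * es i \<le> (1 - w i * \<eta>) * es i"
    using assms(2) es_nonneg by (intro mult_right_mono) auto
  then have "L * (gs i - (1 - w i * \<eta>) * es i) \<le> L * (gs i - \<kappa> * es i)"
    using c by (intro mult_left_mono) auto
  ultimately show ?thesis by linarith
qed

end

lemma exp_quadratic_upper:
  fixes x :: real
  assumes "0 \<le> x" "x \<le> 1 / 2"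
  shows "exp (- x) \<le> exp (x\<^sup>2) * (1 - x)"
proof -
  have "ln (1 - 0) + 0 + 0\<^sup>2 \<le> ln (1 - x) + x + x\<^sup>2"
  proof (rule DERIV_nonneg_imp_nondecreasing[OF assms(1)])
    fix y assume y: "0 \<le> y" "y \<le> x"
    have "((\<lambda>x. ln (1 - x) + x + x\<^sup>2) has_real_derivative (- 1 / (1 - y) + 1 + 2 * y)) (at y)"
      using y assms by (auto intro!: derivative_eq_intros simp: field_simps)
    moreover have "- 1 / (1 - y) + 1 + 2 * y = y * (1 - 2 * y) / (1 - y)"
      using y assms by (simp add: field_simps)
    moreover have "0 \<le> y * (1 - 2 * y) / (1 - y)"
      using y assms by (intro divide_nonneg_nonneg mult_nonneg_nonneg) auto
    ultimately show "\<exists>d. ((\<lambda>x. ln (1 - x) + x + x\<^sup>2) has_real_derivative d) (at y) \<and> 0 \<le> d" by metis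
  qed
  then have "- x - x\<^sup>2 \<le> ln (1 - x)" by simp
  then have "exp (- x - x\<^sup>2) \<le> 1 - x" using assms by (simp add: ln_ge_iff)
  then have "exp (x\<^sup>2) * exp (- x - x\<^sup>2) \<le> exp (x\<^sup>2) * (1 - x)" by (intro mult_left_mono) auto
  then show ?thesis by (simp add: exp_add[symmetric])
qed

lemma one_minus_le_exp_quadratic:
  fixes x :: real
  assumes "0 \<le> x" "x < 1"
  shows "1 - x \<le> exp (- x - x\<^sup>2 / 2)"
proof -
  have "ln (1 - x) + x + x\<^sup>2 / 2 \<le> ln (1 - 0) + 0 + 0\<^sup>2 / 2"
  proof (rule DERIV_nonpos_imp_nonincreasing[OF assms(1)])
    fix y assume y: "0 \<le> y" "y \<le> x"
    have "((\<lambda>x. ln (1 - x) + x + x\<^sup>2 / 2) has_real_derivative (- 1 / (1 - y) + 1 + y)) (at y)"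
      using y assms by (auto intro!: derivative_eq_intros simp: field_simps)
    moreover have "- 1 / (1 - y) + 1 + y \<le> 0"
      using y assms by (simp add: field_simps)
    ultimately show "\<exists>d. ((\<lambda>x. ln (1 - x) + x + x\<^sup>2 / 2) has_real_derivative d) (at y) \<and> d \<le> 0" by blast
  qed
  then have "ln (1 - x) \<le> - x - x\<^sup>2 / 2" by simp
  then show ?thesis using assms by (metis diff_gt_0_iff_gt exp_le_cancel_iff exp_ln)
qed

text \<open>For \<eta> = 1 - \<rho> the power \<eta>^S is a submartingale, so survival up to i has
  probability at most \<rho> + \<open>es\<close>. Survival is antitone in time, so its probability
  at N is at most the average of these bounds, and \<open>gs_step\<close> limits the sum of
  \<open>es\<close> to 2 e / \<rho>, rounded up to 6 / \<rho>. The condition N \<rho>^2 \<le> 1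
  keeps the accumulated growth factor at most e.\<close>

lemma tot_ahead_crude_aux:
  assumes w0: "\<And>i. 0 \<le> w i" and \<rho>: "0 < \<rho>" "\<rho> \<le> 1 / 2" and N: "real N * \<rho>\<^sup>2 \<le> 1" "N \<ge> 1"
    and w: "\<And>i. i < N \<Longrightarrow> 1 \<le> w i \<and> w i \<le> 1 + \<rho> / 4"
  shows "tot ahead w N \<le> \<rho> + 6 / (\<rho> * real N)"
proof -
  define \<eta> where "\<eta> = 1 - \<rho>"
  have \<eta>: "0 < \<eta>" "\<eta> < 1" using \<rho> by (auto simp: \<eta>_def)
  note ctx = w0 \<eta>
  note gs_0 = gs_0[of w \<eta>, OF ctx] and gs_step = gs_step[of w \<eta>, OF ctx] and gs_nonneg = gs_nonneg[of w \<eta>, OF ctx]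
    and es_nonneg = es_nonneg[of w \<eta>, OF ctx] and tot_es_upper = tot_es_upper[of w \<eta>, OF ctx]
    and tot_antimono = tot_antimono[of w, OF w0]
  have up: "\<eta> \<le> exp (w i * (\<eta> - 1))" if "i < N" for i
  proof -
    have "\<eta> \<le> exp (- \<rho> - \<rho>\<^sup>2 / 2)"
      using one_minus_le_exp_quadratic[of \<rho>] \<rho> by (simp add: \<eta>_def)
    also have "\<dots> \<le> exp (w i * (\<eta> - 1))"
    proof -
      have "w i * \<rho> \<le> (1 + \<rho> / 4) * \<rho>" using w[OF that] \<rho> by (intro mult_right_mono) auto
      moreover have "(1 + \<rho> / 4) * \<rho> \<le> \<rho> + \<rho>\<^sup>2 / 2" by (simp add: algebra_simps power2_eq_square)
      ultimately have "w i * \<rho> \<le> \<rho> + \<rho>\<^sup>2 / 2" by simp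
      then show ?thesis by (simp add: \<eta>_def algebra_simps)
    qed
    finally show ?thesis .
  qed
  have L: "exp (w i * (\<eta> - 1)) \<le> exp (\<rho>\<^sup>2) * \<eta>" if "i < N" for i
  proof -
    have "1 * \<rho> \<le> w i * \<rho>" using w[OF that] \<rho> by (intro mult_right_mono) auto
    then have "exp (w i * (\<eta> - 1)) \<le> exp (- \<rho>)" by (simp add: \<eta>_def algebra_simps)
    also have "\<dots> \<le> exp (\<rho>\<^sup>2) * \<eta>" using exp_quadratic_upper[of \<rho>] \<rho> by (simp add: \<eta>_def)
    finally show ?thesis .
  qed
  have K: "w i * \<eta> \<le> 1 - \<rho> / 2" if "i < N" for i
  proof -
    have "w i * \<eta> \<le> (1 + \<rho> / 4) * \<eta>" using w[OF that] \<eta> by (intro mult_right_mono) auto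
    also have "\<dots> = 1 - 3 * \<rho> / 4 - \<rho> * \<rho> / 4" by (simp add: \<eta>_def field_simps)
    also have "\<dots> \<le> 1 - \<rho> / 2"
    proof -
      have "0 \<le> \<rho> * \<rho>" by simp
      then show ?thesis using \<rho> by linarith
    qed
    finally show ?thesis .
  qed
  \<comment> \<open>Discounting by exp (- n \<rho>^2) offsets the factor exp (\<rho>^2) per step, so
    the losses (\<rho> / 2) \<open>es\<close> telescope against the initial value \<eta> \<le>
    1.\<close>
  have "gs w \<eta> n * exp (- (real n * \<rho>\<^sup>2)) + (\<rho> / 2) * (\<Sum>i<n. exp (- (real i * \<rho>\<^sup>2)) * es w \<eta> i) \<le> 1" if "n \<le> N" for n
    using that
  proof (induction n)
    case 0
    then show ?case using \<eta> by (simp add: gs_0)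
  next
    case (Suc n)
    have "gs w \<eta> (Suc n) \<le> exp (\<rho>\<^sup>2) * (gs w \<eta> n - \<rho> / 2 * es w \<eta> n)"
      by (rule gs_step) (use L K Suc in auto)
    then have "gs w \<eta> (Suc n) * exp (- (real (Suc n) * \<rho>\<^sup>2)) \<le>
        exp (\<rho>\<^sup>2) * (gs w \<eta> n - \<rho> / 2 * es w \<eta> n) * exp (- (real (Suc n) * \<rho>\<^sup>2))"
      by (intro mult_right_mono) auto
    also have "\<dots> = (gs w \<eta> n - \<rho> / 2 * es w \<eta> n) * (exp (\<rho>\<^sup>2) * exp (- (real (Suc n) * \<rho>\<^sup>2)))"
      by (simp add: mult_ac)
    also have "exp (\<rho>\<^sup>2) * exp (- (real (Suc n) * \<rho>\<^sup>2)) = exp (- (real n * \<rho>\<^sup>2))"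
      by (simp add: exp_add[symmetric] algebra_simps)
    finally show ?case using Suc by (simp add: algebra_simps)
  qed
  note tel = this[of N, OF order_refl]
  have "(\<rho> / 2) * (\<Sum>i<N. exp (- (real i * \<rho>\<^sup>2)) * es w \<eta> i) \<le> 1"
  proof -
    have "0 \<le> gs w \<eta> N * exp (- (real N * \<rho>\<^sup>2))" using gs_nonneg[of N] by simp
    then show ?thesis using tel by linarith
  qed
  moreover have "exp (- 1) * (\<Sum>i<N. es w \<eta> i) \<le> (\<Sum>i<N. exp (- (real i * \<rho>\<^sup>2)) * es w \<eta> i)"
    unfolding sum_distrib_left
  proof (intro sum_mono mult_right_mono es_nonneg)
    fix i assume "i \<in> {..<N}"
    then have "real i * \<rho>\<^sup>2 \<le> real N * \<rho>\<^sup>2" by (intro mult_right_mono) auto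
    then show "exp (- 1) \<le> exp (- (real i * \<rho>\<^sup>2))" using N by simp
  qed
  ultimately have "(\<rho> / 2) * (exp (- 1) * (\<Sum>i<N. es w \<eta> i)) \<le> 1"
    using \<rho> mult_left_mono[of "exp (- 1) * (\<Sum>i<N. es w \<eta> i)" "\<Sum>i<N. exp (- (real i * \<rho>\<^sup>2)) * es w \<eta> i" "\<rho> / 2"]
    by linarith
  then have "(\<Sum>i<N. es w \<eta> i) \<le> 2 * exp 1 / \<rho>" using \<rho> by (simp add: exp_minus field_simps)
  also have "\<dots> \<le> 6 / \<rho>" using e_less_272 \<rho> by (intro divide_right_mono) auto
  finally have E: "(\<Sum>i<N. es w \<eta> i) \<le> 6 / \<rho>" .
  have "real N * tot ahead w N \<le> (\<Sum>i<N. tot ahead w i)"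
    using sum_mono[of "{..<N}" "\<lambda>_. tot ahead w N" "tot ahead w"] tot_antimono by simp
  also have "\<dots> \<le> (\<Sum>i<N. \<rho> + es w \<eta> i)"
  proof (rule sum_mono)
    fix i assume "i \<in> {..<N}"
    then show "tot ahead w i \<le> \<rho> + es w \<eta> i"
      using tot_es_upper[of i] up by (fastforce simp: \<eta>_def)
  qed
  also have "\<dots> \<le> real N * \<rho> + 6 / \<rho>" using E by (simp add: sum.distrib)
  finally show ?thesis using N \<rho> by (simp add: field_simps)
qed

text \<open>With \<rho> = 1 / sqrt M the preceding bound reads (1 + 6) / sqrt M, as long as the
  drift \<epsilon> is at most \<rho> / 4. For larger N the walk is stopped at M close to 1 / (4
  \<epsilon>)^2, where survival already has probability of order \<epsilon>; rounding M down to an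
  integer costs the factor 7 / 10, whence 40 = 7 * 4 / (7 / 10).\<close>

lemma tot_ahead_crude:
  assumes w0: "\<And>i. 0 \<le> w i" and \<epsilon>: "0 < \<epsilon>" "\<epsilon> \<le> 1 / 16" and N: "N \<ge> 1"
    and w: "\<And>i. i < N \<Longrightarrow> 1 \<le> w i \<and> w i \<le> 1 + \<epsilon>"
  shows "tot ahead w N \<le> 7 / sqrt (real N) + 40 * \<epsilon>"
proof -
  have base: "tot ahead w M \<le> 7 / sqrt (real M)" if M: "M \<ge> 1" "M \<le> N" "4 * \<epsilon> \<le> 1 / sqrt (real M)" for M
  proof (cases "M < 4")
    case True
    then have "sqrt (real M) \<le> sqrt (2\<^sup>2)" by (intro real_sqrt_le_mono) auto
    then have "1 \<le> 7 / sqrt (real M)" using M(1) by simp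
    then show ?thesis using tot_le_1[of w ahead M, OF w0] by linarith
  next
    case False
    then have "sqrt (2\<^sup>2) \<le> sqrt (real M)" by (intro real_sqrt_le_mono) auto
    then have s: "2 \<le> sqrt (real M)" by simp
    have "tot ahead w M \<le> 1 / sqrt (real M) + 6 / (1 / sqrt (real M) * real M)"
    proof (rule tot_ahead_crude_aux[of w, OF w0])
      show "1 / sqrt (real M) \<le> 1 / 2" using s M(1) by (intro divide_left_mono) auto
      show "1 \<le> w i \<and> w i \<le> 1 + 1 / sqrt (real M) / 4" if "i < M" for i
      proof -
        have "\<epsilon> \<le> 1 / sqrt (real M) / 4" using M(3) by simp
        then show ?thesis using w[of i] that M(2) by linarith
      qed
    qed (use s M in \<open>auto simp: power_divide\<close>)
    also have "1 / sqrt (real M) * real M = sqrt (real M)" using s by (simp add: real_div_sqrt)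
    finally show ?thesis by simp
  qed
  show ?thesis
  proof (cases "4 * \<epsilon> \<le> 1 / sqrt (real N)")
    case True
    then show ?thesis using base[of N] N \<epsilon> by simp
  next
    case False
    define x where "x = 1 / (4 * \<epsilon>)\<^sup>2"
    have x: "16 \<le> x" 
    proof -
      have "(4 * \<epsilon>)\<^sup>2 \<le> (1 / 4)\<^sup>2" using \<epsilon> by (intro power_mono) auto
      then show ?thesis using \<epsilon> by (simp add: x_def field_simps power2_eq_square)
    qed
    define M where "M = nat \<lfloor>x\<rfloor>"
    have M: "real M \<le> x" "x - 1 \<le> real M" "M \<ge> 1" using x by (auto simp: M_def) linarith+
    have "sqrt ((4 * \<epsilon>)\<^sup>2) = 4 * \<epsilon>" using \<epsilon> by (intro real_sqrt_unique) auto
    then have sx: "sqrt x = 1 / (4 * \<epsilon>)" unfolding x_def by (simp only: real_sqrt_divide real_sqrt_one)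
    have "sqrt (real M) \<le> 1 / (4 * \<epsilon>)" using M(1) sx by (metis real_sqrt_le_mono)
    then have M4: "4 * \<epsilon> \<le> 1 / sqrt (real M)" using \<epsilon> M(3) by (simp add: field_simps)
    have "1 / (4 * \<epsilon>) < sqrt (real N)" using False \<epsilon> N by (simp add: field_simps)
    then have "sqrt x < sqrt (real N)" by (simp add: sx)
    then have "M \<le> N" using M(1) by simp
    then have "tot ahead w N \<le> tot ahead w M" by (rule tot_antimono[of w, OF w0])
    also have "\<dots> \<le> 7 / sqrt (real M)" using base M M4 \<open>M \<le> N\<close> by blast
    also have "\<dots> \<le> 7 / (sqrt (4 / 5) * sqrt x)"
    proof (intro divide_left_mono)
      have "4 / 5 * x \<le> real M" using M x by linarith
      then show "sqrt (4 / 5) * sqrt x \<le> sqrt (real M)" by (metis real_sqrt_le_mono real_sqrt_mult)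
    qed (use x M in auto)
    also have "\<dots> \<le> 7 / (7 / 10 * sqrt x)"
    proof (intro divide_left_mono mult_right_mono)
      show "7 / 10 \<le> sqrt (4 / 5 :: real)" by (rule real_le_rsqrt) (simp add: power2_eq_square)
    qed (use x in auto)
    also have "\<dots> = 40 * \<epsilon>" using \<epsilon> by (simp add: sx)
    finally have "tot ahead w N \<le> 40 * \<epsilon>" .
    moreover have "0 \<le> 7 / sqrt (real N)" by simp
    ultimately show ?thesis by linarith
  qed
qed

section \<open>The reversed walk and bridges\<close>

abbreviation (input) behind :: "nat \<Rightarrow> nat \<Rightarrow> bool" where "behind i y \<equiv> y \<le> i"

lemma pm_behind_zero: "i < y \<Longrightarrow> pm behind w i y = 0"
  by (cases i) (auto simp: pm_0 pm_Suc)

section \<open>The ballot formula for constant means\<close>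

lemma pm_behind_const_aux:
  fixes n A B :: real
  assumes "n \<noteq> 0" "A \<noteq> 0" "B \<noteq> 0"
  shows "(e * p * (n - x) * N / (n * A)) * (f * r / B) =
      (e * f) * (p * r) / n * (n * (N / (A * B)) - x * N / (A * B))"
    and "D \<noteq> 0 \<Longrightarrow> e / n * (n * (p / A) - n * (x * p / (D * A))) = e * (D - x) * p / (D * A)"
    and "(e * f) * p * (n - x) * N / (n * A) = e * (f * (p * N) / A * (1 - x / n))"
  using assms by (simp_all add: field_simps)

text \<open>The ballot theorem for Poisson steps: the value is e^\<mu> times the Poisson weight of
  \<open>h\<close> with mean \<mu> (i + 1), times 1 - h / (i + 1). Heights equal to \<open>i\<close>
  are allowed, so the forbidden level is \<open>i + 1\<close>; there the formula vanishes, which is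
  why it covers \<open>h = Suc i\<close> and closes the induction.\<close>

lemma pm_behind_const:
  assumes "h \<le> Suc i"
  shows "pm behind (\<lambda>_. \<mu>) i h =
    exp (- \<mu> * real i) * \<mu> ^ h * (real (Suc i) - real h) * real (Suc i) ^ h / (real (Suc i) * fact h)"
  using assms
proof (induction i arbitrary: h)
  case 0
  then have "h = 0 \<or> h = 1" by auto
  then show ?case by (auto simp: pm_0)
next
  case (Suc i)
  show ?case
  proof (cases "h = Suc (Suc i)")
    case True
    then show ?thesis by (simp add: pm_behind_zero)
  next
    case False
    then have h: "h \<le> Suc i" using Suc by simp
    define n where "n = real (Suc i)"
    have n: "n > 0" by (simp add: n_def)
    have s1: "(\<Sum>x\<le>h. n ^ x / (fact x * fact (h - x))) = (n + 1) ^ h / fact h"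
      using binomial_fact_sum[where x = n and m = h and y = 1] by simp
    have s2: "(\<Sum>x\<le>h. real x * n ^ x / (fact x * fact (h - x))) = n * (real h * (n + 1) ^ h / ((n + 1) * fact h))"
    proof (cases h)
      case (Suc k)
      have "(\<Sum>x\<le>Suc k. real x * n ^ x / (fact x * fact (Suc k - x))) =
        (\<Sum>x\<le>k. real (Suc x) * n ^ Suc x / (fact (Suc x) * fact (k - x)))"
        by (subst sum.atMost_Suc_shift) simp
      also have "\<dots> = (\<Sum>x\<le>k. n * (n ^ x / (fact x * fact (k - x))))"
        by (intro sum.cong refl) (simp add: fact_Suc del: of_nat_Suc)
      also have "\<dots> = n * ((n + 1) ^ k / fact k)"
        unfolding sum_distrib_left[symmetric]
        using binomial_fact_sum[where x = n and m = k and y = 1] by simp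
      finally show ?thesis using Suc n by (simp add: fact_Suc del: of_nat_Suc)
    qed simp
    have "pm behind (\<lambda>_. \<mu>) (Suc i) h = (\<Sum>x\<le>h. pm behind (\<lambda>_. \<mu>) i x * pois \<mu> (h - x))"
      using h by (simp add: pm_Suc psucc_def)
    also have "\<dots> = (\<Sum>x\<le>h. exp (- \<mu> * real (Suc i)) * \<mu> ^ h / n * (n * (n ^ x / (fact x * fact (h - x))) -
        real x * n ^ x / (fact x * fact (h - x))))"
    proof (intro sum.cong refl)
      fix x assume x: "x \<in> {..h}"
      have "exp (- \<mu> * real (Suc i)) = exp (- \<mu> * real i) * exp (- \<mu>)"
        by (simp add: exp_add[symmetric] algebra_simps)
      moreover have "\<mu> ^ h = \<mu> ^ x * \<mu> ^ (h - x)" using x by (simp add: power_add[symmetric])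
      moreover have "pm behind (\<lambda>_. \<mu>) i x =
        exp (- \<mu> * real i) * \<mu> ^ x * (n - real x) * n ^ x / (n * fact x)"
        using Suc.IH[of x] x h by (simp add: n_def)
      ultimately show "pm behind (\<lambda>_. \<mu>) i x * pois \<mu> (h - x) =
        exp (- \<mu> * real (Suc i)) * \<mu> ^ h / n * (n * (n ^ x / (fact x * fact (h - x))) -
          real x * n ^ x / (fact x * fact (h - x)))"
        using n unfolding pois_def by (simp only:) (rule pm_behind_const_aux(1), simp_all)
    qed
    also have "\<dots> = exp (- \<mu> * real (Suc i)) * \<mu> ^ h / n *
        (n * ((n + 1) ^ h / fact h) - n * (real h * (n + 1) ^ h / ((n + 1) * fact h)))"
      unfolding sum_distrib_left[symmetric] sum_subtractf s1 s2 ..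
    also have "\<dots> = exp (- \<mu> * real (Suc i)) * \<mu> ^ h * ((n + 1) - real h) * (n + 1) ^ h / ((n + 1) * fact h)"
      using n by (intro pm_behind_const_aux(2)) auto
    finally show ?thesis by (simp add: n_def add.commute)
  qed
qed

lemma tot_behind_eq:
  shows "tot behind w i = (\<Sum>y\<le>i. pm behind w i y)"
  unfolding tot_def
  by (subst infsum_cong_neutral[where T = "{..i}" and g = "pm behind w i"]) (auto simp: pm_behind_zero)

lemma tot_behind_const:
  "tot behind (\<lambda>_. \<mu>) r = exp \<mu> * (\<Sum>h\<le>r. pois (\<mu> * real (Suc r)) h * (1 - real h / real (Suc r)))"
  unfolding tot_behind_eq sum_distrib_left
proof (intro sum.cong refl)
  fix h assume h: "h \<in> {..r}"
  have e: "exp (- \<mu> * real r) = exp \<mu> * exp (- (\<mu> * real (Suc r)))"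
    by (simp add: exp_add[symmetric] algebra_simps)
  show "pm behind (\<lambda>_. \<mu>) r h = exp \<mu> * (pois (\<mu> * real (Suc r)) h * (1 - real h / real (Suc r)))"
    using h unfolding pois_def power_mult_distrib
    by (subst pm_behind_const, simp, unfold e, intro pm_behind_const_aux(3)) (auto simp del: of_nat_Suc)
qed

text \<open>Letting \<open>h\<close> run over all naturals adds only nonpositive terms, since 1 - h
  / (r + 1) \<le> 0 for \<open>h > r\<close>, and the complete series equals 1 - \<mu> by the
  Poisson mean.\<close>

lemma tot_behind_const_lower:
  assumes "0 \<le> \<mu>"
  shows "exp \<mu> * (1 - \<mu>) \<le> tot behind (\<lambda>_. \<mu>) r"
proof -
  define n where "n = real (Suc r)"
  have n: "n > 0" by (simp add: n_def)
  have "(\<lambda>h. pois (\<mu> * n) h + (- 1 / n) * (pois (\<mu> * n) h * real h)) sums (1 + (- 1 / n) * (\<mu> * n))"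
    by (intro sums_add sums_mult pois_sums pois_mean_sums)
  moreover have "pois (\<mu> * n) h + (- 1 / n) * (pois (\<mu> * n) h * real h) = pois (\<mu> * n) h * (1 - real h / n)" for h
    by (simp add: algebra_simps)
  moreover have "1 + (- 1 / n) * (\<mu> * n) = 1 - \<mu>" using n by simp
  ultimately have S: "(\<lambda>h. - (pois (\<mu> * n) h * (1 - real h / n))) sums - (1 - \<mu>)"
    by (intro sums_minus) simp
  have "(\<Sum>h\<in>{..r}. - (pois (\<mu> * n) h * (1 - real h / n))) \<le> (\<Sum>h. - (pois (\<mu> * n) h * (1 - real h / n)))"
  proof (rule sum_le_suminf)
    show "summable (\<lambda>h. - (pois (\<mu> * n) h * (1 - real h / n)))" using S by (rule sums_summable)
    fix h assume "h \<in> - {..r}"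
    then have "1 \<le> real h / n" using n by (auto simp: n_def field_simps)
    then show "0 \<le> - (pois (\<mu> * n) h * (1 - real h / n))"
      using pois_nonneg[of "\<mu> * n" h] assms n by (simp add: mult_nonneg_nonpos)
  qed auto
  then have "1 - \<mu> \<le> (\<Sum>h\<le>r. pois (\<mu> * n) h * (1 - real h / n))"
    using S by (simp add: sums_iff sum_negf)
  then show ?thesis unfolding tot_behind_const n_def[symmetric] by (intro mult_left_mono) auto
qed

text \<open>The positive part \<open>(1 - x)\<^sub>+\<close> is at most \<open>1 - x + (x - \<mu>)\<^sup>2 / (4 (1 - \<mu>))\<close>.\<close>

lemma tot_behind_const_upper:
  assumes "0 \<le> \<mu>" "\<mu> < 1"
  shows "tot behind (\<lambda>_. \<mu>) r \<le> exp \<mu> * (1 - \<mu> + \<mu> / (4 * (1 - \<mu>) * real (Suc r)))"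
proof -
  define n where "n = real (Suc r)"
  have n: "n > 0" by (simp add: n_def)
  define c where "c = 1 / (4 * (1 - \<mu>))"
  let ?f = "\<lambda>h. 1 - real h / n + c * (real h / n - \<mu>)\<^sup>2"
  have pos: "0 \<le> ?f h" for h
  proof -
    define t where "t = real h / n"
    have "0 \<le> (1 - \<mu> - (t - 1))\<^sup>2" by simp
    then have "(t - 1) * (4 * (1 - \<mu>)) \<le> (t - \<mu>)\<^sup>2" by (simp add: power2_eq_square algebra_simps)
    then have "t - 1 \<le> c * (t - \<mu>)\<^sup>2" using assms by (simp add: c_def field_simps)
    then show ?thesis by (simp add: t_def)
  qed
  have "(\<lambda>h. pois (\<mu> * n) h + (- 1 / n) * (pois (\<mu> * n) h * real h) +
      (c / n\<^sup>2) * (pois (\<mu> * n) h * (- (\<mu> * n) + real h)\<^sup>2)) sums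
      (1 + (- 1 / n) * (\<mu> * n) + (c / n\<^sup>2) * ((- (\<mu> * n) + \<mu> * n)\<^sup>2 + \<mu> * n))"
    by (intro sums_add sums_mult pois_sums pois_mean_sums pois_sq_sums)
  moreover have "pois (\<mu> * n) h + (- 1 / n) * (pois (\<mu> * n) h * real h) +
      (c / n\<^sup>2) * (pois (\<mu> * n) h * (- (\<mu> * n) + real h)\<^sup>2) = pois (\<mu> * n) h * ?f h" for h
  proof -
    have "real h / n - \<mu> = (- (\<mu> * n) + real h) / n" using n by (simp add: field_simps)
    then have "(real h / n - \<mu>)\<^sup>2 = (- (\<mu> * n) + real h)\<^sup>2 / n\<^sup>2" by (simp only: power_divide)
    then show ?thesis by (simp add: algebra_simps)
  qed
  moreover have "1 + (- 1 / n) * (\<mu> * n) + (c / n\<^sup>2) * ((- (\<mu> * n) + \<mu> * n)\<^sup>2 + \<mu> * n) =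
      1 - \<mu> + \<mu> / (4 * (1 - \<mu>) * n)"
    using n by (simp add: c_def power2_eq_square)
  ultimately have S: "(\<lambda>h. pois (\<mu> * n) h * ?f h) sums (1 - \<mu> + \<mu> / (4 * (1 - \<mu>) * n))" by (simp only:)
  have "(\<Sum>h\<le>r. pois (\<mu> * n) h * (1 - real h / n)) \<le> (\<Sum>h\<le>r. pois (\<mu> * n) h * ?f h)"
    using assms n by (intro sum_mono mult_left_mono pois_nonneg) (auto simp: c_def)
  also have "\<dots> \<le> (\<Sum>h. pois (\<mu> * n) h * ?f h)"
    using S pos assms n by (intro sum_le_suminf sums_summable) (auto intro!: mult_nonneg_nonneg pois_nonneg)
  also have "\<dots> = 1 - \<mu> + \<mu> / (4 * (1 - \<mu>) * n)" using S by (simp add: sums_iff)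
  finally show ?thesis unfolding tot_behind_const n_def[symmetric] by (intro mult_left_mono) auto
qed

text \<open>The derivative of the distribution function with respect to the mean telescopes to
  \<open>- pois x k\<close>.\<close>

lemma pois_cdf_antimono:
  assumes "\<mu> \<le> \<nu>" "0 \<le> \<mu>"
  shows "(\<Sum>d\<le>k. pois \<nu> d) \<le> (\<Sum>d\<le>k. pois \<mu> d)"
proof (rule DERIV_nonpos_imp_nonincreasing[OF assms(1)])
  fix x assume x: "\<mu> \<le> x"
  have "((\<lambda>x. \<Sum>d\<le>k. pois x d) has_real_derivative (- pois x k)) (at x)" for x
  proof (induction k)
    case 0
    then show ?case by (auto simp: pois_def intro!: derivative_eq_intros)
  next
    case (Suc k)
    have "((\<lambda>x. pois x (Suc k)) has_real_derivative (pois x k - pois x (Suc k))) (at x)"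
      unfolding pois_def
      by (auto intro!: derivative_eq_intros simp: diff_divide_distrib fact_Suc simp del: power_Suc of_nat_Suc)
    from DERIV_add[OF Suc this] show ?case by simp
  qed
  then show "\<exists>y. ((\<lambda>x. \<Sum>d\<le>k. pois x d) has_real_derivative y) (at x) \<and> y \<le> 0"
    using pois_nonneg[of x k] assms x by (intro exI[of _ "- pois x k"]) auto
qed

lemma conv_cumulative:
  fixes a b :: "nat \<Rightarrow> real"
  shows "(\<Sum>y\<le>s. \<Sum>x\<le>y. a x * b (y - x)) = (\<Sum>x\<le>s. a x * (\<Sum>d\<le>s - x. b d))"
    and "(\<Sum>y\<le>s. \<Sum>x\<le>y. a x * b (y - x)) = (\<Sum>d\<le>s. b d * (\<Sum>x\<le>s - d. a x))"
proof -
  have "(\<Sum>y\<le>s. \<Sum>x\<le>y. a x * b (y - x)) = (\<Sum>(x, d)\<in>{(i, j). i + j \<le> s}. a x * b d)"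
    by (rule sum.triangle_reindex_eq[symmetric])
  moreover have "(\<Sum>(x, d)\<in>{(i, j). i + j \<le> s}. a x * b d) = (\<Sum>(x, d)\<in>Sigma {..s} (\<lambda>x. {..s - x}). a x * b d)"
    by (rule sum.cong) auto
  moreover have "\<dots> = (\<Sum>x\<le>s. a x * (\<Sum>d\<le>s - x. b d))"
    by (subst sum.Sigma[symmetric]) (auto simp: sum_distrib_left)
  moreover have "(\<Sum>(x, d)\<in>{(i, j). i + j \<le> s}. a x * b d) = (\<Sum>(d, x)\<in>Sigma {..s} (\<lambda>d. {..s - d}). a x * b d)"
    by (rule sum.reindex_bij_witness[of _ "\<lambda>(d, x). (x, d)" "\<lambda>(x, d). (d, x)"]) auto
  moreover have "\<dots> = (\<Sum>d\<le>s. b d * (\<Sum>x\<le>s - d. a x))"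
    by (subst sum.Sigma[symmetric]) (auto simp: sum_distrib_left mult.commute)
  ultimately show "(\<Sum>y\<le>s. \<Sum>x\<le>y. a x * b (y - x)) = (\<Sum>x\<le>s. a x * (\<Sum>d\<le>s - x. b d))"
    and "(\<Sum>y\<le>s. \<Sum>x\<le>y. a x * b (y - x)) = (\<Sum>d\<le>s. b d * (\<Sum>x\<le>s - d. a x))" by simp_all
qed

text \<open>Smaller increments make it easier to stay below the barrier. The induction runs over
  whole distribution functions: the constraint merely replaces \<open>t\<close> by the minimum of
  \<open>t\<close> and the barrier, and the remaining convolution is monotone in each
  factor.\<close>

lemma cumulative_behind_antimono:
  assumes "\<And>i. 0 \<le> w i" "\<And>i. i < r \<Longrightarrow> w i \<le> w' i"
  shows "(\<Sum>y\<le>t. pm behind w' r y) \<le> (\<Sum>y\<le>t. pm behind w r y)"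
  using assms(2)
proof (induction r arbitrary: t)
  case 0
  then show ?case by (simp add: pm_0)
next
  case (Suc r)
  define s where "s = min t (Suc r)"
  have cum: "(\<Sum>y\<le>t. pm behind v (Suc r) y) = (\<Sum>y\<le>s. psucc behind v r y)" for v
  proof -
    have "(\<Sum>y\<le>t. pm behind v (Suc r) y) = (\<Sum>y\<in>{..s}. pm behind v (Suc r) y)"
      by (intro sum.mono_neutral_right ballI pm_behind_zero) (auto simp: s_def)
    also have "\<dots> = (\<Sum>y\<le>s. psucc behind v r y)"
      by (rule sum.cong) (auto simp: s_def pm_Suc)
    finally show ?thesis .
  qed
  have w: "0 \<le> w r" "w r \<le> w' r" using assms Suc by auto
  have "(\<Sum>y\<le>s. psucc behind w' r y) = (\<Sum>d\<le>s. pois (w' r) d * (\<Sum>x\<le>s - d. pm behind w' r x))"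
    unfolding psucc_def by (rule conv_cumulative(2))
  also have "\<dots> \<le> (\<Sum>d\<le>s. pois (w' r) d * (\<Sum>x\<le>s - d. pm behind w r x))"
  proof (rule sum_mono, rule mult_left_mono)
    show "0 \<le> pois (w' r) d" for d using w by (intro pois_nonneg) auto
    show "(\<Sum>x\<le>s - d. pm behind w' r x) \<le> (\<Sum>x\<le>s - d. pm behind w r x)" for d
      using Suc by auto
  qed
  also have "\<dots> = (\<Sum>x\<le>s. pm behind w r x * (\<Sum>d\<le>s - x. pois (w' r) d))"
    by (rule conv_cumulative(2)[symmetric, THEN trans, OF conv_cumulative(1)])
  also have "\<dots> \<le> (\<Sum>x\<le>s. pm behind w r x * (\<Sum>d\<le>s - x. pois (w r) d))"
    using w assms(1) by (intro sum_mono mult_left_mono pois_cdf_antimono pm_nonneg) auto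
  also have "\<dots> = (\<Sum>y\<le>s. psucc behind w r y)"
    unfolding psucc_def by (rule conv_cumulative(1)[symmetric])
  finally show ?case unfolding cum .
qed

lemma tot_behind_antimono:
  "(\<And>i. 0 \<le> w i) \<Longrightarrow> (\<And>i. i < r \<Longrightarrow> w i \<le> w' i) \<Longrightarrow> tot behind w' r \<le> tot behind w r"
  unfolding tot_behind_eq by (rule cumulative_behind_antimono)

section \<open>Splitting the bridge into two windows and a middle piece\<close>

lemma time_reversal:
  assumes "l \<le> m"
  shows "pm ahead w m m = (\<Sum>x\<le>m. pm ahead w l x * pm behind (\<lambda>j. w (m - 1 - j)) (m - l) (m - x))"
proof -
  define u where "u = (\<lambda>j. w (m - 1 - j))"
  define T where "T l = (\<Sum>x\<le>m. pm ahead w l x * pm behind u (m - l) (m - x))" for l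
  have step: "T (Suc l) = T l" if "l < m" for l
  proof -
    define k where "k = m - Suc l"
    have k: "m - l = Suc k" "u k = w l" using that by (auto simp: k_def u_def)
    let ?F = "\<lambda>x y. pm ahead w l x * pois (w l) (y - x) * pm behind u k (m - y)"
    have "T (Suc l) = (\<Sum>y\<le>m. \<Sum>x\<le>y. ?F x y)"
      unfolding T_def k_def[symmetric]
    proof (intro sum.cong refl)
      fix y assume "y \<in> {..m}"
      show "pm ahead w (Suc l) y * pm behind u k (m - y) = (\<Sum>x\<le>y. ?F x y)"
      proof (cases "Suc l \<le> y")
        case True
        then show ?thesis by (simp add: pm_Suc psucc_def sum_distrib_right)
      next
        case False
        then have "pm behind u k (m - y) = 0" using that by (intro pm_behind_zero) (auto simp: k_def)
        then show ?thesis by simp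
      qed
    qed
    also have "\<dots> = (\<Sum>y\<in>{..m}. \<Sum>x\<in>{x\<in>{..m}. x \<le> y}. ?F x y)"
      by (intro sum.cong) auto
    also have "\<dots> = (\<Sum>x\<in>{..m}. \<Sum>y\<in>{y\<in>{..m}. x \<le> y}. ?F x y)"
      by (rule sum.swap_restrict) auto
    also have "\<dots> = T l"
      unfolding T_def k(1)
    proof (intro sum.cong refl)
      fix x assume x: "x \<in> {..m}"
      show "(\<Sum>y\<in>{y\<in>{..m}. x \<le> y}. ?F x y) = pm ahead w l x * pm behind u (Suc k) (m - x)"
      proof (cases "l \<le> x")
        case True
        have "(\<Sum>y\<in>{y\<in>{..m}. x \<le> y}. pois (w l) (y - x) * pm behind u k (m - y)) =
          (\<Sum>v\<le>m - x. pm behind u k v * pois (u k) (m - x - v))"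
          by (rule sum.reindex_bij_witness[of _ "\<lambda>v. m - v" "\<lambda>y. m - y"]) (use x k in auto)
        also have "\<dots> = pm behind u (Suc k) (m - x)"
          using True that by (simp add: pm_Suc psucc_def k_def)
        finally show ?thesis by (simp add: sum_distrib_left[symmetric] mult.assoc)
      qed (simp add: mass_ahead_zero)
    qed
    finally show ?thesis .
  qed
  have "T m = T l"
    using assms by (induction rule: inc_induct) (use step in auto)
  moreover have "T m = pm ahead w m m"
    unfolding T_def by (subst sum.remove[of _ m]) (auto simp: pm_0 intro!: sum.neutral)
  ultimately show ?thesis by (simp add: T_def u_def)
qed

lemma pois_conv: "(\<Sum>d\<le>m. pois \<mu> d * pois \<nu> (m - d)) = pois (\<mu> + \<nu>) m"
proof -
  have "(\<Sum>d\<le>m. pois \<mu> d * pois \<nu> (m - d)) =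
    exp (- \<mu>) * exp (- \<nu>) * (\<Sum>d\<le>m. (\<mu> ^ d / fact d) * (\<nu> ^ (m - d) / fact (m - d)))"
    unfolding sum_distrib_left by (intro sum.cong refl) (simp add: pois_def)
  then show ?thesis unfolding binomial_fact_sum by (simp add: pois_def exp_add[symmetric])
qed

lemma conv_assoc:
  fixes a b c :: "nat \<Rightarrow> real"
  shows "(\<Sum>y\<le>m. (\<Sum>x\<le>y. a x * b (y - x)) * c (m - y)) = (\<Sum>x\<le>m. a x * (\<Sum>d\<le>m - x. b d * c (m - x - d)))"
proof -
  have "(\<Sum>y\<le>m. (\<Sum>x\<le>y. a x * b (y - x)) * c (m - y)) =
    (\<Sum>y\<in>{..m}. \<Sum>x\<in>{x\<in>{..m}. x \<le> y}. a x * b (y - x) * c (m - y))"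
    unfolding sum_distrib_right by (intro sum.cong) auto
  also have "\<dots> = (\<Sum>x\<in>{..m}. \<Sum>y\<in>{y\<in>{..m}. x \<le> y}. a x * b (y - x) * c (m - y))"
    by (rule sum.swap_restrict) auto
  also have "\<dots> = (\<Sum>x\<le>m. a x * (\<Sum>d\<le>m - x. b d * c (m - x - d)))"
  proof (intro sum.cong refl)
    fix x
    have "(\<Sum>y\<in>{y\<in>{..m}. x \<le> y}. b (y - x) * c (m - y)) = (\<Sum>d\<le>m - x. b d * c (m - x - d))" if "x \<le> m"
      by (rule sum.reindex_bij_witness[of _ "\<lambda>d. x + d" "\<lambda>y. y - x"]) (use that in auto)
    moreover assume "x \<in> {..m}"
    ultimately show "(\<Sum>y\<in>{y\<in>{..m}. x \<le> y}. a x * b (y - x) * c (m - y)) = a x * (\<Sum>d\<le>m - x. b d * c (m - x - d))"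
      by (simp add: sum_distrib_left[symmetric] mult.assoc)
  qed
  finally show ?thesis .
qed

text \<open>\<open>relaxed ok w r l\<close>: the constraint is only imposed up to time \<open>r \<le> l\<close>.\<close>

definition relaxed :: "(nat \<Rightarrow> nat \<Rightarrow> bool) \<Rightarrow> (nat \<Rightarrow> real) \<Rightarrow> nat \<Rightarrow> nat \<Rightarrow> nat \<Rightarrow> real" where
  "relaxed ok w r l x = (\<Sum>h\<le>x. pm ok w r h * pois (mean w l - mean w r) (x - h))"

lemma mean_mono: "(\<And>i. 0 \<le> w i) \<Longrightarrow> r \<le> l \<Longrightarrow> mean w r \<le> mean w l"
  unfolding mean_def by (intro sum_mono2) auto

text \<open>Steps without constraint convolve to a single Poisson step whose mean is the sum of
  theirs; imposing the constraint after time \<open>r\<close> can only remove mass.\<close>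

lemma pm_le_relaxed:
  assumes "\<And>i. 0 \<le> w i" "r \<le> l"
  shows "pm ok w l x \<le> relaxed ok w r l x"
  using assms(2)
proof (induction l arbitrary: x rule: dec_induct)
  case base
  have "relaxed ok w r r x = (\<Sum>h\<in>{x}. pm ok w r h * pois (mean w r - mean w r) (x - h))"
    unfolding relaxed_def by (rule sum.mono_neutral_right) (auto simp: pois_def)
  then show ?case by (simp add: pois_def)
next
  case (step l)
  have "pm ok w (Suc l) x \<le> psucc ok w l x"
    using psucc_nonneg[of w] assms(1) by (simp add: pm_Suc)
  also have "\<dots> \<le> (\<Sum>y\<le>x. relaxed ok w r l y * pois (w l) (x - y))"
    unfolding psucc_def using step assms(1) by (intro sum_mono mult_right_mono pois_nonneg) auto
  also have "\<dots> = relaxed ok w r (Suc l) x"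
    unfolding relaxed_def conv_assoc pois_conv by (simp add: algebra_simps)
  finally show ?case .
qed

lemma relaxed_nonneg: "(\<And>i. 0 \<le> w i) \<Longrightarrow> r \<le> l \<Longrightarrow> 0 \<le> relaxed ok w r l x"
  unfolding relaxed_def using mean_mono[of w r l]
  by (intro sum_nonneg mult_nonneg_nonneg pm_nonneg pois_nonneg) auto

lemma relaxed_has_sum:
  assumes "\<And>i. 0 \<le> w i" "r \<le> l"
  shows "(relaxed ok w r l has_sum tot ok w r) UNIV"
proof -
  have m: "0 \<le> mean w l - mean w r" using mean_mono[of w r l] assms by simp
  have "((\<lambda>y. (\<Sum>x\<le>y. pm ok w r x * pois (mean w l - mean w r) (y - x)) * 1) has_sum tot ok w r) UNIV"
  proof (rule conv_has_sum)
    show "((\<lambda>d. pois (mean w l - mean w r) d * 1) has_sum 1) UNIV" for x :: nat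
      using pois_has_sum m by simp
    show "((\<lambda>x. pm ok w r x * 1) has_sum tot ok w r) UNIV"
      using pm_has_sum[of w, OF assms(1)] by simp
  qed (use assms m in \<open>auto intro: pm_nonneg pois_nonneg\<close>)
  then show ?thesis by (simp add: relaxed_def[abs_def])
qed

lemma sum_atMost_le_tot: "(\<And>i. 0 \<le> w i) \<Longrightarrow> finite A \<Longrightarrow> (\<Sum>h\<in>A. pm ok w r h) \<le> tot ok w r"
  using finite_sum_le_has_sum[OF pm_has_sum[of w ok r], of A] pm_nonneg[of w] by auto

lemma relaxed_le:
  assumes "\<And>i. 0 \<le> w i" "\<And>j. pois (mean w l - mean w r) j \<le> M"
  shows "relaxed ok w r l x \<le> M * tot ok w r"
proof -
  have "relaxed ok w r l x \<le> (\<Sum>h\<le>x. pm ok w r h * M)"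
    unfolding relaxed_def using assms by (intro sum_mono mult_left_mono pm_nonneg) auto
  also have "\<dots> = M * (\<Sum>h\<le>x. pm ok w r h)" by (simp add: sum_distrib_left mult.commute)
  also have "\<dots> \<le> M * tot ok w r"
  proof (intro mult_left_mono sum_atMost_le_tot assms)
    show "0 \<le> M"
    proof -
      have "0 \<le> pois (mean w l - mean w r) 0" by (simp add: pois_def)
      then show ?thesis using assms(2)[of 0] by simp
    qed
  qed auto
  finally show ?thesis .
qed

text \<open>Once the constraint is dropped for the middle steps, the forward part has mass at most
  \<open>M * tot ahead w r\<close> at every position. Summing the reversed window over all positions
  then yields the third factor.\<close>

lemma bridge_upper:
  fixes w :: "nat \<Rightarrow> real" and m r :: nat
  defines "u \<equiv> \<lambda>j. w (m - 1 - j)"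
  assumes "\<And>i. 0 \<le> w i" "2 * r \<le> m" "\<And>j. pois (mean w (m - r) - mean w r) j \<le> M"
  shows "pm ahead w m m \<le> M * tot ahead w r * tot behind u r"
proof -
  have u: "0 \<le> u i" for i using assms by (simp add: u_def)
  have "pm ahead w m m = (\<Sum>x\<le>m. pm ahead w (m - r) x * pm behind u r (m - x))"
    using time_reversal[of "m - r" m w] assms by (simp add: u_def)
  also have "\<dots> \<le> (\<Sum>x\<le>m. (M * tot ahead w r) * pm behind u r (m - x))"
  proof (intro sum_mono mult_right_mono pm_nonneg u)
    fix x
    have "pm ahead w (m - r) x \<le> relaxed ahead w r (m - r) x"
      by (rule pm_le_relaxed) (use assms in auto)
    also have "\<dots> \<le> M * tot ahead w r" by (rule relaxed_le) (use assms in auto)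
    finally show "pm ahead w (m - r) x \<le> M * tot ahead w r" .
  qed
  also have "\<dots> = M * tot ahead w r * (\<Sum>x\<le>m. pm behind u r x)"
    unfolding sum_distrib_left by (rule sum.reindex_bij_witness[of _ "\<lambda>x. m - x" "\<lambda>x. m - x"]) auto
  also have "\<dots> \<le> M * tot ahead w r * tot behind u r"
  proof (intro mult_left_mono sum_atMost_le_tot u mult_nonneg_nonneg tot_nonneg)
    have "0 \<le> pois (mean w (m - r) - mean w r) 0" by (simp add: pois_def)
    then show "0 \<le> M" using assms(4)[of 0] by simp
  qed (use assms in auto)
  finally show ?thesis .
qed

text \<open>Let A and E be the exact masses of the two parts and A', E' the relaxed ones. From A
  \<le> A' and E \<le> E' follows A E \<ge> A' E' - (A' - A) E' - A' (E' - E). Both corrections are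
  lost survival probabilities times the largest local weight M. The main term averages the Poisson
  weight of the middle over both windows; its lower bound is quadratic in the deviation, so that
  only \<open>tot\<close> and \<open>vr\<close> enter.\<close>

lemma bridge_lower:
  fixes w :: "nat \<Rightarrow> real" and m r l :: nat
  defines "u \<equiv> \<lambda>j. w (m - 1 - j)"
  defines "M2 \<equiv> mean w (m - r) - mean w r"
  assumes w: "\<And>i. 0 \<le> w i" and rl: "r \<le> l" "l \<le> m" "r \<le> m - l" and wm: "mean w m = real m"
    and M: "\<And>j. pois (mean w l - mean w r) j \<le> M" "\<And>j. pois (mean u (m - l) - mean u r) j \<le> M"
    and B: "0 \<le> B" "0 \<le> \<delta>" "1 \<le> M2"
      "\<And>j. j \<le> m \<Longrightarrow> B * (1 - \<delta> - (real j - M2)\<^sup>2 / M2) \<le> pois M2 j"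
  shows "B * ((1 - \<delta>) * tot ahead w r * tot behind u r
      - 2 / M2 * (vr ahead w r * tot behind u r + tot ahead w r * vr behind u r))
    - M * (tot behind u r * (tot ahead w r - tot ahead w l) + tot ahead w r * (tot behind u r - tot behind u (m - l)))
    \<le> pm ahead w m m"
proof -
  have u: "0 \<le> u i" for i using w by (simp add: u_def)
  have rm: "r \<le> m" using rl by simp
  have mu: "mean u j = mean w m - mean w (m - j)" if "j \<le> m" for j
  proof -
    have "mean w m = mean w (m - j) + (\<Sum>i\<in>{m - j..<m}. w i)"
      unfolding mean_def by (subst sum.union_disjoint[symmetric]) (auto intro!: sum.cong)
    also have "(\<Sum>i\<in>{m - j..<m}. w i) = mean u j"
      unfolding mean_def u_def
      by (rule sum.reindex_bij_witness[of _ "\<lambda>i. m - 1 - i" "\<lambda>i. m - 1 - i"]) (use that in auto)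
    finally show ?thesis by simp
  qed
  define A where "A = pm ahead w l"
  define A' where "A' = relaxed ahead w r l"
  define E where "E = pm behind u (m - l)"
  define E' where "E' = relaxed behind u r (m - l)"
  have AA: "A x \<le> A' x" "0 \<le> A' x" for x
    unfolding A_def A'_def using rl w by (auto intro: pm_le_relaxed relaxed_nonneg)
  have EE: "E x \<le> E' x" "0 \<le> E' x" for x
    unfolding E_def E'_def using rl u by (auto intro: pm_le_relaxed relaxed_nonneg)
  have M0: "0 \<le> M"
  proof -
    have "0 \<le> pois (mean w l - mean w r) 0" by (simp add: pois_def)
    then show ?thesis using M(1)[of 0] by simp
  qed
  have T: "pm ahead w m m = (\<Sum>x\<le>m. A x * E (m - x))"
    unfolding A_def E_def u_def by (rule time_reversal[OF rl(2)])
  have "(\<Sum>x\<le>m. A' x * E' (m - x)) - (\<Sum>x\<le>m. (A' x - A x) * E' (m - x)) - (\<Sum>x\<le>m. A' x * (E' (m - x) - E (m - x)))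
    = (\<Sum>x\<le>m. A' x * E' (m - x) - (A' x - A x) * E' (m - x) - A' x * (E' (m - x) - E (m - x)))"
    by (simp add: sum_subtractf)
  also have "\<dots> \<le> (\<Sum>x\<le>m. A x * E (m - x))"
  proof (rule sum_mono)
    fix x
    have "0 \<le> (A' x - A x) * (E' (m - x) - E (m - x))" using AA EE by simp
    then show "A' x * E' (m - x) - (A' x - A x) * E' (m - x) - A' x * (E' (m - x) - E (m - x)) \<le> A x * E (m - x)"
      by (simp add: algebra_simps)
  qed
  finally have main: "(\<Sum>x\<le>m. A' x * E' (m - x)) - (\<Sum>x\<le>m. (A' x - A x) * E' (m - x))
    - (\<Sum>x\<le>m. A' x * (E' (m - x) - E (m - x))) \<le> pm ahead w m m" unfolding T .
  have part1: "(\<Sum>x\<le>m. (A' x - A x) * E' (m - x)) \<le> M * (tot behind u r * (tot ahead w r - tot ahead w l))"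
  proof -
    have "(\<Sum>x\<le>m. (A' x - A x) * E' (m - x)) \<le> (\<Sum>x\<le>m. (A' x - A x) * (M * tot behind u r))"
      unfolding E'_def using AA by (intro sum_mono mult_left_mono relaxed_le u M) auto
    also have "\<dots> = (M * tot behind u r) * (\<Sum>x\<le>m. A' x - A x)"
      by (simp add: sum_distrib_left[symmetric] sum_distrib_right[symmetric] mult.commute)
    also have "\<dots> \<le> (M * tot behind u r) * (tot ahead w r - tot ahead w l)"
    proof (intro mult_left_mono mult_nonneg_nonneg M0 tot_nonneg u)
      have "((\<lambda>x. A' x + - 1 * A x) has_sum (tot ahead w r + - 1 * tot ahead w l)) UNIV"
        unfolding A_def A'_def by (intro has_sum_add has_sum_cmult_right relaxed_has_sum pm_has_sum w rl)
      then have "((\<lambda>x. A' x - A x) has_sum (tot ahead w r - tot ahead w l)) UNIV" by simp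
      then show "(\<Sum>x\<le>m. A' x - A x) \<le> tot ahead w r - tot ahead w l"
        by (rule finite_sum_le_has_sum) (use AA in auto)
    qed
    finally show ?thesis by (simp add: mult_ac)
  qed
  have part2: "(\<Sum>x\<le>m. A' x * (E' (m - x) - E (m - x))) \<le> M * (tot ahead w r * (tot behind u r - tot behind u (m - l)))"
  proof -
    have "(\<Sum>x\<le>m. A' x * (E' (m - x) - E (m - x))) \<le> (\<Sum>x\<le>m. (M * tot ahead w r) * (E' (m - x) - E (m - x)))"
      unfolding A'_def using EE by (intro sum_mono mult_right_mono relaxed_le w M) auto
    also have "\<dots> = (M * tot ahead w r) * (\<Sum>x\<le>m. E' x - E x)"
      unfolding sum_distrib_left by (rule sum.reindex_bij_witness[of _ "\<lambda>x. m - x" "\<lambda>x. m - x"]) auto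
    also have "\<dots> \<le> (M * tot ahead w r) * (tot behind u r - tot behind u (m - l))"
    proof (intro mult_left_mono mult_nonneg_nonneg M0 tot_nonneg w)
      have "((\<lambda>x. E' x + - 1 * E x) has_sum (tot behind u r + - 1 * tot behind u (m - l))) UNIV"
        unfolding E_def E'_def by (intro has_sum_add has_sum_cmult_right relaxed_has_sum pm_has_sum u rl)
      then have "((\<lambda>x. E' x - E x) has_sum (tot behind u r - tot behind u (m - l))) UNIV" by simp
      then show "(\<Sum>x\<le>m. E' x - E x) \<le> tot behind u r - tot behind u (m - l)"
        by (rule finite_sum_le_has_sum) (use EE in auto)
    qed
    finally show ?thesis by (simp add: mult_ac)
  qed
  define a where "a = pm ahead w r"
  define e where "e = pm behind u r"
  define Z where "Z h = real h - mean w r" for h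
  define Z' where "Z' h = real h - mean u r" for h
  have a0: "0 \<le> a h" "0 \<le> e h" for h unfolding a_def e_def using w u by (auto intro: pm_nonneg)
  have M2e: "M2 = (mean w l - mean w r) + (mean u (m - l) - mean u r)"
    using mu[of r] mu[of "m - l"] rl rm by (simp add: M2_def)
  \<comment> \<open>Since the total mean is \<open>m\<close>, the middle piece has to compensate
    exactly the deviations of the two windows.\<close>
  have ZZ: "real (m - h - h') - M2 = - (Z h + Z' h')" if "h + h' \<le> m" for h h'
    using that mu[OF rm] wm by (simp add: Z_def Z'_def M2_def)
  have conv: "(\<Sum>x\<le>m. A' x * E' (m - x)) = (\<Sum>h\<le>m. a h * (\<Sum>h'\<le>m - h. e h' * pois M2 (m - h - h')))"
  proof -
    have "(\<Sum>x\<le>m. A' x * E' (m - x)) =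
      (\<Sum>h\<le>m. a h * (\<Sum>d\<le>m - h. pois (mean w l - mean w r) d * E' (m - h - d)))"
      unfolding A'_def relaxed_def a_def by (rule conv_assoc)
    also have "\<dots> = (\<Sum>h\<le>m. a h * (\<Sum>d\<le>m - h. E' d * pois (mean w l - mean w r) (m - h - d)))"
    proof (rule sum.cong[OF refl], rule arg_cong2[where f = "(*)", OF refl])
      fix h
      show "(\<Sum>d\<le>m - h. pois (mean w l - mean w r) d * E' (m - h - d)) =
        (\<Sum>d\<le>m - h. E' d * pois (mean w l - mean w r) (m - h - d))"
        by (rule sum.reindex_bij_witness[of _ "\<lambda>d. m - h - d" "\<lambda>d. m - h - d"])
          (auto simp: mult.commute simp del: diff_diff_left)
    qed
    also have "\<dots> = (\<Sum>h\<le>m. a h * (\<Sum>h'\<le>m - h. e h' * pois M2 (m - h - h')))"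
      unfolding E'_def relaxed_def e_def M2e conv_assoc pois_conv by (simp add: add.commute)
    finally show ?thesis .
  qed
  \<comment> \<open>The inner sum after insertion of the quadratic bound. Written as a combination
    of \<open>a h\<close> and \<open>a h * (Z h)\<^sup>2\<close> it can be summed over all
    \<open>h\<close> in terms of \<open>tot\<close> and \<open>vr\<close>; positions
    \<open>h > m\<close> only help, because \<open>c h \<le> 0\<close> there.\<close>
  define c where "c h = a h * (B * (1 - \<delta>) * tot behind u r - B * (2 / M2) * vr behind u r) -
      B * (2 / M2) * tot behind u r * (a h * (Z h)\<^sup>2)" for h
  have c_eq: "c h = (\<Sum>h'\<le>r. a h * e h' * (B * (1 - \<delta> - 2 / M2 * (Z h)\<^sup>2 - 2 / M2 * (Z' h')\<^sup>2)))" for h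
  proof -
    have "vr behind u r = (\<Sum>h'\<le>r. e h' * (Z' h')\<^sup>2)"
      unfolding vr_def e_def Z'_def
      by (subst infsum_cong_neutral[where T = "{..r}" and g = "\<lambda>y. pm behind u r y * (real y - mean u r)\<^sup>2"])
        (auto simp: pm_behind_zero)
    then show ?thesis
      unfolding c_def tot_behind_eq e_def[symmetric]
      by (simp add: sum_distrib_left sum_distrib_right sum_subtractf algebra_simps sum.distrib sum_divide_distrib)
  qed
  have bound: "B * (1 - \<delta> - 2 / M2 * (Z h)\<^sup>2 - 2 / M2 * (Z' h')\<^sup>2) \<le> (if h + h' \<le> m then pois M2 (m - h - h') else 0)" for h h'
  proof -
    have "0 \<le> (Z h - Z' h')\<^sup>2" by simp
    then have sq: "(Z h + Z' h')\<^sup>2 \<le> 2 * (Z h)\<^sup>2 + 2 * (Z' h')\<^sup>2"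
      by (simp add: power2_eq_square algebra_simps)
    have "(Z h + Z' h')\<^sup>2 / M2 \<le> (2 * (Z h)\<^sup>2 + 2 * (Z' h')\<^sup>2) / M2"
      using sq B by (intro divide_right_mono) auto
    then have le: "B * (1 - \<delta> - 2 / M2 * (Z h)\<^sup>2 - 2 / M2 * (Z' h')\<^sup>2) \<le> B * (1 - \<delta> - (Z h + Z' h')\<^sup>2 / M2)"
      using B by (intro mult_left_mono) (auto simp: add_divide_distrib)
    show ?thesis
    proof (cases "h + h' \<le> m")
      case True
      have sqe: "(real (m - h - h') - M2)\<^sup>2 = (Z h + Z' h')\<^sup>2"
        unfolding ZZ[OF True] by (rule power2_minus)
      have "B * (1 - \<delta> - (Z h + Z' h')\<^sup>2 / M2) \<le> pois M2 (m - h - h')"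
        unfolding sqe[symmetric] by (rule B(4)) simp
      from order.trans[OF le this] show ?thesis unfolding if_P[OF True] .
    next
      case False
      \<comment> \<open>If the windows together overshoot \<open>m\<close>, the deviation is at
        least M2 \<ge> 1, the quadratic bound is nonpositive, and the missing Poisson weight may
        count as 0.\<close>
      then have "M2 \<le> Z h + Z' h'" using mu[OF rm] wm by (simp add: Z_def Z'_def M2_def)
      then have "M2 * M2 \<le> (Z h + Z' h')\<^sup>2" using B unfolding power2_eq_square by (intro mult_mono) auto
      moreover have "1 * M2 \<le> M2 * M2" using B(3) by (intro mult_right_mono) auto
      ultimately have "M2 \<le> (Z h + Z' h')\<^sup>2" by linarith
      then have "1 \<le> (Z h + Z' h')\<^sup>2 / M2" using B(3) by (simp add: pos_le_divide_eq)
      then have "1 - \<delta> - (Z h + Z' h')\<^sup>2 / M2 \<le> 0" using B(2) by linarith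
      then have "B * (1 - \<delta> - (Z h + Z' h')\<^sup>2 / M2) \<le> 0" by (rule mult_nonneg_nonpos[OF B(1)])
      then show ?thesis using le False by simp
    qed
  qed
  have cle: "c h \<le> (if h \<le> m then a h * (\<Sum>h'\<le>m - h. e h' * pois M2 (m - h - h')) else 0)" for h
  proof -
    have "c h \<le> (\<Sum>h'\<le>r. a h * e h' * (if h + h' \<le> m then pois M2 (m - h - h') else 0))"
      unfolding c_eq using bound a0 by (intro sum_mono mult_left_mono) auto
    also have "\<dots> \<le> (if h \<le> m then a h * (\<Sum>h'\<le>m - h. e h' * pois M2 (m - h - h')) else 0)"
    proof (cases "h \<le> m")
      case True
      have "(\<Sum>h'\<le>r. a h * e h' * (if h + h' \<le> m then pois M2 (m - h - h') else 0)) =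
        (\<Sum>h'\<in>{..r} \<inter> {..m - h}. a h * e h' * pois M2 (m - h - h'))"
        by (rule sum.mono_neutral_cong_right) (use True in auto)
      also have "\<dots> \<le> (\<Sum>h'\<in>{..m - h}. a h * e h' * pois M2 (m - h - h'))"
        using a0 B by (intro sum_mono2 mult_nonneg_nonneg pois_nonneg) auto
      finally show ?thesis using True by (simp add: sum_distrib_left mult.assoc)
    qed (auto intro!: sum_nonpos)
    finally show ?thesis .
  qed
  have csum: "(c has_sum (tot ahead w r * (B * (1 - \<delta>) * tot behind u r - B * (2 / M2) * vr behind u r) +
      - (B * (2 / M2) * tot behind u r) * vr ahead w r)) UNIV"
  proof -
    have "((\<lambda>h. a h * (B * (1 - \<delta>) * tot behind u r - B * (2 / M2) * vr behind u r) +
      - (B * (2 / M2) * tot behind u r) * (a h * (Z h)\<^sup>2)) has_sum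
      (tot ahead w r * (B * (1 - \<delta>) * tot behind u r - B * (2 / M2) * vr behind u r) +
      - (B * (2 / M2) * tot behind u r) * vr ahead w r)) UNIV"
      unfolding a_def Z_def
      by (intro has_sum_add has_sum_cmult_right has_sum_cmult_left pm_has_sum vr_has_sum w)
    then show ?thesis by (simp add: c_def[abs_def])
  qed
  have "tot ahead w r * (B * (1 - \<delta>) * tot behind u r - B * (2 / M2) * vr behind u r) +
      - (B * (2 / M2) * tot behind u r) * vr ahead w r \<le> (\<Sum>x\<le>m. A' x * E' (m - x))"
    unfolding conv
  proof (rule has_sum_mono_neutral[OF csum has_sum_finiteI])
    show "c h \<le> a h * (\<Sum>h'\<le>m - h. e h' * pois M2 (m - h - h'))" if "h \<in> UNIV \<inter> {..m}" for h
      using cle[of h] that by simp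
    show "c h \<le> 0" if "h \<in> UNIV - {..m}" for h
      using cle[of h] that by simp
  qed auto
  then show ?thesis using main part1 part2 by (simp add: algebra_simps)
qed

section \<open>Stirling's formula and Poisson probabilities\<close>

text \<open>The constant of Stirling's formula is kept inside, so this tends to ln (2 pi) / 2 and
  not to 0.\<close>

definition stirling_rem :: "nat \<Rightarrow> real" where
  "stirling_rem k = ln (fact k) - ((real k + 1 / 2) * ln (real k) - real k)"

text \<open>Made for x = 1 / k: multiplied by k + 1/2, the lower bound becomes exactly 1 and the
  upper bound 1 + 1 / (4 k) - 1 / (4 (k + 1)). Hence the increments of \<open>stirling_rem\<close>
  have a sign and telescope.\<close>

lemma ln_1p_bounds:
  fixes x :: real
  assumes "0 \<le> x"
  shows "2 * x / (2 + x) \<le> ln (1 + x)" and "ln (1 + x) \<le> x * (2 + x) / (2 * (1 + x))"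
proof -
  have "ln (1 + 0) - 2 * 0 / (2 + 0) \<le> ln (1 + x) - 2 * x / (2 + x)"
  proof (rule DERIV_nonneg_imp_nondecreasing[OF assms])
    fix y :: real assume y: "0 \<le> y"
    have "((\<lambda>x. ln (1 + x) - 2 * x / (2 + x)) has_real_derivative (1 / (1 + y) - 4 / (2 + y)\<^sup>2)) (at y)"
      using y by (auto intro!: derivative_eq_intros simp: power2_eq_square)
    moreover have "1 / (1 + y) - 4 / (2 + y)\<^sup>2 = y\<^sup>2 / ((1 + y) * (2 + y)\<^sup>2)"
    proof -
      have "1 + y \<noteq> 0" "2 + y \<noteq> 0" using y by auto
      then show ?thesis by (simp add: divide_simps) (simp add: power2_eq_square algebra_simps)
    qed
    ultimately have "((\<lambda>x. ln (1 + x) - 2 * x / (2 + x)) has_real_derivative (y\<^sup>2 / ((1 + y) * (2 + y)\<^sup>2))) (at y)"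
      by simp
    then show "\<exists>d. ((\<lambda>x. ln (1 + x) - 2 * x / (2 + x)) has_real_derivative d) (at y) \<and> 0 \<le> d"
      using y by (intro exI[of _ "y\<^sup>2 / ((1 + y) * (2 + y)\<^sup>2)"]) auto
  qed
  then show "2 * x / (2 + x) \<le> ln (1 + x)" by simp
  have "ln (1 + x) - x * (2 + x) / (2 * (1 + x)) \<le> ln (1 + 0) - 0 * (2 + 0) / (2 * (1 + 0))"
  proof (rule DERIV_nonpos_imp_nonincreasing[OF assms])
    fix y :: real assume y: "0 \<le> y"
    have "((\<lambda>x. ln (1 + x) - x * (2 + x) / (2 * (1 + x))) has_real_derivative
        (1 / (1 + y) - ((2 + 2 * y) * (2 * (1 + y)) - y * (2 + y) * 2) / (2 * (1 + y))\<^sup>2)) (at y)"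
      using y by (auto intro!: derivative_eq_intros simp: power2_eq_square algebra_simps)
    moreover have "1 / (1 + y) - ((2 + 2 * y) * (2 * (1 + y)) - y * (2 + y) * 2) / (2 * (1 + y))\<^sup>2 =
      - (y\<^sup>2 / (2 * (1 + y)\<^sup>2))"
    proof -
      have "1 + y \<noteq> 0" using y by auto
      then show ?thesis by (simp add: divide_simps power_mult_distrib) (simp add: power2_eq_square algebra_simps)
    qed
    ultimately have "((\<lambda>x. ln (1 + x) - x * (2 + x) / (2 * (1 + x))) has_real_derivative - (y\<^sup>2 / (2 * (1 + y)\<^sup>2))) (at y)"
      by simp
    then show "\<exists>d. ((\<lambda>x. ln (1 + x) - x * (2 + x) / (2 * (1 + x))) has_real_derivative d) (at y) \<and> d \<le> 0"
      using y by (intro exI[of _ "- (y\<^sup>2 / (2 * (1 + y)\<^sup>2))"]) auto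
  qed
  then show "ln (1 + x) \<le> x * (2 + x) / (2 * (1 + x))" by simp
qed

lemma stirling_rem_step:
  assumes "k \<ge> 1"
  shows "0 \<le> stirling_rem k - stirling_rem (Suc k)"
    and "stirling_rem k - stirling_rem (Suc k) \<le> 1 / (4 * real k) - 1 / (4 * real (Suc k))"
proof -
  define x where "x = 1 / real k"
  have k: "real k > 0" and x: "0 < x" using assms by (simp_all add: x_def)
  have "real (Suc k) = real k * (1 + x)" using k by (simp add: x_def field_simps)
  then have lnS: "ln (real (Suc k)) = ln (real k) + ln (1 + x)"
    using k x by (simp add: ln_mult del: of_nat_Suc)
  have "stirling_rem k - stirling_rem (Suc k) = (real k + 1 / 2) * ln (1 + x) - 1"
    unfolding stirling_rem_def fact_Suc of_nat_mult using k
    by (subst ln_mult) (auto simp: lnS algebra_simps simp del: of_nat_Suc, simp add: algebra_simps)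
  moreover have "(real k + 1 / 2) * (2 * x / (2 + x)) = 1" using k by (simp add: x_def field_simps)
  moreover have "(real k + 1 / 2) * (x * (2 + x) / (2 * (1 + x))) - 1 = 1 / (4 * real k) - 1 / (4 * real (Suc k))"
    using k by (simp add: x_def divide_simps) (simp add: algebra_simps)
  moreover have "(real k + 1 / 2) * (2 * x / (2 + x)) \<le> (real k + 1 / 2) * ln (1 + x)"
    using x by (intro mult_left_mono ln_1p_bounds(1)) auto
  moreover have "(real k + 1 / 2) * ln (1 + x) \<le> (real k + 1 / 2) * (x * (2 + x) / (2 * (1 + x)))"
    using x by (intro mult_left_mono ln_1p_bounds(2)) auto
  ultimately show "0 \<le> stirling_rem k - stirling_rem (Suc k)"
    and "stirling_rem k - stirling_rem (Suc k) \<le> 1 / (4 * real k) - 1 / (4 * real (Suc k))"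
    by linarith+
qed

lemma stirling_rem_antimono: "1 \<le> k \<Longrightarrow> k \<le> l \<Longrightarrow> stirling_rem l \<le> stirling_rem k"
  and stirling_rem_diff: "1 \<le> k \<Longrightarrow> k \<le> l \<Longrightarrow> stirling_rem k - stirling_rem l \<le> 1 / (4 * real k) - 1 / (4 * real l)"
proof -
  show "stirling_rem l \<le> stirling_rem k" if "1 \<le> k" "k \<le> l"
    using that(2,1)
  proof (induction l rule: dec_induct)
    case (step l)
    then show ?case using stirling_rem_step(1)[of l] by simp
  qed simp
  assume "1 \<le> k" "k \<le> l"
  from this(2,1) show "stirling_rem k - stirling_rem l \<le> 1 / (4 * real k) - 1 / (4 * real l)"
  proof (induction l rule: dec_induct)
    case (step l)
    then show ?case using stirling_rem_step(2)[of l] by simp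
  qed simp
qed

lemma wallis_step:
  fixes t s u F D P :: real
  assumes "t \<noteq> 0" "s \<noteq> 0" "u \<noteq> 0" "D \<noteq> 0"
  shows "(4 * t ^ 2) / (s * u) * (P * F ^ 4 / (D ^ 2 * s)) = P * 16 * (t * F) ^ 4 / ((2 * t * s * D) ^ 2 * u)"
  using assms by (simp add: power_mult_distrib power2_eq_square power4_eq_xxxx field_simps)

lemma wallis_product:
  "(\<Prod>k=1..n. (4 * real k ^ 2) / (4 * real k ^ 2 - 1)) = 2 ^ (4 * n) * fact n ^ 4 / (fact (2 * n) ^ 2 * (2 * real n + 1))"
proof (induction n)
  case (Suc n)
  have p: "(0 :: real) < fact n" "(0 :: real) < fact (2 * n)" by auto
  have e: "4 * real (Suc n) ^ 2 - 1 = (2 * real n + 1) * (2 * real n + 3)"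
    by (simp add: power2_eq_square algebra_simps)
  have f: "(fact (2 * Suc n) :: real) = (2 * real n + 2) * (2 * real n + 1) * fact (2 * n)"
    by (simp add: algebra_simps)
  have "(\<Prod>k=1..Suc n. (4 * real k ^ 2) / (4 * real k ^ 2 - 1)) =
    (4 * real (Suc n) ^ 2) / (4 * real (Suc n) ^ 2 - 1) * (2 ^ (4 * n) * fact n ^ 4 / (fact (2 * n) ^ 2 * (2 * real n + 1)))"
    using Suc by (simp add: mult.commute)
  also have "\<dots> = (4 * real (Suc n) ^ 2) / ((2 * real n + 1) * (2 * real n + 3)) *
      (2 ^ (4 * n) * fact n ^ 4 / (fact (2 * n) ^ 2 * (2 * real n + 1)))" unfolding e ..
  also have "\<dots> = 2 ^ (4 * n) * 16 * (real (Suc n) * fact n) ^ 4 /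
      (((2 * real n + 2) * (2 * real n + 1) * fact (2 * n)) ^ 2 * (2 * real n + 3))"
  proof -
    have "(2 * real n + 2) = 2 * real (Suc n)" by simp
    then show ?thesis using p by (simp only:) (rule wallis_step, auto)
  qed
  also have "\<dots> = 2 ^ (4 * Suc n) * fact (Suc n) ^ 4 / (fact (2 * Suc n) ^ 2 * (2 * real (Suc n) + 1))"
  proof -
    have "(2 :: real) ^ (4 * Suc n) = 2 ^ (4 * n) * 16" by (simp add: power_add)
    moreover have "2 * real (Suc n) + 1 = 2 * real n + 3" by simp
    moreover have "(fact (Suc n) :: real) = real (Suc n) * fact n" by simp
    ultimately show ?thesis unfolding f by (simp only:)
  qed
  finally show ?case .
qed simp

text \<open>Monotonicity and the telescoping bound give some limit L. Wallis's product, written with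
  factorials, expresses \<open>ln (W n)\<close> as
  \<open>4 * stirling_rem n - 2 * stirling_rem (2 * n)\<close> plus a term tending to - ln 4, so
  that 2 L - ln 4 = ln (pi / 2).\<close>

lemma stirling_rem_limit: "stirling_rem \<longlonglongrightarrow> ln (2 * pi) / 2"
proof -
  have dec: "decseq (\<lambda>k. stirling_rem (Suc k))"
    by (rule decseq_SucI) (use stirling_rem_antimono in auto)
  have "stirling_rem 1 - 1 / 4 \<le> stirling_rem (Suc k)" for k
  proof -
    have "0 \<le> 1 / (4 * real (Suc k))" by simp
    moreover have "stirling_rem 1 - stirling_rem (Suc k) \<le> 1 / (4 * real 1) - 1 / (4 * real (Suc k))"
      by (rule stirling_rem_diff) auto
    moreover have "1 / (4 * real 1) = 1 / 4" by simp
    ultimately show ?thesis by linarith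
  qed
  with dec obtain L where "(\<lambda>k. stirling_rem (Suc k)) \<longlonglongrightarrow> L"
    using decseq_convergent by blast
  then have L: "stirling_rem \<longlonglongrightarrow> L" using filterlim_sequentially_Suc by blast
  have dbl: "filterlim (\<lambda>n::nat. 2 * n) sequentially sequentially"
    by (rule filterlim_subseq) (auto simp: strict_mono_def)
  have L2: "(\<lambda>n. stirling_rem (2 * n)) \<longlonglongrightarrow> L"
    using filterlim_compose[OF L dbl] .
  define W where "W n = (\<Prod>k=1..n. (4 * real k ^ 2) / (4 * real k ^ 2 - 1))" for n
  have W_lim: "(\<lambda>n. ln (W n)) \<longlonglongrightarrow> ln (pi / 2)"
    unfolding W_def by (intro tendsto_ln wallis) auto
  have W_eq: "eventually (\<lambda>n. ln (W n) =
    4 * stirling_rem n - 2 * stirling_rem (2 * n) + (ln (real n) - ln 2 - ln (2 * real n + 1))) sequentially"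
    using eventually_ge_at_top[of 1]
  proof eventually_elim
    case (elim n)
    then have n: "real n > 0" by simp
    have "ln (W n) = real (4 * n) * ln 2 + real 4 * ln (fact n) - (real 2 * ln (fact (2 * n)) + ln (2 * real n + 1))"
      unfolding W_def wallis_product using n
      by (subst ln_div, simp, simp, subst ln_mult, simp, simp, subst ln_mult, simp, simp, (subst ln_realpow, simp)+)
    moreover have "ln (real (2 * n)) = ln 2 + ln (real n)" using n by (simp add: ln_mult)
    ultimately show ?case by (simp add: stirling_rem_def algebra_simps)
  qed
  have "(\<lambda>n. 4 * stirling_rem n - 2 * stirling_rem (2 * n) + (ln (real n) - ln 2 - ln (2 * real n + 1)))
    \<longlonglongrightarrow> 4 * L - 2 * L + - ln 4"
  proof (intro tendsto_add tendsto_diff tendsto_mult tendsto_const L L2)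
    have "ln (4 :: real) = ln 2 + ln 2" using ln_mult[of 2 "2::real"] by simp
    then show "(\<lambda>n. ln (real n) - ln 2 - ln (2 * real n + 1)) \<longlonglongrightarrow> - ln 4"
      by (simp, real_asymp)
  qed
  then have "(\<lambda>n. ln (W n)) \<longlonglongrightarrow> 4 * L - 2 * L + - ln 4"
    using tendsto_cong[OF W_eq] by blast
  with W_lim have "ln (pi / 2) = 4 * L - 2 * L + - ln 4"
    by (rule LIMSEQ_unique)
  moreover have "ln (2 * pi) = ln (pi / 2) + ln 4" using ln_mult[of "pi / 2" "4 :: real"] by simp
  ultimately have "L = ln (2 * pi) / 2" by simp
  then show ?thesis using L by (simp only:)
qed

lemma stirling_rem_bounds:
  assumes "1 \<le> k"
  shows "ln (2 * pi) / 2 \<le> stirling_rem k" and "stirling_rem k \<le> ln (2 * pi) / 2 + 1 / (4 * real k)"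
proof -
  show "ln (2 * pi) / 2 \<le> stirling_rem k"
    by (rule LIMSEQ_le_const2[OF stirling_rem_limit]) (use assms stirling_rem_antimono in blast)
  have "stirling_rem k - 1 / (4 * real k) \<le> ln (2 * pi) / 2"
  proof (rule LIMSEQ_le_const[OF stirling_rem_limit], intro exI allI impI)
    fix l assume "k \<le> l"
    then show "stirling_rem k - 1 / (4 * real k) \<le> stirling_rem l"
      using stirling_rem_diff[OF assms, of l] by (smt (verit) divide_nonneg_nonneg of_nat_0_le_iff)
  qed
  then show "stirling_rem k \<le> ln (2 * pi) / 2 + 1 / (4 * real k)" by simp
qed

lemma ln_fact_stirling:
  "1 \<le> k \<Longrightarrow> ln (fact k) = real k * ln (real k) - real k + ln (real k) / 2 + stirling_rem k"
  by (simp add: stirling_rem_def algebra_simps)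

section \<open>Local bounds for Poisson weights\<close>

lemma pois_eq_exp:
  assumes "1 \<le> j" "0 < \<mu>"
  shows "pois \<mu> j = exp (real j - \<mu> - real j * ln (real j / \<mu>) - stirling_rem j) / sqrt (real j)"
proof -
  have "ln (pois \<mu> j) = - \<mu> + real j * ln \<mu> - ln (fact j)"
    unfolding pois_def using assms by (simp add: ln_mult ln_div ln_realpow)
  also have "\<dots> = (real j - \<mu> - real j * ln (real j / \<mu>) - stirling_rem j) - ln (sqrt (real j))"
    using assms by (simp add: ln_fact_stirling ln_div ln_sqrt algebra_simps)
  finally have "pois \<mu> j = exp ((real j - \<mu> - real j * ln (real j / \<mu>) - stirling_rem j) - ln (sqrt (real j)))"
    using assms by (metis exp_ln fact_gt_zero pois_def divide_pos_pos exp_gt_zero mult_pos_pos zero_less_power)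
  then show ?thesis using assms by (simp add: exp_diff)
qed

lemma exp_half_ln: "0 < x \<Longrightarrow> exp (- (ln x / 2)) = 1 / sqrt x"
  by (simp add: exp_minus ln_sqrt[symmetric] inverse_eq_divide)

text \<open>For fixed \<open>j\<close> the weight is largest at mean \<open>j\<close>, where
  Stirling's bound applies; ln t \<le> t - 1 expresses this maximality.\<close>

lemma pois_le:
  assumes "1 \<le> j" "0 < \<mu>"
  shows "pois \<mu> j \<le> 1 / sqrt (2 * pi * real j)"
proof -
  have "ln (\<mu> / real j) \<le> \<mu> / real j - 1" using assms by (intro ln_le_minus_one) auto
  then have "real j * ln (\<mu> / real j) \<le> \<mu> - real j"
    using assms mult_left_mono[of "ln (\<mu> / real j)" "\<mu> / real j - 1" "real j"] by (simp add: field_simps)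
  moreover have "ln (real j / \<mu>) = - ln (\<mu> / real j)" using assms by (simp add: ln_div)
  ultimately have "real j - \<mu> - real j * ln (real j / \<mu>) - stirling_rem j \<le> - (ln (2 * pi) / 2)"
    using stirling_rem_bounds(1)[OF assms(1)] by simp
  then have "pois \<mu> j \<le> exp (- (ln (2 * pi) / 2)) / sqrt (real j)"
    unfolding pois_eq_exp[OF assms] by (intro divide_right_mono) auto
  then show ?thesis by (simp add: exp_half_ln real_sqrt_mult)
qed

text \<open>The weights increase up to the integer part of the mean, and from there on
  \<open>pois_le\<close> gives a bound that decreases in \<open>j\<close>.\<close>

lemma pois_le_sup:
  assumes "1 < \<mu>"
  shows "pois \<mu> j \<le> 1 / sqrt (2 * pi * (\<mu> - 1))"
proof -
  define f where "f = nat \<lfloor>\<mu>\<rfloor>"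
  have f: "1 \<le> f" "real f \<le> \<mu>" "\<mu> - 1 \<le> real f" using assms by (auto simp: f_def) linarith+
  have "pois \<mu> j \<le> 1 / sqrt (2 * pi * real (max j f))"
  proof (cases "f \<le> j")
    case True
    then show ?thesis using f assms pois_le[of j \<mu>] by (simp add: max_def)
  next
    case False
    then have "j \<le> f" by simp
    then have "pois \<mu> j \<le> pois \<mu> f"
      using f(2)
    proof (induction f rule: dec_induct)
      case (step k)
      then have "real (Suc k) * pois \<mu> k \<le> \<mu> * pois \<mu> k"
        using assms by (intro mult_right_mono pois_nonneg) auto
      then have "real (Suc k) * pois \<mu> k \<le> real (Suc k) * pois \<mu> (Suc k)" unfolding pois_Suc .
      then have "pois \<mu> k \<le> pois \<mu> (Suc k)" by (simp del: of_nat_Suc)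
      then show ?case using step by simp
    qed simp
    then show ?thesis using f assms pois_le[of f \<mu>] False by (simp add: max_def)
  qed
  also have "\<dots> \<le> 1 / sqrt (2 * pi * (\<mu> - 1))"
    using f assms by (intro divide_left_mono real_sqrt_le_mono mult_left_mono) auto
  finally show ?thesis .
qed

text \<open>A local limit bound with a quadratic in place of a Gaussian factor, so that averaging it
  involves second moments only. It is trivial when the squared deviation exceeds the mean; otherwise
  \<open>j\<close> is at least half the mean and Stirling's formula applies. The hypothesis
  \<open>j \<le> m\<close> provides a prefactor common to all \<open>j\<close>.\<close>

lemma pois_ge:
  assumes "4 \<le> \<mu>" "j \<le> m"
  shows "1 / sqrt (2 * pi * real m) * (1 - 1 / (2 * \<mu>) - (real j - \<mu>)\<^sup>2 / \<mu>) \<le> pois \<mu> j"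
proof (cases "(real j - \<mu>)\<^sup>2 / \<mu> < 1")
  case False
  moreover have "0 \<le> 1 / (2 * \<mu>)" using assms by simp
  ultimately have "1 - 1 / (2 * \<mu>) - (real j - \<mu>)\<^sup>2 / \<mu> \<le> 0" by linarith
  then have "1 / sqrt (2 * pi * real m) * (1 - 1 / (2 * \<mu>) - (real j - \<mu>)\<^sup>2 / \<mu>) \<le> 0"
    by (intro mult_nonneg_nonpos) auto
  also have "0 \<le> pois \<mu> j" using assms by (intro pois_nonneg) auto
  finally show ?thesis .
next
  case True
  then have sq: "(real j - \<mu>)\<^sup>2 < \<mu>" using assms by (simp add: field_simps)
  have j: "\<mu> / 2 \<le> real j"
  proof (rule ccontr)
    assume "\<not> \<mu> / 2 \<le> real j"
    then have "(\<mu> / 2)\<^sup>2 \<le> (\<mu> - real j)\<^sup>2" using assms by (intro power_mono) auto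
    moreover have "(\<mu> - real j)\<^sup>2 = (real j - \<mu>)\<^sup>2" by (rule power2_commute)
    moreover have "\<mu> \<le> (\<mu> / 2)\<^sup>2" using assms mult_right_mono[of 4 \<mu> \<mu>] by (simp add: power2_eq_square)
    ultimately show False using sq by linarith
  qed
  then have j1: "1 \<le> j" "0 < \<mu>" using assms by auto
  have "ln (real j / \<mu>) \<le> real j / \<mu> - 1" using j1 by (intro ln_le_minus_one) auto
  then have "real j * ln (real j / \<mu>) \<le> real j * (real j / \<mu> - 1)" by (intro mult_left_mono) auto
  also have "\<dots> = (real j - \<mu>) + (real j - \<mu>)\<^sup>2 / \<mu>" using j1 by (simp add: field_simps power2_eq_square)
  finally have a: "- ((real j - \<mu>)\<^sup>2 / \<mu>) \<le> real j - \<mu> - real j * ln (real j / \<mu>)" by simp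
  have "1 / (4 * real j) \<le> 1 / (2 * \<mu>)" using j j1 by (intro divide_left_mono) auto
  then have "stirling_rem j \<le> ln (2 * pi) / 2 + 1 / (2 * \<mu>)"
    using stirling_rem_bounds(2)[OF j1(1)] by linarith
  with a have "(- (1 / (2 * \<mu>)) - (real j - \<mu>)\<^sup>2 / \<mu>) + - (ln (2 * pi) / 2) \<le>
    real j - \<mu> - real j * ln (real j / \<mu>) - stirling_rem j" by simp
  then have c1: "exp (- (1 / (2 * \<mu>)) - (real j - \<mu>)\<^sup>2 / \<mu>) * exp (- (ln (2 * pi) / 2)) \<le>
    exp (real j - \<mu> - real j * ln (real j / \<mu>) - stirling_rem j)" by (simp add: exp_add[symmetric])
  have "1 - 1 / (2 * \<mu>) - (real j - \<mu>)\<^sup>2 / \<mu> \<le> exp (- (1 / (2 * \<mu>)) - (real j - \<mu>)\<^sup>2 / \<mu>)"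
    using exp_ge_add_one_self[of "- (1 / (2 * \<mu>)) - (real j - \<mu>)\<^sup>2 / \<mu>"] by linarith
  then have c2: "(1 - 1 / (2 * \<mu>) - (real j - \<mu>)\<^sup>2 / \<mu>) * exp (- (ln (2 * pi) / 2)) \<le>
    exp (- (1 / (2 * \<mu>)) - (real j - \<mu>)\<^sup>2 / \<mu>) * exp (- (ln (2 * pi) / 2))" by (intro mult_right_mono) auto
  have le: "(1 - 1 / (2 * \<mu>) - (real j - \<mu>)\<^sup>2 / \<mu>) * exp (- (ln (2 * pi) / 2)) / sqrt (real j) \<le> pois \<mu> j"
    unfolding pois_eq_exp[OF j1] by (rule divide_right_mono[OF order.trans[OF c2 c1]]) simp
  have e: "exp (- (ln (2 * pi) / 2)) / sqrt (real j) = 1 / sqrt (2 * pi * real j)"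
    by (simp add: exp_half_ln real_sqrt_mult)
  show ?thesis
  proof (cases "0 \<le> 1 - 1 / (2 * \<mu>) - (real j - \<mu>)\<^sup>2 / \<mu>")
    case True
    have "1 / sqrt (2 * pi * real m) \<le> 1 / sqrt (2 * pi * real j)"
      using j1 assms(2) by (intro divide_left_mono real_sqrt_le_mono mult_left_mono) auto
    then have "(1 - 1 / (2 * \<mu>) - (real j - \<mu>)\<^sup>2 / \<mu>) * (1 / sqrt (2 * pi * real m)) \<le>
      (1 - 1 / (2 * \<mu>) - (real j - \<mu>)\<^sup>2 / \<mu>) * (1 / sqrt (2 * pi * real j))"
      using True by (intro mult_left_mono) auto
    also have "\<dots> \<le> pois \<mu> j" using le by (simp add: e[symmetric])
    finally show ?thesis by (simp only: mult.commute)
  next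
    case False
    then have "1 / sqrt (2 * pi * real m) * (1 - 1 / (2 * \<mu>) - (real j - \<mu>)\<^sup>2 / \<mu>) \<le> 0"
      by (intro mult_nonneg_nonpos) auto
    also have "0 \<le> pois \<mu> j" using assms by (intro pois_nonneg) auto
    finally show ?thesis .
  qed
qed

section \<open>The probability of being connected\<close>

lemma exp_minus_upper:
  fixes x :: real
  assumes "0 \<le> x"
  shows "exp (- x) \<le> 1 - x + x\<^sup>2 / 2"
proof -
  define f :: "real \<Rightarrow> real" where "f = (\<lambda>x. 1 - x + x\<^sup>2 / 2 - exp (- x))"
  have "f 0 \<le> f x"
  proof (rule DERIV_nonneg_imp_nondecreasing[OF assms])
    fix y :: real assume y: "0 \<le> y"
    have "(f has_real_derivative (- 1 + y + exp (- y))) (at y)"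
      unfolding f_def by (auto intro!: derivative_eq_intros)
    moreover have "0 \<le> - 1 + y + exp (- y)" using exp_ge_add_one_self[of "- y"] by simp
    ultimately show "\<exists>d. (f has_real_derivative d) (at y) \<and> 0 \<le> d" by blast
  qed
  then show ?thesis by (simp add: f_def)
qed

lemma exp_minus_lower:
  fixes x :: real
  assumes "0 \<le> x"
  shows "1 - x + x\<^sup>2 / 2 - x ^ 3 / 6 \<le> exp (- x)"
proof -
  define f :: "real \<Rightarrow> real" where "f = (\<lambda>x. exp (- x) - (1 - x + x\<^sup>2 / 2 - x ^ 3 / 6))"
  have "f 0 \<le> f x"
  proof (rule DERIV_nonneg_imp_nondecreasing[OF assms])
    fix y :: real assume y: "0 \<le> y"
    have "(f has_real_derivative (- exp (- y) - (- 1 + y - y\<^sup>2 / 2))) (at y)"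
      unfolding f_def by (auto intro!: derivative_eq_intros)
    moreover have "0 \<le> - exp (- y) - (- 1 + y - y\<^sup>2 / 2)" using exp_minus_upper[OF y] by simp
    ultimately show "\<exists>d. (f has_real_derivative d) (at y) \<and> 0 \<le> d" by blast
  qed
  then show ?thesis by (simp add: f_def)
qed

lemma ln_one_minus_lower_cubic:
  fixes x :: real
  assumes "0 \<le> x" "x \<le> 1 / 2"
  shows "exp (- x - x\<^sup>2 / 2 - x ^ 3) \<le> 1 - x"
proof -
  define f :: "real \<Rightarrow> real" where "f = (\<lambda>x. ln (1 - x) + x + x\<^sup>2 / 2 + x ^ 3)"
  have "f 0 \<le> f x"
  proof (rule DERIV_nonneg_imp_nondecreasing[OF assms(1)])
    fix y assume y: "0 \<le> y" "y \<le> x"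
    have "(f has_real_derivative (- 1 / (1 - y) + 1 + y + 3 * y\<^sup>2)) (at y)"
      unfolding f_def using y assms by (auto intro!: derivative_eq_intros simp: field_simps)
    moreover have "- 1 / (1 - y) + 1 + y + 3 * y\<^sup>2 = y\<^sup>2 * (2 - 3 * y) / (1 - y)"
      using y assms by (simp add: field_simps power2_eq_square)
    moreover have "0 \<le> y\<^sup>2 * (2 - 3 * y) / (1 - y)"
      using y assms by (intro divide_nonneg_nonneg mult_nonneg_nonneg) auto
    ultimately show "\<exists>d. (f has_real_derivative d) (at y) \<and> 0 \<le> d" by metis
  qed
  then have "- x - x\<^sup>2 / 2 - x ^ 3 \<le> ln (1 - x)" by (simp add: f_def)
  then show ?thesis using assms by (simp add: ln_ge_iff)
qed

lemma sum_inverse_sqrt_le: "(\<Sum>i=1..n. 1 / sqrt (real i)) \<le> 2 * sqrt (real n)"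
proof (induction n)
  case (Suc n)
  define a where "a = sqrt (real n)"
  define b where "b = sqrt (real (Suc n))"
  have ab: "0 \<le> a" "a \<le> b" "0 < b" by (auto simp: a_def b_def)
  have "(b - a) * (b + a) = 1" by (simp add: a_def b_def square_diff_square_factored[symmetric] algebra_simps)
  moreover have "(b - a) * (b + a) \<le> (b - a) * (2 * b)" using ab by (intro mult_left_mono) auto
  ultimately have "1 / b \<le> 2 * (b - a)" using ab by (simp add: pos_divide_le_eq mult_ac)
  then show ?case using Suc by (simp add: a_def b_def)
qed simp

section \<open>The tilted walk for a graph on m + 1 vertices\<close>

context
  fixes m :: nat and p :: real
  assumes p_pos: "0 < p" and c_small: "real m * p \<le> 1 / 100" and c_large: "1 / 2 \<le> real m * p * sqrt (real m)"
begin

definition c :: real where "c = real m * p"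
definition q :: real where "q = 1 - p"
text \<open>A drift c acting for m steps amounts to c sqrt m standard deviations; \<open>s\<close>
  is the reciprocal, the relative error due to fluctuations.\<close>

definition s :: real where "s = 1 / (c * sqrt (real m))"
text \<open>The tilt that makes the mean of the whole walk equal to \<open>m\<close>, see
  \<open>mean_w_m\<close>.\<close>

definition theta :: real where "theta = c / (1 - q ^ m)"
text \<open>The window length, which is about m s / 16 and also about c^(-2) / (16 s): longer than
  the time c^(-2) in which survival is decided, yet short enough that the means change by a fraction
  of order c s only. The 16 ensures \<open>8 * r \<le> m\<close>.\<close>

definition r :: nat where "r = nat \<lfloor>sqrt (real m) / (16 * c)\<rfloor>"
definition w :: "nat \<Rightarrow> real" where "w i = theta * q ^ i"
definition u :: "nat \<Rightarrow> real" where "u j = w (m - 1 - j)"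

lemma m_pos: "0 < real m"
  using c_large by (cases m) auto

lemma c_pos: "0 < c" and c_le: "c \<le> 1 / 100"
  using p_pos c_small m_pos by (auto simp: c_def)

lemma sqrt_m: "50 \<le> sqrt (real m)"
proof -
  have "1 / 2 \<le> c * sqrt (real m)" using c_large by (simp add: c_def)
  also have "\<dots> \<le> 1 / 100 * sqrt (real m)" using c_le by (intro mult_right_mono) auto
  finally show ?thesis by simp
qed

lemma s_pos: "0 < s" and s_le: "s \<le> 2"
proof -
  have "1 / 2 \<le> c * sqrt (real m)" using c_large by (simp add: c_def)
  then show "s \<le> 2" "0 < s" unfolding s_def by (simp_all add: field_simps)
qed

lemma inv_m: "1 / real m = (c * s)\<^sup>2"
  using c_pos m_pos by (simp add: s_def power_divide)

lemma inv_m_le: "1 / real m \<le> 4 * c\<^sup>2"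
proof -
  have "s\<^sup>2 \<le> 2\<^sup>2" using s_pos s_le by (intro power_mono) auto
  then show ?thesis unfolding inv_m power_mult_distrib using mult_left_mono[of "s\<^sup>2" 4 "c\<^sup>2"] by simp
qed

lemma c_sq: "c\<^sup>2 \<le> c / 100" "c ^ 3 \<le> c\<^sup>2 / 100" "0 < c\<^sup>2" "0 < c ^ 3"
  using c_pos c_le mult_left_mono[of c "1 / 100" c] mult_left_mono[of c "1 / 100" "c\<^sup>2"]
  by (auto simp: power2_eq_square power3_eq_cube)

lemma p_le: "p \<le> c\<^sup>2 / 25"
proof -
  have "p = c * (1 / real m)" using m_pos by (simp add: c_def)
  also have "\<dots> \<le> c * (4 * c\<^sup>2)" using inv_m_le c_pos by (intro mult_left_mono) auto
  also have "\<dots> = 4 * c ^ 3" by (simp add: power2_eq_square power3_eq_cube)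
  finally show ?thesis using c_sq by linarith
qed

lemma p_le': "p \<le> 1 / 2" "p \<le> c / 100"
  using p_le c_sq c_le c_pos by linarith+

lemma q_bounds: "0 < q" "q < 1"
  using p_pos p_le' by (auto simp: q_def)

lemma q_pow_lower: "1 - real i * p \<le> q ^ i"
  using Bernoulli_inequality[of "- p" i] p_le' by (simp add: q_def)

lemma q_pow_exp: "q ^ i \<le> exp (- (real i * p))"
proof -
  have "q \<le> exp (- p)" using exp_ge_add_one_self[of "- p"] by (simp add: q_def)
  then have "q ^ i \<le> exp (- p) ^ i" using q_bounds by (intro power_mono) auto
  then show ?thesis by (simp add: exp_of_nat_mult[symmetric])
qed

lemma q_pow_upper: "q ^ i \<le> 1 - real i * p + (real i * p)\<^sup>2 / 2"
  using q_pow_exp[of i] exp_minus_upper[of "real i * p"] p_pos by simp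

lemma one_minus_qm: "c - c\<^sup>2 / 2 \<le> 1 - q ^ m" "1 - q ^ m \<le> c - c\<^sup>2 / 2 + c ^ 3"
proof -
  show "c - c\<^sup>2 / 2 \<le> 1 - q ^ m" using q_pow_upper[of m] by (simp add: c_def)
  define t where "t = c * (1 + p)"
  have "exp (- p) \<le> exp (p\<^sup>2) * q" using exp_quadratic_upper[of p] p_pos p_le' by (simp add: q_def)
  then have "exp (- p - p\<^sup>2) \<le> q" by (simp add: exp_diff divide_le_eq mult.commute)
  then have "exp (- p - p\<^sup>2) ^ m \<le> q ^ m" by (intro power_mono) auto
  also have "exp (- p - p\<^sup>2) ^ m = exp (- t)"
    by (simp add: exp_of_nat_mult[symmetric] t_def c_def algebra_simps power2_eq_square)
  finally have "exp (- t) \<le> q ^ m" .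
  moreover have t: "c \<le> t" "t \<le> c + c ^ 3 / 25" "t \<le> 2 * c"
  proof -
    show "c \<le> t" using c_pos p_pos by (simp add: t_def)
    have "c * p \<le> c * (c\<^sup>2 / 25)" using p_le c_pos by (intro mult_left_mono) auto
    then show "t \<le> c + c ^ 3 / 25" by (simp add: t_def algebra_simps power2_eq_square power3_eq_cube)
    then show "t \<le> 2 * c" using c_sq c_le c_pos by linarith
  qed
  ultimately have "1 - q ^ m \<le> t - t\<^sup>2 / 2 + t ^ 3 / 6"
    using exp_minus_lower[of t] c_pos by simp
  moreover have "c\<^sup>2 \<le> t\<^sup>2" using t c_pos by (intro power_mono) auto
  moreover have "t ^ 3 \<le> (c * (11 / 10)) ^ 3"
    using t c_pos c_sq c_le by (intro power_mono) auto
  then have "t ^ 3 \<le> 2 * c ^ 3" using c_sq by (simp add: power_mult_distrib power3_eq_cube)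
  ultimately show "1 - q ^ m \<le> c - c\<^sup>2 / 2 + c ^ 3" using t c_sq by linarith
qed

lemma qm_pos: "0 < 1 - q ^ m"
  using one_minus_qm(1) c_sq c_pos by linarith

lemma theta_bounds: "1 + c / 2 - c\<^sup>2 \<le> theta" "theta \<le> 1 + c / 2 + c\<^sup>2"
proof -
  have "(1 + c / 2 - c\<^sup>2) * (1 - q ^ m) \<le> (1 + c / 2 - c\<^sup>2) * (c - c\<^sup>2 / 2 + c ^ 3)"
    using one_minus_qm c_sq c_pos c_le by (intro mult_left_mono) auto
  also have "\<dots> = c * (1 - (c / 2 - c\<^sup>2)\<^sup>2)"
  proof -
    have "c - c\<^sup>2 / 2 + c ^ 3 = c * (1 - (c / 2 - c\<^sup>2))"
      by (simp add: algebra_simps power2_eq_square power3_eq_cube)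
    moreover have "(1 + z) * (c * (1 - z)) = c * (1 - z\<^sup>2)" for z
      by (simp add: algebra_simps power2_eq_square)
    moreover have "1 + c / 2 - c\<^sup>2 = 1 + (c / 2 - c\<^sup>2)" by simp
    ultimately show ?thesis by (simp only:)
  qed
  also have "\<dots> \<le> c * 1" using c_pos by (intro mult_left_mono) auto
  finally show "1 + c / 2 - c\<^sup>2 \<le> theta" using qm_pos by (simp add: theta_def pos_le_divide_eq)
  have "c \<le> c * (1 + c\<^sup>2 / 4 + c * (c / 2 * (1 - c)))" using c_pos c_le by simp
  also have "\<dots> = (1 + c / 2 + c\<^sup>2) * (c - c\<^sup>2 / 2)"
    by (simp add: power2_eq_square algebra_simps diff_divide_distrib)
  also have "\<dots> \<le> (1 + c / 2 + c\<^sup>2) * (1 - q ^ m)"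
    using one_minus_qm c_pos by (intro mult_left_mono) auto
  finally show "theta \<le> 1 + c / 2 + c\<^sup>2" using qm_pos by (simp add: theta_def pos_divide_le_eq)
qed

lemma theta_bounds': "1 \<le> theta" "theta \<le> 1 + c" "theta \<le> 11 / 10"
  using theta_bounds c_sq c_le c_pos by linarith+

lemma theta_qm: "theta * q ^ m = theta - c"
proof -
  have "theta * (1 - q ^ m) = c" using qm_pos by (simp add: theta_def)
  then show ?thesis by (simp add: algebra_simps)
qed

lemma r_bounds: "real r \<le> sqrt (real m) / (16 * c)" "sqrt (real m) / (32 * c) \<le> real r" "1 \<le> r"
proof -
  define x where "x = sqrt (real m) / (16 * c)"
  have x: "2 \<le> x"
  proof -
    have "2 * (16 * c) \<le> sqrt (real m)" using sqrt_m c_le by linarith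
    then show ?thesis using c_pos by (simp add: x_def pos_le_divide_eq)
  qed
  have "real r \<le> x" "x - 1 < real r" using x by (auto simp: r_def x_def[symmetric])
  then show "real r \<le> sqrt (real m) / (16 * c)" "sqrt (real m) / (32 * c) \<le> real r" "1 \<le> r"
    using x by (auto simp: x_def)
qed

lemma r_m: "real r \<le> real m * s / 16" "r \<le> m div 2" "8 * real r \<le> real m"
proof -
  have "sqrt (real m) / (16 * c) = real m * s / 16"
    using c_pos m_pos by (simp add: s_def field_simps)
  then show 1: "real r \<le> real m * s / 16" using r_bounds by simp
  have "real m * s \<le> real m * 2" using s_le m_pos by (intro mult_left_mono) auto
  then show 2: "8 * real r \<le> real m" using 1 by linarith
  then show "r \<le> m div 2" by linarith
qed

lemma inv_r: "1 / real r \<le> 32 * c\<^sup>2 * s" "1 / sqrt (real r) \<le> 8 * c" "sqrt (real r) \<le> 8 * c * real r"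
proof -
  have r: "0 < real r" using r_bounds(3) by simp
  have "1 / real r \<le> 1 / (sqrt (real m) / (32 * c))"
    using r_bounds c_pos m_pos r by (intro divide_left_mono) auto
  also have "\<dots> = 32 * c\<^sup>2 * s" using c_pos m_pos by (simp add: s_def power2_eq_square)
  finally show 1: "1 / real r \<le> 32 * c\<^sup>2 * s" .
  also have "\<dots> \<le> 32 * c\<^sup>2 * 2" using s_le by (intro mult_left_mono) auto
  finally have "1 / real r \<le> (8 * c)\<^sup>2" by (simp add: power_mult_distrib)
  then have "sqrt (1 / real r) \<le> sqrt ((8 * c)\<^sup>2)" by (rule real_sqrt_le_mono)
  moreover have "sqrt ((8 * c)\<^sup>2) = 8 * c" using c_pos by (intro real_sqrt_unique) auto
  ultimately show 2: "1 / sqrt (real r) \<le> 8 * c" by (simp only: real_sqrt_divide real_sqrt_one)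
  have "sqrt (real r) = 1 / sqrt (real r) * real r" using r by (simp add: real_div_sqrt)
  also have "\<dots> \<le> 8 * c * real r" using 2 by (intro mult_right_mono) auto
  finally show "sqrt (real r) \<le> 8 * c * real r" .
qed

lemma rp: "real r * p \<le> c * s / 16" "real r * p \<le> c / 8"
proof -
  have "real r * p \<le> (real m * s / 16) * p" using r_m p_pos by (intro mult_right_mono) auto
  then show "real r * p \<le> c * s / 16" by (simp add: c_def mult_ac)
  also have "\<dots> \<le> c * 2 / 16" using s_le c_pos by (intro divide_right_mono mult_left_mono) auto
  finally show "real r * p \<le> c / 8" by simp
qed

lemma w_nonneg: "0 \<le> w i" and u_nonneg: "0 \<le> u i"
  using theta_bounds' q_bounds by (simp_all add: w_def u_def)

lemma w_le: "w i \<le> theta"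
  using theta_bounds' q_bounds mult_left_mono[of "q ^ i" 1 theta]
  by (auto simp: w_def power_le_one)

lemma w_le2: "w i \<le> 2" and u_le2: "u i \<le> 2"
  using w_le[of i] w_le[of "m - 1 - i"] theta_bounds' by (auto simp: u_def)

lemma mean_w: "mean w i = theta * ((1 - q ^ i) / p)"
  using p_pos q_bounds sum_gp_strict[of q i] by (simp add: mean_def w_def sum_distrib_left[symmetric] q_def)

lemma mean_w_m: "mean w m = real m"
  using p_pos qm_pos by (simp add: mean_w theta_def c_def)

lemma mean_u: "i \<le> m \<Longrightarrow> mean u i = real m - mean w (m - i)"
proof -
  assume i: "i \<le> m"
  have "mean w m = mean w (m - i) + (\<Sum>j\<in>{m - i..<m}. w j)"
    unfolding mean_def by (subst sum.union_disjoint[symmetric]) (auto intro!: sum.cong)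
  also have "(\<Sum>j\<in>{m - i..<m}. w j) = mean u i"
    unfolding mean_def u_def
    by (rule sum.reindex_bij_witness[of _ "\<lambda>j. m - 1 - j" "\<lambda>j. m - 1 - j"]) (use i in auto)
  finally show ?thesis using mean_w_m by simp
qed

lemma geometric_upper: "(1 - q ^ i) / p \<le> real i * (1 - (real i - 1) * p / 2 + (real i * p)\<^sup>2 / 6)"
proof -
  have "(\<Sum>j<i. q ^ j) \<le> real i * (1 - (real i - 1) * p / 2 + (real i * p)\<^sup>2 / 6)"
  proof (induction i)
    case (Suc i)
    have "real i * (1 - (real i - 1) * p / 2 + (real i * p)\<^sup>2 / 6) + (1 - real i * p + (real i * p)\<^sup>2 / 2) =
      real (Suc i) * (1 - (real (Suc i) - 1) * p / 2 + (real (Suc i) * p)\<^sup>2 / 6) - p\<^sup>2 * (3 * real i + 1) / 6"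
      by (simp add: field_simps power2_eq_square)
    moreover have "0 \<le> p\<^sup>2 * (3 * real i + 1) / 6" by simp
    moreover have "(\<Sum>j<Suc i. q ^ j) = (\<Sum>j<i. q ^ j) + q ^ i" by simp
    ultimately show ?case using Suc q_pow_upper[of i] by linarith
  qed simp
  then show ?thesis using sum_gp_strict[of q i] q_bounds p_pos by (simp add: q_def)
qed

lemma geometric_lower: "real i * (1 - real i * p / 2) \<le> (1 - q ^ i) / p"
proof -
  have "real i * (1 - real i * p / 2) * p \<le> 1 - q ^ i"
    using q_pow_upper[of i] by (simp add: algebra_simps power2_eq_square)
  then show ?thesis using p_pos by (simp add: pos_le_divide_eq)
qed

text \<open>The average of the first \<open>i\<close> means is about theta (1 - i p / 2), which is
  still about 1 + c/4 at i = m / 2; c/8 leaves room for the second-order terms. The resulting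
  distance from the diagonal is the linear barrier for the Hajek-Renyi inequality.\<close>

lemma mean_w_lower:
  assumes "2 * i \<le> m + 1"
  shows "real i * (1 + c / 8) \<le> mean w i"
proof -
  have "2 * real i \<le> real m + 1" using assms by linarith
  then have "2 * real i * p \<le> (real m + 1) * p" using p_pos by (intro mult_right_mono) auto
  then have ip: "real i * p \<le> c / 2 + p / 2" by (simp add: c_def algebra_simps)
  have "1 + c / 8 \<le> (1 + c / 2 - c\<^sup>2) * (1 - c / 4 - p / 4)"
  proof -
    define y where "y = c / 4 + p / 4"
    have y: "0 \<le> y" "y \<le> 101 / 400 * c" using c_pos p_pos p_le' by (auto simp: y_def)
    have "y * (1 + c / 2 - c\<^sup>2) \<le> y * (1 + c / 2)" using y by (intro mult_left_mono) auto
    moreover have "y * c \<le> 101 / 400 * c * c" using y c_pos by (intro mult_right_mono) auto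
    moreover have "y * (1 + c / 2) = y + y * c / 2" "101 / 400 * c * c = 101 / 400 * c\<^sup>2"
      by (simp_all add: algebra_simps power2_eq_square)
    ultimately have "y * (1 + c / 2 - c\<^sup>2) \<le> 101 / 400 * c + 101 / 800 * c\<^sup>2"
      using y by linarith
    then have "1 + c / 8 \<le> (1 + c / 2 - c\<^sup>2) - y * (1 + c / 2 - c\<^sup>2)" using c_sq c_pos by linarith
    also have "\<dots> = (1 + c / 2 - c\<^sup>2) * (1 - c / 4 - p / 4)" by (simp add: y_def algebra_simps)
    finally show ?thesis .
  qed
  also have "\<dots> \<le> theta * (1 - real i * p / 2)"
    using theta_bounds ip c_le c_sq p_le' c_pos by (intro mult_mono) auto
  finally have "real i * (1 + c / 8) \<le> real i * (theta * (1 - real i * p / 2))"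
    by (intro mult_left_mono) auto
  also have "\<dots> = theta * (real i * (1 - real i * p / 2))" by simp
  also have "\<dots> \<le> mean w i" unfolding mean_w using geometric_lower theta_bounds' by (intro mult_left_mono) auto
  finally show ?thesis .
qed

lemma mean_u_upper:
  assumes "2 * i \<le> m + 1"
  shows "mean u i \<le> real i * (1 - c / 8)"
proof -
  define x where "x = real i * p"
  have im: "i \<le> m" using assms m_pos by linarith
  have "2 * real i \<le> real m + 1" using assms by linarith
  then have "2 * real i * p \<le> (real m + 1) * p" using p_pos by (intro mult_right_mono) auto
  then have x: "0 \<le> x" "x \<le> c / 2 + p / 2" using p_pos by (auto simp: c_def x_def algebra_simps)
  then have x_le: "x \<le> c" using p_le' c_pos by linarith
  have qmi: "q ^ (m - i) \<le> 1 - c + x + c\<^sup>2 / 2"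
  proof -
    have "real (m - i) * p = c - x" using im by (simp add: c_def x_def of_nat_diff algebra_simps)
    moreover have "(c - x)\<^sup>2 \<le> c\<^sup>2" using x x_le c_pos by (intro power_mono) auto
    ultimately show ?thesis using q_pow_upper[of "m - i"] by simp
  qed
  have g: "(1 - q ^ i) / p \<le> real i * (1 - x / 2 + p / 2 + c\<^sup>2 / 6)"
  proof -
    have "x\<^sup>2 \<le> c\<^sup>2" using x x_le by (intro power_mono) auto
    moreover have "1 - (real i - 1) * p / 2 + (real i * p)\<^sup>2 / 6 = 1 - x / 2 + p / 2 + x\<^sup>2 / 6"
      by (simp add: x_def field_simps)
    ultimately have "1 - (real i - 1) * p / 2 + (real i * p)\<^sup>2 / 6 \<le> 1 - x / 2 + p / 2 + c\<^sup>2 / 6"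
      by simp
    then have "real i * (1 - (real i - 1) * p / 2 + (real i * p)\<^sup>2 / 6) \<le> real i * (1 - x / 2 + p / 2 + c\<^sup>2 / 6)"
      by (rule mult_left_mono) simp
    with geometric_upper[of i] show ?thesis by (rule order.trans)
  qed
  have g0: "0 \<le> (1 - q ^ i) / p" using q_bounds p_pos by (simp add: power_le_one)
  have "mean u i = theta * (q ^ (m - i) * ((1 - q ^ i) / p))"
  proof -
    have "q ^ (m - i) * q ^ i = q ^ m" using im by (simp add: power_add[symmetric])
    then have "theta * (q ^ (m - i) * ((1 - q ^ i) / p)) = theta * ((1 - q ^ m) / p) - theta * ((1 - q ^ (m - i)) / p)"
      by (simp add: algebra_simps diff_divide_distrib)
    then show ?thesis using mean_u[OF im] mean_w[of "m - i"] mean_w[of m] mean_w_m by simp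
  qed
  also have "\<dots> \<le> theta * ((1 - c + x + c\<^sup>2 / 2) * (real i * (1 - x / 2 + p / 2 + c\<^sup>2 / 6)))"
    using theta_bounds' qmi g g0 q_bounds x x_le c_pos c_le p_pos
    by (intro mult_left_mono mult_mono) auto
  also have "\<dots> = real i * (theta * ((1 - c + x + c\<^sup>2 / 2) * (1 - x / 2 + p / 2 + c\<^sup>2 / 6)))" by simp
  also have "\<dots> \<le> real i * (1 - c / 8)"
  proof (intro mult_left_mono)
    define A where "A = c - x - c\<^sup>2 / 2"
    define B where "B = x / 2 - p / 2 - c\<^sup>2 / 6"
    have AB: "\<bar>A\<bar> \<le> 2 * c" "\<bar>B\<bar> \<le> c"
      unfolding A_def B_def abs_le_iff using x x_le c_sq c_pos p_pos p_le' by linarith+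
    have "A * B \<le> \<bar>A\<bar> * \<bar>B\<bar>" using abs_ge_self[of "A * B"] by (simp add: abs_mult)
    also have "\<dots> \<le> 2 * c * c" using AB by (intro mult_mono) auto
    finally have "(1 - A) * (1 - B) \<le> 1 - A - B + 2 * c\<^sup>2" by (simp add: algebra_simps power2_eq_square)
    also have "\<dots> \<le> 1 - 3 / 4 * c + 4 * c\<^sup>2" unfolding A_def B_def using x p_le c_sq by linarith
    finally have 1: "(1 - A) * (1 - B) \<le> 1 - 3 / 4 * c + 4 * c\<^sup>2" .
    have "theta * ((1 - A) * (1 - B)) \<le> theta * (1 - 3 / 4 * c + 4 * c\<^sup>2)"
      using 1 theta_bounds' by (intro mult_left_mono) auto
    also have "\<dots> \<le> (1 + c / 2 + c\<^sup>2) * (1 - 3 / 4 * c + 4 * c\<^sup>2)"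
      using theta_bounds c_le c_pos by (intro mult_right_mono) auto
    also have "\<dots> = 1 - c / 4 + 37 / 8 * c\<^sup>2 + 5 / 4 * c ^ 3 + 4 * (c\<^sup>2 * c\<^sup>2)"
      by (simp add: algebra_simps power2_eq_square power3_eq_cube add_divide_distrib diff_divide_distrib)
    also have "\<dots> \<le> 1 - c / 8"
    proof -
      have *: "1 - c / 4 + 37 / 8 * c\<^sup>2 + 5 / 4 * c ^ 3 + 4 * d \<le> 1 - c / 8" if "d \<le> c\<^sup>2" for d
        using that c_sq c_pos by linarith
      have "c\<^sup>2 * c\<^sup>2 \<le> c\<^sup>2 * 1" using c_le c_pos by (intro mult_left_mono power_le_one) auto
      then show ?thesis by (intro *) simp
    qed
    finally have "theta * ((1 - A) * (1 - B)) \<le> 1 - c / 8" .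
    moreover have "1 - c + x + c\<^sup>2 / 2 = 1 - A" "1 - x / 2 + p / 2 + c\<^sup>2 / 6 = 1 - B"
      by (simp_all add: A_def B_def)
    ultimately show "theta * ((1 - c + x + c\<^sup>2 / 2) * (1 - x / 2 + p / 2 + c\<^sup>2 / 6)) \<le> 1 - c / 8"
      by (simp only:)
  qed auto
  finally show ?thesis .
qed

section \<open>Survival on the windows, crude and sharp\<close>

lemma ahead_crude: "1 \<le> i \<Longrightarrow> i \<le> r \<Longrightarrow> tot ahead w i \<le> 7 / sqrt (real i) + 40 * c"
proof (rule tot_ahead_crude[of w, OF w_nonneg])
  fix j assume "1 \<le> i" "i \<le> r" "j < i"
  have "real j * p \<le> real r * p" using \<open>i \<le> r\<close> \<open>j < i\<close> p_pos by (intro mult_right_mono) auto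
  then have "1 - c / 8 \<le> q ^ j" using q_pow_lower[of j] rp(2) by linarith
  then have "(1 + c / 2 - c\<^sup>2) * (1 - c / 8) \<le> w j"
    unfolding w_def using theta_bounds c_le c_sq c_pos by (intro mult_mono) auto
  moreover have "(1 + c / 2 - c\<^sup>2) * (1 - c / 8) = 1 + 3 / 8 * c - 17 / 16 * c\<^sup>2 + c ^ 3 / 8"
    by (simp add: algebra_simps power2_eq_square power3_eq_cube add_divide_distrib)
  ultimately show "1 \<le> w j \<and> w j \<le> 1 + c"
    using w_le[of j] theta_bounds' c_sq c_pos by linarith
qed (use c_pos c_le in auto)

text \<open>By \<open>theta_qm\<close> this is \<open>theta * q ^ m\<close>, a lower bound for all
  means of the reversed walk; 1 - nu is about c/2.\<close>

definition nu :: real where "nu = theta - c"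

lemma nu_bounds: "1 - c / 2 - c\<^sup>2 \<le> nu" "nu \<le> 1 - c / 2 + c\<^sup>2" "1 - c \<le> nu" "nu \<le> 1 - c / 4" "nu \<le> 1"
  using theta_bounds c_sq c_pos c_le by (auto simp: nu_def)

lemma u_ge: "nu \<le> u j"
proof -
  have "q ^ m \<le> q ^ (m - 1 - j)" using q_bounds by (intro power_decreasing) auto
  then have "theta * q ^ m \<le> theta * q ^ (m - 1 - j)" using theta_bounds' by (intro mult_left_mono) auto
  then show ?thesis unfolding theta_qm by (simp add: u_def w_def nu_def)
qed

lemma behind_crude:
  assumes "1 \<le> i"
  shows "tot behind u i \<le> 7 / sqrt (real i) + 40 * c"
proof (cases "i < 4")
  case True
  then have "sqrt (real i) \<le> sqrt (2\<^sup>2)" by (intro real_sqrt_le_mono) auto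
  then have "1 \<le> 7 / sqrt (real i)" using assms by simp
  then show ?thesis using tot_le_1[of u behind i, OF u_nonneg] c_pos by linarith
next
  case False
  define t where "t = 1 / sqrt (real i)"
  have "sqrt (2\<^sup>2) \<le> sqrt (real i)" using False by (intro real_sqrt_le_mono) auto
  then have "1 / sqrt (real i) \<le> 1 / 2" using assms by (intro divide_left_mono) auto
  then have t: "0 < t" "t \<le> 1 / 2" using assms by (auto simp: t_def)
  have ti: "t * t * real i = 1" using assms by (simp add: t_def)
  \<comment> \<open>Lowering the mean by a further t = 1 / sqrt i keeps 1 - \<mu> at least t, so the
    variance term of \<open>tot_behind_const_upper\<close> is at most t.\<close>
  define \<mu> where "\<mu> = nu - t"
  have \<mu>: "0 \<le> \<mu>" "\<mu> < 1" "1 - \<mu> \<le> c + t" "t \<le> 1 - \<mu>" "\<mu> \<le> 1"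
    using t nu_bounds c_le c_pos by (auto simp: \<mu>_def)
  have "tot behind u i \<le> tot behind (\<lambda>_. \<mu>) i"
  proof (rule tot_behind_antimono)
    show "\<mu> \<le> u j" for j using u_ge[of j] t by (simp add: \<mu>_def)
  qed (use \<mu> in auto)
  also have "\<dots> \<le> exp \<mu> * (1 - \<mu> + \<mu> / (4 * (1 - \<mu>) * real (Suc i)))"
    by (rule tot_behind_const_upper) (use \<mu> in auto)
  also have "\<dots> \<le> 3 * (c + t + t)"
  proof (intro mult_mono)
    have "exp \<mu> \<le> exp 1" using \<mu> by simp
    then show "exp \<mu> \<le> 3" using e_less_272 by linarith
    have "\<mu> / (4 * (1 - \<mu>) * real (Suc i)) \<le> 1 / (t * real i)"
      using \<mu> t assms by (intro frac_le mult_mono) auto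
    also have "1 / (t * real i) = t" using ti t assms by (simp add: field_simps)
    finally show "1 - \<mu> + \<mu> / (4 * (1 - \<mu>) * real (Suc i)) \<le> c + t + t" using \<mu> by linarith
    show "0 \<le> 1 - \<mu> + \<mu> / (4 * (1 - \<mu>) * real (Suc i))" using \<mu> by (intro add_nonneg_nonneg divide_nonneg_nonneg) auto
  qed auto
  also have "\<dots> \<le> 7 * t + 40 * c" using t c_pos by simp
  finally show ?thesis by (simp add: t_def)
qed

text \<open>Here 1 / sqrt r \<le> 8 c gives 96 = 7 * 8 + 40. Summed over time, the hypothesis yields
  at most 15 sqrt r + 40 c r \<le> 160 c r, the term 1 of time 0 being absorbed by sqrt r;
  increments of mean at most 2 double this for \<open>vr\<close>.\<close>

lemma crude_consequences:
  assumes "\<And>i. 1 \<le> i \<Longrightarrow> i \<le> r \<Longrightarrow> tot ok v i \<le> 7 / sqrt (real i) + 40 * c" "\<And>i. 0 \<le> v i" "\<And>i. v i \<le> 2"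
  shows "tot ok v r \<le> 96 * c" "vr ok v r \<le> 320 * c * real r"
proof -
  have "7 / sqrt (real r) \<le> 7 * (8 * c)"
    using mult_left_mono[OF inv_r(2), of 7] by simp
  then show "tot ok v r \<le> 96 * c" using assms(1)[of r] r_bounds by linarith
  have "(\<Sum>j<r. tot ok v j) = tot ok v 0 + (\<Sum>j=1..<r. tot ok v j)"
    using r_bounds(3) by (simp add: lessThan_atLeast0 sum.atLeast_Suc_lessThan)
  also have "\<dots> \<le> 1 + (\<Sum>j=1..<r. 7 * (1 / sqrt (real j)) + 40 * c)"
    using assms by (intro add_mono sum_mono tot_le_1) auto
  also have "\<dots> = 1 + 7 * (\<Sum>j=1..<r. 1 / sqrt (real j)) + 40 * c * real (r - 1)"
    by (simp add: sum.distrib sum_distrib_left mult.commute)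
  also have "\<dots> \<le> sqrt (real r) + 7 * (2 * sqrt (real r)) + 40 * c * real r"
  proof (intro add_mono mult_left_mono)
    have "(\<Sum>j=1..<r. 1 / sqrt (real j)) \<le> (\<Sum>j=1..r. 1 / sqrt (real j))" by (intro sum_mono2) auto
    then show "(\<Sum>j=1..<r. 1 / sqrt (real j)) \<le> 2 * sqrt (real r)" using sum_inverse_sqrt_le[of r] by linarith
  qed (use r_bounds c_pos in auto)
  also have "\<dots> \<le> 160 * c * real r" using inv_r(3) by linarith
  finally have "(\<Sum>j<r. tot ok v j) \<le> 160 * c * real r" .
  then show "vr ok v r \<le> 320 * c * real r"
    using vr_le[of v r 2 ok, OF assms(2,3)] by linarith
qed

lemmas ahead_bounds = crude_consequences[OF ahead_crude w_nonneg w_le2]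
lemmas behind_bounds = crude_consequences[OF behind_crude u_nonneg u_le2]

text \<open>Survival is practically decided within the window: what is lost later is only a fraction
  of order s of the survival probability scale c. The barrier slope c/8 contributes 64 / c^2, and
  1048576 = 512 * 32 * 64.\<close>

lemma drop_bound:
  assumes "tot ok v r \<le> 96 * c" "vr ok v r \<le> 320 * c * real r" "\<And>i. 0 \<le> v i" "\<And>i. v i \<le> 2" "r \<le> l"
    and "\<And>i y. r \<le> i \<Longrightarrow> i < l \<Longrightarrow> \<not> ok (Suc i) y \<Longrightarrow> c / 8 * real (Suc i) \<le> \<bar>real y - mean v (Suc i)\<bar>"
  shows "tot ok v r - tot ok v l \<le> 1048576 * c * s"
proof -
  have r: "0 < real r" using r_bounds(3) by simp
  have "(c / 8)\<^sup>2 * (tot ok v r - tot ok v l) \<le> (vr ok v r / real r + 2 * tot ok v r) / real r"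
    by (rule hajek_renyi[of v r l "c / 8" 2 ok, OF assms(3)]) (use assms r_bounds c_pos in auto)
  also have "\<dots> \<le> (512 * c) / real r"
  proof (rule divide_right_mono)
    have "vr ok v r / real r \<le> 320 * c" using assms(2) r by (simp add: pos_divide_le_eq)
    then show "vr ok v r / real r + 2 * tot ok v r \<le> 512 * c" using assms(1) by linarith
  qed auto
  also have "\<dots> = 512 * c * (1 / real r)" by simp
  also have "\<dots> \<le> 512 * c * (32 * c\<^sup>2 * s)" using inv_r(1) c_pos by (intro mult_left_mono) auto
  also have "\<dots> = (c / 8)\<^sup>2 * (1048576 * c * s)" by (simp add: power2_eq_square)
  finally show ?thesis using c_pos by (simp add: mult_le_cancel_left_pos)
qed

lemma ahead_drop: "2 * l \<le> m \<Longrightarrow> r \<le> l \<Longrightarrow> tot ahead w r - tot ahead w l \<le> 1048576 * c * s"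
proof (rule drop_bound[OF ahead_bounds w_nonneg w_le2])
  fix i y assume "2 * l \<le> m" "i < l" "\<not> Suc i \<le> y"
  then have "real (Suc i) * (1 + c / 8) \<le> mean w (Suc i)" "real y \<le> real (Suc i)"
    using mean_w_lower[of "Suc i"] by auto
  then have "c / 8 * real (Suc i) \<le> mean w (Suc i) - real y" by (simp add: algebra_simps)
  then show "c / 8 * real (Suc i) \<le> \<bar>real y - mean w (Suc i)\<bar>" by linarith
qed

lemma behind_drop: "2 * l \<le> m + 1 \<Longrightarrow> r \<le> l \<Longrightarrow> tot behind u r - tot behind u l \<le> 1048576 * c * s"
proof (rule drop_bound[OF behind_bounds u_nonneg u_le2])
  fix i y assume "2 * l \<le> m + 1" "i < l" "\<not> y \<le> Suc i"
  then have "mean u (Suc i) \<le> real (Suc i) * (1 - c / 8)" "real (Suc i) \<le> real y"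
    using mean_u_upper[of "Suc i"] by auto
  then have "c / 8 * real (Suc i) \<le> real y - mean u (Suc i)" by (simp add: algebra_simps)
  then show "c / 8 * real (Suc i) \<le> \<bar>real y - mean u (Suc i)\<bar>" by linarith
qed

lemma behind_upper: "tot behind u r \<le> exp 1 * (c / 2) * (1 + 2 * c + 64 * s)"
proof -
  have "tot behind u r \<le> tot behind (\<lambda>_. nu) r"
    by (rule tot_behind_antimono) (use u_ge nu_bounds c_le in auto)
  also have "\<dots> \<le> exp nu * (1 - nu + nu / (4 * (1 - nu) * real (Suc r)))"
    by (rule tot_behind_const_upper) (use nu_bounds c_le c_pos in auto)
  also have "\<dots> \<le> exp 1 * (c / 2 * (1 + 2 * c + 64 * s))"
  proof (intro mult_mono)
    show "exp nu \<le> exp 1" using nu_bounds by simp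
    have "nu / (4 * (1 - nu) * real (Suc r)) \<le> 1 / (4 * (c / 4) * real r)"
      using nu_bounds c_pos r_bounds by (intro frac_le mult_mono) auto
    also have "\<dots> = 1 / real r / c" by simp
    also have "\<dots> \<le> 32 * c\<^sup>2 * s / c" using inv_r(1) c_pos by (intro divide_right_mono) auto
    also have "\<dots> = 32 * c * s" using c_pos by (simp add: power2_eq_square)
    finally show "1 - nu + nu / (4 * (1 - nu) * real (Suc r)) \<le> c / 2 * (1 + 2 * c + 64 * s)"
      using nu_bounds by (simp add: algebra_simps power2_eq_square)
    show "0 \<le> 1 - nu + nu / (4 * (1 - nu) * real (Suc r))"
      using nu_bounds c_le by (intro add_nonneg_nonneg divide_nonneg_nonneg) auto
  qed auto
  finally show ?thesis by simp
qed

text \<open>While the upper bound compares with the smallest mean \<open>nu\<close>, this one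
  compares with the largest mean in the window, \<open>w (m - r)\<close>. The two differ by at most
  c s / 8, because r p \<le> c s / 16.\<close>

lemma behind_lower: "exp 1 * (c / 2) * (1 - 3 * c - s) \<le> tot behind u r"
proof -
  define \<mu> where "\<mu> = w (m - r)"
  have rm: "r \<le> m" using r_m by linarith
  have "q ^ (m - r) * q ^ r = q ^ m" using rm by (simp add: power_add[symmetric])
  then have "\<mu> * q ^ r = nu" using theta_qm by (simp add: \<mu>_def w_def nu_def mult.assoc)
  moreover have "1 - c * s / 16 \<le> q ^ r" using q_pow_lower[of r] rp(1) by linarith
  moreover have \<mu>0: "0 \<le> \<mu>" "\<mu> \<le> 2" using w_nonneg w_le2 by (auto simp: \<mu>_def)
  ultimately have "\<mu> * (1 - c * s / 16) \<le> nu" by (metis mult_left_mono)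
  moreover have "\<mu> * (c * s / 16) \<le> 2 * (c * s / 16)" using \<mu>0 c_pos s_pos by (intro mult_right_mono) auto
  ultimately have \<mu>1: "\<mu> \<le> nu + c * s / 8" by (simp add: algebra_simps)
  have "nu \<le> \<mu>"
  proof -
    have "q ^ m \<le> q ^ (m - r)" using q_bounds by (intro power_decreasing) auto
    then have "theta * q ^ m \<le> \<mu>" unfolding \<mu>_def w_def using theta_bounds' by (intro mult_left_mono) auto
    then show ?thesis unfolding theta_qm nu_def .
  qed
  then have \<mu>2: "1 - c \<le> \<mu>" using nu_bounds by linarith
  have gap: "c / 2 * (1 - 2 * c - s) \<le> 1 - \<mu>"
  proof -
    have "0 < c * s" using c_pos s_pos by simp
    moreover have "c / 2 * (1 - 2 * c - s) = c / 2 - c\<^sup>2 - c * s / 2"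
      by (simp add: algebra_simps power2_eq_square)
    ultimately show ?thesis using \<mu>1 nu_bounds by linarith
  qed
  have cs: "c * s \<le> c * 2" using s_le c_pos by (intro mult_left_mono) auto
  then have "0 \<le> 1 - \<mu>" using \<mu>1 nu_bounds by linarith
  have "exp 1 * (1 - c) * (1 - \<mu>) \<le> exp \<mu> * (1 - \<mu>)"
  proof (rule mult_right_mono)
    have "1 - c \<le> exp (\<mu> - 1)" using exp_ge_add_one_self[of "\<mu> - 1"] \<mu>2 by linarith
    then have "exp 1 * (1 - c) \<le> exp 1 * exp (\<mu> - 1)" by (intro mult_left_mono) auto
    then show "exp 1 * (1 - c) \<le> exp \<mu>" by (simp add: exp_add[symmetric])
  qed fact
  also have "\<dots> \<le> tot behind (\<lambda>_. \<mu>) r" by (rule tot_behind_const_lower[OF \<mu>0(1)])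
  also have "\<dots> \<le> tot behind u r"
  proof (rule tot_behind_antimono)
    fix i assume i: "i < r"
    have "q ^ (m - 1 - i) \<le> q ^ (m - r)" using q_bounds i by (intro power_decreasing) auto
    then show "u i \<le> \<mu>" unfolding u_def \<mu>_def w_def using theta_bounds' by (intro mult_left_mono) auto
  qed (rule u_nonneg)
  finally have low: "exp 1 * (1 - c) * (1 - \<mu>) \<le> tot behind u r" .
  have "exp 1 * (c / 2) * (1 - 3 * c - s) \<le> exp 1 * (1 - c) * (1 - \<mu>)"
  proof -
    have "(c / 2) * (1 - 3 * c - s) \<le> (c / 2) * ((1 - c) * (1 - 2 * c - s))"
    proof (rule mult_left_mono)
      have "0 \<le> c * (2 * c + s)" using c_pos s_pos by simp
      then show "1 - 3 * c - s \<le> (1 - c) * (1 - 2 * c - s)" by (simp add: algebra_simps)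
    qed (use c_pos in simp)
    also have "\<dots> = (1 - c) * (c / 2 * (1 - 2 * c - s))" by simp
    also have "\<dots> \<le> (1 - c) * (1 - \<mu>)" using gap c_le by (intro mult_left_mono) auto
    finally have "exp 1 * ((c / 2) * (1 - 3 * c - s)) \<le> exp 1 * ((1 - c) * (1 - \<mu>))" by (intro mult_left_mono) auto
    then show ?thesis by (simp add: mult.assoc)
  qed
  with low show ?thesis by linarith
qed

text \<open>A Poisson branching process of mean 1 + \<rho>/2 survives with probability about \<rho>,
  and the means here are about 1 + c/2. Taking \<rho> slightly below c makes (1 - \<rho>)^S a
  supermartingale on the whole window although the means decrease by up to c s / 8; survival is then
  at least \<rho> + \<open>es\<close>.\<close>

lemma ahead_lower: "c * (1 - 6 * c - s) \<le> tot ahead w r"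
proof (cases "0 < 1 - 6 * c - s")
  case False
  then have "c * (1 - 6 * c - s) \<le> 0" using c_pos by (intro mult_nonneg_nonpos) auto
  then show ?thesis using tot_nonneg[of w ahead r, OF w_nonneg] by linarith
next
  case True
  define \<rho> where "\<rho> = c * (1 - 6 * c - s)"
  have \<rho>: "0 < \<rho>" "\<rho> \<le> c" "\<rho> \<le> 1 / 2"
  proof -
    show "0 < \<rho>" using True c_pos by (simp add: \<rho>_def)
    have "c * (1 - 6 * c - s) \<le> c * 1" using c_pos s_pos by (intro mult_left_mono) auto
    then show "\<rho> \<le> c" by (simp add: \<rho>_def)
    then show "\<rho> \<le> 1 / 2" using c_le by linarith
  qed
  have \<rho>2: "\<rho>\<^sup>2 \<le> c\<^sup>2" using \<rho> by (intro power_mono) auto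
  have "1 - (1 - \<rho>) \<le> tot ahead w r - es w (1 - \<rho>) r"
  proof (rule tot_es_lower[of w "1 - \<rho>", OF w_nonneg])
    fix i assume i: "i < r"
    have "real i * p \<le> real r * p" using i p_pos by (intro mult_right_mono) auto
    then have "1 - c * s / 16 \<le> q ^ i" using q_pow_lower[of i] rp(1) by linarith
    then have "theta * (1 - c * s / 16) \<le> w i" unfolding w_def using theta_bounds' by (intro mult_left_mono) auto
    moreover have "theta * (c * s / 16) \<le> 2 * (c * s / 16)"
      using theta_bounds' c_pos s_pos by (intro mult_right_mono) auto
    ultimately have "theta - c * s / 8 \<le> w i" by (simp add: algebra_simps)
    moreover have "1 + \<rho> / 2 + \<rho>\<^sup>2 \<le> theta - c * s / 8"
    proof -
      have "0 < c * s" using c_pos s_pos by simp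
      moreover have "\<rho> / 2 = c / 2 - 3 * c\<^sup>2 - c * s / 2"
        by (simp add: \<rho>_def algebra_simps power2_eq_square diff_divide_distrib add_divide_distrib)
      ultimately show ?thesis using theta_bounds \<rho>2 c_sq by linarith
    qed
    ultimately have "1 + \<rho> / 2 + \<rho>\<^sup>2 \<le> w i" by linarith
    then have "(1 + \<rho> / 2 + \<rho>\<^sup>2) * \<rho> \<le> w i * \<rho>" using \<rho> by (intro mult_right_mono) auto
    then have "exp (w i * (1 - \<rho> - 1)) \<le> exp (- \<rho> - \<rho>\<^sup>2 / 2 - \<rho> ^ 3)"
      by (simp add: algebra_simps power2_eq_square power3_eq_cube)
    also have "\<dots> \<le> 1 - \<rho>" using ln_one_minus_lower_cubic[of \<rho>] \<rho> by simp
    finally show "exp (w i * (1 - \<rho> - 1)) \<le> 1 - \<rho>" .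
  qed (use \<rho> in auto)
  moreover have "0 \<le> es w (1 - \<rho>) r" by (rule es_nonneg[of w "1 - \<rho>", OF w_nonneg]) (use \<rho> in auto)
  ultimately show ?thesis by (simp add: \<rho>_def)
qed

text \<open>Surviving paths with \<open>S\<close> below half its mean are controlled by Chebyshev's inequality, the
  others by \<open>(1 - \<rho>)\<^sup>S \<le> 1 / (\<rho> S)\<close>.\<close>

lemma ahead_upper: "tot ahead w r \<le> c * (1 + 2 * c + 3000000 * s)"
proof -
  \<comment> \<open>Chosen so that 1 + \<rho>/2 = theta bounds every mean, which makes (1 -
    \<rho>)^S a submartingale.\<close>
  define \<rho> where "\<rho> = 2 * (theta - 1)"
  have \<rho>: "c / 2 \<le> \<rho>" "\<rho> \<le> c + 2 * c\<^sup>2" "0 < \<rho>" "\<rho> < 1"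
    using theta_bounds c_sq c_pos c_le by (auto simp: \<rho>_def)
  have r: "0 < real r" using r_bounds(3) by simp
  have up: "tot ahead w r - es w (1 - \<rho>) r \<le> 1 - (1 - \<rho>)"
  proof (rule tot_es_upper[of w "1 - \<rho>", OF w_nonneg])
    fix i
    have "1 - \<rho> \<le> exp (- \<rho> - \<rho>\<^sup>2 / 2)" by (rule one_minus_le_exp_quadratic) (use \<rho> in auto)
    also have "\<dots> \<le> exp (w i * (1 - \<rho> - 1))"
    proof -
      have "\<rho> = 2 * theta - 2" by (simp add: \<rho>_def)
      then have "1 + \<rho> / 2 = theta" by linarith
      then have "w i * \<rho> \<le> (1 + \<rho> / 2) * \<rho>" using w_le[of i] \<rho> by (intro mult_right_mono) auto
      then show ?thesis by (simp add: algebra_simps power2_eq_square)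
    qed
    finally show "1 - \<rho> \<le> exp (w i * (1 - \<rho> - 1))" .
  qed (use \<rho> in auto)
  \<comment> \<open>Half of the guaranteed excess c r / 8 of the mean over \<open>r\<close>: fewer
    than k active vertices means a deviation of at least k.\<close>
  define k where "k = c / 16 * real r"
  have k: "0 < k" using c_pos r by (simp add: k_def)
  have mean_r: "real r + 2 * k \<le> mean w r"
    using mean_w_lower[of r] r_m by (simp add: k_def algebra_simps)
  have "es w (1 - \<rho>) r \<le> 1 / k\<^sup>2 * vr ahead w r + 1 / (\<rho> * k) * tot ahead w r"
  proof (rule has_sum_mono[OF es_has_sum[of w "1 - \<rho>" r, OF w_nonneg]])
    show "((\<lambda>x. 1 / k\<^sup>2 * (pm ahead w r x * (real x - mean w r)\<^sup>2) + 1 / (\<rho> * k) * pm ahead w r x) has_sum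
      (1 / k\<^sup>2 * vr ahead w r + 1 / (\<rho> * k) * tot ahead w r)) UNIV"
      by (intro has_sum_add has_sum_cmult_right vr_has_sum pm_has_sum w_nonneg)
    fix x
    define t where "t = x + 1 - r"
    have a0: "0 \<le> pm ahead w r x" by (rule pm_nonneg[OF w_nonneg])
    show "pm ahead w r x * (1 - \<rho>) ^ (x + 1 - r) \<le>
      1 / k\<^sup>2 * (pm ahead w r x * (real x - mean w r)\<^sup>2) + 1 / (\<rho> * k) * pm ahead w r x"
    proof (cases "x < r")
      case True
      then show ?thesis by (simp add: mass_ahead_zero)
    next
      case False
      have "(1 - \<rho>) ^ t \<le> 1 / k\<^sup>2 * (real x - mean w r)\<^sup>2 + 1 / (\<rho> * k)"
      proof (cases "real t \<le> k")
        case True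
        then have "k \<le> mean w r - real x" using mean_r False by (simp add: t_def of_nat_diff)
        then have "k\<^sup>2 \<le> (mean w r - real x)\<^sup>2" using k by (intro power_mono) auto
        then have "1 \<le> 1 / k\<^sup>2 * (real x - mean w r)\<^sup>2" using k by (simp add: power2_commute)
        moreover have "(1 - \<rho>) ^ t \<le> 1" using \<rho> by (intro power_le_one) auto
        moreover have "0 \<le> 1 / (\<rho> * k)" using \<rho> k by simp
        ultimately show ?thesis by linarith
      next
        case False
        then have tp: "0 < real t" "k \<le> real t" using k by auto
        have "(1 - \<rho>) ^ t \<le> exp (- \<rho>) ^ t"
          using exp_ge_add_one_self[of "- \<rho>"] \<rho> by (intro power_mono) auto
        also have "\<dots> = exp (real t * - \<rho>)" by (rule exp_of_nat_mult[symmetric])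
        also have "\<dots> = 1 / exp (real t * \<rho>)" by (simp add: exp_minus inverse_eq_divide)
        also have "\<dots> \<le> 1 / (real t * \<rho>)"
        proof (rule divide_left_mono)
          show "real t * \<rho> \<le> exp (real t * \<rho>)"
            using exp_ge_add_one_self[of "real t * \<rho>"] by linarith
        qed (use tp \<rho> in auto)
        also have "\<dots> \<le> 1 / (k * \<rho>)"
          using tp \<rho> k by (intro divide_left_mono mult_right_mono) auto
        finally have "(1 - \<rho>) ^ t \<le> 1 / (\<rho> * k)" by (simp add: mult.commute)
        moreover have "0 \<le> 1 / k\<^sup>2 * (real x - mean w r)\<^sup>2" by simp
        ultimately show ?thesis by linarith
      qed
      then have "pm ahead w r x * (1 - \<rho>) ^ t \<le> pm ahead w r x * (1 / k\<^sup>2 * (real x - mean w r)\<^sup>2 + 1 / (\<rho> * k))"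
        using a0 by (rule mult_left_mono)
      then show ?thesis by (simp add: t_def algebra_simps)
    qed
  qed (use \<rho> in auto)
  also have "\<dots> \<le> 1 / k\<^sup>2 * (320 * c * real r) + 1 / (c / 2 * k) * (96 * c)"
    using ahead_bounds \<rho> k c_pos tot_nonneg[of w ahead r, OF w_nonneg] vr_nonneg[of w ahead r, OF w_nonneg]
    by (intro add_mono mult_mono divide_left_mono mult_right_mono) auto
  also have "\<dots> = 84992 * (1 / real r) / c"
    using c_pos r by (simp add: k_def power2_eq_square field_simps)
  also have "\<dots> \<le> 84992 * (32 * c\<^sup>2 * s) / c"
    using inv_r(1) c_pos by (intro divide_right_mono mult_left_mono) auto
  also have "\<dots> = 2719744 * (c * s)" using c_pos by (simp add: power2_eq_square)
  also have "\<dots> \<le> 3000000 * (c * s)" using c_pos s_pos by simp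
  finally show ?thesis using up \<rho> by (simp add: algebra_simps power2_eq_square)
qed

section \<open>Gluing the two windows together\<close>

definition B :: real where "B = 1 / sqrt (2 * pi * real m)"

lemma B_pos: "0 < B" using m_pos by (simp add: B_def)

lemma mean_w_le: "mean w i \<le> 11 / 10 * real i"
proof -
  have "mean w i \<le> (\<Sum>j<i. 11 / 10)"
    unfolding mean_def using w_le theta_bounds'(3) by (intro sum_mono) (meson order.trans)
  then show ?thesis by simp
qed

lemma mean_u_r: "mean u r \<le> real r"
proof -
  have "mean u r \<le> real r * (1 - c / 8)" using r_m by (intro mean_u_upper) linarith
  also have "\<dots> \<le> real r * 1" using c_pos by (intro mult_left_mono) auto
  finally show ?thesis by simp
qed

lemma m_large: "2500 \<le> real m"
proof -
  have "50\<^sup>2 \<le> (sqrt (real m))\<^sup>2" using sqrt_m by (intro power_mono) auto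
  then show ?thesis by simp
qed

definition mid :: real where "mid = mean w (m - r) - mean w r"

lemma mid_ge: "real m - 21 / 10 * real r \<le> mid" "real m / 2 \<le> mid" "4 \<le> mid"
proof -
  have "mean w (m - r) = real m - mean u r" using mean_u[of r] r_m by simp
  then show 1: "real m - 21 / 10 * real r \<le> mid" using mean_w_le[of r] mean_u_r by (simp add: mid_def)
  then show "real m / 2 \<le> mid" using r_m by linarith
  then show "4 \<le> mid" using m_large by linarith
qed

text \<open>The windows remove at most 21/10 r from the total mean \<open>m\<close>, a fraction of
  order s since r \<le> m s / 16. Passing from \<open>mid\<close> to \<open>m\<close> in the local
  weight therefore costs a factor 1 + s.\<close>

lemma pois_mid_le: "pois mid j \<le> B * (1 + s)"
proof -
  have "1 \<le> (1 + s)\<^sup>2 * (1 - s / 5)"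
  proof -
    have ss: "s * s \<le> s * 2" using s_le s_pos by (intro mult_left_mono) auto
    have "s * s * s \<le> s * 2 * s" using ss s_pos by (intro mult_right_mono) auto
    then have "s * s * s \<le> 2 * (s * s)" by simp
    moreover have "0 \<le> s * s" by simp
    ultimately have "0 \<le> 9 / 5 * s + 3 / 5 * (s * s) - s * s * s / 5" using s_pos by linarith
    also have "\<dots> = (1 + s)\<^sup>2 * (1 - s / 5) - 1" by (simp add: power2_eq_square algebra_simps add_divide_distrib)
    finally show ?thesis by simp
  qed
  then have "2 * pi * real m * 1 \<le> 2 * pi * real m * ((1 + s)\<^sup>2 * (1 - s / 5))"
    by (intro mult_left_mono) auto
  also have "\<dots> = (1 + s)\<^sup>2 * (2 * pi * (real m * (1 - s / 5)))" by simp
  also have "\<dots> \<le> (1 + s)\<^sup>2 * (2 * pi * (mid - 1))"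
  proof (intro mult_left_mono)
    have "real m * (1 - s / 5) = real m - 16 / 5 * (real m * s / 16)" by (simp add: algebra_simps)
    also have "\<dots> \<le> mid - 1" using mid_ge(1) r_m(1) r_bounds(3) by linarith
    finally show "real m * (1 - s / 5) \<le> mid - 1" .
  qed auto
  finally have "sqrt (2 * pi * real m) \<le> (1 + s) * sqrt (2 * pi * (mid - 1))"
    using real_sqrt_le_mono[of "2 * pi * real m" "(1 + s)\<^sup>2 * (2 * pi * (mid - 1))"] s_pos
    by (simp add: real_sqrt_mult)
  then have "1 / sqrt (2 * pi * (mid - 1)) \<le> (1 + s) / sqrt (2 * pi * real m)"
    using mid_ge m_pos by (simp add: frac_le_eq divide_simps mult.commute)
  then show ?thesis using pois_le_sup[of mid j] mid_ge by (simp add: B_def)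
qed

definition T :: real where "T = pm ahead w m m"

lemma T_nonneg: "0 \<le> T" unfolding T_def by (rule pm_nonneg[OF w_nonneg])

lemma product_upper:
  fixes x y :: real
  assumes "0 \<le> y" "x \<le> K"
  shows "(1 + x) * (1 + y) \<le> 1 + x + (1 + K) * y"
  using mult_right_mono[OF assms(2,1)] by (simp add: algebra_simps)

lemma T_upper: "T \<le> B * (exp 1 * c\<^sup>2 / 2) * (1 + 2000000000 * (s + c))"
proof -
  let ?a = "2 * c + 3000000 * s" and ?b = "2 * c + 64 * s"
  have "T \<le> B * (1 + s) * tot ahead w r * tot behind u r"
    unfolding T_def u_def[abs_def]
    by (rule bridge_upper[OF w_nonneg]) (use r_m pois_mid_le in \<open>auto simp: mid_def\<close>)
  also have "\<dots> \<le> B * (1 + s) * (c * (1 + ?a)) * (exp 1 * (c / 2) * (1 + ?b))"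
    using ahead_upper behind_upper tot_nonneg[of w ahead r, OF w_nonneg] tot_nonneg[of u behind r, OF u_nonneg]
      B_pos c_pos s_pos by (intro mult_mono mult_left_mono) (auto simp: add.assoc)
  also have "\<dots> = B * (exp 1 * c\<^sup>2 / 2) * ((1 + s) * (1 + ?b) * (1 + ?a))"
    by (simp add: power2_eq_square)
  also have "\<dots> \<le> B * (exp 1 * c\<^sup>2 / 2) * (1 + 2000000000 * (s + c))"
  proof (rule mult_left_mono)
    have "(1 + s) * (1 + ?b) \<le> 1 + s + (1 + 2) * ?b" using s_le s_pos c_pos by (intro product_upper) auto
    then have "(1 + s) * (1 + ?b) * (1 + ?a) \<le> (1 + (s + 3 * ?b)) * (1 + ?a)"
      using s_pos c_pos by (intro mult_right_mono) auto
    also have "\<dots> \<le> 1 + (s + 3 * ?b) + (1 + 400) * ?a"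
      using s_le s_pos c_pos c_le by (intro product_upper) auto
    finally show "(1 + s) * (1 + ?b) * (1 + ?a) \<le> 1 + 2000000000 * (s + c)"
      using s_pos c_pos by simp
  qed (use B_pos in simp)
  finally show ?thesis .
qed

lemma product_lower:
  fixes X Y a b x y :: real
  assumes "0 \<le> X" "0 \<le> Y" "0 \<le> x" "0 \<le> y" "x * (1 - a) \<le> X" "y * (1 - b) \<le> Y" "0 \<le> a" "0 \<le> b"
  shows "x * y * (1 - a - b) \<le> X * Y"
proof (cases "a \<le> 1 \<and> b \<le> 1")
  case True
  have "x * y * (1 - a - b) \<le> x * y * ((1 - a) * (1 - b))"
    using assms by (intro mult_left_mono) (auto simp: algebra_simps)
  also have "\<dots> = (x * (1 - a)) * (y * (1 - b))" by simp
  also have "\<dots> \<le> X * Y" using assms True by (intro mult_mono) auto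
  finally show ?thesis .
next
  case False
  then have "x * y * (1 - a - b) \<le> 0" using assms by (intro mult_nonneg_nonpos) auto
  also have "0 \<le> X * Y" using assms by simp
  finally show ?thesis .
qed

text \<open>Serves the correction terms of \<open>bridge_lower\<close>, where the middle piece
  covers only half of the walk. They already carry the factor s, so losing a factor 2 in the local
  weight is harmless.\<close>

lemma pois_half_le:
  assumes "real m / 4 + 1 \<le> \<mu>"
  shows "pois \<mu> j \<le> 2 * B"
proof -
  have "pois \<mu> j \<le> 1 / sqrt (2 * pi * (\<mu> - 1))" using assms m_large by (intro pois_le_sup) linarith
  also have "\<dots> \<le> 1 / sqrt (2 * pi * real m / 4)"
    using assms m_pos by (intro divide_left_mono real_sqrt_le_mono) auto
  also have "\<dots> = 2 * B" unfolding B_def real_sqrt_divide real_sqrt_four by simp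
  finally show ?thesis .
qed

lemma T_lower: "B * (exp 1 * c\<^sup>2 / 2) * (1 - 500000000 * (s + c)) \<le> T"
proof -
  \<comment> \<open>The bounds \<open>mean_w_lower\<close> and \<open>mean_u_upper\<close> hold up
    to half of the time, rounded up; so each half is controlled from its own end.\<close>
  define l where "l = m div 2"
  define \<pi>\<^sub>1 where "\<pi>\<^sub>1 = tot ahead w r"
  define \<pi>\<^sub>2 where "\<pi>\<^sub>2 = tot behind u r"
  have l: "r \<le> l" "l \<le> m" "r \<le> m - l" "2 * l \<le> m" "2 * (m - l) \<le> m + 1" "real m \<le> 2 * real l + 1"
    using r_m by (auto simp: l_def)
  have \<pi>: "0 \<le> \<pi>\<^sub>1" "\<pi>\<^sub>1 \<le> 96 * c" "0 \<le> \<pi>\<^sub>2" "\<pi>\<^sub>2 \<le> 96 * c"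
    unfolding \<pi>\<^sub>1_def \<pi>\<^sub>2_def using ahead_bounds behind_bounds tot_nonneg[of w ahead r, OF w_nonneg]
      tot_nonneg[of u behind r, OF u_nonneg] by auto
  have low: "B * ((1 - 1 / (2 * mid)) * \<pi>\<^sub>1 * \<pi>\<^sub>2 - 2 / mid * (vr ahead w r * \<pi>\<^sub>2 + \<pi>\<^sub>1 * vr behind u r))
    - (2 * B) * (\<pi>\<^sub>2 * (\<pi>\<^sub>1 - tot ahead w l) + \<pi>\<^sub>1 * (\<pi>\<^sub>2 - tot behind u (m - l))) \<le> T"
    unfolding T_def \<pi>\<^sub>1_def \<pi>\<^sub>2_def mid_def u_def[abs_def]
  proof (rule bridge_lower[OF w_nonneg l(1-3) mean_w_m]; (fold u_def[abs_def] mid_def)?)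
    have "real l * (1 + c / 8) \<le> mean w l" using l by (intro mean_w_lower) auto
    moreover have "0 \<le> real l * c" using c_pos by simp
    ultimately have "real l \<le> mean w l" by (simp add: algebra_simps)
    then have "real m / 4 + 1 \<le> mean w l - mean w r"
      using l(6) mean_w_le[of r] r_m(3) m_large by linarith
    then show "pois (mean w l - mean w r) j \<le> 2 * B" for j by (rule pois_half_le)
    have "mean u (m - l) = real m - mean w l" using mean_u[of "m - l"] l by simp
    then have "real m / 4 + 1 \<le> mean u (m - l) - mean u r"
      using mean_w_le[of l] l(4) mean_u_r r_m(3) m_large by linarith
    then show "pois (mean u (m - l) - mean u r) j \<le> 2 * B" for j by (rule pois_half_le)
    show "B * (1 - 1 / (2 * mid) - (real j - mid)\<^sup>2 / mid) \<le> pois mid j" if "j \<le> m" for j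
      unfolding B_def using pois_ge[of mid j m] mid_ge(3) that by simp
  qed (use B_pos mid_ge in auto)
  have p1: "c * (exp 1 * (c / 2)) * (1 - (6 * c + s) - (3 * c + s)) \<le> \<pi>\<^sub>1 * \<pi>\<^sub>2"
    using ahead_lower behind_lower c_pos s_pos \<pi>
    by (intro product_lower) (auto simp: \<pi>\<^sub>1_def \<pi>\<^sub>2_def diff_diff_eq)
  have p2: "1 / (2 * mid) * (\<pi>\<^sub>1 * \<pi>\<^sub>2) \<le> s * ((96 * c) * (96 * c))"
  proof (intro mult_mono)
    have "1 / (2 * mid) \<le> 1 / real m" using mid_ge m_pos by (intro divide_left_mono) auto
    also have "\<dots> = s * (c\<^sup>2 * s)" by (simp add: inv_m power2_eq_square)
    also have "\<dots> \<le> s * (1 * 1)"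
    proof (intro mult_left_mono)
      have "c\<^sup>2 * s \<le> (1 / 10000) * 2"
        using s_le s_pos c_le c_pos power_mono[of c "1 / 100" 2] by (intro mult_mono) (auto simp: power_divide)
      then show "c\<^sup>2 * s \<le> 1 * 1" by simp
    qed (use s_pos in auto)
    finally show "1 / (2 * mid) \<le> s" by simp
  qed (use \<pi> s_pos c_pos in auto)
  have p3: "2 / mid * (vr ahead w r * \<pi>\<^sub>2 + \<pi>\<^sub>1 * vr behind u r) \<le> 15360 * (c\<^sup>2 * s)"
  proof -
    have "2 / mid * (vr ahead w r * \<pi>\<^sub>2 + \<pi>\<^sub>1 * vr behind u r) \<le>
      4 / real m * ((320 * c * real r) * (96 * c) + (96 * c) * (320 * c * real r))"
    proof (intro mult_mono add_mono)
      show "2 / mid \<le> 4 / real m" using mid_ge m_pos by (simp add: divide_simps)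
    qed (use \<pi> c_pos m_pos ahead_bounds behind_bounds vr_nonneg[of w ahead r, OF w_nonneg]
        vr_nonneg[of u behind r, OF u_nonneg] in \<open>auto intro!: add_nonneg_nonneg mult_nonneg_nonneg\<close>)
    also have "\<dots> = 245760 * c\<^sup>2 / real m * real r" by (simp add: power2_eq_square)
    also have "\<dots> \<le> 245760 * c\<^sup>2 / real m * (real m * s / 16)" using r_m by (intro mult_left_mono) auto
    also have "\<dots> = 15360 * (c\<^sup>2 * s)" using m_pos by simp
    finally show ?thesis .
  qed
  have p4: "\<pi>\<^sub>2 * (\<pi>\<^sub>1 - tot ahead w l) + \<pi>\<^sub>1 * (\<pi>\<^sub>2 - tot behind u (m - l)) \<le> 201326592 * (c\<^sup>2 * s)"
  proof -
    have "\<pi>\<^sub>2 * (\<pi>\<^sub>1 - tot ahead w l) + \<pi>\<^sub>1 * (\<pi>\<^sub>2 - tot behind u (m - l)) \<le>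
      (96 * c) * (1048576 * c * s) + (96 * c) * (1048576 * c * s)"
      using \<pi> c_pos ahead_drop[of l] behind_drop[of "m - l"] l
        tot_antimono[of w r l ahead, OF w_nonneg] tot_antimono[of u r "m - l" behind, OF u_nonneg]
      by (intro add_mono mult_mono) (auto simp: \<pi>\<^sub>1_def \<pi>\<^sub>2_def)
    then show ?thesis by (simp add: power2_eq_square)
  qed
  have "B * (c * (exp 1 * (c / 2)) * (1 - (6 * c + s) - (3 * c + s)) - s * ((96 * c) * (96 * c)) - 15360 * (c\<^sup>2 * s))
      - (2 * B) * (201326592 * (c\<^sup>2 * s)) \<le> T"
  proof -
    have "c * (exp 1 * (c / 2)) * (1 - (6 * c + s) - (3 * c + s)) - s * ((96 * c) * (96 * c)) - 15360 * (c\<^sup>2 * s)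
      \<le> (1 - 1 / (2 * mid)) * \<pi>\<^sub>1 * \<pi>\<^sub>2 - 2 / mid * (vr ahead w r * \<pi>\<^sub>2 + \<pi>\<^sub>1 * vr behind u r)"
    proof -
      have "(1 - 1 / (2 * mid)) * \<pi>\<^sub>1 * \<pi>\<^sub>2 = \<pi>\<^sub>1 * \<pi>\<^sub>2 - 1 / (2 * mid) * (\<pi>\<^sub>1 * \<pi>\<^sub>2)"
        by (simp add: algebra_simps)
      then show ?thesis using p1 p2 p3 by linarith
    qed
    then have a: "B * (c * (exp 1 * (c / 2)) * (1 - (6 * c + s) - (3 * c + s)) - s * ((96 * c) * (96 * c)) - 15360 * (c\<^sup>2 * s))
      \<le> B * ((1 - 1 / (2 * mid)) * \<pi>\<^sub>1 * \<pi>\<^sub>2 - 2 / mid * (vr ahead w r * \<pi>\<^sub>2 + \<pi>\<^sub>1 * vr behind u r))"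
      using B_pos by (intro mult_left_mono) auto
    have b: "(2 * B) * (\<pi>\<^sub>2 * (\<pi>\<^sub>1 - tot ahead w l) + \<pi>\<^sub>1 * (\<pi>\<^sub>2 - tot behind u (m - l)))
      \<le> (2 * B) * (201326592 * (c\<^sup>2 * s))"
      using B_pos p4 by (intro mult_left_mono) auto
    show ?thesis using low a b by linarith
  qed
  moreover have "B * (exp 1 * c\<^sup>2 / 2) * (1 - 500000000 * (s + c)) \<le>
    B * (c * (exp 1 * (c / 2)) * (1 - (6 * c + s) - (3 * c + s)) - s * ((96 * c) * (96 * c)) - 15360 * (c\<^sup>2 * s))
      - (2 * B) * (201326592 * (c\<^sup>2 * s))"
  proof -
    have "B * (c * (exp 1 * (c / 2)) * (1 - (6 * c + s) - (3 * c + s)) - s * ((96 * c) * (96 * c)) - 15360 * (c\<^sup>2 * s))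
      - (2 * B) * (201326592 * (c\<^sup>2 * s)) =
      B * (c\<^sup>2 * ((exp 1 / 2) * (1 - 9 * c - 2 * s) - 402677760 * s))"
      by (simp add: algebra_simps power2_eq_square)
    moreover have "B * (exp 1 * c\<^sup>2 / 2) * (1 - 500000000 * (s + c)) =
      B * (c\<^sup>2 * ((exp 1 / 2) * (1 - 500000000 * (s + c))))" by simp
    moreover have "B * (c\<^sup>2 * ((exp 1 / 2) * (1 - 500000000 * (s + c)))) \<le>
      B * (c\<^sup>2 * ((exp 1 / 2) * (1 - 9 * c - 2 * s) - 402677760 * s))"
    proof (intro mult_left_mono)
      have "1 \<le> exp 1 / (2 :: real)" using exp_ge_add_one_self[of "1 :: real"] by simp
      then have "1 * (499999991 * c + 499999998 * s) \<le> exp 1 / 2 * (499999991 * c + 499999998 * s)"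
        using c_pos s_pos by (intro mult_right_mono) auto
      then show "(exp 1 / 2) * (1 - 500000000 * (s + c)) \<le> (exp 1 / 2) * (1 - 9 * c - 2 * s) - 402677760 * s"
        using c_pos s_pos by (simp add: algebra_simps)
    qed (use B_pos in auto)
    ultimately show ?thesis by linarith
  qed
  ultimately show ?thesis by linarith
qed

end

text \<open>This makes the tilt legitimate: at a fixed final height every path is reweighted by the
  same power of \<open>k\<close>.\<close>

lemma mass_scale: "mass ok (\<lambda>i. k * v i) n y = k ^ y * mass ok v n y"
proof (induction n arbitrary: y)
  case (Suc n)
  have "mass ok (\<lambda>i. k * v i) n x * ((k * v n) ^ (y - x) / fact (y - x)) =
    k ^ y * (mass ok v n x * (v n ^ (y - x) / fact (y - x)))" if "x \<le> y" for x
  proof -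
    have "k ^ y = k ^ x * k ^ (y - x)" using that by (simp add: power_add[symmetric])
    then show ?thesis unfolding Suc by (simp add: power_mult_distrib)
  qed
  then show ?case by (simp add: sum_distrib_left)
qed auto

text \<open>Undoing the tilt gives \<open>conn p (Suc m) = x * R * t\<close>, where \<open>t\<close>
  is the bridge probability, about b e c^2 / 2, and \<open>R\<close> = m! e^m / m^m. By Stirling's
  formula \<open>R\<close> lies between 1 / b and (1 + s) / b, so the local weight b = 1 / sqrt (2
  pi m) cancels.\<close>

lemma conn_asymptotics:
  fixes m :: nat and p :: real
  assumes "0 < p" "real m * p \<le> 1 / 100" "1 / 2 \<le> real m * p * sqrt (real m)"
  defines "\<Phi> \<equiv> (1 - (1 - p) ^ m) ^ m * (exp 1 * (real m * p)\<^sup>2 / 2)"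
  shows "\<bar>conn p (Suc m) - \<Phi>\<bar> \<le> 10000000000 * (1 / (real m * p * sqrt (real m)) + real m * p) * \<Phi>"
proof -
  note ass = assms(1-3)
  define t where "t = T m p"
  define b where "b = B m"
  define cc where "cc = c m p"
  define ss where "ss = s m p"
  define th where "th = theta m p"
  define x where "x = (1 - (1 - p) ^ m) ^ m"
  have mp: "0 < real m" by (rule m_pos[OF ass])
  have cs: "0 < cc" "0 < ss" "ss \<le> 2"
    unfolding cc_def ss_def using c_pos[OF ass] s_pos[OF ass] s_le[OF ass] by auto
  have qm: "0 < 1 - (1 - p) ^ m" using qm_pos[OF ass] by (simp add: q_def[OF ass])
  have th: "0 < th" using theta_bounds'(1)[OF ass] by (simp add: th_def)
  have bp: "0 < b" using B_pos[OF ass] by (simp add: b_def)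
  define R where "R = fact m * exp (real m) / real m ^ m"
  have conn: "conn p (Suc m) = x * R * t"
  proof -
    have "w m p = (\<lambda>i. (th / p) * (p * (1 - p) ^ i))"
      using assms(1) by (auto simp: w_def[OF ass] th_def q_def[OF ass])
    then have "t = exp (- real m) * ((th / p) ^ m * mass ahead (\<lambda>i. p * (1 - p) ^ i) m m)"
      unfolding t_def T_def[OF ass] pm_def mean_w_m[OF ass] by (simp only: mass_scale)
    moreover have "(th / p) ^ m * x = real m ^ m"
    proof -
      have "th / p * (1 - (1 - p) ^ m) = real m"
        using qm assms(1) by (simp add: th_def theta_def[OF ass] c_def[OF ass] q_def[OF ass])
      then show ?thesis unfolding x_def power_mult_distrib[symmetric] by simp
    qed
    then have "x * real m ^ m * (th / p) ^ m = real m ^ m * real m ^ m" by (simp add: mult_ac)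
    ultimately have "x * R * t = fact m * ((th / p) ^ m * x / real m ^ m) * (exp (real m) * exp (- real m)) *
        mass ahead (\<lambda>i. p * (1 - p) ^ i) m m"
      by (simp add: R_def)
    also have "\<dots> = conn p (Suc m)"
      using \<open>(th / p) ^ m * x = real m ^ m\<close> mp by (simp add: conn_def exp_minus)
    finally show ?thesis ..
  qed
  have R: "1 / b \<le> R" "R \<le> 1 / b * (1 + ss)"
  proof -
    have m1: "1 \<le> m" using mp by simp
    have lnR: "ln R = ln (real m) / 2 + stirling_rem m"
      unfolding R_def using mp ln_fact_stirling[OF m1] by (simp add: ln_div ln_mult ln_realpow)
    have lnb: "ln (1 / b) = ln (real m) / 2 + ln (2 * pi) / 2"
      using mp by (simp add: b_def B_def[OF ass] ln_sqrt ln_mult)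
    have Rp: "0 < R" using mp by (simp add: R_def)
    have "ln (1 / b) \<le> ln R" using lnR lnb stirling_rem_bounds(1)[OF m1] by simp
    then show "1 / b \<le> R" using Rp bp by (simp only: ln_le_cancel_iff zero_less_divide_1_iff)
    have "ln R \<le> ln (1 / b) + 1 / (4 * real m)" using lnR lnb stirling_rem_bounds(2)[OF m1] by simp
    also have "1 / (4 * real m) \<le> ln (1 + ss)"
    proof -
      have "1 / real m \<le> ss / 10"
      proof -
        have "1 / real m = ss * (cc\<^sup>2 * ss)" unfolding ss_def cc_def inv_m[OF ass] by (simp add: power2_eq_square)
        also have "\<dots> \<le> ss * (1 / 10)"
        proof (intro mult_left_mono)
          have "cc\<^sup>2 \<le> (1 / 100)\<^sup>2" using cs c_le[OF ass] by (intro power_mono) (auto simp: cc_def)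
          then have "cc\<^sup>2 * ss \<le> (1 / 100)\<^sup>2 * 2" using cs by (intro mult_mono) auto
          then show "cc\<^sup>2 * ss \<le> 1 / 10" by (simp add: power_divide)
        qed (use cs in auto)
        finally show ?thesis by simp
      qed
      moreover have "ss / 2 \<le> 2 * ss / (2 + ss)" using cs by (simp add: field_simps)
      moreover have "2 * ss / (2 + ss) \<le> ln (1 + ss)" using ln_1p_bounds(1)[of ss] cs by simp
      ultimately show ?thesis using cs by simp
    qed
    finally have "ln R \<le> ln (1 / b * (1 + ss))" using bp cs by (subst ln_mult) auto
    then show "R \<le> 1 / b * (1 + ss)" using Rp bp cs by (subst (asm) ln_le_cancel_iff) auto
  qed
  define F where "F = exp 1 * cc\<^sup>2 / 2"
  have F: "0 < F" using cs by (simp add: F_def)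
  have xp: "0 < x" using qm by (simp add: x_def)
  have t: "b * F * (1 - 500000000 * (ss + cc)) \<le> t" "t \<le> b * F * (1 + 2000000000 * (ss + cc))" "0 \<le> t"
    using T_lower[OF ass] T_upper[OF ass] T_nonneg[OF ass]
    by (simp_all add: t_def b_def F_def cc_def ss_def)
  have "F * (1 - 500000000 * (ss + cc)) = 1 / b * (b * F * (1 - 500000000 * (ss + cc)))" using bp by simp
  also have "\<dots> \<le> 1 / b * t" using t bp by (intro mult_left_mono) auto
  also have "\<dots> \<le> R * t" using R t by (intro mult_right_mono) auto
  finally have lower: "F * (1 - 500000000 * (ss + cc)) \<le> R * t" .
  have "R * t \<le> 1 / b * (1 + ss) * (b * F * (1 + 2000000000 * (ss + cc)))"
    using R t bp cs by (intro mult_mono) auto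
  also have "\<dots> = F * ((1 + ss) * (1 + 2000000000 * (ss + cc)))" using bp by simp
  also have "\<dots> \<le> F * (1 + ss + (1 + 2) * (2000000000 * (ss + cc)))"
    using F cs product_upper[OF ass, of "2000000000 * (ss + cc)" ss 2] by (intro mult_left_mono) auto
  finally have upper: "R * t \<le> F * (1 + ss + (1 + 2) * (2000000000 * (ss + cc)))" .
  have "\<bar>R * t - F\<bar> \<le> F * (10000000000 * (ss + cc))"
  proof (rule abs_leI)
    have "F * (1 + ss + (1 + 2) * (2000000000 * (ss + cc))) \<le> F * (1 + 10000000000 * (ss + cc))"
      using F cs by (intro mult_left_mono) auto
    then show "R * t - F \<le> F * (10000000000 * (ss + cc))" using upper by (simp add: algebra_simps)
    have "F * (1 - 10000000000 * (ss + cc)) \<le> F * (1 - 500000000 * (ss + cc))"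
      using F cs by (intro mult_left_mono) auto
    then show "- (R * t - F) \<le> F * (10000000000 * (ss + cc))" using lower by (simp add: algebra_simps)
  qed
  then have "x * \<bar>R * t - F\<bar> \<le> x * (F * (10000000000 * (ss + cc)))" using xp by (intro mult_left_mono) auto
  moreover have "x * \<bar>R * t - F\<bar> = \<bar>x * R * t - x * F\<bar>"
    using xp by (simp add: abs_mult right_diff_distrib[symmetric] mult.assoc)
  moreover have "\<Phi> = x * F" by (simp add: \<Phi>_def x_def F_def cc_def c_def[OF ass])
  ultimately show ?thesis
    unfolding conn by (simp add: mult_ac ss_def s_def[OF ass] cc_def c_def[OF ass])
qed

hide_const (open) c q s theta r w u nu B mid T es gs

section \<open>The expected number of components\<close>

lemma ln_one_minus_bounds:
  fixes x :: real
  assumes "0 \<le> x" "x \<le> 1 / 2"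
  shows "ln (1 - x) \<le> - x - x\<^sup>2 / 2" "- x - x\<^sup>2 / 2 - x ^ 3 \<le> ln (1 - x)" "ln (1 - x) \<le> - x" "- x - x\<^sup>2 \<le> ln (1 - x)"
proof -
  show "ln (1 - x) \<le> - x - x\<^sup>2 / 2"
  proof -
    have "ln (1 - x) \<le> ln (exp (- x - x\<^sup>2 / 2))"
      using one_minus_le_exp_quadratic[of x] assms by (subst ln_le_cancel_iff) auto
    then show ?thesis by simp
  qed
  then show "ln (1 - x) \<le> - x" using zero_le_power2[of x] by linarith
  show 1: "- x - x\<^sup>2 / 2 - x ^ 3 \<le> ln (1 - x)"
    using ln_one_minus_lower_cubic[of x] assms by (subst ln_ge_iff) auto
  have "x ^ 3 \<le> x\<^sup>2 / 2"
    using mult_left_mono[OF assms(2), of "x\<^sup>2"] by (simp add: power2_eq_square power3_eq_cube mult.assoc)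
  then show "- x - x\<^sup>2 \<le> ln (1 - x)" using 1 by linarith
qed

text \<open>Second-order expansion of each logarithm: the cubic remainders sum to at most k^4 / n^3,
  and k / n collects the lower-order parts of the power sums.\<close>

lemma ln_falling_product:
  fixes n k :: nat
  assumes "1 \<le> k" "2 * k \<le> n"
  shows "\<bar>(\<Sum>i<k. ln (1 - real i / real n)) + (real k)\<^sup>2 / (2 * real n) + real k ^ 3 / (6 * (real n)\<^sup>2)\<bar>
    \<le> real k ^ 4 / real n ^ 3 + real k / real n"
proof -
  define N where "N = real n"
  have N: "0 < N" using assms by (simp add: N_def)
  have t: "0 \<le> real i / N" "real i / N \<le> 1 / 2" if "i < k" for i
    using that assms N by (auto simp: N_def divide_simps)
  have S1: "(\<Sum>i<k. real i) = (real k)\<^sup>2 / 2 - real k / 2"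
    by (induction k) (auto simp: power2_eq_square field_simps)
  have S2: "(\<Sum>i<k. (real i)\<^sup>2) = real k ^ 3 / 3 - (real k)\<^sup>2 / 2 + real k / 6"
    by (induction k) (auto simp: power2_eq_square power3_eq_cube field_simps)
  have S3: "(\<Sum>i<k. (real i) ^ 3) \<le> real k ^ 4"
  proof -
    have "(\<Sum>i<k. (real i) ^ 3) \<le> (\<Sum>i<k. (real k) ^ 3)" by (intro sum_mono power_mono) auto
    then show ?thesis by (simp add: power4_eq_xxxx power3_eq_cube)
  qed
  have "(\<Sum>i<k. - (real i / N) - (real i / N)\<^sup>2 / 2) = - (\<Sum>i<k. real i) / N - (\<Sum>i<k. (real i)\<^sup>2) / (2 * N\<^sup>2)"
    by (simp add: sum_subtractf sum_negf sum_divide_distrib power_divide mult.commute)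
  also have "\<dots> = - (real k)\<^sup>2 / (2 * N) - real k ^ 3 / (6 * N\<^sup>2) + (real k / (2 * N) + (real k)\<^sup>2 / (4 * N\<^sup>2) - real k / (12 * N\<^sup>2))"
    unfolding S1 S2 by (simp add: add_divide_distrib diff_divide_distrib)
  finally have main: "(\<Sum>i<k. - (real i / N) - (real i / N)\<^sup>2 / 2) = - (real k)\<^sup>2 / (2 * N) - real k ^ 3 / (6 * N\<^sup>2)
    + (real k / (2 * N) + (real k)\<^sup>2 / (4 * N\<^sup>2) - real k / (12 * N\<^sup>2))" .
  have rem: "0 \<le> real k / (2 * N) + (real k)\<^sup>2 / (4 * N\<^sup>2) - real k / (12 * N\<^sup>2)"
    "real k / (2 * N) + (real k)\<^sup>2 / (4 * N\<^sup>2) - real k / (12 * N\<^sup>2) \<le> real k / N"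
  proof -
    define z where "z = real k / N"
    have z: "0 < z" "z \<le> 1 / 2" using assms N by (auto simp: z_def N_def divide_simps)
    have e: "real k / (2 * N) = z / 2" "(real k)\<^sup>2 / (4 * N\<^sup>2) = z\<^sup>2 / 4" "real k / (12 * N\<^sup>2) = z / (12 * N)"
      by (simp_all add: z_def power_divide power2_eq_square)
    have "z\<^sup>2 \<le> z / 2" using mult_left_mono[OF z(2), of z] z by (simp add: power2_eq_square)
    moreover have "1 \<le> N" using assms by (simp add: N_def)
    then have "z / (12 * N) \<le> z / (12 * 1)" using z by (intro divide_left_mono mult_left_mono) auto
    moreover have "0 \<le> z / (12 * N)" using z N by simp
    ultimately show "0 \<le> real k / (2 * N) + (real k)\<^sup>2 / (4 * N\<^sup>2) - real k / (12 * N\<^sup>2)"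
      "real k / (2 * N) + (real k)\<^sup>2 / (4 * N\<^sup>2) - real k / (12 * N\<^sup>2) \<le> real k / N"
      unfolding e z_def[symmetric] using z zero_le_power2[of z] by linarith+
  qed
  have "(\<Sum>i<k. ln (1 - real i / N)) \<le> (\<Sum>i<k. - (real i / N) - (real i / N)\<^sup>2 / 2)"
    using t by (intro sum_mono ln_one_minus_bounds) auto
  moreover have "(\<Sum>i<k. - (real i / N) - (real i / N)\<^sup>2 / 2) - real k ^ 4 / N ^ 3 \<le> (\<Sum>i<k. ln (1 - real i / N))"
  proof -
    have "(\<Sum>i<k. - (real i / N) - (real i / N)\<^sup>2 / 2) - real k ^ 4 / N ^ 3 \<le>
      (\<Sum>i<k. - (real i / N) - (real i / N)\<^sup>2 / 2) - (\<Sum>i<k. (real i) ^ 3) / N ^ 3"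
      using S3 N by (intro diff_left_mono divide_right_mono) auto
    also have "\<dots> = (\<Sum>i<k. - (real i / N) - (real i / N)\<^sup>2 / 2 - (real i / N) ^ 3)"
      by (simp add: sum_subtractf sum_divide_distrib power_divide)
    also have "\<dots> \<le> (\<Sum>i<k. ln (1 - real i / N))"
      using t by (intro sum_mono ln_one_minus_bounds) auto
    finally show ?thesis .
  qed
  moreover have "0 \<le> real k ^ 4 / N ^ 3" "0 \<le> real k / N" using N by auto
  ultimately show ?thesis using main rem unfolding N_def[symmetric] abs_le_iff by linarith
qed

lemma ln_binomial:
  fixes n k :: nat
  assumes "1 \<le> k" "2 * k \<le> n"
  shows "ln (real (n choose k)) = (\<Sum>i<k. ln (1 - real i / real n)) + real k * ln (real n) - ln (fact k)"
proof -
  have n: "0 < real n" using assms by simp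
  have "real (n choose k) = (\<Prod>i<k. real n - real i) / fact k"
    using binomial_gbinomial[of n k, where ?'a = real] by (simp add: gbinomial_prod_rev lessThan_atLeast0)
  also have "(\<Prod>i<k. real n - real i) = (\<Prod>i<k. real n * (1 - real i / real n))"
    using n by (intro prod.cong refl) (simp add: field_simps)
  finally have "real (n choose k) = (\<Prod>i<k. real n * (1 - real i / real n)) / fact k" .
  moreover have pos: "0 < 1 - real i / real n" if "i < k" for i using that assms n by (simp add: field_simps)
  moreover have "0 < (\<Prod>i<k. real n * (1 - real i / real n))"
    using pos n by (intro prod_pos mult_pos_pos) auto
  ultimately have "ln (real (n choose k)) = ln (\<Prod>i<k. real n * (1 - real i / real n)) - ln (fact k)"
  proof -
    have "ln (P / fact k) = ln P - ln (fact k)" if "0 < P" for P :: real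
      using that by (simp add: ln_div)
    then show ?thesis
      using \<open>real (n choose k) = (\<Prod>i<k. real n * (1 - real i / real n)) / fact k\<close>
        \<open>0 < (\<Prod>i<k. real n * (1 - real i / real n))\<close> by (simp only:)
  qed
  also have "ln (\<Prod>i<k. real n * (1 - real i / real n)) = (\<Sum>i<k. ln (real n * (1 - real i / real n)))"
    using pos n by (intro ln_prod) auto
  also have "\<dots> = (\<Sum>i<k. ln (real n) + ln (1 - real i / real n))"
  proof (intro sum.cong refl)
    show "ln (real n * (1 - real i / real n)) = ln (real n) + ln (1 - real i / real n)" if "i \<in> {..<k}" for i
      using that pos n by (intro ln_mult_pos) auto
  qed
  finally show ?thesis by (simp add: sum.distrib)
qed

lemma exp_minus_upper_cubic:
  fixes x :: real
  assumes "0 \<le> x"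
  shows "exp (- x) \<le> 1 - x + x\<^sup>2 / 2 - x ^ 3 / 6 + x ^ 4 / 24"
proof -
  define f :: "real \<Rightarrow> real" where "f = (\<lambda>x. 1 - x + x\<^sup>2 / 2 - x ^ 3 / 6 + x ^ 4 / 24 - exp (- x))"
  have "f 0 \<le> f x"
  proof (rule DERIV_nonneg_imp_nondecreasing[OF assms])
    fix y :: real assume y: "0 \<le> y"
    have "(f has_real_derivative (- 1 + y - y\<^sup>2 / 2 + y ^ 3 / 6 + exp (- y))) (at y)"
      unfolding f_def by (auto intro!: derivative_eq_intros)
    moreover have "0 \<le> - 1 + y - y\<^sup>2 / 2 + y ^ 3 / 6 + exp (- y)" using exp_minus_lower[OF y] by simp
    ultimately show "\<exists>d. (f has_real_derivative d) (at y) \<and> 0 \<le> d" by blast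
  qed
  then show ?thesis by (simp add: f_def)
qed

lemma ln_one_minus_exp:
  fixes t :: real
  assumes "0 < t" "t \<le> 1 / 2"
  shows "\<bar>ln (1 - exp (- t)) - (ln t - t / 2 + t\<^sup>2 / 24)\<bar> \<le> t ^ 3"
proof -
  define z where "z = 1 - (1 - exp (- t)) / t"
  have t3: "0 < t\<^sup>2" "0 < t ^ 3" "t\<^sup>2 \<le> t / 2" "t ^ 3 \<le> t\<^sup>2 / 2" "t ^ 4 \<le> t ^ 3 / 2"
    using assms mult_left_mono[OF assms(2), of t] mult_left_mono[OF assms(2), of "t\<^sup>2"] mult_left_mono[OF assms(2), of "t ^ 3"]
    by (simp_all add: power2_eq_square power3_eq_cube power4_eq_xxxx mult.assoc)
  have "1 - exp (- t) = t * (1 - z)" using assms by (simp add: z_def)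
  moreover have z: "t / 2 - t\<^sup>2 / 6 \<le> z" "z \<le> t / 2 - t\<^sup>2 / 6 + t ^ 3 / 24"
  proof -
    have tz: "t * z = t - 1 + exp (- t)" using assms by (simp add: z_def field_simps)
    have "t * (t / 2 - t\<^sup>2 / 6) = t\<^sup>2 / 2 - t ^ 3 / 6" by (simp add: algebra_simps power2_eq_square power3_eq_cube)
    then have "t * (t / 2 - t\<^sup>2 / 6) \<le> t * z" using exp_minus_lower[of t] assms tz by linarith
    then show "t / 2 - t\<^sup>2 / 6 \<le> z" using assms by simp
    have "t * (t / 2 - t\<^sup>2 / 6 + t ^ 3 / 24) = t\<^sup>2 / 2 - t ^ 3 / 6 + t ^ 4 / 24"
      by (simp add: algebra_simps power2_eq_square power3_eq_cube power4_eq_xxxx)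
    then have "t * z \<le> t * (t / 2 - t\<^sup>2 / 6 + t ^ 3 / 24)" using exp_minus_upper_cubic[of t] assms tz by linarith
    then show "z \<le> t / 2 - t\<^sup>2 / 6 + t ^ 3 / 24" using assms by simp
  qed
  moreover have z01: "0 \<le> z" "z \<le> t / 2" "z \<le> 1 / 2" using z t3 assms by linarith+
  ultimately have eq: "ln (1 - exp (- t)) = ln t + ln (1 - z)" using assms by (simp add: ln_mult)
  have zz: "z\<^sup>2 \<le> t\<^sup>2 / 4" using power_mono[OF z01(2,1), of 2] by (simp add: power_divide)
  have zz': "t\<^sup>2 / 4 - t ^ 3 / 6 \<le> z\<^sup>2"
  proof -
    have "(t / 2 - t\<^sup>2 / 6)\<^sup>2 \<le> z\<^sup>2" using z(1) t3 assms by (intro power_mono) auto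
    moreover have "(t / 2 - t\<^sup>2 / 6)\<^sup>2 = t\<^sup>2 / 4 - t ^ 3 / 6 + t ^ 4 / 36"
      by (simp add: power2_diff power_divide) (simp add: power2_eq_square power3_eq_cube power4_eq_xxxx)
    moreover have "0 \<le> t ^ 4" by simp
    ultimately show ?thesis by linarith
  qed
  have z3: "z ^ 3 \<le> t ^ 3 / 8" using power_mono[OF z01(2,1), of 3] by (simp add: power_divide)
  have "ln (1 - z) \<le> - z - z\<^sup>2 / 2" "- z - z\<^sup>2 / 2 - z ^ 3 \<le> ln (1 - z)"
    using ln_one_minus_bounds[of z] z01 by auto
  then show ?thesis unfolding eq abs_le_iff using z zz zz' z3 t3 by linarith
qed

lemma abs_sum_le:
  fixes a1 :: real
  assumes "\<bar>a1\<bar> \<le> b1" "\<bar>a2\<bar> \<le> b2" "\<bar>a3\<bar> \<le> b3" "\<bar>a4\<bar> \<le> b4" "\<bar>a5\<bar> \<le> b5" "\<bar>a6\<bar> \<le> b6"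
    "\<bar>a7\<bar> \<le> b7" "\<bar>a8\<bar> \<le> b8" "\<bar>a9\<bar> \<le> b9" "\<bar>a10\<bar> \<le> b10" "\<bar>a11\<bar> \<le> b11" "\<bar>a12\<bar> \<le> b12"
  shows "\<bar>a1 - a2 + a3 + a4 + a5 - a6 + a7 + a8 - a9 + a10 + a11 + a12\<bar>
    \<le> b1 + b2 + b3 + b4 + b5 + b6 + b7 + b8 + b9 + b10 + b11 + b12"
  using assms unfolding abs_le_iff by linarith

text \<open>The logarithm of \<open>(n choose k) (1 - q\<^sup>m)\<^sup>m q\<^sup>k\<^sup>(\<^sup>n\<^sup>-\<^sup>k\<^sup>) \<cdot> e (m p)\<^sup>2 / 2\<close> for \<open>m = k - 1\<close>, \<open>q = 1 - p\<close>, \<open>p = (1 + \<mu>) / n\<close>.\<close>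

lemma ln_main_term:
  fixes n k :: nat and \<mu> :: real
  assumes k: "2 \<le> k" "10 * k \<le> n" and \<mu>: "\<bar>\<mu>\<bar> \<le> 1 / 10"
  defines "p \<equiv> (1 + \<mu>) / real n"
  defines "m \<equiv> k - 1"
  shows "\<bar>ln (real (n choose k)) + real m * ln (1 - (1 - p) ^ m) + real (k * (n - k)) * ln (1 - p) + 1
      + 2 * ln (real m * p) - ln 2
      - (ln (real k) / 2 - ln (real n) - ln (8 * pi) / 2 - real k * \<mu>\<^sup>2 / 2 + (real k)\<^sup>2 * \<mu> / (2 * real n) - real k ^ 3 / (8 * (real n)\<^sup>2))\<bar>
    \<le> 20 * (real k / real n + 1 / real k + real k ^ 4 / real n ^ 3 + \<bar>\<mu>\<bar> * real k ^ 3 / (real n)\<^sup>2 + \<bar>\<mu>\<bar> + real k * \<bar>\<mu>\<bar> ^ 3)"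
proof -
  define N K M where "N = real n" and "K = real k" and "M = real m"
  define z where "z = K / N"
  have NK: "0 < N" "2 \<le> K" "10 * K \<le> N" "M = K - 1" using k by (auto simp: N_def K_def M_def m_def)
  have z: "0 < z" "z \<le> 1 / 10" using NK by (auto simp: z_def divide_simps)
  have \<mu>': "- (1 / 10) \<le> \<mu>" "\<mu> \<le> 1 / 10" using \<mu> by auto
  have p: "0 < p" "p = (1 + \<mu>) / N" "K * p = (1 + \<mu>) * z"
    using \<mu>' NK z by (auto simp: p_def N_def z_def)
  moreover have "(1 + \<mu>) * z \<le> 11 / 10 * z" using \<mu>' z by (intro mult_right_mono) auto
  ultimately have p: "0 < p" "p = (1 + \<mu>) / N" "K * p = (1 + \<mu>) * z" "K * p \<le> 11 / 10 * z" by auto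
  have pK: "p \<le> K * p / 2" using p(1) NK(2) mult_right_mono[of 2 K p] by simp
  then have p_small: "p \<le> 1 / 2" "p \<le> z" using p z by linarith+
  define c where "c = M * p"
  have "K * p - p = c" unfolding c_def NK(4) by (simp add: algebra_simps)
  moreover have "0 < c" unfolding c_def using NK p(1) by (intro mult_pos_pos) auto
  ultimately have c: "0 < c" "c \<le> K * p" "K * p - p = c" using p(1) by auto
  have c2: "c \<le> 2 * z" "c \<le> 1" "K * p \<le> 2 * z" "K * p \<le> 1" using c(2) p(4) z by linarith+
  \<comment> \<open>Then (1 - p)^m = exp (- t) exactly. The quantity t exceeds c = M p by a factor
    of at most 1 + p, and c falls short of K p by p; the bounds \<open>e4\<close> to
    \<open>e12\<close> make these replacements one at a time.\<close>
  define t where "t = - (M * ln (1 - p))"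
  have lnq: "- p - p\<^sup>2 \<le> ln (1 - p)" "ln (1 - p) \<le> - p"
    using ln_one_minus_bounds[of p] p p_small by auto
  have t: "c \<le> t" "t \<le> c * (1 + p)" "t \<le> 2 * z"
  proof -
    have "M * ln (1 - p) \<le> M * - p" using lnq NK by (intro mult_left_mono) auto
    then show "c \<le> t" by (simp add: t_def c_def)
    have "M * (- p - p\<^sup>2) \<le> M * ln (1 - p)" using lnq NK by (intro mult_left_mono) auto
    then show 1: "t \<le> c * (1 + p)" by (simp add: t_def c_def algebra_simps power2_eq_square)
    have "c * p \<le> c * (1 / 2)" using c p_small by (intro mult_left_mono) auto
    moreover have "c * (1 + p) = c + c * p" by (simp add: algebra_simps)
    ultimately show "t \<le> 2 * z" using 1 c(2) p(4) z by linarith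
  qed
  have t0: "0 < t" "t \<le> 1 / 2" using t c z by linarith+
  have qm: "(1 - p) ^ m = exp (- t)"
  proof -
    have "exp (- t) = exp (ln (1 - p)) ^ m" by (simp add: t_def M_def exp_of_nat_mult[symmetric])
    then show ?thesis using p_small by simp
  qed
  define Er where "Er = z + 1 / K + K ^ 4 / N ^ 3 + \<bar>\<mu>\<bar> * K ^ 3 / N\<^sup>2 + \<bar>\<mu>\<bar> + K * \<bar>\<mu>\<bar> ^ 3"
  define S where "S = (\<Sum>i<k. ln (1 - real i / real n))"
  have e1: "\<bar>S + K\<^sup>2 / (2 * N) + K ^ 3 / (6 * N\<^sup>2)\<bar> \<le> K ^ 4 / N ^ 3 + z"
    using ln_falling_product[of k n] k by (simp add: S_def K_def N_def z_def)
  have e2: "\<bar>stirling_rem k - ln (2 * pi) / 2\<bar> \<le> 1 / (4 * K)"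
    using stirling_rem_bounds[of k] k by (simp add: K_def)
  have e3: "\<bar>K * (N - K) * ln (1 - p) + K * (N - K) * p\<bar> \<le> 2 * z"
  proof -
    have "K * (N - K) * (- p - p\<^sup>2) \<le> K * (N - K) * ln (1 - p)" "K * (N - K) * ln (1 - p) \<le> K * (N - K) * - p"
      using lnq NK by (intro mult_left_mono mult_nonneg_nonneg; simp)+
    moreover have "K * (N - K) * p\<^sup>2 \<le> K * N * p\<^sup>2" using NK by (intro mult_right_mono mult_left_mono) auto
    moreover have "K * N * p\<^sup>2 = (1 + \<mu>)\<^sup>2 * z" using NK by (simp add: p(2) z_def power2_eq_square)
    moreover have "(1 + \<mu>)\<^sup>2 \<le> (11 / 10)\<^sup>2" using \<mu>' by (intro power_mono) auto
    then have "(1 + \<mu>)\<^sup>2 * z \<le> 2 * z" using z by (intro mult_right_mono) (auto simp: power_divide)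
    ultimately show ?thesis by (simp add: abs_le_iff algebra_simps)
  qed
  have Kz: "K * z ^ 3 = K ^ 4 / N ^ 3" by (simp add: z_def power_divide power4_eq_xxxx power3_eq_cube)
  have e4: "\<bar>M * ln (1 - exp (- t)) - (M * ln t - M * t / 2 + M * t\<^sup>2 / 24)\<bar> \<le> 8 * (K ^ 4 / N ^ 3)"
  proof -
    have "\<bar>M * ln (1 - exp (- t)) - (M * ln t - M * t / 2 + M * t\<^sup>2 / 24)\<bar> = M * \<bar>ln (1 - exp (- t)) - (ln t - t / 2 + t\<^sup>2 / 24)\<bar>"
    proof -
      have "M * ln (1 - exp (- t)) - (M * ln t - M * t / 2 + M * t\<^sup>2 / 24) = M * (ln (1 - exp (- t)) - (ln t - t / 2 + t\<^sup>2 / 24))"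
        by (simp add: algebra_simps)
      then show ?thesis using NK by (simp add: abs_mult)
    qed
    also have "\<dots> \<le> K * (2 * z) ^ 3"
    proof (rule mult_mono)
      have "t ^ 3 \<le> (2 * z) ^ 3" using t t0 by (intro power_mono) auto
      then show "\<bar>ln (1 - exp (- t)) - (ln t - t / 2 + t\<^sup>2 / 24)\<bar> \<le> (2 * z) ^ 3"
        using ln_one_minus_exp[OF t0] by linarith
    qed (use NK in auto)
    also have "\<dots> = 8 * (K * z ^ 3)" by (simp add: power_mult_distrib)
    finally show ?thesis unfolding Kz .
  qed
  have e5: "\<bar>M * ln t - M * ln c\<bar> \<le> 2 * z"
  proof -
    have "ln c \<le> ln t" using t c by simp
    moreover have "ln t \<le> ln (c * (1 + p))" using t c t0 p by simp
    moreover have "ln (c * (1 + p)) = ln c + ln (1 + p)" using c p by (simp add: ln_mult)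
    moreover have "ln (1 + p) \<le> p" using p by (intro ln_add_one_self_le_self) auto
    ultimately have "M * ln c \<le> M * ln t" "M * ln t \<le> M * (ln c + p)"
      using NK by (auto intro!: mult_left_mono)
    moreover have "M * p \<le> 2 * z" using c2 by (simp only: c_def)
    ultimately show ?thesis by (simp add: abs_le_iff algebra_simps)
  qed
  have cp: "c * p * M \<le> 2 * z" "c * p \<le> z"
  proof -
    have "c * p * M = c * c" by (simp add: c_def)
    also have "c * c \<le> (2 * z) * 1" using c(1) c2 z by (intro mult_mono) auto
    finally show "c * p * M \<le> 2 * z" by simp
    have "c * p \<le> 1 * p" using c2 p(1) by (intro mult_right_mono) auto
    then show "c * p \<le> z" using p_small by linarith
  qed
  have e6: "\<bar>M * t / 2 - M * c / 2\<bar> \<le> z"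
  proof -
    have "M * c \<le> M * t" "M * t \<le> M * (c * (1 + p))" using t NK by (auto intro!: mult_left_mono)
    moreover have "M * (c * (1 + p)) = M * c + c * p * M" by (simp add: algebra_simps)
    ultimately show ?thesis using cp by (simp add: abs_le_iff)
  qed
  have e7: "\<bar>M * t\<^sup>2 / 24 - M * c\<^sup>2 / 24\<bar> \<le> z"
  proof -
    have "c\<^sup>2 \<le> t\<^sup>2" using t c by (intro power_mono) auto
    moreover have "t\<^sup>2 \<le> (c * (1 + p))\<^sup>2" using t t0 by (intro power_mono) auto
    moreover have "(c * (1 + p))\<^sup>2 \<le> c\<^sup>2 + 3 * (c * p)"
    proof -
      have "(c * (1 + p))\<^sup>2 = c\<^sup>2 + c * p * (c * (2 + p))" by (simp add: power2_eq_square algebra_simps)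
      moreover have "c * p * (c * (2 + p)) \<le> c * p * (1 * 3)"
        using c(1) c2 p(1) p_small by (intro mult_left_mono mult_mono) auto
      ultimately show ?thesis by simp
    qed
    ultimately have "M * c\<^sup>2 \<le> M * t\<^sup>2" "M * t\<^sup>2 \<le> M * (c\<^sup>2 + 3 * (c * p))"
      using NK by (auto intro!: mult_left_mono)
    then show ?thesis using cp by (simp add: abs_le_iff algebra_simps)
  qed
  have lnc: "ln c = ln (K * p) + ln (1 - 1 / K)"
  proof -
    have "(K * p) * (1 - 1 / K) = K * p - p" using NK by (simp add: right_diff_distrib)
    then have "c = (K * p) * (1 - 1 / K)" using c(3) by simp
    moreover have "0 < K * p" "0 < 1 - 1 / K" using NK p(1) by auto
    ultimately show ?thesis by (simp only: ln_mult_pos)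
  qed
  have lK: "- (1 / K) - (1 / K)\<^sup>2 \<le> ln (1 - 1 / K)" "ln (1 - 1 / K) \<le> - (1 / K)"
    using ln_one_minus_bounds[of "1 / K"] NK by (auto simp: divide_simps)
  have e8: "\<bar>M * ln c + 2 * ln c - ((K + 1) * ln (K * p) - 1)\<bar> \<le> 4 * (1 / K)"
  proof -
    have "M * ln c + 2 * ln c - ((K + 1) * ln (K * p) - 1) = (K + 1) * ln (1 - 1 / K) + 1"
      unfolding lnc NK(4) by (simp add: algebra_simps)
    moreover have "(K + 1) * (- (1 / K) - (1 / K)\<^sup>2) \<le> (K + 1) * ln (1 - 1 / K)"
      by (rule mult_left_mono[OF lK(1)]) (use NK in simp)
    moreover have "(K + 1) * ln (1 - 1 / K) \<le> (K + 1) * - (1 / K)"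
      by (rule mult_left_mono[OF lK(2)]) (use NK in simp)
    moreover have "(K + 1) * - (1 / K) = - 1 - 1 / K" using NK by (simp add: field_simps)
    moreover have "(K + 1) * (- (1 / K) - (1 / K)\<^sup>2) = - 1 - 2 * (1 / K) - (1 / K)\<^sup>2"
      using NK by (simp add: field_simps power2_eq_square)
    moreover have "(1 / K)\<^sup>2 \<le> 1 / K" using NK by (simp add: power2_eq_square divide_simps)
    moreover have "0 < 1 / K" using NK by simp
    ultimately show ?thesis unfolding abs_le_iff by linarith
  qed
  have e9: "\<bar>M * c / 2 - K\<^sup>2 * p / 2\<bar> \<le> 2 * z"
  proof -
    have "M * c / 2 - K\<^sup>2 * p / 2 = - (K * p) + p / 2" unfolding c_def NK(4) by (simp add: power2_eq_square algebra_simps diff_divide_distrib add_divide_distrib)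
    then show ?thesis unfolding abs_le_iff using p z pK by linarith
  qed
  have e10: "\<bar>M * c\<^sup>2 / 24 - K ^ 3 * p\<^sup>2 / 24\<bar> \<le> z"
  proof -
    have "K ^ 3 * p\<^sup>2 - M * c\<^sup>2 = p\<^sup>2 * (K ^ 3 - M ^ 3)" by (simp add: c_def power2_eq_square power3_eq_cube algebra_simps)
    also have "K ^ 3 - M ^ 3 = 3 * K\<^sup>2 - 3 * K + 1" unfolding NK(4) by (simp add: power2_eq_square power3_eq_cube algebra_simps)
    finally have eq: "K ^ 3 * p\<^sup>2 - M * c\<^sup>2 = p\<^sup>2 * (3 * K\<^sup>2 - 3 * K + 1)" .
    have "p\<^sup>2 * (3 * K\<^sup>2 - 3 * K + 1) \<le> p\<^sup>2 * (3 * K\<^sup>2)" using NK by (intro mult_left_mono) auto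
    also have "\<dots> = 3 * ((K * p) * (K * p))" by (simp add: power2_eq_square)
    also have "(K * p) * (K * p) \<le> (2 * z) * 1"
      by (rule mult_mono[OF c2(3,4)]) (use z(1) NK(2) p(1) in simp_all)
    finally have "p\<^sup>2 * (3 * K\<^sup>2 - 3 * K + 1) \<le> 6 * z" by simp
    moreover have "0 \<le> p\<^sup>2 * (3 * K\<^sup>2 - 3 * K + 1)"
      using NK mult_mono[of 2 K 1 K] by (intro mult_nonneg_nonneg) (auto simp: power2_eq_square)
    ultimately show ?thesis unfolding abs_le_iff using eq z by linarith
  qed
  have e11: "\<bar>(K + 1) * ln (1 + \<mu>) - K * \<mu> + K * \<mu>\<^sup>2 / 2\<bar> \<le> 2 * \<bar>\<mu>\<bar> + K * \<bar>\<mu>\<bar> ^ 3"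
  proof -
    have A: "\<bar>ln (1 + \<mu>) - \<mu> + \<mu>\<^sup>2 / 2\<bar> \<le> \<bar>\<mu>\<bar> ^ 3"
    proof (cases "0 \<le> \<mu>")
      case True
      define f :: "real \<Rightarrow> real" where "f = (\<lambda>x. x - x\<^sup>2 / 2 + x ^ 3 - ln (1 + x))"
      define g :: "real \<Rightarrow> real" where "g = (\<lambda>x. ln (1 + x) - x + x\<^sup>2 / 2)"
      have "f 0 \<le> f \<mu>"
      proof (rule DERIV_nonneg_imp_nondecreasing[OF True])
        fix y assume y: "0 \<le> y" "y \<le> \<mu>"
        have "(f has_real_derivative (1 - y + 3 * y\<^sup>2 - 1 / (1 + y))) (at y)"
          unfolding f_def using y by (auto intro!: derivative_eq_intros)
        moreover have "1 - y + 3 * y\<^sup>2 - 1 / (1 + y) = y\<^sup>2 * (2 + 3 * y) / (1 + y)"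
          using y by (simp add: field_simps power2_eq_square)
        moreover have "0 \<le> y\<^sup>2 * (2 + 3 * y) / (1 + y)" using y by simp
        ultimately show "\<exists>d. (f has_real_derivative d) (at y) \<and> 0 \<le> d" by metis
      qed
      moreover have "g 0 \<le> g \<mu>"
      proof (rule DERIV_nonneg_imp_nondecreasing[OF True])
        fix y assume y: "0 \<le> y" "y \<le> \<mu>"
        have "(g has_real_derivative (1 / (1 + y) - 1 + y)) (at y)"
          unfolding g_def using y by (auto intro!: derivative_eq_intros)
        moreover have "1 / (1 + y) - 1 + y = y\<^sup>2 / (1 + y)"
          using y by (simp add: field_simps power2_eq_square)
        moreover have "0 \<le> y\<^sup>2 / (1 + y)" using y by simp
        ultimately show "\<exists>d. (g has_real_derivative d) (at y) \<and> 0 \<le> d" by metis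
      qed
      ultimately show ?thesis using True by (simp add: f_def g_def abs_le_iff)
    next
      case False
      then show ?thesis using ln_one_minus_bounds(1,2)[of "- \<mu>"] \<mu>' by (simp add: abs_le_iff)
    qed
    have "K * \<bar>ln (1 + \<mu>) - \<mu> + \<mu>\<^sup>2 / 2\<bar> \<le> K * \<bar>\<mu>\<bar> ^ 3" using A NK by (intro mult_left_mono) auto
    then have "\<bar>K * ln (1 + \<mu>) - K * \<mu> + K * \<mu>\<^sup>2 / 2\<bar> \<le> K * \<bar>\<mu>\<bar> ^ 3"
    proof -
      have "K * ln (1 + \<mu>) - K * \<mu> + K * \<mu>\<^sup>2 / 2 = K * (ln (1 + \<mu>) - \<mu> + \<mu>\<^sup>2 / 2)" by (simp add: algebra_simps)
      then show ?thesis using NK \<open>K * \<bar>ln (1 + \<mu>) - \<mu> + \<mu>\<^sup>2 / 2\<bar> \<le> K * \<bar>\<mu>\<bar> ^ 3\<close> by (simp add: abs_mult)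
    qed
    moreover have "\<bar>ln (1 + \<mu>)\<bar> \<le> 2 * \<bar>\<mu>\<bar>" using abs_ln_one_plus_x_minus_x_bound[of \<mu>] \<mu>
    proof -
      have "\<bar>\<mu>\<bar>\<^sup>2 \<le> \<bar>\<mu>\<bar> * 1" unfolding power2_eq_square using \<mu> by (intro mult_left_mono) auto
      then have "\<mu>\<^sup>2 \<le> \<bar>\<mu>\<bar>" by simp
      moreover have "\<bar>\<mu>\<bar> ^ 3 \<le> \<bar>\<mu>\<bar> * 1 * (1 / 10)" unfolding power3_eq_cube using \<mu> by (intro mult_mono) auto
      ultimately show ?thesis using A abs_ge_self[of \<mu>] abs_ge_minus_self[of \<mu>] zero_le_power2[of \<mu>]
        unfolding abs_le_iff by linarith
    qed
    ultimately show ?thesis unfolding distrib_right abs_le_iff by linarith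
  qed
  have e12: "\<bar>K ^ 3 * p\<^sup>2 / 24 - K ^ 3 / (24 * N\<^sup>2)\<bar> \<le> \<bar>\<mu>\<bar> * K ^ 3 / N\<^sup>2"
  proof -
    have "K ^ 3 * p\<^sup>2 / 24 - K ^ 3 / (24 * N\<^sup>2) = K ^ 3 / N\<^sup>2 * (\<mu> * (2 + \<mu>) / 24)"
      unfolding p(2) power_divide using NK by (simp add: field_simps power2_eq_square)
    then have "\<bar>K ^ 3 * p\<^sup>2 / 24 - K ^ 3 / (24 * N\<^sup>2)\<bar> = K ^ 3 / N\<^sup>2 * (\<bar>\<mu>\<bar> * (\<bar>2 + \<mu>\<bar> / 24))"
      using NK by (simp add: abs_mult)
    also have "\<dots> \<le> K ^ 3 / N\<^sup>2 * (\<bar>\<mu>\<bar> * 1)"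
      using NK \<mu>' by (intro mult_left_mono) auto
    finally show ?thesis by (simp add: mult_ac)
  qed
  have lnKp: "ln (K * p) = ln K + ln (1 + \<mu>) - ln N"
    using NK p(2) \<mu>' by (simp add: ln_mult ln_div)
  have ln8: "ln (8 * pi) = ln (2 * pi) + 2 * ln 2"
    using ln_mult_pos[of "2 * pi" 4] ln_mult_pos[of 2 "2 :: real"] by simp
  have binom: "ln (real (n choose k)) = S + K * ln N - (K * ln K - K + ln K / 2 + stirling_rem k)"
    using ln_binomial[of k n] ln_fact_stirling[of k] k by (simp add: S_def K_def N_def)
  have kn: "real (k * (n - k)) = K * (N - K)" using k by (simp add: K_def N_def of_nat_diff)
  have Np: "N * p = 1 + \<mu>" using p(2) NK by simp
  have "K * (N - K) * p = K * (N * p) - K\<^sup>2 * p" by (simp add: algebra_simps power2_eq_square)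
  then have x1: "K * (N - K) * p = K * (1 + \<mu>) - K\<^sup>2 * p" unfolding Np .
  have x2: "K\<^sup>2 * p / 2 = K\<^sup>2 / (2 * N) + K\<^sup>2 * \<mu> / (2 * N)" unfolding p(2) by (simp add: distrib_left add_divide_distrib)
  have x3: "K ^ 3 / (24 * N\<^sup>2) = K ^ 3 / N\<^sup>2 / 24" "K ^ 3 / (6 * N\<^sup>2) = K ^ 3 / N\<^sup>2 / 6" "K ^ 3 / (8 * N\<^sup>2) = K ^ 3 / N\<^sup>2 / 8"
    by simp_all
  \<comment> \<open>The main terms combine as follows. The falling product, the factor (1 - p)^(k (n
    - k)) and M t / 2 contribute - K^2 / (2 N) + K^2 p - K^2 p / 2 = K^2 \<mu> / (2 N); the cubic
    coefficient is - 1/6 + 1/24 = - 1/8, the 1/24 coming from t^2 / 24.\<close>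
  have total: "ln (real (n choose k)) + M * ln (1 - exp (- t)) + K * (N - K) * ln (1 - p) + 1 + 2 * ln c - ln 2
      - (ln K / 2 - ln N - ln (8 * pi) / 2 - K * \<mu>\<^sup>2 / 2 + K\<^sup>2 * \<mu> / (2 * N) - K ^ 3 / (8 * N\<^sup>2))
    = (S + K\<^sup>2 / (2 * N) + K ^ 3 / (6 * N\<^sup>2)) - (stirling_rem k - ln (2 * pi) / 2)
      + (K * (N - K) * ln (1 - p) + K * (N - K) * p)
      + (M * ln (1 - exp (- t)) - (M * ln t - M * t / 2 + M * t\<^sup>2 / 24)) + (M * ln t - M * ln c)
      - (M * t / 2 - M * c / 2) + (M * t\<^sup>2 / 24 - M * c\<^sup>2 / 24)
      + (M * ln c + 2 * ln c - ((K + 1) * ln (K * p) - 1)) - (M * c / 2 - K\<^sup>2 * p / 2)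
      + (M * c\<^sup>2 / 24 - K ^ 3 * p\<^sup>2 / 24) + ((K + 1) * ln (1 + \<mu>) - K * \<mu> + K * \<mu>\<^sup>2 / 2)
      + (K ^ 3 * p\<^sup>2 / 24 - K ^ 3 / (24 * N\<^sup>2))"
    unfolding binom lnKp ln8 x1 x3 using x2 by (simp add: algebra_simps add_divide_distrib)
  have pos: "0 < z" "0 < 1 / K" "0 \<le> K ^ 4 / N ^ 3" "0 \<le> \<bar>\<mu>\<bar> * K ^ 3 / N\<^sup>2" "0 \<le> \<bar>\<mu>\<bar>" "0 \<le> K * \<bar>\<mu>\<bar> ^ 3"
    using z NK by auto
  have quarter: "1 / (4 * K) = 1 / K / 4" by simp
  have "\<bar>ln (real (n choose k)) + M * ln (1 - exp (- t)) + K * (N - K) * ln (1 - p) + 1 + 2 * ln c - ln 2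
      - (ln K / 2 - ln N - ln (8 * pi) / 2 - K * \<mu>\<^sup>2 / 2 + K\<^sup>2 * \<mu> / (2 * N) - K ^ 3 / (8 * N\<^sup>2))\<bar> \<le> 20 * Er"
  proof -
    have "20 * Er = 20 * z + 20 * (1 / K) + 20 * (K ^ 4 / N ^ 3) + 20 * (\<bar>\<mu>\<bar> * K ^ 3 / N\<^sup>2) + 20 * \<bar>\<mu>\<bar> + 20 * (K * \<bar>\<mu>\<bar> ^ 3)"
      unfolding Er_def distrib_left ..
    moreover have gen: "c + a + b / 4 + 2 * a + 8 * c + 2 * a + a + a + 4 * b + 2 * a + a + (2 * e + f) + d
        \<le> 20 * a + 20 * b + 20 * c + 20 * d + 20 * e + 20 * f"
      if "0 < a" "0 < b" "0 \<le> c" "0 \<le> d" "0 \<le> e" "0 \<le> f" for a b c d e f :: real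
      using that by linarith
    ultimately have "K ^ 4 / N ^ 3 + z + 1 / K / 4 + 2 * z + 8 * (K ^ 4 / N ^ 3) + 2 * z + z + z + 4 * (1 / K) + 2 * z + z
      + (2 * \<bar>\<mu>\<bar> + K * \<bar>\<mu>\<bar> ^ 3) + \<bar>\<mu>\<bar> * K ^ 3 / N\<^sup>2 \<le> 20 * Er"
      using gen[OF pos] by (simp only:)
    then show ?thesis unfolding total
      using abs_sum_le[OF e1 e2[unfolded quarter] e3 e4 e5 e6 e7 e8 e9 e10 e11 e12] by (rule order.trans[rotated])
  qed
  then show ?thesis
    unfolding qm kn by (simp add: Er_def K_def N_def M_def z_def c_def)
qed

section \<open>Passage to the critical scaling\<close>

lemma powr_twelfth:
  assumes "0 < n"
  defines "y \<equiv> real n powr (1/12)"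
  shows "0 < y" "real n = y ^ 12" "real n powr (2/3) = y ^ 8" "real n powr (3/4) = y ^ 9"
    "real n powr (-4/3) = 1 / y ^ 16" "real n powr (1/4) = y ^ 3"
proof -
  have n: "0 < real n" using assms by simp
  show y: "0 < y" using n by (simp add: y_def)
  have e: "y ^ j = real n powr (real j / 12)" for j
    using n by (simp add: y_def powr_realpow[symmetric] powr_powr)
  show "real n = y ^ 12" "real n powr (2/3) = y ^ 8" "real n powr (3/4) = y ^ 9" "real n powr (1/4) = y ^ 3"
    using n by (simp_all add: e)
  have "real n powr (-4/3) = 1 / real n powr (real 16 / 12)" using n by (simp add: powr_minus_divide[symmetric])
  then show "real n powr (-4/3) = 1 / y ^ 16" unfolding e .
qed

text \<open>Each of the five terms of \<open>E1\<close> is at most 1. Since n^(-1/10) = y^(-6/5)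
  \<ge> y^(-2), errors such as k / n \<le> y^(-3) are absorbed as well.\<close>

lemma E1_facts:
  assumes "0 < n" "0 < k"
  defines "y \<equiv> real n powr (1/12)"
  assumes y: "1 \<le> y" and lam: "\<bar>lam\<bar> \<le> y" and k: "y ^ 8 \<le> real k" "real k \<le> y ^ 9"
  shows "real k ^ 4 / real n ^ 3 \<le> E1 k n lam" "\<bar>lam\<bar> / y \<le> E1 k n lam" "\<bar>lam\<bar> ^ 3 * real k / real n \<le> E1 k n lam"
    "y ^ 8 / real k \<le> E1 k n lam" "1 / y ^ 2 \<le> E1 k n lam" "0 < E1 k n lam" "E1 k n lam \<le> 5"
    "real k ^ 4 / real n ^ 3 + \<bar>lam\<bar> / y + \<bar>lam\<bar> ^ 3 * real k / real n + y ^ 8 / real k \<le> E1 k n lam"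
proof -
  note pw = powr_twelfth[OF assms(1), folded y_def]
  have yp: "0 < y" by (rule pw(1))
  have E1: "E1 k n lam = real k ^ 4 / real n ^ 3 + \<bar>lam\<bar> / y + \<bar>lam\<bar> ^ 3 * real k / real n + y ^ 8 / real k + 1 / real n powr (1/10)"
    by (simp add: E1_def pw(3) y_def)
  have p10: "real n powr (1/10) = y powr (6/5)"
    using assms(1) by (simp add: y_def powr_powr)
  have p1: "y powr (6/5) \<le> y ^ 2" using y yp powr_mono[of "6/5" 2 y] by (simp add: powr_numeral)
  have p2: "1 \<le> y powr (6/5)" using y by (simp add: ge_one_powr_ge_zero)
  have last: "1 / y ^ 2 \<le> 1 / real n powr (1/10)" "1 / real n powr (1/10) \<le> 1" "0 < 1 / real n powr (1/10)"
    unfolding p10 using p1 p2 yp by (auto intro!: divide_left_mono)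
  have nonneg: "0 \<le> real k ^ 4 / real n ^ 3" "0 \<le> \<bar>lam\<bar> / y" "0 \<le> \<bar>lam\<bar> ^ 3 * real k / real n" "0 \<le> y ^ 8 / real k"
    using yp by auto
  show "real k ^ 4 / real n ^ 3 \<le> E1 k n lam" "\<bar>lam\<bar> / y \<le> E1 k n lam" "\<bar>lam\<bar> ^ 3 * real k / real n \<le> E1 k n lam"
    "y ^ 8 / real k \<le> E1 k n lam" "1 / y ^ 2 \<le> E1 k n lam" "0 < E1 k n lam"
    "real k ^ 4 / real n ^ 3 + \<bar>lam\<bar> / y + \<bar>lam\<bar> ^ 3 * real k / real n + y ^ 8 / real k \<le> E1 k n lam"
    unfolding E1 using nonneg last by linarith+
  have "real k ^ 4 \<le> (y ^ 9) ^ 4" using k by (intro power_mono) auto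
  then have "real k ^ 4 / real n ^ 3 \<le> 1" using yp by (simp add: pw(2) power_mult[symmetric] divide_le_eq)
  moreover have "\<bar>lam\<bar> / y \<le> 1" using lam yp by (simp add: divide_le_eq)
  moreover have "\<bar>lam\<bar> ^ 3 * real k / real n \<le> 1"
  proof -
    have "\<bar>lam\<bar> ^ 3 * real k \<le> y ^ 3 * y ^ 9" using lam k by (intro mult_mono power_mono) auto
    also have "\<dots> = real n" by (simp add: pw(2) power_add[symmetric])
    finally show ?thesis using assms(1) by (simp add: divide_le_eq)
  qed
  moreover have "y ^ 8 / real k \<le> 1" using k assms(2) by (simp add: divide_le_eq)
  ultimately show "E1 k n lam \<le> 5" unfolding E1 using last by linarith
qed

definition mainA :: "nat \<Rightarrow> real \<Rightarrow> nat \<Rightarrow> real" where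
  "mainA n lam k = sqrt (real k) / (sqrt (8 * pi) * real n) * exp (- G_lam lam (real k / real n powr (2/3)))"

text \<open>The logarithmic error is at most 80 E1, hence at most 400 because E1 \<le> 5;
  exponentiating it costs the factor exp 400.\<close>

definition K1 :: real where "K1 = 80 * exp 400"
definition K2 :: real where "K2 = 40000000000 * (1 + 5 * K1) + K1"

lemma K_pos: "0 < K1" "0 < K2"
  by (auto simp: K1_def K2_def intro!: add_pos_pos)

lemma abs_exp_minus_one: "\<bar>x\<bar> \<le> M \<Longrightarrow> \<bar>exp x - 1\<bar> \<le> \<bar>x\<bar> * exp M" for x :: real
proof -
  assume x: "\<bar>x\<bar> \<le> M"
  have "1 - x \<le> exp (- x)" using exp_ge_add_one_self[of "- x"] by simp
  then have "exp x * (1 - x) \<le> exp x * exp (- x)" by (intro mult_left_mono) auto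
  then have 1: "exp x - 1 \<le> x * exp x" by (simp add: exp_minus algebra_simps)
  have 2: "x \<le> exp x - 1" using exp_ge_add_one_self[of x] by linarith
  have "\<bar>exp x - 1\<bar> \<le> \<bar>x\<bar> * max 1 (exp x)"
  proof (cases "0 \<le> x")
    case True
    then show ?thesis using 1 2 by (simp add: max_def abs_if)
  next
    case False
    then show ?thesis using 2 by (simp add: max_def abs_if)
  qed
  also have "\<dots> \<le> \<bar>x\<bar> * exp M" using x by (intro mult_left_mono) (auto simp: max_def)
  finally show ?thesis .
qed

lemma expected_comps_asymptotics:
  assumes n: "0 < n"
  defines "y \<equiv> real n powr (1/12)"
  assumes y: "10 \<le> y" and lam: "\<bar>lam\<bar> \<le> y" and k: "y ^ 8 \<le> real k" "real k \<le> y ^ 9"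
  shows "\<bar>expected_comps (p_crit n lam) n k - mainA n lam k\<bar> \<le> K2 * E1 k n lam * mainA n lam k"
proof -
  note pw = powr_twelfth[OF n, folded y_def]
  have y1: "1 \<le> y" using y by simp
  have y8: "100000000 \<le> y ^ 8" using power_mono[of 10 y 8] y by simp
  have y3: "1000 \<le> y ^ 3" using power_mono[of 10 y 3] y by simp
  have kp: "0 < k" "2 \<le> k" "100 \<le> real k" using k y8 by auto
  note E = E1_facts[OF n kp(1), folded y_def, OF y1 lam k]
  \<comment> \<open>Here y^4 = n^(1/3), so that n p = 1 + \<mu>.\<close>
  define \<mu> where "\<mu> = lam / y ^ 4"
  define p where "p = p_crit n lam"
  define m where "m = k - 1"
  have N: "0 < real n" using n by simp
  have p_eq: "p = (1 + \<mu>) / real n"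
    unfolding p_def p_crit_def pw(5) \<mu>_def using pw(1) by (simp add: pw(2) field_simps flip: power_add)
  have y4: "y ^ 4 = y * y ^ 3" by (simp add: power4_eq_xxxx power3_eq_cube)
  have \<mu>: "\<bar>\<mu>\<bar> \<le> 1 / y ^ 3" "\<bar>\<mu>\<bar> \<le> \<bar>lam\<bar> / y" "\<bar>\<mu>\<bar> \<le> 1 / 1000"
  proof -
    have "\<bar>\<mu>\<bar> = \<bar>lam\<bar> / (y * y ^ 3)" using pw(1) by (simp add: \<mu>_def y4 abs_mult)
    also have "\<dots> \<le> y / (y * y ^ 3)" using lam pw(1) by (intro divide_right_mono) auto
    also have "\<dots> = 1 / y ^ 3" using pw(1) by simp
    finally show 1: "\<bar>\<mu>\<bar> \<le> 1 / y ^ 3" .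
    also have "\<dots> \<le> 1 / 1000" using y3 pw(1) by (intro divide_left_mono) auto
    finally show "\<bar>\<mu>\<bar> \<le> 1 / 1000" .
    have "\<bar>lam\<bar> / (y * y ^ 3) \<le> \<bar>lam\<bar> / (y * 1)"
      using y3 pw(1) by (intro divide_left_mono mult_left_mono) auto
    then show "\<bar>\<mu>\<bar> \<le> \<bar>lam\<bar> / y" using pw(1) by (simp add: \<mu>_def y4 abs_mult)
  qed
  have \<mu>': "999 / 1000 \<le> 1 + \<mu>" "1 + \<mu> \<le> 1001 / 1000" using \<mu>(3) by (auto simp: abs_le_iff)
  have kn: "real k / real n \<le> 1 / y ^ 3"
  proof -
    have "real k / real n \<le> y ^ 9 / real n" using k N by (intro divide_right_mono) auto
    also have "\<dots> = 1 / y ^ 3" using pw(1) by (simp add: pw(2) field_simps flip: power_add)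
    finally show ?thesis .
  qed
  have kn': "real k / real n \<le> 1 / 1000"
  proof -
    have "1 / y ^ 3 \<le> 1 / 1000" using y3 pw(1) by (intro divide_left_mono) auto
    then show ?thesis using kn by linarith
  qed
  have k10: "10 * k \<le> n"
  proof -
    have "real k \<le> real n / 1000" using kn' N by (simp add: divide_le_eq)
    then show ?thesis by linarith
  qed
  have m: "real m = real k - 1" "0 < real m" "99 / 100 * real k \<le> real m" "real m \<le> real k"
    using kp by (auto simp: m_def of_nat_diff)
  have p0: "0 < p" "p \<le> 1 / 2"
  proof -
    show "0 < p" unfolding p_eq using \<mu>' N by simp
    have "p \<le> (1001 / 1000) / real n" unfolding p_eq using \<mu>' N by (intro divide_right_mono) auto
    also have "\<dots> \<le> (1001 / 1000) / 1000" using k10 kp by (intro divide_left_mono) auto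
    finally show "p \<le> 1 / 2" by simp
  qed
  have mp: "real m * p = real m / real n * (1 + \<mu>)" by (simp add: p_eq)
  have mp_le: "real m * p \<le> 2 * (real k / real n)"
  proof -
    have "real m / real n * (1 + \<mu>) \<le> real k / real n * 2"
      using m \<mu>' N by (intro mult_mono divide_right_mono) auto
    then show ?thesis unfolding mp by (simp add: mult.commute)
  qed
  have mp_ge: "9 / 10 * (real k / real n) \<le> real m * p"
  proof -
    have "9 / 10 * (real k / real n) \<le> 98901 / 100000 * (real k / real n)" by (intro mult_right_mono) auto
    also have "\<dots> = (99 / 100 * real k) / real n * (999 / 1000)" by simp
    also have "\<dots> \<le> real m / real n * (1 + \<mu>)"
      using m \<mu>' N by (intro mult_mono divide_right_mono) auto
    finally show ?thesis unfolding mp .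
  qed
  have sq: "9 / 10 * y ^ 4 \<le> sqrt (real m)"
  proof (rule real_le_rsqrt)
    have "(9 / 10 * y ^ 4)\<^sup>2 = 81 / 100 * y ^ 8"
      unfolding power_mult_distrib power_mult[symmetric] by (simp add: power_divide)
    also have "\<dots> \<le> real m" using k m by linarith
    finally show "(9 / 10 * y ^ 4)\<^sup>2 \<le> real m" .
  qed
  have s_ge: "81 / 100 * (real k / y ^ 8) \<le> real m * p * sqrt (real m)"
  proof -
    have "9 / 10 * (real k / real n) * (9 / 10 * y ^ 4) \<le> real m * p * sqrt (real m)"
      by (rule mult_mono[OF mp_ge sq]) (use pw(1) m(2) p0 in simp_all)
    moreover have "9 / 10 * (real k / real n) * (9 / 10 * y ^ 4) = 81 / 100 * (real k / y ^ 8)"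
      using pw(1) by (simp add: pw(2) field_simps flip: power_add)
    ultimately show ?thesis by simp
  qed
  have a1: "1 \<le> real k / y ^ 8" using k pw(1) by simp
  have s_le: "1 / (real m * p * sqrt (real m)) \<le> 2 * (y ^ 8 / real k)"
  proof -
    have "1 / (real m * p * sqrt (real m)) \<le> 1 / (81 / 100 * (real k / y ^ 8))"
      using s_ge a1 kp pw(1) m p0 by (intro divide_left_mono mult_pos_pos) auto
    also have "\<dots> = 100 / 81 * (y ^ 8 / real k)" by simp
    also have "\<dots> \<le> 2 * (y ^ 8 / real k)" using pw(1) by (intro mult_right_mono) auto
    finally show ?thesis .
  qed
  have kn_E: "real k / real n \<le> E1 k n lam"
  proof -
    have "1 / y ^ 3 \<le> 1 / y ^ 2" using y1 pw(1) by (intro divide_left_mono power_increasing) auto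
    then show ?thesis using kn E(5) by linarith
  qed
  define q where "q = 1 - p"
  have q: "0 < q" "q < 1" using p0 by (auto simp: q_def)
  define \<Phi> where "\<Phi> = (1 - q ^ m) ^ m * (exp 1 * (real m * p)\<^sup>2 / 2)"
  have qm: "0 < 1 - q ^ m" using q m by (simp add: power_less_one_iff)
  have \<Phi>: "0 < \<Phi>" unfolding \<Phi>_def using qm m p0 by simp
  have conn: "\<bar>conn p k - \<Phi>\<bar> \<le> 40000000000 * E1 k n lam * \<Phi>"
  proof -
    have "\<bar>conn p (Suc m) - \<Phi>\<bar> \<le> 10000000000 * (1 / (real m * p * sqrt (real m)) + real m * p) * \<Phi>"
      unfolding \<Phi>_def q_def
    proof (rule conn_asymptotics)
      show "real m * p \<le> 1 / 100" using mp_le kn' by linarith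
      show "1 / 2 \<le> real m * p * sqrt (real m)" using s_ge a1 by linarith
    qed (rule p0)
    also have "\<dots> \<le> 10000000000 * (4 * E1 k n lam) * \<Phi>"
      using s_le mp_le kn_E E(4) \<Phi> by (intro mult_right_mono mult_left_mono) auto
    finally show ?thesis using kp by (simp add: m_def)
  qed
  define W where "W = real (n choose k) * q ^ (k * (n - k))"
  define F where "F = \<Phi> * W"
  have bin: "0 < real (n choose k)" using k10 by (simp add: zero_less_binomial_iff)
  have W: "0 < W" unfolding W_def using bin q by simp
  have F: "0 < F" unfolding F_def using \<Phi> W by simp
  have EF: "\<bar>expected_comps p n k - F\<bar> \<le> 40000000000 * E1 k n lam * F"
  proof -
    have "expected_comps p n k - F = (conn p k - \<Phi>) * W"
      by (simp add: expected_comps_def F_def W_def q_def algebra_simps)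
    then have "\<bar>expected_comps p n k - F\<bar> = \<bar>conn p k - \<Phi>\<bar> * W" using W by (simp add: abs_mult)
    also have "\<dots> \<le> 40000000000 * E1 k n lam * \<Phi> * W" using conn W by (intro mult_right_mono) auto
    finally show ?thesis by (simp add: F_def mult.assoc)
  qed
  define A where "A = mainA n lam k"
  have A: "0 < A" unfolding A_def mainA_def using kp N by simp
  have lnF: "ln F = ln (real (n choose k)) + real m * ln (1 - q ^ m) + real (k * (n - k)) * ln q + 1
      + 2 * ln (real m * p) - ln 2"
  proof -
    have mpp: "0 < real m * p" using m p0 by simp
    have mp2: "0 < (real m * p)\<^sup>2" using mpp by (rule zero_less_power)
    have e1: "ln \<Phi> = real m * ln (1 - q ^ m) + (1 + 2 * ln (real m * p) - ln 2)"
    proof -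
      have "ln (exp 1 * (real m * p)\<^sup>2 / 2) = ln (exp 1 * (real m * p)\<^sup>2) - ln 2"
        using mp2 by (intro ln_divide_pos mult_pos_pos) auto
      also have "ln (exp 1 * (real m * p)\<^sup>2) = ln (exp 1) + ln ((real m * p)\<^sup>2)"
        using mp2 by (intro ln_mult_pos) auto
      also have "\<dots> = 1 + 2 * ln (real m * p)"
        using ln_realpow[of "real m * p" 2] by (simp del: ln_mult)
      finally have "ln (exp 1 * (real m * p)\<^sup>2 / 2) = 1 + 2 * ln (real m * p) - ln 2" .
      moreover have "ln \<Phi> = ln ((1 - q ^ m) ^ m) + ln (exp 1 * (real m * p)\<^sup>2 / 2)"
        unfolding \<Phi>_def by (rule ln_mult_pos) (use qm mp2 in \<open>simp_all del: power_mult_distrib\<close>)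
      ultimately show ?thesis using qm by (simp add: ln_realpow)
    qed
    have "ln W = ln (real (n choose k)) + real (k * (n - k)) * ln q"
      unfolding W_def using bin q by (subst ln_mult_pos) (auto simp: ln_realpow)
    moreover have "ln F = ln \<Phi> + ln W" unfolding F_def using \<Phi> W by (rule ln_mult_pos)
    ultimately show ?thesis using e1 by simp
  qed
  have lnA: "ln A = ln (real k) / 2 - ln (real n) - ln (8 * pi) / 2 - real k * \<mu>\<^sup>2 / 2
      + (real k)\<^sup>2 * \<mu> / (2 * real n) - real k ^ 3 / (8 * (real n)\<^sup>2)"
  proof -
    have "ln A = ln (sqrt (real k) / (sqrt (8 * pi) * real n)) + - G_lam lam (real k / y ^ 8)"
      unfolding A_def mainA_def pw(3) using kp N by (subst ln_mult_pos) auto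
    also have "ln (sqrt (real k) / (sqrt (8 * pi) * real n)) = ln (real k) / 2 - (ln (8 * pi) / 2 + ln (real n))"
      using kp N by (subst ln_divide_pos, simp, simp, subst ln_mult_pos, simp, simp) (simp add: ln_sqrt)
    \<comment> \<open>With a = k / y^8: k \<mu>^2 / 2 = \<lambda>^2 a / 2, k^2 \<mu> / (2 n) =
      \<lambda> a^2 / 2 and k^3 / (8 n^2) = a^3 / 8, the three terms of
      \<open>G_lam\<close>.\<close>
    also have "- G_lam lam (real k / y ^ 8) = - (real k * \<mu>\<^sup>2 / 2)
      + (real k)\<^sup>2 * \<mu> / (2 * real n) - real k ^ 3 / (8 * (real n)\<^sup>2)"
      unfolding G_lam_def \<mu>_def pw(2) using pw(1)
      by (simp add: power_divide field_simps flip: power_add power_mult)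
    finally show ?thesis by simp
  qed
  define \<Delta> where "\<Delta> = ln F - ln A"
  have \<Delta>: "\<bar>\<Delta>\<bar> \<le> 80 * E1 k n lam"
  proof -
    have "\<bar>\<Delta>\<bar> \<le> 20 * (real k / real n + 1 / real k + real k ^ 4 / real n ^ 3 + \<bar>\<mu>\<bar> * real k ^ 3 / (real n)\<^sup>2 + \<bar>\<mu>\<bar> + real k * \<bar>\<mu>\<bar> ^ 3)"
      unfolding \<Delta>_def lnF lnA q_def m_def p_eq
      by (rule ln_main_term[OF kp(2) k10]) (use \<mu>(3) in auto)
    moreover have "1 / real k \<le> y ^ 8 / real k" using y8 by (intro divide_right_mono) auto
    moreover have "\<bar>\<mu>\<bar> * real k ^ 3 / (real n)\<^sup>2 \<le> \<bar>lam\<bar> / y"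
    proof -
      have "\<bar>\<mu>\<bar> * real k ^ 3 / (real n)\<^sup>2 \<le> \<bar>\<mu>\<bar> * (y ^ 9) ^ 3 / (real n)\<^sup>2"
        using k N by (intro divide_right_mono mult_left_mono power_mono) auto
      also have "\<dots> = \<bar>lam\<bar> / y" unfolding \<mu>_def pw(2) using pw(1)
        by (simp add: abs_mult field_simps flip: power_add power_mult power_Suc power_Suc2)
      finally show ?thesis .
    qed
    moreover have "real k * \<bar>\<mu>\<bar> ^ 3 = \<bar>lam\<bar> ^ 3 * real k / real n"
      unfolding \<mu>_def pw(2) using pw(1) by (simp add: power_divide flip: power_mult)
    moreover have gen: "x \<le> 80 * e" if "x \<le> 20 * (a + b + c + d + f + g)" "b \<le> b'" "d \<le> d'" "g = g'" "f \<le> d'"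
      "a \<le> e" "d' \<le> e" "c + d' + g' + b' \<le> e" "0 < e" for x a b c d f g b' d' g' e :: real
      using that unfolding distrib_left by linarith
    ultimately show ?thesis using gen \<mu>(2) kn_E E(2) E(8) E(6) by blast
  qed
  have F_eq: "F = A * exp \<Delta>" using F A by (simp add: \<Delta>_def exp_diff)
  have FA: "\<bar>F - A\<bar> \<le> K1 * E1 k n lam * A"
  proof -
    have "\<bar>exp \<Delta> - 1\<bar> \<le> \<bar>\<Delta>\<bar> * exp 400" using \<Delta> E(7) by (intro abs_exp_minus_one) linarith
    also have "\<dots> \<le> 80 * E1 k n lam * exp 400" using \<Delta> by (intro mult_right_mono) auto
    finally have "\<bar>exp \<Delta> - 1\<bar> \<le> K1 * E1 k n lam" by (simp add: K1_def mult_ac)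
    moreover have "\<bar>F - A\<bar> = A * \<bar>exp \<Delta> - 1\<bar>"
    proof -
      have "F - A = A * (exp \<Delta> - 1)" by (simp add: F_eq algebra_simps)
      then show ?thesis using A by (simp add: abs_mult)
    qed
    ultimately show ?thesis using A by (simp add: mult.commute)
  qed
  have "F \<le> (1 + 5 * K1) * A"
  proof -
    have "K1 * E1 k n lam * A \<le> K1 * 5 * A" using K_pos E(7) A by (intro mult_right_mono mult_left_mono) auto
    then show ?thesis using FA by (simp add: abs_le_iff algebra_simps)
  qed
  then have "40000000000 * E1 k n lam * F \<le> 40000000000 * E1 k n lam * ((1 + 5 * K1) * A)"
    using E(6) by (intro mult_left_mono) auto
  then have "\<bar>expected_comps p n k - A\<bar> \<le> 40000000000 * E1 k n lam * ((1 + 5 * K1) * A) + K1 * E1 k n lam * A"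
    using EF FA by linarith
  also have "\<dots> = K2 * E1 k n lam * A" by (simp add: K2_def algebra_simps)
  finally show ?thesis by (simp add: A_def p_def)
qed

section \<open>Second components and large components\<close>

lemma mass_le:
  assumes "\<And>i. 0 \<le> w i"
  shows "mass ok w i y \<le> mean w i ^ y / fact y"
proof (induction i arbitrary: y)
  case (Suc i)
  have "mass ok w (Suc i) y \<le> (\<Sum>x\<le>y. mean w i ^ x / fact x * (w i ^ (y - x) / fact (y - x)))"
  proof (cases "ok (Suc i) y")
    case True
    have "mass ok w i x * (w i ^ (y - x) / fact (y - x)) \<le> mean w i ^ x / fact x * (w i ^ (y - x) / fact (y - x))" for x
      by (rule mult_right_mono[OF Suc.IH]) (use assms in auto)
    then have "(\<Sum>x\<le>y. mass ok w i x * (w i ^ (y - x) / fact (y - x))) \<le>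
      (\<Sum>x\<le>y. mean w i ^ x / fact x * (w i ^ (y - x) / fact (y - x)))"
      by (rule sum_mono)
    then show ?thesis using True by simp
  next
    case False
    have "0 \<le> mean w i" unfolding mean_def using assms by (intro sum_nonneg) auto
    then show ?thesis using False assms by (auto intro!: sum_nonneg mult_nonneg_nonneg)
  qed
  then show ?case unfolding binomial_fact_sum by simp
qed auto

lemma conn_nonneg: "0 \<le> p \<Longrightarrow> p \<le> 1 \<Longrightarrow> 0 \<le> conn p k"
proof -
  assume p: "0 \<le> p" "p \<le> 1"
  have "0 \<le> mass ahead w i y" if "\<And>i. 0 \<le> w i" for w i y
    using that by (induction i arbitrary: y) (auto intro!: sum_nonneg mult_nonneg_nonneg)
  then show ?thesis unfolding conn_def using p by (intro mult_nonneg_nonneg) auto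
qed

text \<open>Dropping the constraint leaves one Poisson-type weight, whose mean is the geometric sum
  of p (1 - p)^i.\<close>

lemma conn_le:
  assumes "0 < p" "p < 1"
  shows "conn p k \<le> (1 - (1 - p) ^ (k - 1)) ^ (k - 1)"
proof -
  have m: "mean (\<lambda>i. p * (1 - p) ^ i) i = 1 - (1 - p) ^ i" for i
    using assms sum_gp_strict[of "1 - p" i] by (simp add: mean_def sum_distrib_left[symmetric])
  have "mass ahead (\<lambda>i. p * (1 - p) ^ i) (k - 1) (k - 1) \<le> (1 - (1 - p) ^ (k - 1)) ^ (k - 1) / fact (k - 1)"
    using mass_le[of "\<lambda>i. p * (1 - p) ^ i" ahead "k - 1" "k - 1"] assms by (simp add: m)
  then show ?thesis unfolding conn_def by (simp add: field_simps)
qed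

lemma expected_comps_nonneg: "0 \<le> p \<Longrightarrow> p \<le> 1 \<Longrightarrow> 0 \<le> expected_comps p n k"
  unfolding expected_comps_def by (intro mult_nonneg_nonneg conn_nonneg) auto

text \<open>With \<open>conn_le\<close> the expected number becomes, up to 1 / \<sigma> \<le> 1 / p
  for the missing factor of \<sigma>, the probability that a binomial variable with parameters n and
  \<sigma> equals j; exponential tilting by h bounds it.\<close>

lemma expected_comps_chernoff:
  assumes p: "0 < p" "p < 1" and j: "1 \<le> j" "j \<le> n"
  defines "\<sigma> \<equiv> 1 - (1 - p) ^ j"
  shows "expected_comps p n j \<le> 1 / p * exp (real n * \<sigma> * (exp h - 1) - h * real j)"
proof -
  have q: "0 < (1 - p) ^ j" "(1 - p) ^ j \<le> 1 - p"
    using p j power_decreasing[of 1 j "1 - p"] by auto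
  have \<sigma>: "p \<le> \<sigma>" "\<sigma> < 1" "0 < \<sigma>" using q p by (auto simp: \<sigma>_def)
  have "conn p j \<le> (1 - (1 - p) ^ (j - 1)) ^ (j - 1)" by (rule conn_le[OF p])
  also have "\<dots> \<le> \<sigma> ^ (j - 1)"
    unfolding \<sigma>_def using p by (intro power_mono diff_left_mono power_decreasing) (auto simp: power_le_one)
  also have "\<dots> = \<sigma> ^ j / \<sigma>" using \<sigma> j by (simp add: power_diff)
  finally have "conn p j \<le> \<sigma> ^ j / \<sigma>" .
  then have "expected_comps p n j \<le> real (n choose j) * (\<sigma> ^ j / \<sigma>) * (1 - p) ^ (j * (n - j))"
    unfolding expected_comps_def using p by (intro mult_right_mono mult_left_mono) auto
  also have "(1 - p) ^ (j * (n - j)) = (1 - \<sigma>) ^ (n - j)" by (simp add: \<sigma>_def power_mult)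
  also have "real (n choose j) * (\<sigma> ^ j / \<sigma>) * (1 - \<sigma>) ^ (n - j) =
      1 / \<sigma> * exp (- (h * real j)) * (real (n choose j) * (\<sigma> * exp h) ^ j * (1 - \<sigma>) ^ (n - j))"
    by (simp add: power_mult_distrib exp_of_nat_mult[symmetric] exp_minus mult.commute)
  also have "\<dots> \<le> 1 / p * exp (- (h * real j)) * (exp (real n * \<sigma> * (exp h - 1)))"
  proof (intro mult_mono)
    show "1 / \<sigma> \<le> 1 / p" using \<sigma> p by (intro divide_left_mono) auto
    have "real (n choose j) * (\<sigma> * exp h) ^ j * (1 - \<sigma>) ^ (n - j) \<le>
      (\<Sum>i\<le>n. real (n choose i) * (\<sigma> * exp h) ^ i * (1 - \<sigma>) ^ (n - i))"
      using \<sigma> j by (intro member_le_sum) auto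
    also have "\<dots> = (1 + \<sigma> * (exp h - 1)) ^ n"
      unfolding binomial_ring[symmetric] by (simp add: algebra_simps)
    also have "\<dots> \<le> exp (\<sigma> * (exp h - 1)) ^ n"
    proof (rule power_mono)
      have "0 \<le> (1 - \<sigma>) + \<sigma> * exp h" using \<sigma> by simp
      then show "0 \<le> 1 + \<sigma> * (exp h - 1)" by (simp add: algebra_simps)
    qed (rule exp_ge_add_one_self)
    also have "\<dots> = exp (real n * \<sigma> * (exp h - 1))" by (simp add: exp_of_nat_mult[symmetric] mult.assoc)
    finally show "real (n choose j) * (\<sigma> * exp h) ^ j * (1 - \<sigma>) ^ (n - j) \<le> exp (real n * \<sigma> * (exp h - 1))" .
  qed (use \<sigma> p in auto)
  also have "\<dots> = 1 / p * exp (real n * \<sigma> * (exp h - 1) - h * real j)"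
    by (simp add: exp_diff exp_minus mult.assoc inverse_eq_divide)
  finally show ?thesis .
qed

lemma exp_upper_quadratic:
  fixes h :: real
  assumes "0 \<le> h" "h \<le> 1 / 5"
  shows "exp h \<le> 1 + h + 3 / 5 * h\<^sup>2"
proof -
  define A where "A = 1 - h + h\<^sup>2 / 2 - h ^ 3 / 6"
  define B where "B = 1 + h + 3 / 5 * h\<^sup>2"
  have h: "h\<^sup>2 \<le> h / 5" "h ^ 3 \<le> h\<^sup>2 / 5" "h ^ 4 \<le> h ^ 3 / 5" "h ^ 5 \<le> h ^ 4 / 5" "0 \<le> h\<^sup>2" "0 \<le> h ^ 3" "0 \<le> h ^ 4"
    using assms mult_left_mono[OF assms(2), of h] mult_left_mono[OF assms(2), of "h\<^sup>2"]
      mult_left_mono[OF assms(2), of "h ^ 3"] mult_left_mono[OF assms(2), of "h ^ 4"]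
    by (simp_all add: power2_eq_square power3_eq_cube power4_eq_xxxx mult.assoc numeral_eq_Suc)
  have "A * B = 1 + h\<^sup>2 / 10 - 4 / 15 * h ^ 3 + 2 / 15 * h ^ 4 - h ^ 5 / 10"
    unfolding A_def B_def by (simp add: algebra_simps add_divide_distrib diff_divide_distrib power2_eq_square
      power_numeral_even power_numeral_odd power3_eq_cube)
  then have "1 \<le> A * B" using h by linarith
  also have "A * B \<le> exp (- h) * B"
    unfolding A_def B_def using exp_minus_lower[OF assms(1)] assms(1) by (intro mult_right_mono) auto
  finally have "exp h * 1 \<le> exp h * (exp (- h) * B)" by (intro mult_left_mono) auto
  also have "\<dots> = B" by (simp add: exp_minus)
  finally show ?thesis by (simp add: B_def)
qed

text \<open>To second order 1 - exp (- t) with t = x + x^2 / 5 is x - 3 x^2 / 10; the claim keeps x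
  - x^2 / 5 and spends the rest on the corrections. The allowance x / 5 in the hypothesis is where
  \<lambda> \<le> n^(1/12) / 5 enters.\<close>

lemma sigma_upper:
  assumes x: "0 < x" "x \<le> 1" and p: "0 < p" "p \<le> x / 1000" and jp: "real j * p \<le> x * (1 + x / 5)"
  shows "1 - (1 - p) ^ j \<le> x * (1 - x / 5)"
proof -
  have "exp (- p) \<le> exp (p\<^sup>2) * (1 - p)" using p x by (intro exp_quadratic_upper) auto
  then have "exp (- p - p\<^sup>2) \<le> 1 - p" by (simp add: exp_diff divide_le_eq mult.commute)
  then have "exp (- p - p\<^sup>2) ^ j \<le> (1 - p) ^ j" by (intro power_mono) auto
  also have "exp (- p - p\<^sup>2) ^ j = exp (- (real j * p * (1 + p)))"
    by (simp add: exp_of_nat_mult[symmetric] algebra_simps power2_eq_square)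
  finally have 1: "exp (- (real j * p * (1 + p))) \<le> (1 - p) ^ j" .
  define t where "t = x + 21 / 100 * x\<^sup>2"
  have x2: "x\<^sup>2 \<le> x" "x ^ 3 \<le> x\<^sup>2" "0 < x\<^sup>2" "0 < x ^ 3"
    using x mult_left_mono[OF x(2), of x] mult_left_mono[OF x(2), of "x\<^sup>2"]
    by (simp_all add: power2_eq_square power3_eq_cube)
  have "real j * p * (1 + p) \<le> x * (1 + x / 5) * (1 + x / 1000)"
    by (rule mult_mono[OF jp]) (use p x in auto)
  also have "\<dots> = x + 201 / 1000 * x\<^sup>2 + x ^ 3 / 5000"
    by (simp add: field_simps power2_eq_square power3_eq_cube)
  also have "\<dots> \<le> t" unfolding t_def using x2 by linarith
  finally have "exp (- t) \<le> (1 - p) ^ j" using 1 by (smt (verit) exp_le_cancel_iff)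
  moreover have "1 - t + t\<^sup>2 / 2 - t ^ 3 / 6 \<le> exp (- t)" using x x2 by (intro exp_minus_lower) (simp add: t_def)
  moreover have "x\<^sup>2 + 42 / 100 * x ^ 3 \<le> t\<^sup>2"
  proof -
    have "t\<^sup>2 = x\<^sup>2 + 42 / 100 * x ^ 3 + (21 / 100 * x\<^sup>2)\<^sup>2"
      by (simp add: t_def power2_eq_square power3_eq_cube algebra_simps)
    moreover have "0 \<le> (21 / 100 * x\<^sup>2)\<^sup>2" by simp
    ultimately show ?thesis by linarith
  qed
  moreover have "t ^ 3 \<le> (121 / 100 * x) ^ 3" using x x2 by (intro power_mono) (auto simp: t_def)
  then have "t ^ 3 \<le> 1771561 / 1000000 * x ^ 3" by (simp add: power_mult_distrib power_divide)
  moreover have "x * (1 - x / 5) = x - x\<^sup>2 / 5" by (simp add: algebra_simps power2_eq_square)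
  moreover have "t = x + 21 / 100 * x\<^sup>2" by (simp add: t_def)
  ultimately show ?thesis using x2 by linarith
qed

text \<open>At most n sizes, each contributing at most 2 n exp (- y^3 / 60), with n = y^12. The rate
  1/60 beats the 1/80 in \<open>E2\<close>.\<close>

definition tail :: "real \<Rightarrow> real" where "tail y = 2 * y ^ 24 * exp (- (y ^ 3 / 60))"

lemma p_crit_facts:
  assumes n: "0 < n"
  defines "y \<equiv> real n powr (1/12)"
  assumes y: "10 \<le> y" and lam: "\<bar>lam\<bar> \<le> y"
  defines "p \<equiv> p_crit n lam"
  shows "p = (1 + lam / y ^ 4) / real n" "0 < p" "p < 1" "1 / p \<le> 2 * real n" "p \<le> 2 / real n" "\<bar>lam / y ^ 4\<bar> \<le> 1 / y ^ 3"
proof -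
  note pw = powr_twelfth[OF n, folded y_def]
  have N: "0 < real n" using n by simp
  have y12: "1000 \<le> real n" unfolding pw(2) using power_mono[of 10 y 12] y by simp
  show p_eq: "p = (1 + lam / y ^ 4) / real n"
    unfolding p_def p_crit_def pw(5) using pw(1) by (simp add: pw(2) field_simps flip: power_add)
  have "\<bar>lam\<bar> / y ^ 4 \<le> y / y ^ 4" using lam pw(1) by (intro divide_right_mono) auto
  also have "\<dots> = 1 / y ^ 3" using pw(1) by (simp add: power4_eq_xxxx power3_eq_cube)
  finally show mu: "\<bar>lam / y ^ 4\<bar> \<le> 1 / y ^ 3" using pw(1) by simp
  also have "\<dots> \<le> 1 / 2" using power_mono[of 10 y 3] y pw(1) by (intro divide_left_mono) auto
  finally have mu': "1 / 2 \<le> 1 + lam / y ^ 4" "1 + lam / y ^ 4 \<le> 2" unfolding abs_le_iff by linarith+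
  show p0: "0 < p" unfolding p_eq using mu' N by (intro divide_pos_pos) linarith+
  show pn: "p \<le> 2 / real n" unfolding p_eq using mu' N by (intro divide_right_mono) auto
  also have "\<dots> \<le> 2 / 1000" using y12 by (intro divide_left_mono) auto
  finally show "p < 1" by simp
  have "1 / p = real n / (1 + lam / y ^ 4)" by (simp add: p_eq)
  also have "\<dots> \<le> real n / (1 / 2)" using mu' N by (intro divide_left_mono mult_pos_pos) linarith+
  finally show "1 / p \<le> 2 * real n" by simp
qed

lemma expected_comps_tail:
  assumes n: "0 < n"
  defines "y \<equiv> real n powr (1/12)"
  assumes y: "10 \<le> y" and lam: "\<bar>lam\<bar> \<le> y" "lam \<le> y / 5" and n': "n' \<le> n" and j: "y ^ 9 \<le> real j" "j \<le> n'"
  shows "expected_comps (p_crit n lam) n' j \<le> 2 * y ^ 12 * exp (- (y ^ 3 / 60))"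
proof -
  note pw = powr_twelfth[OF n, folded y_def]
  define p where "p = p_crit n lam"
  note P = p_crit_facts[OF n, folded y_def, OF y lam(1), folded p_def]
  have N: "0 < real n" using n by simp
  define x where "x = real j / real n"
  define \<sigma> where "\<sigma> = 1 - (1 - p) ^ j"
  have x_ge: "1 / y ^ 3 \<le> x"
  proof -
    have "1 / y ^ 3 = y ^ 9 / real n" using pw(1) by (simp add: pw(2) field_simps flip: power_add)
    also have "\<dots> \<le> x" unfolding x_def using j N by (intro divide_right_mono) auto
    finally show ?thesis .
  qed
  have x: "0 < x" "x \<le> 1"
  proof -
    show "0 < x" using x_ge pw(1) by (smt (verit) zero_less_divide_1_iff zero_less_power)
    show "x \<le> 1" using j n' N by (simp add: x_def)
  qed
  have mu: "lam / y ^ 4 \<le> x / 5"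
  proof -
    have "lam / y ^ 4 \<le> y / 5 / y ^ 4" using lam pw(1) by (intro divide_right_mono) auto
    also have "\<dots> = 1 / y ^ 3 / 5" using pw(1) by (simp add: power4_eq_xxxx power3_eq_cube)
    also have "\<dots> \<le> x / 5" by (rule divide_right_mono[OF x_ge]) simp
    finally show ?thesis .
  qed
  have jn: "real j = x * real n" using N by (simp add: x_def)
  have "\<sigma> \<le> x * (1 - x / 5)"
    unfolding \<sigma>_def
  proof (rule sigma_upper[OF x P(2)])
    have "2 / real n \<le> (1 / y ^ 3) / 1000"
    proof -
      have "2000 * y ^ 3 \<le> y ^ 9 * y ^ 3"
        using power_mono[of 10 y 9] y pw(1) by (intro mult_right_mono) auto
      then have "2000 * y ^ 3 \<le> real n" by (simp add: pw(2) flip: power_add)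
      then show ?thesis using pw(1) N by (simp add: divide_simps)
    qed
    also have "\<dots> \<le> x / 1000" by (rule divide_right_mono[OF x_ge]) simp
    finally show "p \<le> x / 1000" using P(5) by linarith
    have "real j * p = x * (1 + lam / y ^ 4)" using N by (simp add: P(1) jn)
    also have "\<dots> \<le> x * (1 + x / 5)" using mu x by (intro mult_left_mono) auto
    finally show "real j * p \<le> x * (1 + x / 5)" .
  qed
  \<comment> \<open>The minimiser of the leading part 3 h^2 / 5 - x h / 5 of the exponent, with
    value - x^2 / 60.\<close>
  define h where "h = x / 6"
  have h: "0 \<le> h" "h \<le> 1 / 5" using x by (auto simp: h_def)
  have \<sigma>0: "0 \<le> \<sigma>" using P by (simp add: \<sigma>_def power_le_one)
  have eh: "0 \<le> exp h - 1" "exp h - 1 \<le> h + 3 / 5 * h\<^sup>2" using h exp_upper_quadratic[OF h] by auto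
  have "real n' * \<sigma> * (exp h - 1) - h * real j \<le> real n * (x * (1 - x / 5)) * (h + 3 / 5 * h\<^sup>2) - h * real j"
    using \<open>\<sigma> \<le> x * (1 - x / 5)\<close> \<sigma>0 eh n' x by (intro diff_right_mono mult_mono mult_nonneg_nonneg) auto
  also have "\<dots> = real n * x * ((1 - x / 5) * (h + 3 / 5 * h\<^sup>2) - h)" by (simp add: jn algebra_simps)
  also have "\<dots> \<le> real n * x * (- (x\<^sup>2 / 60))"
  proof (intro mult_left_mono)
    have "(1 - x / 5) * (h + 3 / 5 * h\<^sup>2) - h = - (x\<^sup>2 / 60) - x ^ 3 / 300"
      by (simp add: h_def field_simps power2_eq_square power3_eq_cube)
    then show "(1 - x / 5) * (h + 3 / 5 * h\<^sup>2) - h \<le> - (x\<^sup>2 / 60)" using x by simp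
  qed (use x N in auto)
  also have "\<dots> = - (real n * x ^ 3 / 60)" by (simp add: power2_eq_square power3_eq_cube)
  also have "\<dots> \<le> - (y ^ 3 / 60)"
  proof -
    have "(1 / y ^ 3) ^ 3 \<le> x ^ 3" using x_ge pw(1) by (intro power_mono) auto
    then have "real n * (1 / y ^ 3) ^ 3 \<le> real n * x ^ 3" using N by (intro mult_left_mono) auto
    moreover have "real n * (1 / y ^ 3) ^ 3 = y ^ 3"
      using pw(1) by (simp add: pw(2) power_divide field_simps flip: power_add power_mult)
    ultimately show ?thesis by simp
  qed
  finally have expo: "real n' * \<sigma> * (exp h - 1) - h * real j \<le> - (y ^ 3 / 60)" .
  have j1: "1 \<le> j" using j(1) power_mono[of 10 y 9] y by simp
  have "expected_comps p n' j \<le> 1 / p * exp (real n' * \<sigma> * (exp h - 1) - h * real j)"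
    unfolding \<sigma>_def by (rule expected_comps_chernoff[OF P(2,3) j1 j(2)])
  also have "\<dots> \<le> (2 * real n) * exp (- (y ^ 3 / 60))"
    using expo P by (intro mult_mono) auto
  finally show ?thesis by (simp add: p_def pw(2))
qed

lemma expected_comps_tail_sum:
  assumes n: "0 < n"
  defines "y \<equiv> real n powr (1/12)"
  assumes y: "10 \<le> y" and lam: "\<bar>lam\<bar> \<le> y" "lam \<le> y / 5" and n': "n' \<le> n"
    and S: "S \<subseteq> {1..n'}" "\<And>j. j \<in> S \<Longrightarrow> y ^ 9 \<le> real j"
  shows "(\<Sum>j\<in>S. expected_comps (p_crit n lam) n' j) \<le> tail y"
proof -
  note pw = powr_twelfth[OF n, folded y_def]
  have "(\<Sum>j\<in>S. expected_comps (p_crit n lam) n' j) \<le> (\<Sum>j\<in>S. 2 * y ^ 12 * exp (- (y ^ 3 / 60)))"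
  proof (rule sum_mono)
    fix j assume "j \<in> S"
    then show "expected_comps (p_crit n lam) n' j \<le> 2 * y ^ 12 * exp (- (y ^ 3 / 60))"
      using expected_comps_tail[OF n, folded y_def, OF y lam n'] S by auto
  qed
  also have "\<dots> = real (card S) * (2 * y ^ 12 * exp (- (y ^ 3 / 60)))" by simp
  also have "\<dots> \<le> real n * (2 * y ^ 12 * exp (- (y ^ 3 / 60)))"
  proof (rule mult_right_mono)
    have "card S \<le> card {1..n'}" using S by (intro card_mono) auto
    then show "real (card S) \<le> real n" using n' by simp
  qed (use pw(1) in auto)
  also have "\<dots> = tail y" by (simp add: tail_def pw(2) flip: power_add)
  finally show ?thesis .
qed

text \<open>Removing \<open>k\<close> vertices turns \<open>G\<^bsub>\<lambda>\<^esub>(b)\<close> into \<open>G\<^bsub>\<lambda> - a\<^esub>(b)\<close>.\<close>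

lemma expected_comps_removed:
  assumes n: "0 < n"
  defines "y \<equiv> real n powr (1/12)"
  assumes y: "10 \<le> y" and lam: "\<bar>lam\<bar> \<le> y" and k: "y ^ 8 \<le> real k" "lam * y ^ 8 \<le> real k" "k \<le> i" "real i \<le> y ^ 9"
  shows "expected_comps (p_crit n lam) (n - k) i \<le> (1 + 5 * K2) * exp 3 * y ^ 12 * (1 / (sqrt (real k) * (real i)\<^sup>2))"
proof -
  note pw = powr_twelfth[OF n, folded y_def]
  define p where "p = p_crit n lam"
  note P = p_crit_facts[OF n, folded y_def, OF y lam(1), folded p_def]
  have N: "0 < real n" using n by simp
  have y8: "100000000 \<le> y ^ 8" using power_mono[of 10 y 8] y by simp
  have kp: "0 < k" "0 < i" using k y8 by auto
  have ki: "real k \<le> real i" using k by simp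
  have in3: "1000 * real i \<le> real n"
  proof -
    have "1000 * real i \<le> y ^ 3 * y ^ 9"
      using power_mono[of 10 y 3] y k by (intro mult_mono) auto
    then show ?thesis by (simp add: pw(2) flip: power_add)
  qed
  then have in3': "k + i \<le> n" "i \<le> n" using ki by linarith+
  define a where "a = real k / y ^ 8"
  define b where "b = real i / y ^ 8"
  have ab: "1 \<le> a" "a \<le> b" "lam \<le> a" using k pw(1) ki by (auto simp: a_def b_def divide_right_mono pos_le_divide_eq)
  have bin_pos: "0 < real (n choose i)" using in3' by (simp add: zero_less_binomial_iff)
  have binom: "real ((n - k) choose i) \<le> real (n choose i) *
    exp (- (real k * real i / real n) - real k * (real i)\<^sup>2 / (2 * (real n)\<^sup>2) - (real k)\<^sup>2 * real i / (2 * (real n)\<^sup>2) + 1)"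
  proof -
    have e: "real (N choose i) = (\<Prod>j<i. real N - real j) / fact i" for N
      using binomial_gbinomial[of N i, where ?'a = real] by (simp add: gbinomial_prod_rev lessThan_atLeast0)
    \<comment> \<open>Second order is needed here: summed over j, the terms k j / n^2 and k^2 / (2
      n^2) give about a b^2 / 2 and a^2 b / 2, which are of the same order as G itself.\<close>
    have le: "real (n - k) - real j \<le> (real n - real j) *
        exp (- (real k / real n + real k * real j / (real n)\<^sup>2 + (real k)\<^sup>2 / (2 * (real n)\<^sup>2)))" if "j < i" for j
    proof -
      have nj: "0 < real n - real j" "real j < real n" using that in3' by auto
      define t where "t = real k / (real n - real j)"
      have t: "0 \<le> t" "t \<le> 1 / 2"
        using nj that in3 ki by (auto simp: t_def divide_le_eq)
      have "real (n - k) - real j = (real n - real j) * (1 - t)"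
        using nj in3' by (simp add: t_def field_simps of_nat_diff)
      moreover have "1 - t \<le> exp (- t - t\<^sup>2 / 2)" using t by (intro one_minus_le_exp_quadratic) auto
      moreover have "exp (- t - t\<^sup>2 / 2) \<le> exp (- (real k / real n + real k * real j / (real n)\<^sup>2 + (real k)\<^sup>2 / (2 * (real n)\<^sup>2)))"
      proof -
        have inv: "1 / real n + real j / (real n)\<^sup>2 \<le> 1 / (real n - real j)"
        proof -
          have "(1 / real n + real j / (real n)\<^sup>2) * (real n - real j) = 1 - (real j / real n)\<^sup>2"
            using N by (simp add: field_simps power2_eq_square)
          also have "\<dots> \<le> 1" by simp
          finally show ?thesis using nj by (simp add: pos_le_divide_eq)
        qed
        then have "real k * (1 / real n + real j / (real n)\<^sup>2) \<le> real k * (1 / (real n - real j))"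
          by (intro mult_left_mono) auto
        then have t1: "real k / real n + real k * real j / (real n)\<^sup>2 \<le> t" by (simp add: t_def distrib_left)
        have "real k / real n \<le> t" using t1 by (smt (verit) divide_nonneg_nonneg mult_nonneg_nonneg of_nat_0_le_iff zero_le_power2)
        then have "(real k / real n)\<^sup>2 \<le> t\<^sup>2" using N by (intro power_mono) auto
        then have "(real k)\<^sup>2 / (2 * (real n)\<^sup>2) \<le> t\<^sup>2 / 2" by (simp add: power_divide)
        then show ?thesis using t1 by simp
      qed
      ultimately show ?thesis using nj by (smt (verit) mult_left_mono)
    qed
    have "(\<Prod>j<i. real (n - k) - real j) \<le> (\<Prod>j<i. (real n - real j) *
        exp (- (real k / real n + real k * real j / (real n)\<^sup>2 + (real k)\<^sup>2 / (2 * (real n)\<^sup>2))))"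
      using le in3' by (intro prod_mono) (auto simp: of_nat_diff)
    also have "\<dots> = (\<Prod>j<i. real n - real j) *
        exp (\<Sum>j<i. - (real k / real n + real k * real j / (real n)\<^sup>2 + (real k)\<^sup>2 / (2 * (real n)\<^sup>2)))"
      by (simp add: prod.distrib exp_sum)
    also have "(\<Sum>j<i. - (real k / real n + real k * real j / (real n)\<^sup>2 + (real k)\<^sup>2 / (2 * (real n)\<^sup>2))) =
      - (real k * real i / real n) - real k * (real i)\<^sup>2 / (2 * (real n)\<^sup>2) - (real k)\<^sup>2 * real i / (2 * (real n)\<^sup>2)
        + real k * real i / (2 * (real n)\<^sup>2)"
    proof -
      have "(\<Sum>j<i. real j) = (real i)\<^sup>2 / 2 - real i / 2"
        by (induction i) (auto simp: power2_eq_square field_simps)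
      then have "(\<Sum>j<i. real k * real j / (real n)\<^sup>2) = real k * ((real i)\<^sup>2 / 2 - real i / 2) / (real n)\<^sup>2"
        by (simp add: sum_distrib_left[symmetric] sum_divide_distrib[symmetric])
      moreover have "real k * ((real i)\<^sup>2 / 2 - real i / 2) / (real n)\<^sup>2 =
          real k * (real i)\<^sup>2 / (2 * (real n)\<^sup>2) - real k * real i / (2 * (real n)\<^sup>2)"
        by (simp add: right_diff_distrib diff_divide_distrib)
      ultimately show ?thesis
        by (simp add: sum_negf sum_subtractf sum.distrib mult.commute)
    qed
    finally have 1: "(\<Prod>j<i. real (n - k) - real j) \<le> (\<Prod>j<i. real n - real j) * exp (- (real k * real i / real n)
      - real k * (real i)\<^sup>2 / (2 * (real n)\<^sup>2) - (real k)\<^sup>2 * real i / (2 * (real n)\<^sup>2) + real k * real i / (2 * (real n)\<^sup>2))" .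
    have small: "real k * real i / (2 * (real n)\<^sup>2) \<le> 1"
    proof -
      have "real k * real i \<le> real n * real n" using in3 ki by (intro mult_mono) auto
      also have "\<dots> \<le> 2 * (real n)\<^sup>2" by (simp add: power2_eq_square)
      finally show ?thesis using N by (simp add: divide_le_eq)
    qed
    have "(\<Prod>j<i. real (n - k) - real j) \<le> (\<Prod>j<i. real n - real j) * exp (- (real k * real i / real n)
      - real k * (real i)\<^sup>2 / (2 * (real n)\<^sup>2) - (real k)\<^sup>2 * real i / (2 * (real n)\<^sup>2) + 1)"
      using small in3' by (intro order.trans[OF 1] mult_left_mono prod_nonneg) auto
    then show ?thesis unfolding e by (simp add: divide_right_mono)
  qed
  have powq: "(1 - p) ^ (i * (n - k - i)) \<le> (1 - p) ^ (i * (n - i)) * exp (real i * real k * p + 1)"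
  proof -
    have q: "0 < 1 - p" using P by simp
    have p2: "p \<le> 1 / 2"
    proof -
      have "4 \<le> real n" using in3 kp by linarith
      then have "2 / real n \<le> 2 / 4" by (intro divide_left_mono) auto
      then show ?thesis using P(5) by linarith
    qed
    have "exp (- p) \<le> exp (p\<^sup>2) * (1 - p)" using P p2 by (intro exp_quadratic_upper) auto
    then have "exp (- p - p\<^sup>2) \<le> 1 - p" by (simp add: exp_diff divide_le_eq mult.commute)
    then have "exp (- p - p\<^sup>2) ^ (i * k) \<le> (1 - p) ^ (i * k)" by (intro power_mono) auto
    moreover have "exp (- p - p\<^sup>2) ^ (i * k) = exp (- (real i * real k * p + real i * real k * p\<^sup>2))"
      by (simp add: exp_of_nat_mult[symmetric] right_diff_distrib mult.assoc)
    ultimately have "exp (- (real i * real k * p + real i * real k * p\<^sup>2)) * exp (real i * real k * p + real i * real k * p\<^sup>2)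
        \<le> (1 - p) ^ (i * k) * exp (real i * real k * p + real i * real k * p\<^sup>2)"
      by (intro mult_right_mono) auto
    then have "1 \<le> (1 - p) ^ (i * k) * exp (real i * real k * p + real i * real k * p\<^sup>2)"
      by (simp only: exp_minus_inverse mult.commute[of "exp (- _)"])
    also have "\<dots> \<le> (1 - p) ^ (i * k) * exp (real i * real k * p + 1)"
    proof (intro mult_left_mono)
      have "real i * real k * p\<^sup>2 \<le> (real n / 1000) * (real n / 1000) * (2 / real n)\<^sup>2"
      proof (rule mult_mono[OF mult_mono])
        show "p\<^sup>2 \<le> (2 / real n)\<^sup>2" using P by (intro power_mono) auto
      qed (use in3 ki in auto)
      also have "\<dots> \<le> 1" using N by (simp add: power2_eq_square)
      finally show "exp (real i * real k * p + real i * real k * p\<^sup>2) \<le> exp (real i * real k * p + 1)" by simp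
    qed (use q in auto)
    finally have "(1 - p) ^ (i * (n - k - i)) * 1 \<le> (1 - p) ^ (i * (n - k - i)) * ((1 - p) ^ (i * k) * exp (real i * real k * p + 1))"
      using q by (intro mult_left_mono) auto
    moreover have "i * (n - k - i) + i * k = i * (n - i)"
    proof -
      have "n - k - i + k = n - i" using in3' by simp
      then show ?thesis by (simp add: distrib_left[symmetric])
    qed
    then have "(1 - p) ^ (i * (n - k - i)) * (1 - p) ^ (i * k) = (1 - p) ^ (i * (n - i))"
      by (simp add: power_add[symmetric])
    ultimately show ?thesis by (simp add: mult.assoc[symmetric])
  qed
  define Q where "Q = - (real k * real i / real n) - real k * (real i)\<^sup>2 / (2 * (real n)\<^sup>2) - (real k)\<^sup>2 * real i / (2 * (real n)\<^sup>2)
    + real i * real k * p"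
  have Q: "Q = - (a * b\<^sup>2 / 2) - a\<^sup>2 * b / 2 + lam * a * b"
  proof -
    have "Q = - (real k * (real i)\<^sup>2 / (2 * (real n)\<^sup>2)) - (real k)\<^sup>2 * real i / (2 * (real n)\<^sup>2) + real i * real k * (lam / y ^ 4) / real n"
      unfolding Q_def P(1) by (simp add: distrib_left add_divide_distrib mult.commute)
    also have "real k * (real i)\<^sup>2 / (2 * (real n)\<^sup>2) = a * b\<^sup>2 / 2"
      using pw(1) by (simp add: a_def b_def pw(2) power_divide flip: power_add power_mult)
    also have "(real k)\<^sup>2 * real i / (2 * (real n)\<^sup>2) = a\<^sup>2 * b / 2"
      using pw(1) by (simp add: a_def b_def pw(2) power_divide flip: power_add power_mult)
    also have "real i * real k * (lam / y ^ 4) / real n = lam * a * b"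
      using pw(1) by (simp add: a_def b_def pw(2) mult_ac flip: power_add power_mult)
    finally show ?thesis .
  qed
  have removed: "expected_comps p (n - k) i \<le> expected_comps p n i * exp (Q + 2)"
  proof -
    have "expected_comps p (n - k) i \<le> (real (n choose i) *
      exp (- (real k * real i / real n) - real k * (real i)\<^sup>2 / (2 * (real n)\<^sup>2) - (real k)\<^sup>2 * real i / (2 * (real n)\<^sup>2) + 1)) *
      conn p i * ((1 - p) ^ (i * (n - i)) * exp (real i * real k * p + 1))"
      unfolding expected_comps_def using binom powq P conn_nonneg[of p i]
      by (intro mult_mono mult_nonneg_nonneg) auto
    also have "\<dots> = expected_comps p n i * (exp (- (real k * real i / real n) - real k * (real i)\<^sup>2 / (2 * (real n)\<^sup>2)
      - (real k)\<^sup>2 * real i / (2 * (real n)\<^sup>2) + 1) * exp (real i * real k * p + 1))"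
      by (simp add: expected_comps_def mult_ac)
    also have "exp (- (real k * real i / real n) - real k * (real i)\<^sup>2 / (2 * (real n)\<^sup>2)
      - (real k)\<^sup>2 * real i / (2 * (real n)\<^sup>2) + 1) * exp (real i * real k * p + 1) = exp (Q + 2)"
      by (simp add: exp_add[symmetric] Q_def algebra_simps)
    finally show ?thesis .
  qed
  have i8: "y ^ 8 \<le> real i" using k ki by linarith
  have E: "expected_comps p n i \<le> (1 + 5 * K2) * mainA n lam i"
  proof -
    have "E1 i n lam \<le> 5" using E1_facts(7)[OF n kp(2), folded y_def, of lam] y lam i8 k(4) by simp
    moreover have A0: "0 \<le> mainA n lam i" by (simp add: mainA_def)
    ultimately have "K2 * E1 i n lam * mainA n lam i \<le> K2 * 5 * mainA n lam i"
      using K_pos by (intro mult_right_mono mult_left_mono) auto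
    moreover have "\<bar>expected_comps p n i - mainA n lam i\<bar> \<le> K2 * E1 i n lam * mainA n lam i"
      unfolding p_def using expected_comps_asymptotics[OF n, folded y_def, of lam i] y lam i8 k(4) by simp
    ultimately show ?thesis by (simp add: abs_le_iff algebra_simps)
  qed
  \<comment> \<open>The left side equals - b (b + 2 (a - \<lambda>))^2 / 8, the exponent of a graph
    with parameter \<lambda> - a. As a \<ge> \<lambda>, this parameter is nonpositive and the
    bracket is at least b.\<close>
  have GQ: "- G_lam lam b + Q \<le> - (b ^ 3 / 8)"
  proof -
    have "- G_lam lam b + Q = - (b * (b + 2 * (a - lam))\<^sup>2 / 8)"
      unfolding Q G_lam_def by (simp add: field_simps power2_eq_square power3_eq_cube)
    moreover have "b * b\<^sup>2 / 8 \<le> b * (b + 2 * (a - lam))\<^sup>2 / 8"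
      using ab by (intro divide_right_mono mult_left_mono power_mono) auto
    ultimately show ?thesis by (simp add: power3_eq_cube power2_eq_square)
  qed
  \<comment> \<open>Polynomial decay suffices: together with sqrt i it leaves i^(-5/2), which is
    summable over i.\<close>
  have b3: "exp (- (b ^ 3 / 8)) \<le> 8 / b ^ 3"
  proof -
    have "b ^ 3 / 8 \<le> exp (b ^ 3 / 8)" using exp_ge_add_one_self[of "b ^ 3 / 8"] by linarith
    then have "1 / exp (b ^ 3 / 8) \<le> 1 / (b ^ 3 / 8)" using ab by (intro divide_left_mono) auto
    then show ?thesis by (simp add: exp_minus inverse_eq_divide)
  qed
  have "expected_comps p (n - k) i \<le> (1 + 5 * K2) * mainA n lam i * exp (Q + 2)"
    using removed E by (smt (verit) exp_ge_zero mult_right_mono)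
  also have "\<dots> = (1 + 5 * K2) * exp 2 * (sqrt (real i) / (sqrt (8 * pi) * real n)) * exp (- G_lam lam b + Q)"
  proof -
    have "exp (- G_lam lam b) * exp (Q + 2) = exp 2 * exp (- G_lam lam b + Q)"
      by (simp add: mult_exp_exp add_ac)
    then show ?thesis by (simp add: mainA_def pw(3) b_def mult_ac)
  qed
  also have "\<dots> \<le> (1 + 5 * K2) * exp 2 * (sqrt (real i) / (4 * real n)) * (8 / b ^ 3)"
  proof (intro mult_mono)
    have "4 \<le> sqrt (8 * pi)" using pi_gt3 by (intro real_le_rsqrt) simp
    then show "sqrt (real i) / (sqrt (8 * pi) * real n) \<le> sqrt (real i) / (4 * real n)"
      using N by (intro divide_left_mono mult_right_mono mult_pos_pos) auto
    show "exp (- G_lam lam b + Q) \<le> 8 / b ^ 3" using GQ b3 by (smt (verit) exp_le_cancel_iff)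
  qed (use K_pos N ab in \<open>auto intro!: mult_nonneg_nonneg\<close>)
  also have "\<dots> = (1 + 5 * K2) * exp 2 * 2 * y ^ 12 * (sqrt (real i) / real i ^ 3)"
  proof -
    have "8 / b ^ 3 = 8 * (y ^ 12 * y ^ 12) / real i ^ 3"
      by (simp add: b_def power_divide flip: power_add power_mult)
    moreover have "sqrt (real i) / (4 * y ^ 12) * (8 * (y ^ 12 * y ^ 12) / real i ^ 3) = 2 * y ^ 12 * (sqrt (real i) / real i ^ 3)"
      using pw(1) by (simp add: divide_simps)
    ultimately show ?thesis unfolding pw(2) by (simp only: mult.assoc)
  qed
  also have "\<dots> \<le> (1 + 5 * K2) * exp 2 * 2 * y ^ 12 * (1 / (sqrt (real k) * (real i)\<^sup>2))"
  proof (intro mult_left_mono)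
    have "sqrt (real i) / real i ^ 3 = sqrt (real i) / ((sqrt (real i) * sqrt (real i)) * (real i)\<^sup>2)"
      by (simp add: power2_eq_square power3_eq_cube)
    also have "\<dots> = 1 / (sqrt (real i) * (real i)\<^sup>2)"
    proof -
      have gen: "s / ((s * s) * z) = 1 / (s * z)" if "s \<noteq> 0" for s z :: real
        using that by (simp add: divide_simps)
      show ?thesis by (rule gen) (use kp in simp)
    qed
    also have "\<dots> \<le> 1 / (sqrt (real k) * (real i)\<^sup>2)"
      using ki kp by (intro divide_left_mono mult_right_mono) auto
    finally show "sqrt (real i) / real i ^ 3 \<le> 1 / (sqrt (real k) * (real i)\<^sup>2)" .
  qed (use K_pos pw(1) in auto)
  also have "\<dots> \<le> (1 + 5 * K2) * exp 3 * y ^ 12 * (1 / (sqrt (real k) * (real i)\<^sup>2))"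
  proof (intro mult_right_mono)
    have "(2 :: real) \<le> exp 1" using exp_ge_add_one_self[of "1 :: real"] by simp
    then have "exp 2 * 2 \<le> exp 2 * exp (1 :: real)" by (intro mult_left_mono) auto
    then have "exp 2 * 2 \<le> exp (3 :: real)" by (simp add: exp_add[symmetric])
    then have "(1 + 5 * K2) * (exp 2 * 2) \<le> (1 + 5 * K2) * exp 3" using K_pos by (intro mult_left_mono) auto
    then show "(1 + 5 * K2) * exp 2 * 2 \<le> (1 + 5 * K2) * exp 3" by simp
  qed (use pw(1) in auto)
  finally show ?thesis by (simp add: p_def)
qed

section \<open>The law of the largest component\<close>

lemma sum_inverse_squares_le: "1 \<le> k \<Longrightarrow> (\<Sum>i=k..M. 1 / (real i)\<^sup>2) \<le> 2 / real k"
proof -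
  assume k: "1 \<le> k"
  have "(\<Sum>i=k..M. 1 / (real i)\<^sup>2) \<le> 2 / real k - 1 / real M" if "k \<le> M"
    using that
  proof (induction M rule: dec_induct)
    case base
    have "1 / (real k)\<^sup>2 \<le> 1 / real k" using k by (intro divide_left_mono) (auto simp: power2_eq_square)
    then show ?case by simp
  next
    case (step M)
    have M: "0 < real M" using step k by simp
    have "1 / (1 + real M)\<^sup>2 \<le> 1 / real M - 1 / (1 + real M)"
    proof -
      have "1 / real M - 1 / (1 + real M) = 1 / (real M * (1 + real M))"
        using M by (simp add: field_simps)
      moreover have "1 / (1 + real M)\<^sup>2 \<le> 1 / (real M * (1 + real M))"
        using M by (intro divide_left_mono) (auto simp: power2_eq_square)
      ultimately show ?thesis by simp
    qed
    then show ?case using step by simp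
  qed
  then show ?thesis by (cases "k \<le> M") (auto intro: order.trans)
qed

definition K3 :: real where "K3 = 2 * (1 + 5 * K2) * exp 3"
definition K5 :: real where "K5 = K2 + (1 + 5 * K2) * (K3 + 1)"

lemma K3_pos: "0 < K3" and K5_pos: "0 < K5"
  using K_pos by (auto simp: K3_def K5_def intro!: add_pos_pos mult_pos_pos)

text \<open>The bounds i^(-2) sum to at most 2 / k, and y^12 / sqrt k \<le> y^8 because k \<ge> y^8.
  Up to the Chernoff tail, the expected number of further large components is thus of the order of
  the term n^(2/3) / k in \<open>E1\<close>.\<close>

lemma expected_comps_removed_sum:
  assumes n: "0 < n"
  defines "y \<equiv> real n powr (1/12)"
  assumes y: "10 \<le> y" and lam: "\<bar>lam\<bar> \<le> y" "lam \<le> y / 5" and k: "y ^ 8 \<le> real k" "lam * y ^ 8 \<le> real k"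
  shows "(\<Sum>j=k..n-k. expected_comps (p_crit n lam) (n - k) j) \<le> K3 * (y ^ 8 / real k) + tail y"
proof -
  note pw = powr_twelfth[OF n, folded y_def]
  let ?e = "\<lambda>j. expected_comps (p_crit n lam) (n - k) j"
  let ?S1 = "{j \<in> {k..n-k}. real j \<le> y ^ 9}" and ?S2 = "{j \<in> {k..n-k}. \<not> real j \<le> y ^ 9}"
  have k1: "1 \<le> k"
  proof -
    have "0 < real k" using k(1) pw(1) by (smt (verit) zero_less_power)
    then show ?thesis by simp
  qed
  have "(\<Sum>j=k..n-k. ?e j) = (\<Sum>j\<in>?S1 \<union> ?S2. ?e j)" by (intro sum.cong) auto
  also have "\<dots> = (\<Sum>j\<in>?S1. ?e j) + (\<Sum>j\<in>?S2. ?e j)" by (intro sum.union_disjoint) auto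
  also have "(\<Sum>j\<in>?S2. ?e j) \<le> tail y"
    unfolding y_def by (rule expected_comps_tail_sum[OF n]) (use y lam k1 in \<open>auto simp: y_def\<close>)
  also have "(\<Sum>j\<in>?S1. ?e j) \<le> (\<Sum>j\<in>?S1. (1 + 5 * K2) * exp 3 * y ^ 12 * (1 / (sqrt (real k) * (real j)\<^sup>2)))"
    using y lam k by (intro sum_mono) (auto simp: y_def intro!: expected_comps_removed[OF n, unfolded times_divide_eq_right mult_1_right])
  also have "\<dots> \<le> (\<Sum>j=k..n-k. (1 + 5 * K2) * exp 3 * y ^ 12 * (1 / (sqrt (real k) * (real j)\<^sup>2)))"
    using K_pos pw(1) by (intro sum_mono2) auto
  also have "\<dots> = (1 + 5 * K2) * exp 3 * y ^ 12 * (1 / sqrt (real k)) * (\<Sum>j=k..n-k. 1 / (real j)\<^sup>2)"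
    by (simp add: sum_distrib_left)
  also have "\<dots> \<le> (1 + 5 * K2) * exp 3 * y ^ 12 * (1 / y ^ 4) * (2 / real k)"
  proof (rule mult_mono[OF mult_left_mono])
    have "y ^ 4 \<le> sqrt (real k)" using k(1) by (intro real_le_rsqrt) (simp flip: power_mult)
    then show "1 / sqrt (real k) \<le> 1 / y ^ 4" using pw(1) k1 by (intro divide_left_mono mult_pos_pos) auto
  qed (use sum_inverse_squares_le[OF k1] K_pos pw(1) in \<open>auto intro!: sum_nonneg\<close>)
  also have "\<dots> = K3 * (y ^ 8 / real k)"
  proof -
    have "y ^ 12 * (1 / y ^ 4) = y ^ 8" using pw(1) by (simp add: field_simps flip: power_add)
    then have "C * y ^ 12 * (1 / y ^ 4) * (2 / real k) = 2 * C * (y ^ 8 / real k)" for C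
      by (simp only: mult.assoc[of C] mult.left_commute[of 2]) simp
    then show ?thesis by (simp add: K3_def)
  qed
  finally show ?thesis by simp
qed

text \<open>The probability lies between N (1 - R) and N, where N is the expected number of
  components of size k and R that of further ones of size at least k in the remaining graph; both R
  and the relative error of N are O(E1).\<close>

lemma er_prob_L1_eq_asymptotics:
  assumes n: "0 < n"
  defines "y \<equiv> real n powr (1/12)"
  assumes y: "10 \<le> y" "tail y \<le> 1 / y ^ 2" and lam: "\<bar>lam\<bar> \<le> y" "lam \<le> y / 5"
    and k: "y ^ 8 \<le> real k" "lam * y ^ 8 \<le> real k" "real k \<le> y ^ 9"
  shows "\<bar>er_prob n (p_crit n lam) (\<lambda>E. L1 n E = k) - mainA n lam k\<bar> \<le> K5 * E1 k n lam * mainA n lam k"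
proof -
  note pw = powr_twelfth[OF n, folded y_def]
  note P = p_crit_facts[OF n, folded y_def, OF y(1) lam(1)]
  have k1: "1 \<le> k" 
  proof -
    have "0 < real k" using k(1) pw(1) by (smt (verit) zero_less_power)
    then show ?thesis by simp
  qed
  have kn: "k \<le> n"
  proof -
    have "y ^ 9 \<le> y ^ 12" using y by (intro power_increasing) auto
    then have "real k \<le> real n" using k(3) pw(2) by linarith
    then show ?thesis by simp
  qed
  define R where "R = (\<Sum>j=k..n-k. expected_comps (p_crit n lam) (n - k) j)"
  have k0: "0 < k" using k1 by simp
  note E = E1_facts[OF n k0, folded y_def, OF _ lam(1) k(1,3)]
  have y1: "1 \<le> y" using y by simp
  have R: "R \<le> (K3 + 1) * E1 k n lam"
  proof -
    have "R \<le> K3 * (y ^ 8 / real k) + tail y"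
      unfolding R_def y_def by (rule expected_comps_removed_sum[OF n]) (use y lam k in \<open>auto simp: y_def\<close>)
    also have "\<dots> \<le> K3 * E1 k n lam + E1 k n lam"
      using E(4,5)[OF y1] y(2) K3_pos by (intro add_mono mult_left_mono) auto
    finally show ?thesis by (simp add: distrib_right)
  qed
  let ?A = "mainA n lam k" and ?N = "expected_comps (p_crit n lam) n k"
  let ?P = "er_prob n (p_crit n lam) (\<lambda>E. L1 n E = k)"
  have A0: "0 \<le> ?A" by (simp add: mainA_def)
  have N0: "0 \<le> ?N" using P by (intro expected_comps_nonneg) auto
  have close: "\<bar>?N - ?A\<bar> \<le> K2 * E1 k n lam * ?A"
    unfolding y_def by (rule expected_comps_asymptotics[OF n]) (use y lam k in \<open>auto simp: y_def\<close>)
  have up: "?P \<le> ?N" using P k1 kn by (intro er_prob_L1_eq_le) auto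
  have lo: "?N * (1 - R) \<le> ?P" unfolding R_def using P k1 kn by (intro er_prob_L1_eq_ge) auto
  have N5: "?N \<le> (1 + 5 * K2) * ?A"
  proof -
    have "K2 * E1 k n lam * ?A \<le> K2 * 5 * ?A"
      using E(7)[OF y1] K_pos A0 by (intro mult_right_mono mult_left_mono) auto
    then show ?thesis using close by (simp add: abs_le_iff algebra_simps)
  qed
  have "?N * R \<le> ?N * ((K3 + 1) * E1 k n lam)" by (rule mult_left_mono[OF R N0])
  also have "\<dots> \<le> (1 + 5 * K2) * ?A * ((K3 + 1) * E1 k n lam)"
    using K3_pos E(6)[OF y1] by (intro mult_right_mono[OF N5]) auto
  finally have NR: "?N * R \<le> (1 + 5 * K2) * (K3 + 1) * E1 k n lam * ?A" by (simp add: mult_ac)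
  have K5: "K5 * E1 k n lam * ?A = K2 * E1 k n lam * ?A + (1 + 5 * K2) * (K3 + 1) * E1 k n lam * ?A"
    by (simp add: K5_def distrib_right)
  have "0 \<le> (1 + 5 * K2) * (K3 + 1) * E1 k n lam * ?A"
    using K_pos K3_pos E(6)[OF y1] A0 by (intro mult_nonneg_nonneg) auto
  moreover have "?N * (1 - R) = ?N - ?N * R" by (simp add: right_diff_distrib)
  ultimately show ?thesis using up lo close NR unfolding K5 abs_le_iff by linarith
qed

section \<open>Summation against an approximate antiderivative\<close>

definition fhat :: "real \<Rightarrow> real \<Rightarrow> real" where
  "fhat lam x = sqrt x / sqrt (8 * pi) * exp (- G_lam lam x)"

definition mainB :: "real \<Rightarrow> real \<Rightarrow> real" where
  "mainB lam x = sqrt x / (sqrt (8 * pi) * G_lam' lam x) * exp (- G_lam lam x)"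

lemma fhat_nonneg: "0 \<le> x \<Longrightarrow> 0 \<le> fhat lam x" by (simp add: fhat_def)

lemma mainB_eq: "mainB lam x = fhat lam x / G_lam' lam x"
  by (simp add: mainB_def fhat_def)

text \<open>The derivative factors as (3 x - 2 \<lambda>) (x - 2 \<lambda>) / 8 and vanishes at 2
  \<lambda>; the condition 3 \<lambda> \<le> x keeps the factors at least 7 x / 3 and x / 3.\<close>

lemma G_lam'_ge:
  assumes "3 * lam \<le> x" "0 \<le> x"
  shows "7 / 72 * x\<^sup>2 \<le> G_lam' lam x"
proof -
  have "(7 * x / 3) * (x / 3) \<le> (3 * x - 2 * lam) * (x - 2 * lam)"
    using assms by (intro mult_mono) auto
  moreover have "G_lam' lam x = (3 * x - 2 * lam) * (x - 2 * lam) / 8"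
    unfolding G_lam'_def by (simp add: field_simps power2_eq_square)
  ultimately show ?thesis by (simp add: power2_eq_square)
qed

lemma G_lam'_ge_const:
  assumes "3 * lam \<le> x" "1 \<le> x"
  shows "7 / 72 \<le> G_lam' lam x"
proof -
  have "1 \<le> x\<^sup>2" using assms by (intro one_le_power)
  then show ?thesis using G_lam'_ge[of lam x] assms by linarith
qed

lemma G_lam''_le:
  assumes "3 * lam \<le> x" "0 \<le> x"
  shows "(3 * x / 4 - lam) * x \<le> 12 * G_lam' lam x"
proof -
  define v where "v = x - 3 * lam"
  have lam: "lam = (x - v) / 3" by (simp add: v_def)
  have "12 * G_lam' lam x - (3 * x / 4 - lam) * x = 3 / 4 * x\<^sup>2 + 7 / 3 * (v * x) + 2 / 3 * v\<^sup>2"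
    unfolding G_lam'_def lam by (simp add: field_simps power2_eq_square)
  moreover have "0 \<le> 3 / 4 * x\<^sup>2 + 7 / 3 * (v * x) + 2 / 3 * v\<^sup>2"
    using assms by (intro add_nonneg_nonneg mult_nonneg_nonneg) (auto simp: v_def)
  ultimately show ?thesis by linarith
qed

lemma G_lam_has_derivative: "(G_lam lam has_real_derivative G_lam' lam x) (at x)"
  unfolding G_lam_def[abs_def] G_lam'_def
  by (auto intro!: derivative_eq_intros simp: power2_eq_square)

text \<open>The relative error of \<open>- mainB\<close> as an antiderivative of
  \<open>fhat\<close>: the first term comes from differentiating 1 / G', with G'' = 3 x / 4 -
  \<lambda>, the second from differentiating sqrt x.\<close>

definition eta :: "real \<Rightarrow> real \<Rightarrow> real" where
  "eta lam x = (3 * x / 4 - lam) / (G_lam' lam x)\<^sup>2 - 1 / (2 * x * G_lam' lam x)"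

text \<open>Both terms are nonnegative, so their difference is at most the larger one, and each is
  at most 12 / (x G'). The 124 rounds up 12 * 72 / 7.\<close>

lemma eta_bound:
  assumes "3 * lam \<le> x" "1 \<le> x"
  shows "\<bar>eta lam x\<bar> \<le> 124 / x ^ 3"
proof -
  let ?D = "G_lam' lam x"
  have D: "7 / 72 * x\<^sup>2 \<le> ?D" "0 < ?D" using G_lam'_ge[of lam x] G_lam'_ge_const[of lam x] assms by auto
  have "12 / (x * ?D) \<le> 12 / (x * (7 / 72 * x\<^sup>2))"
    using D assms by (intro divide_left_mono mult_left_mono mult_pos_pos) auto
  also have "\<dots> = (864 / 7) / x ^ 3" by (simp add: power2_eq_square power3_eq_cube)
  also have "\<dots> \<le> 124 / x ^ 3" using assms by (intro divide_right_mono) auto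
  finally have b: "12 / (x * ?D) \<le> 124 / x ^ 3" .
  have "(3 * x / 4 - lam) / ?D\<^sup>2 = ((3 * x / 4 - lam) * x) / (x * ?D\<^sup>2)" using assms by simp
  also have "\<dots> \<le> (12 * ?D) / (x * ?D\<^sup>2)"
    using G_lam''_le[of lam x] assms by (intro divide_right_mono) auto
  also have "\<dots> = 12 / (x * ?D)" using D by (simp add: power2_eq_square)
  finally have 1: "(3 * x / 4 - lam) / ?D\<^sup>2 \<le> 12 / (x * ?D)" .
  have 2: "0 \<le> (3 * x / 4 - lam) / ?D\<^sup>2" using assms by simp
  have "1 / (2 * x * ?D) = (1 / 2) / (x * ?D)" by simp
  also have "\<dots> \<le> 12 / (x * ?D)" using assms D by (intro divide_right_mono) auto
  finally have 3: "1 / (2 * x * ?D) \<le> 12 / (x * ?D)" .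
  have 4: "0 \<le> 1 / (2 * x * ?D)" using assms D by simp
  have gen: "\<bar>A - B\<bar> \<le> D" if "A \<le> C" "0 \<le> A" "B \<le> C" "0 \<le> B" "C \<le> D" for A B C D :: real
    using that by linarith
  show ?thesis unfolding eta_def by (rule gen[OF 1 2 3 4 b])
qed

lemma mainB_has_derivative:
  assumes "3 * lam \<le> x" "1 \<le> x"
  shows "(mainB lam has_real_derivative - (fhat lam x * (1 + eta lam x))) (at x)"
proof -
  let ?D = "G_lam' lam x"
  have D: "0 < ?D" using G_lam'_ge_const[of lam x] assms by auto
  have s: "sqrt x * sqrt x = x" "0 < sqrt x" using assms by auto
  have dG': "(G_lam' lam has_real_derivative (3 * x / 4 - lam)) (at x)"
    unfolding G_lam'_def[abs_def] by (auto intro!: derivative_eq_intros)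
  have de: "((\<lambda>x. exp (- G_lam lam x)) has_real_derivative exp (- G_lam lam x) * (- ?D)) (at x)"
    by (intro DERIV_fun_exp DERIV_minus G_lam_has_derivative)
  have ds: "((\<lambda>x. sqrt x / sqrt (8 * pi)) has_real_derivative (inverse (sqrt x) / 2) / sqrt (8 * pi)) (at x)"
    using assms by (intro DERIV_cdivide DERIV_real_sqrt) auto
  have "((\<lambda>x. sqrt x / sqrt (8 * pi) * exp (- G_lam lam x) / G_lam' lam x) has_real_derivative
    (((inverse (sqrt x) / 2) / sqrt (8 * pi) * exp (- G_lam lam x) + exp (- G_lam lam x) * (- ?D) * (sqrt x / sqrt (8 * pi))) * ?D
      - sqrt x / sqrt (8 * pi) * exp (- G_lam lam x) * (3 * x / 4 - lam)) / (?D * ?D)) (at x)"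
    using D by (intro DERIV_divide DERIV_mult ds de dG') auto
  moreover have "mainB lam = (\<lambda>x. sqrt x / sqrt (8 * pi) * exp (- G_lam lam x) / G_lam' lam x)"
    by (simp add: fun_eq_iff mainB_def)
  moreover have "(((inverse (sqrt x) / 2) / sqrt (8 * pi) * exp (- G_lam lam x) + exp (- G_lam lam x) * (- ?D) * (sqrt x / sqrt (8 * pi))) * ?D
      - sqrt x / sqrt (8 * pi) * exp (- G_lam lam x) * (3 * x / 4 - lam)) / (?D * ?D) = - (fhat lam x * (1 + eta lam x))"
  proof -
    have gen: "((inverse r / 2 / S * e + e * - D * (r / S)) * D - r / S * e * H) / (D * D) =
      - (r / S * e * (1 + (H / D\<^sup>2 - 1 / (2 * (r * r) * D))))" if "0 < r" "0 < S" "0 < D" for r S e D H :: real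
      using that by (simp add: field_simps power2_eq_square)
    show ?thesis unfolding fhat_def eta_def using gen[of "sqrt x" "sqrt (8 * pi)" ?D] s D by simp
  qed
  ultimately show ?thesis by simp
qed

lemma mainA_eq_fhat:
  assumes n: "0 < n"
  defines "y \<equiv> real n powr (1/12)"
  shows "mainA n lam j = 1 / y ^ 8 * fhat lam (real j / y ^ 8)"
proof -
  note pw = powr_twelfth[OF n, folded y_def]
  have "sqrt (y ^ 8) = y ^ 4" using pw(1) real_sqrt_unique[of "y ^ 4" "y ^ 8"] by (simp flip: power_mult)
  then have s: "sqrt (real j / y ^ 8) = sqrt (real j) / y ^ 4" by (simp add: real_sqrt_divide)
  have "y ^ 8 * y ^ 4 = real n" unfolding pw(2) by (simp flip: power_add)
  then have "sqrt (real j) / (S * real n) * e = 1 / y ^ 8 * (sqrt (real j) / y ^ 4 / S * e)" for S e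
    by (metis (no_types, opaque_lifting) divide_divide_eq_left mult.commute times_divide_eq_left mult_1)
  then show ?thesis unfolding mainA_def fhat_def pw(3) s .
qed

lemma G_lam'_le:
  assumes "\<bar>lam\<bar> \<le> y" "0 \<le> x" "x \<le> 11 / 10 * y"
  shows "G_lam' lam x \<le> 4 * y\<^sup>2"
proof -
  have y: "0 \<le> y" using assms by linarith
  have "x\<^sup>2 \<le> (11 / 10 * y)\<^sup>2" using assms by (intro power_mono) auto
  moreover have "lam\<^sup>2 \<le> y\<^sup>2" using assms by (simp add: abs_le_square_iff[symmetric])
  moreover have "- (lam * x) \<le> y * (11 / 10 * y)"
  proof -
    have "\<bar>lam\<bar> * x \<le> y * (11 / 10 * y)" using assms y by (intro mult_mono) auto
    moreover have "- lam * x \<le> \<bar>lam\<bar> * x" using assms by (intro mult_right_mono) auto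
    ultimately show ?thesis by simp
  qed
  ultimately have "G_lam' lam x \<le> 3 / 8 * (11 / 10 * y)\<^sup>2 + y * (11 / 10 * y) + y\<^sup>2 / 2"
    unfolding G_lam'_def by linarith
  also have "\<dots> = (363 / 800 + 11 / 10 + 1 / 2) * y\<^sup>2" by (simp add: power2_eq_square field_simps)
  also have "\<dots> \<le> 4 * y\<^sup>2" by (intro mult_right_mono) auto
  finally show ?thesis .
qed

text \<open>The mean value theorem is applied twice on a cell of mesh n^(-2/3): to
  \<open>mainB\<close>, which produces \<open>fhat\<close> at an intermediate point, and to G, which
  moves that point back to x. Since G' \<le> 4 y^2, G changes by at most 4 / y^6 on the cell; 248 is
  twice the 124 of \<open>eta_bound\<close>.\<close>

lemma mainB_difference:
  assumes y: "10 \<le> y" and lam: "\<bar>lam\<bar> \<le> y" "3 * lam \<le> x" and x: "1 \<le> x" "x \<le> y"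
  defines "h \<equiv> 1 / y ^ 8"
  shows "\<bar>h * fhat lam x - (mainB lam x - mainB lam (x + h))\<bar> \<le> h * fhat lam x * (5 / y ^ 6 + 248 / x ^ 3)"
proof -
  have "1 \<le> y ^ 8" using y by (intro one_le_power) auto
  then have h: "0 < h" "h \<le> 1" by (auto simp: h_def divide_le_eq)
  obtain \<xi> where \<xi>: "x < \<xi>" "\<xi> < x + h"
    and B: "mainB lam (x + h) - mainB lam x = (x + h - x) * (- (fhat lam \<xi> * (1 + eta lam \<xi>)))"
    using MVT2[of x "x + h" "mainB lam" "\<lambda>z. - (fhat lam z * (1 + eta lam z))"] h lam x mainB_has_derivative
    by (smt (verit))
  obtain \<zeta> where \<zeta>: "x < \<zeta>" "\<zeta> < \<xi>" and G: "G_lam lam \<xi> - G_lam lam x = (\<xi> - x) * G_lam' lam \<zeta>"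
    using MVT2[of x \<xi> "G_lam lam" "G_lam' lam"] \<xi> G_lam_has_derivative by blast
  define \<Delta> where "\<Delta> = G_lam lam \<xi> - G_lam lam x"
  have \<zeta>2: "\<zeta> \<le> 11 / 10 * y" using \<zeta> \<xi> h x y by linarith
  have D: "0 \<le> G_lam' lam \<zeta>" "G_lam' lam \<zeta> \<le> 4 * y\<^sup>2"
    using G_lam'_ge_const[of lam \<zeta>] G_lam'_le[of lam y \<zeta>] \<zeta> \<zeta>2 lam x by auto
  have \<Delta>0: "0 \<le> \<Delta>" unfolding \<Delta>_def G using \<xi> D by simp
  have "\<Delta> \<le> h * (4 * y\<^sup>2)" unfolding \<Delta>_def G using \<xi> D h by (intro mult_mono) auto
  also have "\<dots> = 4 / y ^ 6"
  proof -
    have "y ^ 8 = y\<^sup>2 * y ^ 6" by (simp flip: power_add)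
    moreover have "1 / (y\<^sup>2 * z) * (4 * y\<^sup>2) = 4 / z" for z using y by simp
    ultimately show ?thesis unfolding h_def by (simp only:)
  qed
  finally have \<Delta>1: "\<Delta> \<le> 4 / y ^ 6" .
  have eG: "exp (- G_lam lam \<xi>) = exp (- G_lam lam x) * exp (- \<Delta>)" by (simp add: \<Delta>_def mult_exp_exp)
  have S: "0 < sqrt (8 * pi)" by simp
  let ?f = "fhat lam x" and ?g = "fhat lam \<xi>"
  have f0: "0 \<le> ?f" and g0: "0 \<le> ?g" using x \<xi> by (auto intro!: fhat_nonneg)
  have up: "?g \<le> ?f * (1 + h)"
  proof -
    have "1 * h \<le> x * h" using x h by (intro mult_right_mono) auto
    then have "\<xi> \<le> x * (1 + h)" using \<xi> unfolding distrib_left by linarith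
    also have "\<dots> \<le> x * (1 + h)\<^sup>2" using x h by (intro mult_left_mono) (auto simp: power2_eq_square)
    finally have "sqrt \<xi> \<le> sqrt x * (1 + h)"
      using h by (metis abs_of_nonneg add_nonneg_nonneg less_eq_real_def real_sqrt_abs real_sqrt_le_mono real_sqrt_mult zero_le_one)
    moreover have "exp (- G_lam lam \<xi>) \<le> exp (- G_lam lam x)" using \<Delta>0 by (simp add: \<Delta>_def)
    ultimately have "sqrt \<xi> / sqrt (8 * pi) * exp (- G_lam lam \<xi>) \<le> sqrt x * (1 + h) / sqrt (8 * pi) * exp (- G_lam lam x)"
      using x h by (intro mult_mono divide_right_mono) auto
    then show ?thesis by (simp add: fhat_def mult_ac)
  qed
  have lo: "?f * (1 - \<Delta>) \<le> ?g"
  proof -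
    have "?f * (1 - \<Delta>) \<le> ?f * exp (- \<Delta>)" using f0 exp_ge_add_one_self[of "- \<Delta>"] by (intro mult_left_mono) auto
    also have "\<dots> = sqrt x / sqrt (8 * pi) * exp (- G_lam lam \<xi>)" by (simp add: fhat_def eG)
    also have "\<dots> \<le> ?g" unfolding fhat_def using \<xi> by (intro mult_right_mono divide_right_mono) auto
    finally show ?thesis .
  qed
  have eta: "\<bar>eta lam \<xi>\<bar> \<le> 124 / x ^ 3"
  proof -
    have "\<bar>eta lam \<xi>\<bar> \<le> 124 / \<xi> ^ 3" using eta_bound[of lam \<xi>] \<xi> lam x by auto
    also have "\<dots> \<le> 124 / x ^ 3" using \<xi> x by (intro divide_left_mono power_mono mult_pos_pos) auto
    finally show ?thesis .
  qed
  have g2: "?g \<le> ?f * 2" using up mult_left_mono[OF _ f0, of "1 + h" 2] h by linarith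
  have "\<bar>?g * eta lam \<xi>\<bar> \<le> ?f * 2 * (124 / x ^ 3)"
    unfolding abs_mult using g0 f0 by (intro mult_mono[OF _ eta]) (use g2 in auto)
  then have 1: "\<bar>?g * eta lam \<xi>\<bar> \<le> ?f * (248 / x ^ 3)" by (simp add: mult.commute)
  have "h \<le> 1 / y ^ 6" unfolding h_def using y by (intro divide_left_mono power_increasing) auto
  then have 2: "?f * h \<le> ?f * (1 / y ^ 6)" "?f * \<Delta> \<le> ?f * (4 / y ^ 6)" using \<Delta>1 f0 by (intro mult_left_mono; simp)+
  have "\<bar>?f - ?g\<bar> \<le> ?f * (5 / y ^ 6)"
  proof -
    have "0 \<le> ?f * h" "0 \<le> ?f * \<Delta>" using f0 h \<Delta>0 by auto
    moreover have "?f * (5 / y ^ 6) = ?f * (1 / y ^ 6) + ?f * (4 / y ^ 6)" by (simp add: distrib_left[symmetric])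
    moreover have "\<bar>f - g\<bar> \<le> t" if "0 \<le> u" "0 \<le> v" "t = b + c" "g \<le> f + u" "f - v \<le> g" "u \<le> b" "v \<le> c"
      for f g t u v b c :: real
      using that by linarith
    ultimately show ?thesis using up lo 2 unfolding distrib_left right_diff_distrib mult_1_right by blast
  qed
  then have "\<bar>?f - ?g * (1 + eta lam \<xi>)\<bar> \<le> ?f * (5 / y ^ 6) + ?f * (248 / x ^ 3)"
    using 1 unfolding distrib_left by linarith
  then have "h * \<bar>?f - ?g * (1 + eta lam \<xi>)\<bar> \<le> h * (?f * (5 / y ^ 6) + ?f * (248 / x ^ 3))"
    using h by (intro mult_left_mono) auto
  moreover have "h * ?f - (mainB lam x - mainB lam (x + h)) = h * (?f - ?g * (1 + eta lam \<xi>))"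
    using B by (simp add: algebra_simps)
  ultimately show ?thesis using h by (simp add: abs_mult distrib_left mult.assoc)
qed

definition K7 :: real where "K7 = 4 * (720 / 7) ^ 5"

text \<open>Beyond a the function G lies above its tangent, which gives decay at rate G'(a). Half of
  the rate pays for five powers of (a + t) / a: four demanded by the hypothesis-free weight on the
  left and one bounding the square root. The constant is 720 / 7 because G'(a) / 2 \<ge> 7 / 144 is
  shared among five powers.\<close>

lemma fhat_decay:
  assumes a: "1 \<le> a" "3 * lam \<le> a" and t: "0 \<le> t"
  shows "fhat lam (a + t) * ((a + t) / a) ^ 4 \<le> (720 / 7) ^ 5 * fhat lam a * exp (- (G_lam' lam a * t / 2))"
proof -
  let ?D = "G_lam' lam a" and ?z = "(a + t) / a"
  have D: "7 / 72 \<le> ?D" using G_lam'_ge_const[of lam a] a by auto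
  have z: "1 \<le> ?z" using a t by simp
  have "G_lam lam (a + t) = G_lam lam a + ?D * t + ((3 * a / 4 - lam) * t\<^sup>2 / 2 + t ^ 3 / 8)"
    unfolding G_lam_def G_lam'_def by (simp add: field_simps power2_eq_square power3_eq_cube)
  moreover have "0 \<le> (3 * a / 4 - lam) * t\<^sup>2 / 2 + t ^ 3 / 8" using a t by simp
  ultimately have "- G_lam lam (a + t) \<le> - G_lam lam a + - (?D * t)" by linarith
  then have e: "exp (- G_lam lam (a + t)) \<le> exp (- G_lam lam a) * exp (- (?D * t))"
    unfolding mult_exp_exp by simp
  have s: "sqrt (a + t) \<le> sqrt a * ?z"
  proof -
    have "a + t = a * ?z" using a by simp
    also have "\<dots> \<le> a * ?z\<^sup>2" using a z mult_left_mono[of 1 ?z ?z] by (intro mult_left_mono) (auto simp: power2_eq_square)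
    finally have "sqrt (a + t) \<le> sqrt (a * ?z\<^sup>2)" by (rule real_sqrt_le_mono)
    also have "\<dots> = sqrt a * ?z" unfolding real_sqrt_mult real_sqrt_abs using z by linarith
    finally show ?thesis .
  qed
  have "?z \<le> 1 + t" using a t mult_right_mono[of 1 a t] by (simp add: divide_le_eq distrib_right algebra_simps)
  also have "\<dots> \<le> 720 / 7 * (1 + 7 / 720 * t)" by simp
  also have "\<dots> \<le> 720 / 7 * exp (7 / 720 * t)" by (intro mult_left_mono) (simp_all add: exp_ge_add_one_self)
  finally have "?z ^ 5 \<le> (720 / 7 * exp (7 / 720 * t)) ^ 5" using z by (intro power_mono) auto
  also have "\<dots> = (720 / 7) ^ 5 * exp (7 / 144 * t)"    unfolding power_mult_distrib by (simp add: exp_of_nat_mult[symmetric])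
  also have "\<dots> \<le> (720 / 7) ^ 5 * exp (?D * t / 2)"
    using mult_right_mono[OF D t] by simp
  finally have z5: "?z ^ 5 \<le> (720 / 7) ^ 5 * exp (?D * t / 2)" .
  have "fhat lam (a + t) * ?z ^ 4 \<le> (sqrt a * ?z / sqrt (8 * pi) * (exp (- G_lam lam a) * exp (- (?D * t)))) * ?z ^ 4"
    unfolding fhat_def using s e z a by (intro mult_right_mono mult_mono divide_right_mono) auto
  also have "\<dots> = fhat lam a * exp (- (?D * t)) * ?z ^ 5"
    by (simp add: fhat_def numeral_eq_Suc mult_ac)
  also have "\<dots> \<le> fhat lam a * exp (- (?D * t)) * ((720 / 7) ^ 5 * exp (?D * t / 2))"
    using fhat_nonneg[of a lam] a by (intro mult_left_mono[OF z5] mult_nonneg_nonneg) auto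
  also have "\<dots> = (720 / 7) ^ 5 * fhat lam a * (exp (- (?D * t)) * exp (?D * t / 2))" by (simp only: mult_ac)
  also have "exp (- (?D * t)) * exp (?D * t / 2) = exp (- (?D * t / 2))" by (simp add: mult_exp_exp)
  finally show ?thesis .
qed

lemma sum_exp_le:
  fixes z :: real
  assumes "0 < z" "z \<le> 1"
  shows "(\<Sum>j=k..J. exp (- (z * real (j - k)))) \<le> 2 / z"
proof (cases "k \<le> J")
  case True
  let ?r = "exp (- z)"
  have "(1 - ?r) * (\<Sum>j=k..J. exp (- (z * real (j - k)))) = 1 - exp (- (z * real (Suc J - k)))"
    using True
  proof (induction J rule: dec_induct)
    case (step J)
    have "exp (- (z * real (Suc (Suc J) - k))) = ?r * exp (- (z * real (Suc J - k)))"
      using step by (simp add: mult_exp_exp Suc_diff_le algebra_simps)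
    moreover have "(\<Sum>j=k..Suc J. exp (- (z * real (j - k)))) =
        (\<Sum>j=k..J. exp (- (z * real (j - k)))) + exp (- (z * real (Suc J - k)))"
      using step by simp
    moreover have "(1 - r) * (S + E) = 1 - r * E" if "(1 - r) * S = 1 - E" for r S E :: real
      unfolding distrib_left that by (simp add: left_diff_distrib)
    ultimately show ?case using step.IH by (simp only:)
  qed simp
  then have "(1 - ?r) * (\<Sum>j=k..J. exp (- (z * real (j - k)))) \<le> 1" by simp
  moreover have "z / 2 \<le> 1 - ?r"
  proof -
    have "z * z \<le> z * 1" using assms by (intro mult_left_mono) auto
    moreover have "exp (- z) \<le> 1 - z + z * z / 2"
      using exp_minus_upper[of z] assms by (simp add: power2_eq_square)
    ultimately show ?thesis by linarith
  qed
  then have "z / 2 * (\<Sum>j=k..J. exp (- (z * real (j - k)))) \<le> (1 - ?r) * (\<Sum>j=k..J. exp (- (z * real (j - k))))"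
    by (intro mult_right_mono sum_nonneg) auto
  ultimately have "z / 2 * (\<Sum>j=k..J. exp (- (z * real (j - k)))) \<le> 1" by linarith
  then show ?thesis using assms by (simp add: pos_le_divide_eq mult.commute)
qed (use assms in auto)

text \<open>The weight (j / k)^4 covers the growth of \<open>E1\<close>, so that relative errors in
  (a) sum to a relative error of \<open>mainB\<close> at k. The geometric series contributes 4 /
  (G'(a) h), whose mesh h cancels and leaves \<open>fhat\<close> / G' =
  \<open>mainB\<close>.\<close>

lemma fhat_sum_le:
  assumes y: "10 \<le> y" and lam: "\<bar>lam\<bar> \<le> y" and k: "y ^ 8 \<le> real k" "3 * lam * y ^ 8 \<le> real k" "real k \<le> y ^ 9"
  shows "(\<Sum>j=k..J. 1 / y ^ 8 * fhat lam (real j / y ^ 8) * (real j / real k) ^ 4) \<le> K7 * mainB lam (real k / y ^ 8)"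
proof -
  define a where "a = real k / y ^ 8"
  define h where "h = 1 / y ^ 8"
  let ?D = "G_lam' lam a"
  have yp: "0 < y ^ 8" using y by simp
  have a: "1 \<le> a" "3 * lam \<le> a" "a \<le> y"
    using k yp by (auto simp: a_def pos_le_divide_eq pos_divide_le_eq simp flip: power_Suc)
  have D: "7 / 72 \<le> ?D" "?D \<le> 4 * y\<^sup>2" using G_lam'_ge_const[of lam a] G_lam'_le[of lam y a] a lam y by auto
  have h: "0 < h" using yp by (simp add: h_def)
  have z: "0 < ?D * h / 2" "?D * h / 2 \<le> 1"
  proof -
    show "0 < ?D * h / 2" using D h by simp
    have "2 * y\<^sup>2 \<le> y ^ 6 * y\<^sup>2" using power_mono[of 10 y 6] y by (intro mult_right_mono) auto
    then have "4 * y\<^sup>2 \<le> 2 * y ^ 8" by (simp flip: power_add)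
    then have "?D \<le> 2 * y ^ 8" using D by linarith
    then show "?D * h / 2 \<le> 1" using yp by (simp add: h_def divide_le_eq)
  qed
  have kp: "0 < real k" using k yp by linarith
  have "(\<Sum>j=k..J. 1 / y ^ 8 * fhat lam (real j / y ^ 8) * (real j / real k) ^ 4) \<le>
    (\<Sum>j=k..J. h * ((720 / 7) ^ 5 * fhat lam a) * exp (- (?D * h / 2 * real (j - k))))"
  proof (rule sum_mono)
    fix j assume "j \<in> {k..J}"
    then have j: "k \<le> j" by simp
    define t where "t = real (j - k) * h"
    have xj: "real j / y ^ 8 = a + t"
      using j by (simp add: a_def t_def h_def of_nat_diff add_divide_distrib[symmetric])
    have "(a + t) / a = (real j / y ^ 8) / (real k / y ^ 8)" by (simp only: xj a_def[symmetric])
    then have rj: "real j / real k = (a + t) / a" using yp by simp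
    have "fhat lam (a + t) * ((a + t) / a) ^ 4 \<le> (720 / 7) ^ 5 * fhat lam a * exp (- (?D * t / 2))"
      using h by (intro fhat_decay a) (simp add: t_def)
    then have "h * (fhat lam (a + t) * ((a + t) / a) ^ 4) \<le> h * ((720 / 7) ^ 5 * fhat lam a * exp (- (?D * t / 2)))"
      using h by (intro mult_left_mono) auto
    then show "1 / y ^ 8 * fhat lam (real j / y ^ 8) * (real j / real k) ^ 4
      \<le> h * ((720 / 7) ^ 5 * fhat lam a) * exp (- (?D * h / 2 * real (j - k)))"
      unfolding xj rj h_def[symmetric] by (simp add: t_def mult_ac)
  qed
  also have "\<dots> = h * ((720 / 7) ^ 5 * fhat lam a) * (\<Sum>j=k..J. exp (- (?D * h / 2 * real (j - k))))"
    by (simp add: sum_distrib_left)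
  also have "\<dots> \<le> h * ((720 / 7) ^ 5 * fhat lam a) * (2 / (?D * h / 2))"
    using h fhat_nonneg[of a lam] a by (intro mult_left_mono sum_exp_le[OF z] mult_nonneg_nonneg) auto
  also have "\<dots> = K7 * mainB lam a"
  proof -
    have "h * (C * f) * (2 / (D * h / 2)) = (4 * C) * (f / D)" for C f D :: real using h by simp
    then show ?thesis unfolding K7_def mainB_eq by blast
  qed
  finally show ?thesis by (simp add: a_def)
qed

text \<open>The term k^4 / n^3 grows exactly like the fourth power of the ratio; one further term
  grows linearly, and the others are constant or decreasing in k.\<close>

lemma E1_growth:
  assumes "0 < k" "k \<le> j"
  shows "E1 j n lam \<le> (real j / real k) ^ 4 * E1 k n lam"
proof -
  let ?r = "real j / real k"
  have r: "1 \<le> ?r" using assms by simp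
  have r4: "1 \<le> ?r ^ 4" by (rule one_le_power[OF r])
  have rr: "?r \<le> ?r ^ 4" using power_increasing[of 1 4 ?r] r by simp
  have jr: "real j = ?r * real k" using assms by simp
  have 1: "real j ^ 4 / real n ^ 3 = ?r ^ 4 * (real k ^ 4 / real n ^ 3)"
    using assms by (simp add: power_divide)
  have 2: "\<bar>lam\<bar> ^ 3 * real j / real n \<le> ?r ^ 4 * (\<bar>lam\<bar> ^ 3 * real k / real n)"
  proof -
    have "\<bar>lam\<bar> ^ 3 * real j / real n = ?r * (\<bar>lam\<bar> ^ 3 * real k / real n)" using assms by simp
    also have "\<dots> \<le> ?r ^ 4 * (\<bar>lam\<bar> ^ 3 * real k / real n)" by (rule mult_right_mono[OF rr]) simp
    finally show ?thesis .
  qed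
  have m: "x \<le> ?r ^ 4 * x" if "0 \<le> x" for x using mult_right_mono[OF r4 that] by simp
  have "real n powr (2/3) / real j \<le> real n powr (2/3) / real k" using assms by (intro divide_left_mono) auto
  also have "\<dots> \<le> ?r ^ 4 * (real n powr (2/3) / real k)" by (rule m) simp
  finally have 3: "real n powr (2/3) / real j \<le> ?r ^ 4 * (real n powr (2/3) / real k)" .
  have 4: "\<bar>lam\<bar> / real n powr (1/12) \<le> ?r ^ 4 * (\<bar>lam\<bar> / real n powr (1/12))"
    "1 / real n powr (1/10) \<le> ?r ^ 4 * (1 / real n powr (1/10))" by (rule m; simp)+
  show ?thesis unfolding E1_def distrib_left by (intro add_mono 2 3 4) (simp only: 1)
qed

text \<open>From \<lambda> \<le> x / 5 follows x - 2 \<lambda> \<ge> 3 x / 5, hence G \<ge> 9 x^3 /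
  200, well above the y^3 / 80 in the exponent of \<open>E2\<close>.\<close>

lemma mainB_tail:
  assumes y: "1 \<le> y" "y \<le> x" and lam: "lam \<le> y / 5"
  shows "mainB lam x \<le> 3 * exp (- (y ^ 3 / 80))"
proof -
  have x: "1 \<le> x" "lam \<le> x / 5" using assms by linarith+
  have D: "7 / 72 * x\<^sup>2 \<le> G_lam' lam x" using G_lam'_ge[of lam x] x by auto
  have G: "y ^ 3 / 80 \<le> G_lam lam x"
  proof -
    have "(3 / 5 * x)\<^sup>2 \<le> (x - 2 * lam)\<^sup>2" using x by (intro power_mono) auto
    then have "x * (3 / 5 * x)\<^sup>2 \<le> x * (x - 2 * lam)\<^sup>2" using x by (intro mult_left_mono) auto
    moreover have "G_lam lam x = x * (x - 2 * lam)\<^sup>2 / 8"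
      unfolding G_lam_def by (simp add: field_simps power2_eq_square power3_eq_cube)
    moreover have "x * (3 / 5 * x)\<^sup>2 = 9 / 25 * x ^ 3" by (simp add: power2_eq_square power3_eq_cube)
    moreover have "y ^ 3 \<le> x ^ 3" "0 \<le> x ^ 3" using y x by (auto intro: power_mono)
    ultimately show ?thesis by linarith
  qed
  have x2: "sqrt x \<le> x\<^sup>2"
  proof -
    have "sqrt x \<le> x" using x by (intro real_le_lsqrt) (auto simp: power2_eq_square)
    also have "\<dots> \<le> x\<^sup>2" using x mult_left_mono[of 1 x x] by (simp add: power2_eq_square)
    finally show ?thesis .
  qed
  have s4: "4 \<le> sqrt (8 * pi)" using pi_gt3 by (intro real_le_rsqrt) simp
  have "sqrt x / (sqrt (8 * pi) * G_lam' lam x) \<le> x\<^sup>2 / (4 * (7 / 72 * x\<^sup>2))"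
    using x2 s4 D x by (intro frac_le mult_mono) auto
  also have "\<dots> \<le> 3" using x by simp
  finally have "sqrt x / (sqrt (8 * pi) * G_lam' lam x) \<le> 3" .
  then show ?thesis unfolding mainB_def using G by (intro mult_mono) auto
qed

definition K8 :: real where "K8 = (K5 + 253) * K7"

lemma er_prob_L1_ge_asymptotics:
  assumes n: "0 < n"
  defines "y \<equiv> real n powr (1/12)"
  assumes y: "10 \<le> y" "tail y \<le> 1 / y ^ 2" "tail y \<le> E2 n" and lam: "\<bar>lam\<bar> \<le> y" "lam \<le> y / 5"
    and k: "y ^ 8 \<le> real k" "3 * lam * y ^ 8 \<le> real k" "real k \<le> y ^ 9"
  shows "\<bar>er_prob n (p_crit n lam) (\<lambda>E. L1 n E \<ge> k) - mainB lam (real k / y ^ 8)\<bar>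
    \<le> K8 * E1 k n lam * mainB lam (real k / y ^ 8) + 4 * E2 n"
proof -
  note pw = powr_twelfth[OF n, folded y_def]
  note P = p_crit_facts[OF n, folded y_def, OF y(1) lam(1)]
  define h where "h = 1 / y ^ 8"
  define x where "x j = real j / y ^ 8" for j :: nat
  define e where "e = E1 k n lam"
  define f where "f j = mainA n lam j" for j
  \<comment> \<open>Estimate (a) is available only up to y^9. Sizes beyond J are left to the
    Chernoff bound, and the telescoped sum ends in a boundary value of \<open>mainB\<close> past y,
    which is O(E2).\<close>
  define J where "J = nat \<lfloor>y ^ 9\<rfloor>"
  have yp: "0 < y ^ 8" "0 \<le> y ^ 9" using pw(1) by simp_all
  have J: "real J \<le> y ^ 9" "y ^ 9 \<le> real (Suc J)" unfolding J_def using yp(2) by linarith+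
  have "real k < real (Suc J)" unfolding J_def using k(3) yp(2) by linarith
  then have kJ: "k \<le> J" by simp
  have k0: "0 < k"
  proof -
    have "0 < real k" using k(1) yp by linarith
    then show ?thesis by simp
  qed
  have y1: "1 \<le> y" using y by simp
  note E = E1_facts[OF n k0, folded y_def, OF y1 lam(1) k(1,3)]
  have S: "(\<Sum>j=k..J. f j * (real j / real k) ^ 4) \<le> K7 * mainB lam (x k)"
    unfolding f_def mainA_eq_fhat[OF n] y_def[symmetric] x_def by (rule fhat_sum_le[OF y(1) lam(1) k])
  have f0: "0 \<le> f j" for j by (simp add: f_def mainA_def)
  have j_facts: "y ^ 8 \<le> real j" "3 * lam * y ^ 8 \<le> real j" "lam * y ^ 8 \<le> real j" "real j \<le> y ^ 9" "1 \<le> (real j / real k) ^ 4" "k \<le> j" if "j \<in> {k..J}" for j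
  proof -
    have j: "real k \<le> real j" "real j \<le> real J" using that by auto
    show 1: "y ^ 8 \<le> real j" "3 * lam * y ^ 8 \<le> real j" "real j \<le> y ^ 9" "k \<le> j" using j J k by linarith+
    show "lam * y ^ 8 \<le> real j" using 1 by (cases "0 \<le> lam * y ^ 8") auto
    show "1 \<le> (real j / real k) ^ 4" using j k0 by (intro one_le_power) simp
  qed
  have A: "\<bar>(\<Sum>j=k..J. er_prob n (p_crit n lam) (\<lambda>E. L1 n E = j)) - (\<Sum>j=k..J. f j)\<bar>
      \<le> (\<Sum>j=k..J. K5 * e * (f j * (real j / real k) ^ 4))"
    unfolding sum_subtractf[symmetric]
  proof (rule order.trans[OF sum_abs sum_mono])
    fix j assume j: "j \<in> {k..J}"
    have "\<bar>er_prob n (p_crit n lam) (\<lambda>E. L1 n E = j) - f j\<bar> \<le> K5 * E1 j n lam * f j"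
      unfolding f_def y_def by (rule er_prob_L1_eq_asymptotics[OF n]) (use y lam j_facts[OF j] in \<open>auto simp: y_def\<close>)
    also have "\<dots> \<le> K5 * ((real j / real k) ^ 4 * e) * f j"
      unfolding e_def using K5_pos f0 E1_growth[OF k0 j_facts(6)[OF j]]
      by (intro mult_right_mono[OF mult_left_mono]) auto
    finally show "\<bar>er_prob n (p_crit n lam) (\<lambda>E. L1 n E = j) - f j\<bar> \<le> K5 * e * (f j * (real j / real k) ^ 4)"
      by (simp add: mult_ac)
  qed
  have B: "\<bar>(\<Sum>j=k..J. f j) - (\<Sum>j=k..J. mainB lam (x j) - mainB lam (x (Suc j)))\<bar>
      \<le> (\<Sum>j=k..J. 253 * e * (f j * (real j / real k) ^ 4))"
    unfolding sum_subtractf[symmetric]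
  proof (rule order.trans[OF sum_abs sum_mono])
    fix j assume j: "j \<in> {k..J}"
    note F = j_facts[OF j]
    have xj: "1 \<le> x j" "3 * lam \<le> x j" "x j \<le> y"
      using F yp by (auto simp: x_def pos_le_divide_eq pos_divide_le_eq simp flip: power_Suc)
    have xs: "x (Suc j) = x j + 1 / y ^ 8" by (simp add: x_def add_divide_distrib)
    have fj: "f j = 1 / y ^ 8 * fhat lam (x j)" unfolding f_def x_def mainA_eq_fhat[OF n] y_def[symmetric] ..
    have "1 / y ^ 6 \<le> 1 / y ^ 2" using y1 by (intro divide_left_mono power_increasing) auto
    then have e1: "1 / y ^ 6 \<le> e" using E(5) by (simp add: e_def)
    have "x k \<le> x j ^ 3"
    proof -
      have "x k \<le> x j" using F yp by (simp add: x_def divide_right_mono)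
      also have "\<dots> \<le> x j ^ 3" using power_increasing[of 1 3 "x j"] xj by simp
      finally show ?thesis .
    qed
    then have "1 / x j ^ 3 \<le> 1 / x k" using xj k0 yp by (intro divide_left_mono mult_pos_pos) (auto simp: x_def)
    then have e2: "1 / x j ^ 3 \<le> e" using E(4) by (simp add: e_def x_def)
    have "5 / y ^ 6 + 248 / x j ^ 3 = 5 * (1 / y ^ 6) + 248 * (1 / x j ^ 3)" by simp
    then have e3: "5 / y ^ 6 + 248 / x j ^ 3 \<le> 253 * e" using e1 e2 by linarith
    have "\<bar>f j - (mainB lam (x j) - mainB lam (x (Suc j)))\<bar> \<le> f j * (5 / y ^ 6 + 248 / x j ^ 3)"
      unfolding fj xs by (rule mainB_difference[OF y(1) lam(1) xj(2,1,3)])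
    also have "\<dots> \<le> f j * (253 * e)" by (rule mult_left_mono[OF e3 f0])
    also have "\<dots> \<le> f j * (253 * e) * (real j / real k) ^ 4"
      using mult_left_mono[OF F(5), of "f j * (253 * e)"] f0 E(6) by (simp add: e_def)
    finally show "\<bar>f j - (mainB lam (x j) - mainB lam (x (Suc j)))\<bar> \<le> 253 * e * (f j * (real j / real k) ^ 4)"
      by (simp add: mult_ac)
  qed
  have C: "(\<Sum>j=k..J. mainB lam (x j) - mainB lam (x (Suc j))) = mainB lam (x k) - mainB lam (x (Suc J))"
    using sum_Suc_diff[of k J "\<lambda>j. - mainB lam (x j)"] kJ by simp
  have sum: "(\<Sum>j=k..J. K5 * e * (f j * (real j / real k) ^ 4)) + (\<Sum>j=k..J. 253 * e * (f j * (real j / real k) ^ 4))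
    \<le> K8 * e * mainB lam (x k)"
  proof -
    have "(K5 + 253) * e * (\<Sum>j=k..J. f j * (real j / real k) ^ 4) \<le> (K5 + 253) * e * (K7 * mainB lam (x k))"
      using K5_pos E(6) by (intro mult_left_mono[OF S]) (auto simp: e_def)
    moreover have "(K5 + 253) * e * S = K5 * e * S + 253 * e * S" for S by (simp add: distrib_right)
    moreover have "(K5 + 253) * e * (K7 * M) = K8 * e * M" for M by (simp add: K8_def mult_ac)
    ultimately show ?thesis by (simp only: sum_distrib_left[symmetric])
  qed
  have y3: "1 \<le> y ^ 3" by (rule one_le_power[OF y1])
  have E2: "exp (- (y ^ 3 / 80)) \<le> E2 n"
    unfolding E2_def pw(6) using y3 mult_right_mono[OF y3, of "exp (- (y ^ 3 / 80))"] by simp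
  have xJ: "y \<le> x (Suc J)" using J yp by (simp add: x_def pos_le_divide_eq flip: power_Suc)
  have tB: "mainB lam (x (Suc J)) \<le> 3 * E2 n" using mainB_tail[OF y1 xJ lam(2)] E2 by linarith
  have tB0: "0 \<le> mainB lam (x (Suc J))"
    unfolding mainB_def using G_lam'_ge_const[of lam "x (Suc J)"] xJ y1 lam by auto
  have p01: "0 \<le> p_crit n lam" "p_crit n lam \<le> 1" using P by auto
  have "er_prob n (p_crit n lam) (\<lambda>E. L1 n E \<ge> Suc J) \<le> (\<Sum>j=Suc J..n. expected_comps (p_crit n lam) n j)"
    using p01 by (intro er_prob_L1_ge_le) auto
  also have "\<dots> \<le> tail y"
    unfolding y_def
  proof (rule expected_comps_tail_sum[OF n])
    fix j assume "j \<in> {Suc J..n}"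
    then have "real (Suc J) \<le> real j" unfolding of_nat_le_iff by simp
    then show "(real n powr (1/12)) ^ 9 \<le> real j" using J by (simp add: y_def)
  qed (use y lam in \<open>auto simp: y_def\<close>)
  finally have tP: "er_prob n (p_crit n lam) (\<lambda>E. L1 n E \<ge> Suc J) \<le> E2 n" using y(3) by linarith
  have tP0: "0 \<le> er_prob n (p_crit n lam) (\<lambda>E. L1 n E \<ge> Suc J)" by (rule er_prob_nonneg[OF p01])
  \<comment> \<open>The 4 consists of 3 for the boundary value of \<open>mainB\<close> and 1 for the
    probability of a component larger than J.\<close>
  have "\<bar>er_prob n (p_crit n lam) (\<lambda>E. L1 n E \<ge> k) - mainB lam (x k)\<bar> \<le> K8 * e * mainB lam (x k) + 4 * E2 n"
    unfolding er_prob_L1_ge_eq_sum[OF kJ] using A B sum tB tB0 tP tP0 unfolding C by linarith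
  then show ?thesis by (simp add: x_def e_def)
qed

theorem theorem2p1:
  "\<exists>C N. \<forall>n lam k. n \<ge> N \<and> n > 0
     \<and> - (real n powr (1/12)) \<le> lam \<and> lam \<le> real n powr (1/12) / 5
     \<and> max (3 * lam) 1 * real n powr (2/3) \<le> real k \<and> real k \<le> real n powr (3/4) \<longrightarrow>
     (let a = real k / real n powr (2/3);
          mainA = sqrt (real k) / (sqrt (8 * pi) * real n) * exp (- G_lam lam a);
          mainB = sqrt a / (sqrt (8 * pi) * G_lam' lam a) * exp (- G_lam lam a)
      in \<bar>er_prob n (p_crit n lam) (\<lambda>E. L1 n E = k) - mainA\<bar>
           \<le> C * \<bar>mainA\<bar> * E1 k n lam + C * E2 n
       \<and> \<bar>er_prob n (p_crit n lam) (\<lambda>E. L1 n E \<ge> k) - mainB\<bar>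
           \<le> C * \<bar>mainB\<bar> * E1 k n lam + C * E2 n)"
proof -
  \<comment> \<open>The two comparisons fix how large n has to be: the first puts the Chernoff tail
    below \<open>E1\<close> in (a), the second below \<open>E2\<close> in (b), the rate 1/60 - 1/80
    outweighing all powers of y.\<close>
  have "\<forall>\<^sub>F y in at_top. tail y \<le> 1 / y ^ 2" unfolding tail_def by real_asymp
  moreover have "\<forall>\<^sub>F y in at_top. tail y \<le> y ^ 3 * exp (- (y ^ 3 / 80))" unfolding tail_def by real_asymp
  ultimately have "\<forall>\<^sub>F y in at_top. 10 \<le> y \<and> tail y \<le> 1 / y ^ 2 \<and> tail y \<le> y ^ 3 * exp (- (y ^ 3 / 80))"
    using eventually_ge_at_top[of 10] by eventually_elim auto
  moreover have "filterlim (\<lambda>n. real n powr (1/12)) at_top sequentially" by real_asymp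
  ultimately have "\<forall>\<^sub>F n in sequentially. 10 \<le> real n powr (1/12) \<and> tail (real n powr (1/12)) \<le> 1 / (real n powr (1/12)) ^ 2
    \<and> tail (real n powr (1/12)) \<le> (real n powr (1/12)) ^ 3 * exp (- ((real n powr (1/12)) ^ 3 / 80))"
    by (rule eventually_compose_filterlim)
  then obtain N where N: "\<And>n. N \<le> n \<Longrightarrow> 10 \<le> real n powr (1/12) \<and> tail (real n powr (1/12)) \<le> 1 / (real n powr (1/12)) ^ 2
    \<and> tail (real n powr (1/12)) \<le> (real n powr (1/12)) ^ 3 * exp (- ((real n powr (1/12)) ^ 3 / 80))"
    unfolding eventually_sequentially by blast
  define C where "C = K5 + K8 + 4"
  have K8: "0 < K8" using K5_pos by (simp add: K8_def K7_def)
  have C: "K5 \<le> C" "K8 \<le> C" "4 \<le> C" "0 \<le> C" using K5_pos K8 by (auto simp: C_def)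
  have "\<bar>er_prob n (p_crit n lam) (\<lambda>E. L1 n E = k) - mainA n lam k\<bar> \<le> C * \<bar>mainA n lam k\<bar> * E1 k n lam + C * E2 n
      \<and> \<bar>er_prob n (p_crit n lam) (\<lambda>E. L1 n E \<ge> k) - mainB lam (real k / real n powr (2/3))\<bar>
        \<le> C * \<bar>mainB lam (real k / real n powr (2/3))\<bar> * E1 k n lam + C * E2 n"
    if H: "N \<le> n" "0 < n" "- (real n powr (1/12)) \<le> lam" "lam \<le> real n powr (1/12) / 5"
      "max (3 * lam) 1 * real n powr (2/3) \<le> real k" "real k \<le> real n powr (3/4)" for n lam k
  proof -
    define y where "y = real n powr (1/12)"
    note pw = powr_twelfth[OF H(2), folded y_def]
    have y: "10 \<le> y" "tail y \<le> 1 / y ^ 2" "tail y \<le> E2 n"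
      using N[OF H(1)] by (auto simp: y_def[symmetric] E2_def pw(6))
    have lam: "\<bar>lam\<bar> \<le> y" "lam \<le> y / 5" using H(3,4) y(1) by (auto simp: y_def[symmetric])
    have yp: "0 < y ^ 8" using pw(1) by simp
    have "1 * y ^ 8 \<le> max (3 * lam) 1 * y ^ 8" "3 * lam * y ^ 8 \<le> max (3 * lam) 1 * y ^ 8"
      using yp by (intro mult_right_mono; simp)+
    then have k: "y ^ 8 \<le> real k" "3 * lam * y ^ 8 \<le> real k" "real k \<le> y ^ 9"
      using H(5,6) by (auto simp: pw(3,4))
    then have k': "lam * y ^ 8 \<le> real k" by (cases "0 \<le> lam * y ^ 8") auto
    have k0: "0 < k"
    proof -
      have "0 < real k" using k(1) yp by linarith
      then show ?thesis by simp
    qed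
    have e: "0 < E1 k n lam"
      using E1_facts(6)[OF H(2) k0, folded y_def, OF _ lam(1) k(1,3)] y(1) by simp
    have E2: "0 \<le> E2 n" by (simp add: E2_def)
    have up: "K * e * M \<le> C * \<bar>M\<bar> * e" if "0 \<le> K" "K \<le> C" "0 < e" for K e M :: real
    proof -
      have "K * e * M \<le> K * e * \<bar>M\<bar>" using that by (intro mult_left_mono) auto
      also have "\<dots> \<le> C * e * \<bar>M\<bar>" using that by (intro mult_right_mono) auto
      finally show ?thesis by (simp add: mult_ac)
    qed
    have "\<bar>er_prob n (p_crit n lam) (\<lambda>E. L1 n E = k) - mainA n lam k\<bar> \<le> K5 * E1 k n lam * mainA n lam k"
      unfolding y_def by (rule er_prob_L1_eq_asymptotics[OF H(2)]) (use y lam k k' in \<open>auto simp: y_def\<close>)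
    also have "\<dots> \<le> C * \<bar>mainA n lam k\<bar> * E1 k n lam" using K5_pos C e by (intro up) auto
    also have "\<dots> \<le> C * \<bar>mainA n lam k\<bar> * E1 k n lam + C * E2 n" using C E2 by simp
    finally have a: "\<bar>er_prob n (p_crit n lam) (\<lambda>E. L1 n E = k) - mainA n lam k\<bar> \<le> C * \<bar>mainA n lam k\<bar> * E1 k n lam + C * E2 n" .
    let ?B = "mainB lam (real k / real n powr (2/3))"
    have "\<bar>er_prob n (p_crit n lam) (\<lambda>E. L1 n E \<ge> k) - ?B\<bar> \<le> K8 * E1 k n lam * ?B + 4 * E2 n"
      unfolding pw(3) unfolding y_def
      by (rule er_prob_L1_ge_asymptotics[OF H(2)]) (use y lam k in \<open>auto simp: y_def\<close>)
    also have "\<dots> \<le> C * \<bar>?B\<bar> * E1 k n lam + C * E2 n"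
      using K8 C e E2 by (intro add_mono up mult_right_mono) auto
    finally show ?thesis using a by blast
  qed
  then show ?thesis unfolding Let_def mainA_def mainB_def by blast
qed

end
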